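(* Let $s>0$, $1\le p,q\le\infty$, $1\le r<\infty$, $\alpha\in(0,\infty)$ and let $L,T>0$. Then $$\inf_{\widetilde f,\;Q\in\mathcal Q_\alpha}\ \sup_{f\in\mathcal D^s_{pq}(L,T)}\mathbb E_{f,Q}\|\widetilde f-f\|_r^r\ \gtrsim\ \big(n(e^\alpha-1)^2\big)^{-\frac{rs}{2s+2}},$$ where the infimum is taken over all estimators $\widetilde f$ based on the private views $Z_1,\dots,Z_n$ and all (sequences of) Markov kernels $Q\in\mathcal Q_\alpha$ guaranteeing local $\alpha$-differential privacy.
   Context: Asymptotic notation: $a_n\gtrsim b_n$ means that there exist a constant $C>0$ and a fixed integer $n_0$ such that $a_n\ge C\,b_n$ for all $n\ge n_0$. Privacy: $X_1,\dots,X_n$ are i.i.d. real-valued with density $f$ on $\mathbb R$, regarded as taking values in a measurable space $(\mathcal X,\mathscr X)$. Private data take values in a measurable space $(\mathcal Z,\mathscr Z)$ and are generated successively: given $X_i=x_i$ and $Z_1=z_1,\dots,Z_{i-1}=z_{i-1}$, one draws $Z_i\sim Q_i(\cdot\mid X_i=x_i,Z_1=z_1,\dots,Z_{i-1}=z_{i-1})$ with a Markov kernel $Q_i:\mathscr Z\times\mathcal X\times\mathcal Z^{i-1}\to[0,1]$. The sequence $Q=(Q_i)$ provides (local) $\alpha$-differential privacy if for all $i$, all $z_1,\dots,z_{i-1}$ and all $x,x'\in\mathcal X$ $$\sup_{A\in\mathscr Z}\frac{Q_i(A\mid X_i=x,Z_1=z_1,\dots,Z_{i-1}=z_{i-1})}{Q_i(A\mid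 X_i=x',Z_1=z_1,\dots,Z_{i-1}=z_{i-1})}\le e^\alpha .$$ $\mathcal Q_\alpha$ is the set of all such $Q$; $\mathbb E_{f,Q}$ is expectation when $X_i\sim f$ i.i.d. and the $Z_i$ are generated via $Q$. An estimator $\widetilde f$ is a measurable function of $(Z_1,\dots,Z_n)$ with values in functions on $\mathbb R$. Wavelets: $\varphi$ is a father wavelet generating a multiresolution analysis of $\mathbb L^2(\mathbb R)$, $\psi$ is an associated mother wavelet, $\varphi_{jk}(x)=2^{j/2}\varphi(2^jx-k)$, $\psi_{jk}(x)=2^{j/2}\psi(2^jx-k)$, and for each integer $j_0$ the functions $\varphi_{j_0k}$ ($k\in\mathbb Z$), $\psi_{jk}$ ($j\ge j_0$, $k\in\mathbb Z$) form a wavelet basis (orthonormal) of $\mathbb L^2(\mathbb R)$. It is assumed that $\varphi$ is $N+1$ times weakly differentiable for some integer $N$ with $0<s<N+1$, that $\sup_x\sum_k|\varphi^{(N+1)}(x-k)|<\infty$ (a.e.), and that there is a bounded non-increasing function $\Phi$ on $\mathbb R_+$ with $|\varphi(u)|\le\Phi(|u|)$, $\int\Phi(|u|)\,du<\infty$ and $\int\Phi(|u|)|u|^N\,du<\infty$. Besov classes: with $\alpha_{0k}=\int f\varphi_{0k}$ and $\beta_{jk}=\int f\psi_{jk}$, $$J_{spq}(f)=\|\alpha_{0\cdot}\|_{p}+\Big(\sum_{j\ge0}\big(2^{j(s+1/2-1/p)}\|\beta_{j\cdot}\|_{p}\big)^q\Big)^{1/q}$$ ($\|\cdot\|_p$ the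 $\ell^p$ norm over $k$; usual modification if $q=\infty$), and $\mathcal D^s_{pq}(L,T)$ is the set of $f:\mathbb R\to\mathbb R$ with $J_{spq}(f)\le L$, $f\ge0$, $\int f=1$, $\mathrm{supp}(f)\subseteq[-T,T]$. $\|\cdot\|_r$ on functions is the $\mathbb L^r(\mathbb R)$ norm.
   Formalization: Added: some density in the class has Besov norm strictly below L (for small L the class is empty and the bound fails), and the mother wavelet has a bounded non-increasing integrable majorant, as the usual one built from the father wavelet does (else its coefficients may be undefined). *)

theory Defs
  imports "HOL-Probability.Probability"
begin

section \<open>Wavelet bases of the real line\<close>

text \<open>The space of real-valued square-integrable functions; functions are not identified
  when they agree almost everywhere.\<close>

definition L2 :: "(real \<Rightarrow> real) set" where
  "L2 = {f \<in> borel_measurable lborel. integrable lborel (\<lambda>x. (f x)\<^sup>2)}"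

definition l2_inner :: "(real \<Rightarrow> real) \<Rightarrow> (real \<Rightarrow> real) \<Rightarrow> real" where
  "l2_inner f g = (\<integral>x. f x * g x \<partial>lborel)"

definition l2_dist_sq :: "(real \<Rightarrow> real) \<Rightarrow> (real \<Rightarrow> real) \<Rightarrow> ennreal" where
  "l2_dist_sq f g = (\<integral>\<^sup>+x. ennreal ((f x - g x)\<^sup>2) \<partial>lborel)"

definition orthonormal_system :: "'i set \<Rightarrow> ('i \<Rightarrow> real \<Rightarrow> real) \<Rightarrow> bool" where
  "orthonormal_system I e \<longleftrightarrow>
     (\<forall>i\<in>I. e i \<in> L2) \<and> (\<forall>i\<in>I. \<forall>j\<in>I. l2_inner (e i) (e j) = (if i = j then 1 else 0))"

definition closed_span :: "'i set \<Rightarrow> ('i \<Rightarrow> real \<Rightarrow> real) \<Rightarrow> (real \<Rightarrow> real) set" where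
  "closed_span I e = {f \<in> L2. \<forall>\<epsilon>>0. \<exists>F c. finite F \<and> F \<subseteq> I \<and>
       l2_dist_sq f (\<lambda>x. \<Sum>i\<in>F. c i * e i x) < ennreal \<epsilon>}"

definition orthonormal_basis_of ::
  "(real \<Rightarrow> real) set \<Rightarrow> 'i set \<Rightarrow> ('i \<Rightarrow> real \<Rightarrow> real) \<Rightarrow> bool" where
  "orthonormal_basis_of V I e \<longleftrightarrow> orthonormal_system I e \<and> closed_span I e = V"

definition dil :: "(real \<Rightarrow> real) \<Rightarrow> int \<Rightarrow> int \<Rightarrow> real \<Rightarrow> real" where
  "dil g j k x = 2 powr (of_int j / 2) * g (2 powr of_int j * x - of_int k)"

definition mra_space :: "(real \<Rightarrow> real) \<Rightarrow> int \<Rightarrow> (real \<Rightarrow> real) set" where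
  "mra_space \<phi> j = closed_span UNIV (dil \<phi> j)"

definition father_wavelet :: "(real \<Rightarrow> real) \<Rightarrow> bool" where
  "father_wavelet \<phi> \<longleftrightarrow>
     orthonormal_system UNIV (dil \<phi> 0) \<and>
     (\<forall>j. mra_space \<phi> j \<subseteq> mra_space \<phi> (j + 1)) \<and>
     (\<forall>f. (\<forall>j. f \<in> mra_space \<phi> j) \<longrightarrow> (AE x in lborel. f x = 0)) \<and>
     (\<forall>f\<in>L2. \<forall>\<epsilon>>0. \<exists>j. \<exists>g\<in>mra_space \<phi> j. l2_dist_sq f g < ennreal \<epsilon>)"

text \<open>The integer translates of \<open>\<psi>\<close> form an orthonormal basis of the orthogonal complement of
  \<open>V\<^sub>0\<close> in \<open>V\<^sub>1\<close>.\<close>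

definition mother_wavelet :: "(real \<Rightarrow> real) \<Rightarrow> (real \<Rightarrow> real) \<Rightarrow> bool" where
  "mother_wavelet \<phi> \<psi> \<longleftrightarrow>
     orthonormal_basis_of
       {f \<in> mra_space \<phi> 1. \<forall>g\<in>mra_space \<phi> 0. l2_inner f g = 0} UNIV (dil \<psi> 0)"

text \<open>\<open>Inl k\<close> indexes \<open>\<phi>\<^bsub>j0,k\<^esub>\<close>, and \<open>Inr (j, k)\<close> indexes \<open>\<psi>\<^bsub>j,k\<^esub>\<close>.\<close>

definition wavelet_family ::
  "(real \<Rightarrow> real) \<Rightarrow> (real \<Rightarrow> real) \<Rightarrow> int \<Rightarrow> int + int \<times> int \<Rightarrow> real \<Rightarrow> real" where
  "wavelet_family \<phi> \<psi> j0 = case_sum (dil \<phi> j0) (\<lambda>(j, k). dil \<psi> j k)"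

definition wavelet_basis :: "(real \<Rightarrow> real) \<Rightarrow> (real \<Rightarrow> real) \<Rightarrow> bool" where
  "wavelet_basis \<phi> \<psi> \<longleftrightarrow>
     (\<forall>j0. orthonormal_basis_of L2 (UNIV <+> {j0..} \<times> UNIV) (wavelet_family \<phi> \<psi> j0))"


section \<open>Regularity and localisation\<close>

definition test_function :: "(real \<Rightarrow> real) \<Rightarrow> bool" where
  "test_function \<eta> \<longleftrightarrow>
     (\<forall>m x. ((deriv ^^ m) \<eta>) field_differentiable at x) \<and> (\<exists>R. \<forall>x. R < \<bar>x\<bar> \<longrightarrow> \<eta> x = 0)"

definition locally_integrable :: "(real \<Rightarrow> real) \<Rightarrow> bool" where
  "locally_integrable g \<longleftrightarrow> (\<forall>R. set_integrable lborel {-R..R} g)"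

definition weak_derivative :: "nat \<Rightarrow> (real \<Rightarrow> real) \<Rightarrow> (real \<Rightarrow> real) \<Rightarrow> bool" where
  "weak_derivative m g h \<longleftrightarrow> locally_integrable g \<and> locally_integrable h \<and>
     (\<forall>\<eta>. test_function \<eta> \<longrightarrow>
        (\<integral>x. g x * (deriv ^^ m) \<eta> x \<partial>lborel) = (-1) ^ m * (\<integral>x. h x * \<eta> x \<partial>lborel))"

definition regular :: "nat \<Rightarrow> (real \<Rightarrow> real) \<Rightarrow> bool" where
  "regular m \<phi> \<longleftrightarrow> (\<exists>h. weak_derivative m \<phi> h \<and>
     (\<exists>C::real. AE x in lborel.
        (\<integral>\<^sup>+k. ennreal \<bar>h (x - of_int k)\<bar> \<partial>count_space (UNIV :: int set)) \<le> ennreal C))"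

definition localised :: "nat \<Rightarrow> (real \<Rightarrow> real) \<Rightarrow> bool" where
  "localised N g \<longleftrightarrow> (\<exists>\<Phi> :: real \<Rightarrow> real.
     bounded (\<Phi> ` {0..}) \<and> antimono_on {0..} \<Phi> \<and> (\<forall>u. \<bar>g u\<bar> \<le> \<Phi> \<bar>u\<bar>) \<and>
     integrable lborel (\<lambda>u. \<Phi> \<bar>u\<bar>) \<and> integrable lborel (\<lambda>u. \<Phi> \<bar>u\<bar> * \<bar>u\<bar> ^ N))"

text \<open>The localisation of \<open>\<psi>\<close> is part of what it means to be associated with a localised \<open>\<phi>\<close>:
  the usual construction \<open>\<psi> = \<Sum>\<^sub>k (-1)\<^sup>k h\<^bsub>1-k\<^esub> \<phi>\<^bsub>1,k\<^esub>\<close>, with \<open>h\<^sub>k = \<integral> \<phi> \<phi>\<^bsub>1,k\<^esub>\<close>, inherits it from \<open>\<phi>\<close>.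
  It makes the coefficients \<open>\<integral> f \<psi>\<^bsub>j,k\<^esub>\<close> meaningful for an arbitrary density \<open>f\<close>, which need not be
  square-integrable.  Without it \<open>\<psi>\<close> could be convolved with an arbitrary sequence whose Fourier
  series is unimodular; this does not preserve the \<open>\<ell>\<^sup>p\<close> norms of the coefficients unless
  \<open>p = 2\<close>.\<close>

definition wavelet_system :: "nat \<Rightarrow> (real \<Rightarrow> real) \<Rightarrow> (real \<Rightarrow> real) \<Rightarrow> bool" where
  "wavelet_system N \<phi> \<psi> \<longleftrightarrow>
     father_wavelet \<phi> \<and> mother_wavelet \<phi> \<psi> \<and> wavelet_basis \<phi> \<psi> \<and>
     regular (N + 1) \<phi> \<and> localised N \<phi> \<and> localised 0 \<psi>"


section \<open>Besov classes of densities\<close>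

definition epowr :: "ennreal \<Rightarrow> real \<Rightarrow> ennreal" where
  "epowr x a = (if x = \<infinity> then \<infinity> else ennreal (enn2real x powr a))"

definition lp_norm :: "ennreal \<Rightarrow> ('k \<Rightarrow> ennreal) \<Rightarrow> ennreal" where
  "lp_norm p a =
     (if p = \<infinity> then (SUP k. a k)
      else epowr (\<integral>\<^sup>+k. epowr (a k) (enn2real p) \<partial>count_space UNIV) (1 / enn2real p))"

definition coeff_norm :: "ennreal \<Rightarrow> (real \<Rightarrow> real) \<Rightarrow> int \<Rightarrow> (real \<Rightarrow> real) \<Rightarrow> ennreal" where
  "coeff_norm p g j f = lp_norm p (\<lambda>k. ennreal \<bar>\<integral>x. f x * dil g j k x \<partial>lborel\<bar>)"

text \<open>Note that \<open>enn2real (1 / p) = 0\<close> for \<open>p = \<infinity>\<close>.\<close>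

definition besov_norm ::
  "(real \<Rightarrow> real) \<Rightarrow> (real \<Rightarrow> real) \<Rightarrow> real \<Rightarrow> ennreal \<Rightarrow> ennreal \<Rightarrow> (real \<Rightarrow> real) \<Rightarrow> ennreal" where
  "besov_norm \<phi> \<psi> s p q f =
     coeff_norm p \<phi> 0 f +
     lp_norm q (\<lambda>j::nat. ennreal (2 powr (real j * (s + 1/2 - enn2real (1 / p))))
                        * coeff_norm p \<psi> (int j) f)"

definition besov_densities ::
  "(real \<Rightarrow> real) \<Rightarrow> (real \<Rightarrow> real) \<Rightarrow> real \<Rightarrow> ennreal \<Rightarrow> ennreal \<Rightarrow> real \<Rightarrow> real
    \<Rightarrow> (real \<Rightarrow> real) set" where
  "besov_densities \<phi> \<psi> s p q L T =
     {f \<in> borel_measurable borel. (\<forall>x. 0 \<le> f x) \<and>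
        integrable lborel f \<and> (\<integral>x. f x \<partial>lborel) = 1 \<and> closure {x. f x \<noteq> 0} \<subseteq> {-T..T} \<and>
        besov_norm \<phi> \<psi> s p q f \<le> ennreal L}"


section \<open>Locally private data\<close>

text \<open>Observations are numbered from \<open>0\<close>.  A mechanism \<open>Q\<close> releases the \<open>i\<close>-th view with law
  \<open>Q i x z\<close>, where \<open>x\<close> is the \<open>i\<close>-th observation and \<open>z\<close>, an extensional function on \<open>{..<i}\<close>,
  holds the views released before.\<close>

type_synonym 'z mechanism = "nat \<Rightarrow> real \<Rightarrow> (nat \<Rightarrow> 'z) \<Rightarrow> 'z measure"

definition views :: "'z measure \<Rightarrow> nat \<Rightarrow> (nat \<Rightarrow> 'z) measure" where
  "views Z n = (\<Pi>\<^sub>M i\<in>{..<n}. Z)"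

text \<open>The ratio is taken in \<^typ>\<open>ennreal\<close>, where \<open>0 / 0 = 0\<close> and \<open>a / 0 = \<infinity>\<close> for \<open>a > 0\<close>.\<close>

definition private_mechanisms :: "'z measure \<Rightarrow> real \<Rightarrow> nat \<Rightarrow> 'z mechanism set" where
  "private_mechanisms Z \<alpha> n = {Q. \<forall>i<n.
     (\<lambda>(x, z). Q i x z) \<in> (borel \<Otimes>\<^sub>M views Z i) \<rightarrow>\<^sub>M prob_algebra Z \<and>
     (\<forall>z\<in>space (views Z i). \<forall>x x'.
        (SUP A\<in>sets Z. emeasure (Q i x z) A / emeasure (Q i x' z) A) \<le> ennreal (exp \<alpha>))}"

text \<open>The conditional law of the first \<open>n\<close> views, given the observations \<open>x\<close>.\<close>

primrec views_given :: "'z measure \<Rightarrow> 'z mechanism \<Rightarrow> (nat \<Rightarrow> real) \<Rightarrow> nat \<Rightarrow> (nat \<Rightarrow> 'z) measure"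
  where
  "views_given Z Q x 0 = return (views Z 0) (\<lambda>_. undefined)"
| "views_given Z Q x (Suc i) =
     views_given Z Q x i \<bind> (\<lambda>z. distr (Q i (x i) z) (views Z (Suc i)) (\<lambda>y. z(i := y)))"

definition views_law :: "'z measure \<Rightarrow> 'z mechanism \<Rightarrow> nat \<Rightarrow> (real \<Rightarrow> real) \<Rightarrow> (nat \<Rightarrow> 'z) measure"
  where
  "views_law Z Q n f =
     (\<Pi>\<^sub>M i\<in>{..<n}. density lborel (\<lambda>t. ennreal (f t))) \<bind> (\<lambda>x. views_given Z Q x n)"

text \<open>Joint measurability makes the \<open>L\<^sup>r\<close> loss a random variable.\<close>

definition estimators :: "'z measure \<Rightarrow> nat \<Rightarrow> ((nat \<Rightarrow> 'z) \<Rightarrow> real \<Rightarrow> real) set" where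
  "estimators Z n = {F. (\<lambda>(z, t). F z t) \<in> borel_measurable (views Z n \<Otimes>\<^sub>M borel)}"

definition risk ::
  "'z measure \<Rightarrow> nat \<Rightarrow> real \<Rightarrow> ((nat \<Rightarrow> 'z) \<Rightarrow> real \<Rightarrow> real) \<Rightarrow> 'z mechanism \<Rightarrow> (real \<Rightarrow> real) \<Rightarrow> ennreal"
  where
  "risk Z n r F Q f =
     (\<integral>\<^sup>+z. (\<integral>\<^sup>+t. ennreal (\<bar>F z t - f t\<bar> powr r) \<partial>lborel) \<partial>views_law Z Q n f)"

definition minimax_risk :: "'z measure \<Rightarrow> real \<Rightarrow> nat \<Rightarrow> real \<Rightarrow> (real \<Rightarrow> real) set \<Rightarrow> ennreal" where
  "minimax_risk Z \<alpha> n r D =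
     (INF (F, Q) \<in> estimators Z n \<times> private_mechanisms Z \<alpha> n. SUP f\<in>D. risk Z n r F Q f)"

end

theory Submission
  imports Defs
begin

text \<open>
  The bound comes from Assouad's argument on a hypercube of densities whose neighbours no private
  mechanism can tell apart.

  Let \<open>f1\<close> be a density in the interior of the Besov class that is at least some
  \<open>c > 0\<close> on \<open>[T/4, T/2]\<close>, and let \<open>h\<close> be the derivative of a smooth bump on \<open>[0, 1]\<close>, so that
  \<open>\<integral> h = 0\<close>.  For a resolution \<open>J\<close> and a set \<open>A\<close> of dyadic cells in \<open>[T/4, T/2]\<close> put
  \<open>f\<^sub>A(x) = f1(x) + \<gamma> 2\<^bsup>-Js\<^esup> \<Sum>\<^bsub>k\<in>A\<^esub> h(2\<^bsup>J\<^esup> x - k)\<close>.  There are of the order of \<open>2\<^bsup>J\<^esup>\<close> cells, and switching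
  one of them changes the density by at most \<open>2\<^bsup>-J(s+1)\<^esup> / 2\<close> in \<open>L\<^sup>1\<close>, while on the cell itself the
  integral of the \<open>r\<close>-th power of the change is of the order of \<open>2\<^bsup>-J(rs+1)\<^esup>\<close>.

  Under an \<open>\<alpha>\<close>-private channel \<open>K\<close> the integrals \<open>\<integral> g dK(x)\<close> of a function \<open>g \<ge> 0\<close>
  agree up to the factor \<open>e\<^bsup>\<alpha>\<^esup>\<close> for all \<open>x\<close>.  Hence the laws \<open>M\<close>, \<open>M'\<close> of one view under densities
  \<open>f\<close>, \<open>f'\<close> satisfy \<open>\<bar>\<integral> g dM - \<integral> g dM'\<bar> \<le> \<delta> \<integral> g dM'\<close> with \<open>\<delta> = (e\<^bsup>\<alpha>\<^esup> - 1) \<parallel>f - f'\<parallel>\<^sub>1\<close>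
  (\<open>private_marginals_close\<close>).  Applied to the positive and the negative part of a centred
  function this gives \<open>(\<integral> u dM)\<^sup>2 \<le> (1 + \<delta>\<^sup>2) \<integral> u\<^sup>2 dM'\<close>, an inequality that multiplies up along the
  sequential mechanism (\<open>views_law_second_moment\<close>).  When \<open>n \<delta>\<^sup>2 \<le> 1/2\<close> no test separates the laws
  of the \<open>n\<close> views, and each cell costs an estimator a constant share of the distance there.
  With \<open>2\<^bsup>J(2s+2)\<^esup>\<close> of the order of \<open>n (e\<^bsup>\<alpha>\<^esup> - 1)\<^sup>2\<close> the cells add up to a risk of the order of
  \<open>2\<^bsup>J\<^esup> 2\<^bsup>-J(rs+1)\<^esup> = 2\<^bsup>-Jrs\<^esup>\<close>, which is the claimed rate.

  What remains is that \<open>f\<^sub>A\<close> belongs to the Besov class with one \<open>\<gamma>\<close> for all \<open>J\<close> and \<open>A\<close>.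
  This needs a geometric decay, faster than \<open>2\<^bsup>-is\<^esup>\<close>, of the coefficients of a smooth function
  against \<open>\<psi>(2\<^sup>i x - k)\<close>, both in the supremum and in the sum over \<open>k\<close> (\<open>jackson_estimate\<close>); the
  \<open>\<ell>\<^sup>p\<close> norms lie between these two.  The usual argument by vanishing moments is not at hand, since
  \<open>\<psi>\<close> need not have moments of positive order: it is only dominated by an integrable
  non-increasing function, and smoothness is known of \<open>\<phi>\<close> alone.  Three steps replace it.

  First, let \<open>\<phi>\<^sub>m(x) = 2\<^bsup>-m\<^esup> \<phi>(2\<^bsup>-m\<^esup> x)\<close>.  Since \<open>\<phi>\<^sub>m\<close> lies in \<open>V\<^bsub>-m\<^esub> \<subseteq> V\<^sub>0\<close>, it is orthogonal to
  all \<open>\<psi>(\<cdot> - k)\<close>, which says that the correlation of \<open>\<phi>\<^sub>m\<close> with \<open>\<psi>\<close> vanishes at all integers.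
  Its derivative of order \<open>N + 1\<close> is of size \<open>2\<^bsup>-m(N+1)\<^esup>\<close>, because the weak derivative of \<open>\<phi>\<close> is
  integrable, and by Rolle's theorem a function with that many zeros is as small as that
  derivative (\<open>coarse_father_mother_small\<close>).

  Second, write \<open>v * \<zeta> = v * (w * \<zeta>) + (v - w * v) * \<zeta>\<close> with \<open>\<integral> w = 1\<close>.  If \<open>w * \<zeta>\<close> is small and
  \<open>w\<close> is concentrated at a scale finer than that of \<open>v\<close>, then both summands are small, and the
  second can be treated again in the same way (\<open>iterated_smoothing\<close>).  With \<open>w\<close> proportional to
  \<open>\<phi>\<^sub>m\<close> this transfers the smallness from \<open>\<phi>\<^sub>m\<close> to a band-limited kernel \<open>v\<close>, for which the
  iteration can go on for ever (\<open>low_pass_mother_small\<close>).  It uses that \<open>\<integral> \<phi> \<noteq> 0\<close>, which follows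
  from the density of the spaces \<open>V\<^sub>j\<close> (\<open>father_mean_nonzero\<close>).

  Third, the same splitting with the band-limited kernel as \<open>w\<close> transfers the smallness to
  arbitrary smooth functions.  The detour is what makes the decay geometric: the band-limited
  kernel has a moment of order \<open>1/2\<close>, whereas \<open>\<phi>\<close> may have no moment of positive order if \<open>N = 0\<close>.
\<close>

section \<open>Convolutions and translation-invariant norms\<close>

definition bdd_integrable :: "(real \<Rightarrow> real) \<Rightarrow> bool" where
  "bdd_integrable v \<longleftrightarrow> integrable lborel v \<and> (\<exists>B. \<forall>x. \<bar>v x\<bar> \<le> B)"

definition convol :: "(real \<Rightarrow> real) \<Rightarrow> (real \<Rightarrow> real) \<Rightarrow> real \<Rightarrow> real" where
  "convol w v x = (\<integral>z. w z * v (x - z) \<partial>lborel)"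

text \<open>One notion for three norms that convolutions respect: the index measure \<open>W\<close> and the shifts \<open>y\<close>
  are Lebesgue measure on the line for the \<open>L\<^sup>1\<close> norm, a single unshifted point for the supremum
  norm, and all integers for the supremum of the periodisation
  \<open>x \<mapsto> \<Sum>\<^sub>k \<bar>v (x - k)\<bar>\<close>.  The last one controls \<open>\<ell>\<^sup>1\<close> norms of wavelet coefficients.\<close>

definition shift_norm :: "'i measure \<Rightarrow> ('i \<Rightarrow> real) \<Rightarrow> (real \<Rightarrow> real) \<Rightarrow> ennreal" where
  "shift_norm W y v = (SUP x. \<integral>\<^sup>+i. ennreal \<bar>v (x - y i)\<bar> \<partial>W)"

lemma bdd_integrableD:
  assumes "bdd_integrable v"
  shows "integrable lborel v" "v \<in> borel_measurable borel" "\<exists>B. \<forall>x. \<bar>v x\<bar> \<le> B"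
  using assms by (auto simp: bdd_integrable_def dest: borel_measurable_integrable)

lemma bdd_integrable_bound:
  assumes "bdd_integrable v"
  obtains B where "0 < B" "\<And>x. \<bar>v x\<bar> \<le> B"
proof -
  obtain B where "\<forall>x. \<bar>v x\<bar> \<le> B" using assms by (auto simp: bdd_integrable_def)
  then have "\<And>x. \<bar>v x\<bar> \<le> \<bar>B\<bar> + 1" by (meson abs_ge_self dual_order.trans less_add_one less_imp_le)
  then show ?thesis using that[of "\<bar>B\<bar> + 1"] by auto
qed

lemma bdd_integrable_diff: "bdd_integrable v \<Longrightarrow> bdd_integrable w \<Longrightarrow> bdd_integrable (\<lambda>x. v x - w x)"
proof -
  assume v: "bdd_integrable v" and w: "bdd_integrable w"
  obtain B where B: "\<And>x. \<bar>v x\<bar> \<le> B" using bdd_integrable_bound[OF v] by metis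
  obtain B' where B': "\<And>x. \<bar>w x\<bar> \<le> B'" using bdd_integrable_bound[OF w] by metis
  have "\<bar>v x - w x\<bar> \<le> B + B'" for x using B[of x] B'[of x] by linarith
  then show ?thesis using v w unfolding bdd_integrable_def by auto
qed

lemma bdd_integrable_cmult: "bdd_integrable v \<Longrightarrow> bdd_integrable (\<lambda>x. c * v x)"
proof -
  assume v: "bdd_integrable v"
  obtain B where B: "\<And>x. \<bar>v x\<bar> \<le> B" using bdd_integrable_bound[OF v] by metis
  have "\<bar>c * v x\<bar> \<le> \<bar>c\<bar> * B" for x using B[of x] by (simp add: abs_mult mult_left_mono)
  then show ?thesis using v unfolding bdd_integrable_def by auto
qed

lemma integrable_affine:
  fixes v :: "real \<Rightarrow> real"
  assumes "integrable lborel v" "c \<noteq> 0"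
  shows "integrable lborel (\<lambda>x. v (t + c * x))"
  using lborel_integrable_real_affine[OF assms] by simp

lemma bdd_integrable_affine:
  assumes "bdd_integrable v" "c \<noteq> 0"
  shows "bdd_integrable (\<lambda>x. v (t + c * x))"
  using assms integrable_affine unfolding bdd_integrable_def by auto

lemma bdd_integrable_mult_integrable:
  assumes "integrable lborel w" "bdd_integrable v" "c \<noteq> 0"
  shows "integrable lborel (\<lambda>z. w z * v (t + c * z))"
proof -
  obtain B where B: "\<And>x. \<bar>v x\<bar> \<le> B" using bdd_integrable_bound[OF assms(2)] by metis
  have [measurable]: "v \<in> borel_measurable borel" "w \<in> borel_measurable borel"
    using bdd_integrableD[OF assms(2)] assms(1) by auto
  show ?thesis
  proof (rule Bochner_Integration.integrable_bound[where f="\<lambda>z. B * w z"])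
    show "AE z in lborel. norm (w z * v (t + c * z)) \<le> norm (B * w z)"
    proof (rule AE_I2)
      fix z
      have "\<bar>v (t + c * z)\<bar> \<le> \<bar>B\<bar>" using B[of "t + c * z"] by linarith
      then show "norm (w z * v (t + c * z)) \<le> norm (B * w z)"
        by (simp add: abs_mult mult.commute[of "\<bar>B\<bar>"] mult_left_mono)
    qed
  qed (use assms in auto)
qed

lemma convol_integrand:
  assumes "integrable lborel w" "bdd_integrable v"
  shows "integrable lborel (\<lambda>z. w z * v (x - z))"
  using bdd_integrable_mult_integrable[OF assms, of "-1" x] by simp

lemma convol_commute: "convol w v = convol v w"
proof
  fix x
  have "convol w v x = (\<integral>z. w (x + (-1) * z) * v (x - (x + (-1) * z)) \<partial>lborel)"
    unfolding convol_def by (subst lborel_integral_real_affine[of "-1" _ x]) auto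
  also have "\<dots> = convol v w x" unfolding convol_def by (simp add: mult.commute)
  finally show "convol w v x = convol v w x" .
qed

lemma convol_measurable [measurable]:
  assumes [measurable]: "w \<in> borel_measurable borel" "v \<in> borel_measurable borel"
  shows "convol w v \<in> borel_measurable borel"
proof -
  have "(\<lambda>x. \<integral>z. w z * v (x - z) \<partial>lborel) \<in> borel_measurable borel"
    by measurable
  then show ?thesis by (simp add: convol_def[abs_def])
qed

lemma abs_integral_le_nn:
  fixes f :: "'a \<Rightarrow> real"
  shows "ennreal \<bar>\<integral>x. f x \<partial>M\<bar> \<le> (\<integral>\<^sup>+x. ennreal \<bar>f x\<bar> \<partial>M)"
  using integral_norm_bound_ennreal[of M f] by (cases "integrable M f")
     (auto simp: not_integrable_integral_eq)

lemma convol_abs_le: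
  "ennreal \<bar>convol w v x\<bar> \<le> (\<integral>\<^sup>+z. ennreal \<bar>w z\<bar> * ennreal \<bar>v (x - z)\<bar> \<partial>lborel)"
  unfolding convol_def
  by (rule order.trans[OF abs_integral_le_nn]) (simp add: abs_mult ennreal_mult)

lemma shift_norm_le_iff: "shift_norm W y v \<le> c \<longleftrightarrow> (\<forall>x. (\<integral>\<^sup>+i. ennreal \<bar>v (x - y i)\<bar> \<partial>W) \<le> c)"
  by (simp add: shift_norm_def SUP_le_iff)

lemma shift_norm_ge: "(\<integral>\<^sup>+i. ennreal \<bar>v (x - y i)\<bar> \<partial>W) \<le> shift_norm W y v"
  unfolding shift_norm_def by (rule SUP_upper) simp

lemma shift_norm_add_le:
  assumes [measurable]: "v \<in> borel_measurable borel" "w \<in> borel_measurable borel" "y \<in> borel_measurable W"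
    and "\<And>x. u x = v x + w x"
  shows "shift_norm W y u \<le> shift_norm W y v + shift_norm W y w"
  unfolding shift_norm_le_iff
proof
  fix x
  have "(\<integral>\<^sup>+i. ennreal \<bar>u (x - y i)\<bar> \<partial>W) \<le> (\<integral>\<^sup>+i. ennreal \<bar>v (x - y i)\<bar> + ennreal \<bar>w (x - y i)\<bar> \<partial>W)"
    by (rule nn_integral_mono)
      (auto simp: assms(4) simp flip: ennreal_plus intro!: ennreal_leI)
  also have "\<dots> = (\<integral>\<^sup>+i. ennreal \<bar>v (x - y i)\<bar> \<partial>W) + (\<integral>\<^sup>+i. ennreal \<bar>w (x - y i)\<bar> \<partial>W)"
    by (rule nn_integral_add) measurable
  also have "\<dots> \<le> shift_norm W y v + shift_norm W y w" by (intro add_mono shift_norm_ge)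
  finally show "(\<integral>\<^sup>+i. ennreal \<bar>u (x - y i)\<bar> \<partial>W) \<le> shift_norm W y v + shift_norm W y w" .
qed

text \<open>Tonelli's theorem for a function dominated by a superposition of functions \<open>g \<cdot> z\<close>: this is the
  form of Minkowski's integral inequality behind all convolution estimates below.\<close>

lemma shift_norm_mono_kernel:
  assumes "sigma_finite_measure W"
    and [measurable]: "y \<in> borel_measurable W" "v \<in> borel_measurable borel" "k \<in> borel_measurable borel"
    and g[measurable]: "(\<lambda>(x,z). g x z) \<in> borel_measurable (borel \<Otimes>\<^sub>M borel)"
    and u: "\<And>x. ennreal \<bar>u x\<bar> \<le> (\<integral>\<^sup>+z. k z * g x z \<partial>lborel)"
    and gb: "\<And>x z. (\<integral>\<^sup>+i. g (x - y i) z \<partial>W) \<le> b z"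
  shows "shift_norm W y u \<le> (\<integral>\<^sup>+z. k z * b z \<partial>lborel)"
  unfolding shift_norm_le_iff
proof
  interpret W: sigma_finite_measure W by fact
  interpret P: pair_sigma_finite W lborel by unfold_locales
  fix x
  have [measurable]: "(\<lambda>(i,z). k z * g (x - y i) z) \<in> borel_measurable (W \<Otimes>\<^sub>M lborel)"
  proof -
    have [measurable]: "(\<lambda>p. g (x - y (fst p)) (snd p)) \<in> borel_measurable (W \<Otimes>\<^sub>M lborel)"
      using measurable_compose[OF _ g, of "\<lambda>p. (x - y (fst p), snd p)" "W \<Otimes>\<^sub>M lborel"] by simp
    show ?thesis by (simp add: split_beta')
  qed
  have "(\<integral>\<^sup>+i. ennreal \<bar>u (x - y i)\<bar> \<partial>W) \<le> (\<integral>\<^sup>+i. \<integral>\<^sup>+z. k z * g (x - y i) z \<partial>lborel \<partial>W)"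
    by (rule nn_integral_mono) (rule u)
  also have "\<dots> = (\<integral>\<^sup>+z. \<integral>\<^sup>+i. k z * g (x - y i) z \<partial>W \<partial>lborel)"
    by (rule P.Fubini'[symmetric]) measurable
  also have "\<dots> = (\<integral>\<^sup>+z. k z * (\<integral>\<^sup>+i. g (x - y i) z \<partial>W) \<partial>lborel)"
  proof (rule nn_integral_cong, rule nn_integral_cmult)
    fix z show "(\<lambda>i. g (x - y i) z) \<in> borel_measurable W"
      using measurable_compose[OF _ g, of "\<lambda>i. (x - y i, z)" W] by simp
  qed
  also have "\<dots> \<le> (\<integral>\<^sup>+z. k z * b z \<partial>lborel)"
    by (intro nn_integral_mono mult_left_mono gb) simp
  finally show "(\<integral>\<^sup>+i. ennreal \<bar>u (x - y i)\<bar> \<partial>W) \<le> (\<integral>\<^sup>+z. k z * b z \<partial>lborel)" .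
qed

lemma shift_norm_convol_le:
  assumes "sigma_finite_measure W"
    and [measurable]: "y \<in> borel_measurable W" "w \<in> borel_measurable borel" "v \<in> borel_measurable borel"
  shows "shift_norm W y (convol w v) \<le> (\<integral>\<^sup>+z. ennreal \<bar>w z\<bar> \<partial>lborel) * shift_norm W y v"
proof -
  have "shift_norm W y (convol w v) \<le> (\<integral>\<^sup>+z. ennreal \<bar>w z\<bar> * shift_norm W y v \<partial>lborel)"
  proof (rule shift_norm_mono_kernel[where g="\<lambda>x z. ennreal \<bar>v (x - z)\<bar>" and v=v])
    fix x z
    show "(\<integral>\<^sup>+ i. ennreal \<bar>v (x - y i - z)\<bar> \<partial>W) \<le> shift_norm W y v"
      using shift_norm_ge[where v=v and x="x - z" and y=y and W=W] by (simp add: algebra_simps)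
  qed (use assms convol_abs_le in \<open>auto\<close>)
  also have "\<dots> = (\<integral>\<^sup>+z. ennreal \<bar>w z\<bar> \<partial>lborel) * shift_norm W y v"
    by (rule nn_integral_multc) measurable
  finally show ?thesis .
qed

abbreviation "norm_L1 \<equiv> shift_norm lborel (\<lambda>x::real. x)"

abbreviation "norm_sup \<equiv> shift_norm (count_space (UNIV::unit set)) (\<lambda>_. 0)"

abbreviation "norm_per \<equiv> shift_norm (count_space (UNIV::int set)) of_int"

lemma norm_L1_eq: 
  assumes [measurable]: "v \<in> borel_measurable borel"
  shows "norm_L1 v = (\<integral>\<^sup>+z. ennreal \<bar>v z\<bar> \<partial>lborel)"
proof -
  have "(\<integral>\<^sup>+i. ennreal \<bar>v (x - i)\<bar> \<partial>lborel) = (\<integral>\<^sup>+z. ennreal \<bar>v z\<bar> \<partial>lborel)" for x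
    using nn_integral_real_affine[of "\<lambda>z. ennreal \<bar>v z\<bar>" "-1" x] by simp
  then show ?thesis by (simp add: shift_norm_def)
qed

lemma norm_sup_eq: "norm_sup v = (SUP x. ennreal \<bar>v x\<bar>)"
  by (simp add: shift_norm_def nn_integral_count_space_finite)

lemma norm_sup_le_iff: "0 \<le> c \<Longrightarrow> norm_sup v \<le> ennreal c \<longleftrightarrow> (\<forall>x. \<bar>v x\<bar> \<le> c)"
  by (simp add: norm_sup_eq SUP_le_iff)

text \<open>Cut the line into the unit cells \<open>[k, k + 1)\<close> and move all of them onto \<open>[0, 1)\<close>.\<close>

lemma nn_integral_split_int:
  fixes f :: "real \<Rightarrow> ennreal"
  assumes [measurable]: "f \<in> borel_measurable borel"
  shows "(\<integral>\<^sup>+x. f x \<partial>lborel) =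
    (\<integral>\<^sup>+x. indicator {0..<1} x * (\<integral>\<^sup>+k. f (x - of_int k) \<partial>count_space (UNIV::int set)) \<partial>lborel)"
proof -
  interpret P: pair_sigma_finite "count_space (UNIV::int set)" "lborel :: real measure"
    by (intro pair_sigma_finite.intro sigma_finite_lborel sigma_finite_measure_count_space_countable) auto
  have 1: "(\<integral>\<^sup>+k. indicator {0..<1} (x + of_int k) \<partial>count_space (UNIV::int set)) = (1::ennreal)" for x :: real
  proof -
    have "indicator {0..<1} (x + of_int k) = (indicator {- \<lfloor>x\<rfloor>} k :: ennreal)" for k :: int
      by (auto simp: indicator_def; linarith)
    then show ?thesis by (simp add: nn_integral_indicator)
  qed
  have "(\<integral>\<^sup>+x. f x \<partial>lborel) = (\<integral>\<^sup>+x. f x * (\<integral>\<^sup>+k. indicator {0..<1} (x + of_int k) \<partial>count_space (UNIV::int set)) \<partial>lborel)"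
    by (simp add: 1)
  also have "\<dots> = (\<integral>\<^sup>+x. (\<integral>\<^sup>+k. f x * indicator {0..<1} (x + of_int k) \<partial>count_space (UNIV::int set)) \<partial>lborel)"
    by (intro nn_integral_cong nn_integral_cmult[symmetric]) simp
  also have "\<dots> = (\<integral>\<^sup>+k. (\<integral>\<^sup>+x. f x * indicator {0..<1} (x + of_int k) \<partial>lborel) \<partial>count_space (UNIV::int set))"
    by (rule P.Fubini') measurable
  also have "\<dots> = (\<integral>\<^sup>+k. (\<integral>\<^sup>+x. f (x - of_int k) * indicator {0..<1} x \<partial>lborel) \<partial>count_space (UNIV::int set))"
  proof (rule nn_integral_cong)
    fix k :: int
    show "(\<integral>\<^sup>+x. f x * indicator {0..<1} (x + of_int k) \<partial>lborel) = (\<integral>\<^sup>+x. f (x - of_int k) * indicator {0..<1} x \<partial>lborel)"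
      using nn_integral_real_affine[of "\<lambda>x. f x * indicator {0..<1} (x + of_int k)" 1 "- of_int k"] by simp
  qed
  also have "\<dots> = (\<integral>\<^sup>+x. (\<integral>\<^sup>+k. f (x - of_int k) * indicator {0..<1} x \<partial>count_space (UNIV::int set)) \<partial>lborel)"
    by (rule P.Fubini'[symmetric]) measurable
  also have "\<dots> = (\<integral>\<^sup>+x. indicator {0..<1} x * (\<integral>\<^sup>+k. f (x - of_int k) \<partial>count_space (UNIV::int set)) \<partial>lborel)"
    by (intro nn_integral_cong) (simp add: nn_integral_cmult[symmetric] mult.commute)
  finally show ?thesis .
qed

lemma norm_L1_le_norm_per:
  assumes [measurable]: "v \<in> borel_measurable borel"
  shows "norm_L1 v \<le> norm_per v"
proof -
  have "norm_L1 v = (\<integral>\<^sup>+x. indicator {0..<1} x * (\<integral>\<^sup>+k. ennreal \<bar>v (x - of_int k)\<bar> \<partial>count_space (UNIV::int set)) \<partial>lborel)"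
    unfolding norm_L1_eq[OF assms] by (rule nn_integral_split_int) measurable
  also have "\<dots> \<le> (\<integral>\<^sup>+x. indicator {0..<1::real} x * norm_per v \<partial>lborel)"
    by (intro nn_integral_mono mult_left_mono shift_norm_ge) simp
  also have "\<dots> = norm_per v" by (simp add: nn_integral_multc)
  finally show ?thesis .
qed

lemma bdd_integrable_convol:
  assumes "bdd_integrable w" "bdd_integrable v"
  shows "bdd_integrable (convol w v)"
proof -
  have [measurable]: "v \<in> borel_measurable borel" "w \<in> borel_measurable borel"
    using bdd_integrableD assms by auto
  have "norm_L1 (convol w v) \<le> norm_L1 w * norm_L1 v"
    using shift_norm_convol_le[OF sigma_finite_lborel, of "\<lambda>x. x" w v] by (simp add: norm_L1_eq)
  also have "\<dots> < \<infinity>"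
    using assms by (auto simp: norm_L1_eq bdd_integrable_def integrable_iff_bounded ennreal_mult_less_top)
  finally have "integrable lborel (convol w v)"
    by (auto simp: integrable_iff_bounded norm_L1_eq)
  moreover obtain B where B: "0 < B" "\<And>x. \<bar>v x\<bar> \<le> B" using bdd_integrable_bound assms by metis
  have "\<bar>convol w v x\<bar> \<le> (\<integral>z. \<bar>w z\<bar> * B \<partial>lborel)" for x
    unfolding convol_def
  proof (rule order.trans[OF integral_abs_bound integral_mono])
    show "integrable lborel (\<lambda>z. \<bar>w z * v (x - z)\<bar>)" using convol_integrand assms by (auto simp: bdd_integrable_def)
    show "integrable lborel (\<lambda>z. \<bar>w z\<bar> * B)" using assms by (auto simp: bdd_integrable_def)
    show "\<bar>w z * v (x - z)\<bar> \<le> \<bar>w z\<bar> * B" for z using B(2)[of "x-z"] by (simp add: abs_mult mult_left_mono)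
  qed
  ultimately show ?thesis unfolding bdd_integrable_def by blast
qed

lemma convol_left_commute:
  assumes "bdd_integrable u" "bdd_integrable w" "bdd_integrable v"
  shows "convol u (convol w v) = convol w (convol u v)"
proof
  fix x
  have [measurable]: "v \<in> borel_measurable borel" "w \<in> borel_measurable borel" "u \<in> borel_measurable borel"
    using bdd_integrableD assms by auto
  obtain B where B: "0 < B" "\<And>x. \<bar>v x\<bar> \<le> B" using bdd_integrable_bound assms by metis
  have "integrable (lborel \<Otimes>\<^sub>M lborel) (\<lambda>(z,t). u z * w t * v (x - z - t))"
  proof (rule Bochner_Integration.integrable_bound[where f="\<lambda>(z,t). B * (u z * w t)"])
    have "integrable (lborel \<Otimes>\<^sub>M lborel) (\<lambda>(z,t). u z * w t)"
      by (rule lborel_pair.Fubini_integrable) (use assms in \<open>auto simp: bdd_integrable_def abs_mult\<close>)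
    then show "integrable (lborel \<Otimes>\<^sub>M lborel) (\<lambda>(z,t). B * (u z * w t))"
      by (auto simp: split_beta')
    show "AE p in lborel \<Otimes>\<^sub>M lborel. norm (case p of (z, t) \<Rightarrow> u z * w t * v (x - z - t))
        \<le> norm (case p of (z, t) \<Rightarrow> B * (u z * w t))"
    proof (rule AE_I2, clarsimp)
      fix z t
      have "\<bar>u z * w t * v (x - z - t)\<bar> \<le> \<bar>u z * w t\<bar> * B"
        using B(2)[of "x - z - t"] by (subst abs_mult) (rule mult_left_mono, auto)
      then show "\<bar>u z * w t * v (x - z - t)\<bar> \<le> \<bar>B * (u z * w t)\<bar>"
        using B(1) by (simp add: abs_mult mult_ac)
    qed
  qed measurable
  from lborel_pair.Fubini_integral[OF this]
  have "(\<integral>t. \<integral>z. u z * w t * v (x - z - t) \<partial>lborel \<partial>lborel) = (\<integral>z. \<integral>t. u z * w t * v (x - z - t) \<partial>lborel \<partial>lborel)"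
    by simp
  moreover have "(\<integral>z. \<integral>t. u z * w t * v (x - z - t) \<partial>lborel \<partial>lborel) = convol u (convol w v) x"
    unfolding convol_def by (simp add: mult.assoc)
  moreover have "(\<integral>t. \<integral>z. u z * w t * v (x - z - t) \<partial>lborel \<partial>lborel) = (\<integral>t. w t * \<integral>z. u z * v (x - t - z) \<partial>lborel \<partial>lborel)"
    by (subst integral_mult_right_zero[symmetric]) (simp add: algebra_simps)
  ultimately show "convol u (convol w v) x = convol w (convol u v) x"
    unfolding convol_def by simp
qed

lemma convol_assoc:
  assumes "bdd_integrable u" "bdd_integrable w" "bdd_integrable v"
  shows "convol (convol w u) v = convol u (convol w v)"
  using convol_left_commute[OF assms(3,2,1)] convol_left_commute[OF assms(1,2,3)]
  by (metis convol_commute)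

text \<open>Absolute continuity with derivative \<open>v'\<close>, for increasing arguments and with the integration
  variable reflected so that the integral is a convolution.\<close>

definition primitive_of :: "(real \<Rightarrow> real) \<Rightarrow> (real \<Rightarrow> real) \<Rightarrow> bool" where
  "primitive_of v v' \<longleftrightarrow> (\<forall>x y. x \<le> y \<longrightarrow> v y - v x = (\<integral>t. indicator {0..y-x} t * v' (y - t) \<partial>lborel))"

lemma primitive_of_shift:
  assumes "primitive_of v v'" "v' \<in> borel_measurable borel"
  shows "ennreal \<bar>v x - v (x - z)\<bar> \<le> (\<integral>\<^sup>+t. indicator {min 0 z..max 0 z} t * ennreal \<bar>v' (x - t)\<bar> \<partial>lborel)"
proof -
  note [measurable] = assms(2)
  consider "0 \<le> z" | "z < 0" by linarith
  then show ?thesis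
  proof cases
    case 1
    have "v x - v (x - z) = (\<integral>t. indicator {0..z} t * v' (x - t) \<partial>lborel)"
      using assms(1)[unfolded primitive_of_def, rule_format, of "x - z" x] 1 by simp
    then show ?thesis using abs_integral_le_nn[of lborel "\<lambda>t. indicator {0..z} t * v' (x - t)"] 1
      by (auto simp: abs_mult ennreal_mult min_def max_def ennreal_indicator cong: nn_integral_cong_simp)
  next
    case 2
    have "v (x - z) - v x = (\<integral>t. indicator {0..-z} t * v' ((x - z) - t) \<partial>lborel)"
      using assms(1)[unfolded primitive_of_def, rule_format, of x "x - z"] 2 by simp
    then have "ennreal \<bar>v x - v (x - z)\<bar> \<le> (\<integral>\<^sup>+t. indicator {0..-z} t * ennreal \<bar>v' ((x - z) - t)\<bar> \<partial>lborel)"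
      using abs_integral_le_nn[of lborel "\<lambda>t. indicator {0..-z} t * v' ((x-z) - t)"]
      by (simp add: abs_mult ennreal_mult ennreal_indicator abs_minus_commute[of "v x"])
    also have "\<dots> = (\<integral>\<^sup>+t. indicator {0..-z} (t-z) * ennreal \<bar>v' (x - t)\<bar> \<partial>lborel)"
      using nn_integral_real_affine[of "\<lambda>t. indicator {0..-z} t * ennreal \<bar>v' ((x - z) - t)\<bar>" 1 "-z"]
      by (simp add: algebra_simps)
    also have "\<dots> = (\<integral>\<^sup>+t. indicator {min 0 z..max 0 z} t * ennreal \<bar>v' (x - t)\<bar> \<partial>lborel)"
      using 2 by (intro nn_integral_cong) (auto simp: indicator_def)
    finally show ?thesis .
  qed
qed

lemma shift_norm_shift_le:
  assumes W: "sigma_finite_measure W" and y[measurable]: "y \<in> borel_measurable W"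
    and "primitive_of v v'" and [measurable]: "v \<in> borel_measurable borel" "v' \<in> borel_measurable borel"
  shows "shift_norm W y (\<lambda>x. v x - v (x - z)) \<le> ennreal \<bar>z\<bar> * shift_norm W y v'"
    "shift_norm W y (\<lambda>x. v x - v (x - z)) \<le> 2 * shift_norm W y v"
proof -
  have "shift_norm W y (\<lambda>x. v x - v (x - z)) \<le> (\<integral>\<^sup>+t. indicator {min 0 z..max 0 z} t * shift_norm W y v' \<partial>lborel)"
  proof (rule shift_norm_mono_kernel[where g="\<lambda>x z. ennreal \<bar>v' (x - z)\<bar>" and v=v])
    fix x t
    show "(\<integral>\<^sup>+ i. ennreal \<bar>v' (x - y i - t)\<bar> \<partial>W) \<le> shift_norm W y v'"
      using shift_norm_ge[where v=v' and x="x - t" and y=y and W=W] by (simp add: algebra_simps)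
  qed (use assms primitive_of_shift in \<open>auto\<close>)
  also have "\<dots> = ennreal \<bar>z\<bar> * shift_norm W y v'"
    by (subst nn_integral_multc) (auto simp: min_def max_def)
  finally show "shift_norm W y (\<lambda>x. v x - v (x - z)) \<le> ennreal \<bar>z\<bar> * shift_norm W y v'" .
  have "shift_norm W y (\<lambda>x. v x - v (x - z)) \<le> shift_norm W y v + shift_norm W y (\<lambda>x. - v (x - z))"
    by (rule shift_norm_add_le) auto
  also have "shift_norm W y (\<lambda>x. - v (x - z)) \<le> shift_norm W y v"
    unfolding shift_norm_le_iff using shift_norm_ge[where v=v and x="_ - z" and y=y and W=W] by (simp add: algebra_simps)
  finally show "shift_norm W y (\<lambda>x. v x - v (x - z)) \<le> 2 * shift_norm W y v" 
    by (simp add: mult_2 add_left_mono)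
qed

text \<open>The increment of \<open>w * v\<close> is \<open>w\<close> convolved with the increments of \<open>v\<close>, which are themselves
  convolutions of \<open>v'\<close> with an indicator; so the claim is associativity of convolution.\<close>

lemma primitive_of_convol:
  assumes "bdd_integrable w" "bdd_integrable v" "bdd_integrable v'" "primitive_of v v'"
  shows "primitive_of (convol w v) (convol w v')"
  unfolding primitive_of_def
proof (intro allI impI)
  fix x y :: real assume "x \<le> y"
  define I where "I = (\<lambda>t. indicator {0..y-x} t :: real)"
  have I: "bdd_integrable I"
    unfolding I_def bdd_integrable_def
    by (auto intro!: exI[of _ 1] integrable_real_indicator simp: indicator_def emeasure_lborel_Icc_eq)
  have *: "v (y - z) - v (x - z) = convol I v' (y - z)" for z
    using assms(4) \<open>x \<le> y\<close> unfolding primitive_of_def convol_def I_def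
    by (auto dest!: spec[of _ "x - z"] spec[of _ "y-z"])
  have "convol w v y - convol w v x = (\<integral>z. w z * v (y - z) - w z * v (x - z) \<partial>lborel)"
    unfolding convol_def using convol_integrand assms
    by (subst Bochner_Integration.integral_diff) (auto simp: bdd_integrable_def)
  also have "\<dots> = convol w (convol I v') y"
    unfolding right_diff_distrib[symmetric] * by (simp add: convol_def)
  also have "\<dots> = convol I (convol w v') y" using convol_left_commute I assms by metis
  finally show "convol w v y - convol w v x = (\<integral>t. indicator {0..y-x} t * convol w v' (y - t) \<partial>lborel)"
    by (simp add: convol_def I_def)
qed

lemma primitive_of_diff:
  assumes "bdd_integrable v'" "bdd_integrable w'" "primitive_of v v'" "primitive_of w w'"
  shows "primitive_of (\<lambda>x. v x - w x) (\<lambda>x. v' x - w' x)"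
  unfolding primitive_of_def
proof (intro allI impI)
  fix x y :: real assume "x \<le> y"
  have I: "integrable lborel (indicator {0..y-x} :: real \<Rightarrow> real)"
    by (intro integrable_real_indicator) (auto simp: emeasure_lborel_Icc_eq)
  show "v y - w y - (v x - w x) = (\<integral>t. indicator {0..y-x} t * (v' (y - t) - w' (y - t)) \<partial>lborel)"
    using convol_integrand[OF I assms(1), of y] convol_integrand[OF I assms(2), of y]
    using assms(3)[unfolded primitive_of_def, rule_format, OF \<open>x \<le> y\<close>]
      assms(4)[unfolded primitive_of_def, rule_format, OF \<open>x \<le> y\<close>]
    by (simp add: right_diff_distrib Bochner_Integration.integral_diff)
qed

text \<open>Since \<open>\<integral> w = 1\<close>, the defect \<open>v - w * v\<close> averages the increments \<open>v x - v (x - z)\<close> over \<open>z\<close>.  An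
  increment is at most \<open>\<bar>z\<bar>\<close> times the norm of the derivative and at most twice the norm of \<open>v\<close>, hence
  the truncated first moment of \<open>w\<close>, which is finite for every integrable \<open>w\<close>.\<close>

lemma shift_norm_defect_le:
  assumes W: "sigma_finite_measure W" and y[measurable]: "y \<in> borel_measurable W"
    and w: "bdd_integrable w" "(\<integral>z. w z \<partial>lborel) = 1"
    and v: "bdd_integrable v" "bdd_integrable v'" "primitive_of v v'"
    and c: "0 \<le> c" "0 \<le> D" "shift_norm W y v \<le> ennreal c" "shift_norm W y v' \<le> ennreal (c * D)"
    and eps: "(\<integral>\<^sup>+z. ennreal (\<bar>w z\<bar> * min 2 (D * \<bar>z\<bar>)) \<partial>lborel) \<le> ennreal \<epsilon>"
  shows "shift_norm W y (\<lambda>x. v x - convol w v x) \<le> ennreal (c * \<epsilon>)"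
proof -
  have [measurable]: "v \<in> borel_measurable borel" "w \<in> borel_measurable borel" "v' \<in> borel_measurable borel"
    using bdd_integrableD v w by auto
  have "shift_norm W y (\<lambda>x. v x - convol w v x) \<le> (\<integral>\<^sup>+z. ennreal \<bar>w z\<bar> * ennreal (c * min 2 (D * \<bar>z\<bar>)) \<partial>lborel)"
  proof (rule shift_norm_mono_kernel[where g="\<lambda>x z. ennreal \<bar>v x - v (x - z)\<bar>" and v=v])
    fix x
    have "v x - convol w v x = (\<integral>z. w z * v x - w z * v (x - z) \<partial>lborel)"
      using w convol_integrand[of w v x] v
      by (subst Bochner_Integration.integral_diff) (auto simp: bdd_integrable_def convol_def)
    also have "\<dots> = (\<integral>z. w z * (v x - v (x - z)) \<partial>lborel)" by (simp add: right_diff_distrib)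
    finally show "ennreal \<bar>v x - convol w v x\<bar> \<le> (\<integral>\<^sup>+ z. ennreal \<bar>w z\<bar> * ennreal \<bar>v x - v (x - z)\<bar> \<partial>lborel)"
      using abs_integral_le_nn[of lborel "\<lambda>z. w z * (v x - v (x - z))"] by (simp add: abs_mult ennreal_mult)
  next
    fix x z
    have "shift_norm W y (\<lambda>x. v x - v (x - z)) \<le> ennreal \<bar>z\<bar> * ennreal (c * D)"
      using shift_norm_shift_le(1)[OF W y v(3), of z] c by (meson \<open>v \<in> _\<close> \<open>v' \<in> _\<close> dual_order.trans mult_left_mono zero_le)
    moreover have "shift_norm W y (\<lambda>x. v x - v (x - z)) \<le> 2 * ennreal c"
      using shift_norm_shift_le(2)[OF W y v(3), of z] c by (meson \<open>v \<in> _\<close> \<open>v' \<in> _\<close> dual_order.trans mult_left_mono zero_le)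
    ultimately have "shift_norm W y (\<lambda>x. v x - v (x - z)) \<le> ennreal (c * min 2 (D * \<bar>z\<bar>))"
      using c by (auto simp: min_def mult_ac ennreal_mult)
    then show "(\<integral>\<^sup>+ i. ennreal \<bar>v (x - y i) - v (x - y i - z)\<bar> \<partial>W) \<le> ennreal (c * min 2 (D * \<bar>z\<bar>))"
      unfolding shift_norm_le_iff by auto
  qed (use W in auto)
  also have "\<dots> = (\<integral>\<^sup>+z. ennreal c * ennreal (\<bar>w z\<bar> * min 2 (D * \<bar>z\<bar>)) \<partial>lborel)"
    using c by (intro nn_integral_cong) (simp add: ennreal_mult[symmetric] mult_ac)
  also have "\<dots> = ennreal c * (\<integral>\<^sup>+z. ennreal (\<bar>w z\<bar> * min 2 (D * \<bar>z\<bar>)) \<partial>lborel)"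
    by (rule nn_integral_cmult) measurable
  also have "\<dots> \<le> ennreal c * ennreal \<epsilon>" by (intro mult_left_mono eps) simp
  also have "\<dots> = ennreal (c * \<epsilon>)" using c by (simp add: ennreal_mult')
  finally show ?thesis .
qed

definition smooth_chain :: "nat \<Rightarrow> (nat \<Rightarrow> real \<Rightarrow> real) \<Rightarrow> bool" where
  "smooth_chain M v \<longleftrightarrow> (\<forall>r\<le>M. bdd_integrable (v r)) \<and> (\<forall>r<M. primitive_of (v r) (v (Suc r)))"

lemma smooth_chain_defect:
  assumes "smooth_chain (Suc M) v" "bdd_integrable w"
  shows "smooth_chain M (\<lambda>r x. v r x - convol w (v r) x)"
  using assms unfolding smooth_chain_def
  by (auto intro!: bdd_integrable_diff bdd_integrable_convol primitive_of_diff primitive_of_convol)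

text \<open>Split \<open>v * \<zeta> = v * (w * \<zeta>) + (v - w * v) * \<zeta>\<close>.  The first summand is small because \<open>w * \<zeta>\<close> is.
  In the second, \<open>v - w * v\<close> has again derivatives of all orders in question, smaller by the factor
  \<open>\<epsilon>\<close>; so the step can be repeated as often as there are derivatives, and what is left after
  \<open>M\<close> steps is estimated by the size of \<open>\<zeta>\<close> itself.\<close>

lemma iterated_smoothing:
  assumes W: "sigma_finite_measure W" and y[measurable]: "y \<in> borel_measurable W"
    and y'[measurable]: "y' \<in> borel_measurable W'"
    and compat: "\<And>u \<zeta> a b. bdd_integrable u \<Longrightarrow> bdd_integrable \<zeta> \<Longrightarrow> 0 \<le> a \<Longrightarrow> 0 \<le> b \<Longrightarrow> shift_norm W y u \<le> ennreal a \<Longrightarrow> norm_per \<zeta> \<le> ennreal b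
        \<Longrightarrow> shift_norm W' y' (convol u \<zeta>) \<le> ennreal (a * b)"
    and w: "bdd_integrable w" "(\<integral>z. w z \<partial>lborel) = 1"
    and D: "0 \<le> D"
    and eps: "(\<integral>\<^sup>+z. ennreal (\<bar>w z\<bar> * min 2 (D * \<bar>z\<bar>)) \<partial>lborel) \<le> ennreal \<epsilon>" "0 \<le> \<epsilon>"
    and z: "bdd_integrable \<zeta>" "norm_per \<zeta> \<le> ennreal C0" "norm_per (convol w \<zeta>) \<le> ennreal \<kappa>" "0 \<le> C0" "0 \<le> \<kappa>"
    and v: "smooth_chain M v" "\<And>r. r \<le> M \<Longrightarrow> shift_norm W y (v r) \<le> ennreal (c * D ^ r)" "0 \<le> c"
  shows "shift_norm W' y' (convol (v 0) \<zeta>) \<le> ennreal (c * (\<kappa> * (\<Sum>n<M. \<epsilon> ^ n) + C0 * \<epsilon> ^ M))"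
  using v
proof (induction M arbitrary: v c)
  case 0
  then show ?case using compat[of "v 0" \<zeta> c C0] z by (auto simp: smooth_chain_def)
next
  case (Suc M)
  define u where "u = (\<lambda>r x. v r x - convol w (v r) x)"
  have u: "smooth_chain M u" unfolding u_def using Suc.prems w by (intro smooth_chain_defect) auto
  have b: "bdd_integrable (v 0)" "bdd_integrable (u 0)" using Suc.prems u by (auto simp: smooth_chain_def)
  have un: "shift_norm W y (u r) \<le> ennreal (c * \<epsilon> * D ^ r)" if "r \<le> M" for r
  proof -
    have "shift_norm W y (u r) \<le> ennreal (c * D ^ r * \<epsilon>)"
      unfolding u_def
      by (rule shift_norm_defect_le[OF W y w, where v'="v (Suc r)" and D=D])
        (use Suc.prems(1,3) Suc.prems(2)[of r] Suc.prems(2)[of "Suc r"] that eps D in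
          \<open>auto simp: smooth_chain_def mult_ac\<close>)
    then show ?thesis by (simp add: mult_ac)
  qed
  have IH: "shift_norm W' y' (convol (u 0) \<zeta>) \<le> ennreal (c * \<epsilon> * (\<kappa> * (\<Sum>n<M. \<epsilon> ^ n) + C0 * \<epsilon> ^ M))"
    by (rule Suc.IH[OF u un]) (use Suc.prems eps in auto)
  have split: "convol (v 0) \<zeta> x = convol (v 0) (convol w \<zeta>) x + convol (u 0) \<zeta> x" for x
  proof -
    have 1: "convol (v 0) (convol w \<zeta>) = convol (convol w (v 0)) \<zeta>" using convol_assoc[OF b(1) w(1) z(1)] by simp
    have "convol (u 0) \<zeta> x = (\<integral>t. v 0 t * \<zeta> (x - t) - convol w (v 0) t * \<zeta> (x - t) \<partial>lborel)"
      unfolding u_def convol_def[of "\<lambda>x. v 0 x - convol w (v 0) x"] by (simp add: left_diff_distrib)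
    also have "\<dots> = convol (v 0) \<zeta> x - convol (convol w (v 0)) \<zeta> x"
      unfolding convol_def[of "v 0" \<zeta>] convol_def[of "convol w (v 0)"]
      by (rule Bochner_Integration.integral_diff) (use convol_integrand bdd_integrable_convol bdd_integrableD b w z in auto)
    finally show ?thesis by (simp add: 1)
  qed
  have m: "convol (v 0) (convol w \<zeta>) \<in> borel_measurable borel" "convol (u 0) \<zeta> \<in> borel_measurable borel"
    using b w z by (auto intro!: bdd_integrableD bdd_integrable_convol)
  have "shift_norm W' y' (convol (v 0) \<zeta>) \<le> shift_norm W' y' (convol (v 0) (convol w \<zeta>)) + shift_norm W' y' (convol (u 0) \<zeta>)"
    by (rule shift_norm_add_le[OF m y' split])
  also have "\<dots> \<le> ennreal (c * \<kappa>) + ennreal (c * \<epsilon> * (\<kappa> * (\<Sum>n<M. \<epsilon> ^ n) + C0 * \<epsilon> ^ M))"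
    by (intro add_mono IH compat bdd_integrable_convol b w z) (use Suc.prems(2)[of 0] Suc.prems(3) in auto)
  also have "\<dots> = ennreal (c * (\<kappa> * (\<Sum>n<Suc M. \<epsilon> ^ n) + C0 * \<epsilon> ^ Suc M))"
  proof -
    have "(\<Sum>n<Suc M. \<epsilon> ^ n) = 1 + \<epsilon> * (\<Sum>n<M. \<epsilon> ^ n)"
      by (subst sum.lessThan_Suc_shift) (simp add: sum_distrib_left)
    moreover have "0 \<le> (\<Sum>n<M. \<epsilon> ^ n)" using eps by (intro sum_nonneg) auto
    ultimately show ?thesis using Suc.prems(3) eps z
      by (simp add: ennreal_plus[symmetric] del: ennreal_plus sum.lessThan_Suc) (simp add: algebra_simps)
  qed
  finally show ?case .
qed

lemma norm_per_convol_le: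
  assumes "bdd_integrable u" "bdd_integrable \<zeta>" "0 \<le> a" "0 \<le> b" "norm_L1 u \<le> ennreal a" "norm_per \<zeta> \<le> ennreal b"
  shows "norm_per (convol u \<zeta>) \<le> ennreal (a * b)"
proof -
  have [measurable]: "u \<in> borel_measurable borel" "\<zeta> \<in> borel_measurable borel" using bdd_integrableD assms by auto
  have "norm_per (convol u \<zeta>) \<le> norm_L1 u * norm_per \<zeta>"
    using shift_norm_convol_le[of "count_space (UNIV::int set)" of_int u \<zeta>]
    by (simp add: norm_L1_eq sigma_finite_measure_count_space_countable)
  also have "\<dots> \<le> ennreal a * ennreal b" by (intro mult_mono assms) auto
  finally show ?thesis using assms by (simp add: ennreal_mult)
qed

lemma norm_sup_convol_le:
  assumes "bdd_integrable u" "bdd_integrable \<zeta>" "0 \<le> a" "0 \<le> b" "norm_sup u \<le> ennreal a" "norm_per \<zeta> \<le> ennreal b"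
  shows "norm_sup (convol u \<zeta>) \<le> ennreal (a * b)"
proof -
  have [measurable]: "u \<in> borel_measurable borel" "\<zeta> \<in> borel_measurable borel" using bdd_integrableD assms by auto
  have "norm_sup (convol u \<zeta>) = norm_sup (convol \<zeta> u)" by (simp add: convol_commute)
  also have "\<dots> \<le> norm_L1 \<zeta> * norm_sup u"
    using shift_norm_convol_le[of "count_space (UNIV::unit set)" "\<lambda>_. 0" \<zeta> u]
    by (simp add: norm_L1_eq sigma_finite_measure_count_space_countable)
  also have "\<dots> \<le> ennreal b * ennreal a" by (intro mult_mono assms order.trans[OF norm_L1_le_norm_per]) auto
  finally show ?thesis using assms by (simp add: ennreal_mult mult_ac)
qed

section \<open>A smooth bump\<close>

text \<open>The products of \<open>exp (- 1 / x - 1 / (1 - x))\<close> with negative powers of \<open>x\<close> and \<open>1 - x\<close> on \<open>(0, 1)\<close>,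
  extended by zero.  Their linear span is closed under differentiation, which yields all the
  derivatives of the bump at once.\<close>

definition bump_term :: "nat \<Rightarrow> nat \<Rightarrow> real \<Rightarrow> real" where
  "bump_term a b x = (if 0 < x \<and> x < 1 then (1/x)^a * (1/(1-x))^b * exp (- (1/x) - 1/(1-x)) else 0)"

lemma power_le_fact_exp: "0 \<le> (y::real) \<Longrightarrow> y ^ k * exp (- y) \<le> fact k"
proof -
  assume y: "0 \<le> y"
  have "(\<Sum>n\<in>{k}. y ^ n /\<^sub>R fact n) \<le> (\<Sum>n. y ^ n /\<^sub>R fact n)"
    by (rule sum_le_suminf[OF summable_exp_generic]) (use y in auto)
  then have "y ^ k / fact k \<le> exp y" by (simp add: exp_def divide_inverse mult.commute)
  then have "y ^ k \<le> fact k * exp y" by (simp add: field_simps)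
  then have "y ^ k * exp (- y) \<le> (fact k * exp y) * exp (- y)" by (intro mult_right_mono) auto
  then show ?thesis by (simp add: mult.assoc flip: exp_add)
qed

text \<open>The exponential absorbs any negative power; keeping a factor \<open>x\<^sup>2\<close> gives the derivative at \<open>0\<close>.\<close>

lemma bump_term_le: "\<bar>bump_term a b x\<bar> \<le> fact (a+2) * fact b * x\<^sup>2"
proof (cases "0 < x \<and> x < 1")
  case True
  then have "bump_term a b x = x\<^sup>2 * (((1/x)^(a+2) * exp (- (1/x))) * ((1/(1-x))^b * exp (- (1/(1-x)))))"
  proof -
    have e: "exp (- (1/x) - 1/(1-x)) = exp (- (1/x)) * exp (- (1/(1-x)))" by (simp flip: exp_add)
    have p: "(1/x)^a = x\<^sup>2 * (1/x)^(a+2)" using True by (simp add: power_add power2_eq_square)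
    show ?thesis using True unfolding bump_term_def by (simp only: e p) (simp add: mult_ac)
  qed
  moreover have "((1/x)^(a+2) * exp (- (1/x))) * ((1/(1-x))^b * exp (- (1/(1-x)))) \<le> fact (a+2) * fact b"
    using True by (intro mult_mono power_le_fact_exp) auto
  then have "x\<^sup>2 * (((1/x)^(a+2) * exp (- (1/x))) * ((1/(1-x))^b * exp (- (1/(1-x))))) \<le> x\<^sup>2 * (fact (a+2) * fact b)"
    by (intro mult_left_mono) auto
  moreover have "0 \<le> bump_term a b x" using True by (simp add: bump_term_def)
  ultimately have "\<bar>bump_term a b x\<bar> \<le> x\<^sup>2 * (fact (a+2) * fact b)" by linarith
  then show ?thesis by (simp only: mult.commute)
next
  case False
  then have "bump_term a b x = 0" by (simp add: bump_term_def)
  then show ?thesis by simp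
qed

lemma bump_term_reflect: "bump_term a b x = bump_term b a (1 - x)"
  by (auto simp: bump_term_def mult_ac intro!: arg_cong[of _ _ exp])

lemma bump_term_deriv_0: "(bump_term a b has_real_derivative 0) (at 0)"
proof -
  define C :: real where "C = fact (a+2) * fact b"
  have "((\<lambda>h. C * \<bar>h\<bar>) \<longlongrightarrow> C * \<bar>0\<bar>) (at 0)" by (intro tendsto_intros)
  then have l: "((\<lambda>h. C * \<bar>h\<bar>) \<longlongrightarrow> 0) (at 0)" by simp
  have "((\<lambda>h. (bump_term a b (0 + h) - bump_term a b 0) / h) \<longlongrightarrow> 0) (at 0)"
  proof (rule Lim_null_comparison[OF _ l])
    have "norm ((bump_term a b (0 + h) - bump_term a b 0) / h) \<le> C * \<bar>h\<bar>" if "h \<noteq> 0" for h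
    proof -
      have "\<bar>bump_term a b h\<bar> \<le> C * \<bar>h\<bar> * \<bar>h\<bar>" using bump_term_le[of a b h] by (simp add: C_def power2_eq_square mult.assoc)
      then show ?thesis using that by (simp add: bump_term_def[of a b 0] field_simps)
    qed
    then show "\<forall>\<^sub>F h in at 0. norm ((bump_term a b (0 + h) - bump_term a b 0) / h) \<le> C * \<bar>h\<bar>"
      by (simp add: eventually_at_filter)
  qed
  then show ?thesis by (simp only: DERIV_def)
qed

definition bump_term' :: "nat \<Rightarrow> nat \<Rightarrow> real \<Rightarrow> real" where
  "bump_term' a b x = - real a * bump_term (a+1) b x + real b * bump_term a (b+1) x + bump_term (a+2) b x - bump_term a (b+2) x"

lemma bump_term_deriv: "(bump_term a b has_real_derivative bump_term' a b x) (at x)"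
proof -
  consider "0 < x \<and> x < 1" | "x < 0 \<or> x > 1" | "x = 0" | "x = 1" by linarith
  then show ?thesis
  proof cases
    case 1
    have e: "eventually (\<lambda>y. y \<in> {0<..<1}) (nhds x)" using 1 by (intro eventually_nhds_in_open) auto
    have "((\<lambda>x. (1/x)^a * (1/(1-x))^b * exp (- (1/x) - 1/(1-x))) has_real_derivative bump_term' a b x) (at x)"
    proof -
      define u where "u = 1/x"
      define w where "w = 1/(1-x)"
      define E where "E = exp (- u - w)"
      have du0: "((\<lambda>x. 1/x) has_real_derivative - (u^2)) (at x)"
        using 1 by (auto intro!: derivative_eq_intros simp: u_def field_simps power2_eq_square)
      have dw0: "((\<lambda>x. 1/(1-x)) has_real_derivative w^2) (at x)"
        using 1 by (auto intro!: derivative_eq_intros simp: w_def field_simps power2_eq_square)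
      have du: "((\<lambda>x. (1/x)^a) has_real_derivative - real a * u^(a+1)) (at x)"
        using DERIV_power[OF du0, of a]
        by (rule DERIV_cong) (cases a; simp add: u_def[symmetric] power2_eq_square algebra_simps)
      have dw: "((\<lambda>x. (1/(1-x))^b) has_real_derivative real b * w^(b+1)) (at x)"
        using DERIV_power[OF dw0, of b]
        by (rule DERIV_cong) (cases b; simp add: w_def power2_eq_square)
      have de: "((\<lambda>x. exp (- (1/x) - 1/(1-x))) has_real_derivative (E * (u^2 - w^2))) (at x)"
        using DERIV_fun_exp[OF DERIV_diff[OF DERIV_minus[OF du0] dw0]] by (simp add: E_def u_def w_def)
      have "bump_term' a b x = - real a * (u^(a+1) * w^b * E) + real b * (u^a * w^(b+1) * E) + u^(a+2) * w^b * E - u^a * w^(b+2) * E"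
        using 1 by (simp add: bump_term'_def bump_term_def u_def w_def E_def)
      then show ?thesis
        using DERIV_mult[OF DERIV_mult[OF du dw] de]
        by (elim DERIV_cong) (simp add: u_def[symmetric] w_def[symmetric] E_def algebra_simps power2_eq_square)
    qed
    then show ?thesis
      by (rule has_field_derivative_transform_within_open[where S="{0<..<1}"]) (use 1 in \<open>auto simp: bump_term_def\<close>)
  next
    case 2
    have "((\<lambda>_. 0) has_real_derivative bump_term' a b x) (at x)" using 2 by (auto simp: bump_term'_def bump_term_def)
    then show ?thesis
      by (rule has_field_derivative_transform_within_open[where S="{..<0} \<union> {1<..}"])
        (use 2 in \<open>auto simp: bump_term_def\<close>)
  next
    case 3
    then show ?thesis using bump_term_deriv_0 by (simp add: bump_term'_def bump_term_def)
  next
    case 4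
    have "((\<lambda>x. bump_term b a (1 - x)) has_real_derivative 0) (at x)"
    proof -
      have d: "(bump_term b a has_real_derivative 0) (at (1 - x))" using bump_term_deriv_0 4 by simp
      have "((\<lambda>x. 1 - x) has_real_derivative - 1) (at x)" by (auto intro!: derivative_eq_intros)
      from DERIV_chain2[OF d this] show ?thesis by simp
    qed
    moreover have "(\<lambda>x. bump_term b a (1 - x)) = bump_term a b" by (rule ext) (rule bump_term_reflect[symmetric])
    ultimately show ?thesis using 4 by (simp add: bump_term'_def bump_term_def[of _ _ 1])
  qed
qed

inductive_set bump_space :: "(real \<Rightarrow> real) set" where
  base: "bump_term a b \<in> bump_space"
| scale: "g \<in> bump_space \<Longrightarrow> (\<lambda>x. c * g x) \<in> bump_space"
| add: "g \<in> bump_space \<Longrightarrow> h \<in> bump_space \<Longrightarrow> (\<lambda>x. g x + h x) \<in> bump_space"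

lemma bump_space_deriv:
  assumes "g \<in> bump_space"
  shows "deriv g \<in> bump_space \<and> (\<forall>x. (g has_real_derivative deriv g x) (at x))"
proof -
  have "\<exists>g'\<in>bump_space. \<forall>x. (g has_real_derivative g' x) (at x)" using assms
  proof induction
    case (base a b)
    have "bump_term' a b = (\<lambda>x. ((- real a) * bump_term (a+1) b x + real b * bump_term a (b+1) x) + (bump_term (a+2) b x + (-1) * bump_term a (b+2) x))"
      by (auto simp: bump_term'_def)
    also have "\<dots> \<in> bump_space" by (intro bump_space.intros)
    finally show ?case using bump_term_deriv by blast
  next
    case (scale g c)
    then obtain g' where g': "g' \<in> bump_space" "\<And>x. (g has_real_derivative g' x) (at x)" by blast
    then show ?case by (intro bexI[of _ "\<lambda>x. c * g' x"] bump_space.scale) (auto intro!: DERIV_cmult)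
  next
    case (add g h)
    then obtain g' h' where g': "g' \<in> bump_space" "\<And>x. (g has_real_derivative g' x) (at x)"
      "h' \<in> bump_space" "\<And>x. (h has_real_derivative h' x) (at x)" by blast
    then show ?case by (intro bexI[of _ "\<lambda>x. g' x + h' x"] bump_space.add) (auto intro!: DERIV_add)
  qed
  then obtain g' where g': "g' \<in> bump_space" "\<And>x. (g has_real_derivative g' x) (at x)" by blast
  then have "deriv g = g'" using DERIV_imp_deriv by blast
  then show ?thesis using g' by auto
qed

lemma bump_space_outside: "g \<in> bump_space \<Longrightarrow> x \<le> 0 \<or> 1 \<le> x \<Longrightarrow> g x = 0"
  by (induction rule: bump_space.induct) (auto simp: bump_term_def)

definition bump :: "nat \<Rightarrow> real \<Rightarrow> real" where "bump r = (deriv ^^ r) (bump_term 0 0)"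

lemma bump_in: "bump r \<in> bump_space"
  by (induction r) (auto simp: bump_def bump_space.base bump_space_deriv)

lemma bump_deriv: "(bump r has_real_derivative bump (Suc r) x) (at x)"
  using bump_space_deriv[OF bump_in[of r]] by (simp add: bump_def)

lemma bump_outside: "x \<le> 0 \<or> 1 \<le> x \<Longrightarrow> bump r x = 0"
  using bump_space_outside bump_in by blast

lemma bump_0_pos: "0 < x \<Longrightarrow> x < 1 \<Longrightarrow> 0 < bump 0 x"
  by (simp add: bump_def bump_term_def)

lemma bump_0_nonneg: "0 \<le> bump 0 x"
  by (simp add: bump_def bump_term_def)

lemma bump_continuous: "continuous_on A (bump r)"
  using bump_deriv DERIV_isCont continuous_at_imp_continuous_on by blast

lemma bump_measurable [measurable]: "bump r \<in> borel_measurable borel"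
  by (rule borel_measurable_continuous_onI[OF bump_continuous])

lemma bump_bounded: obtains B where "0 < B" "\<And>x. \<bar>bump r x\<bar> \<le> B"
proof -
  have "compact (bump r ` {0..1})" by (intro compact_continuous_image bump_continuous) auto
  then obtain B where B: "\<And>x. x \<in> {0..1} \<Longrightarrow> \<bar>bump r x\<bar> \<le> B"
    using compact_imp_bounded[of "bump r ` {0..1}"] unfolding bounded_iff real_norm_def by (metis imageI)
  have "\<bar>bump r x\<bar> \<le> \<bar>B\<bar> + 1" for x
    using B[of x] bump_outside[of x r] by (cases "x \<in> {0..1}") auto
  then show ?thesis using that[of "\<bar>B\<bar> + 1"] by auto
qed

lemma bdd_integrable_compact_support:
  assumes [measurable]: "f \<in> borel_measurable borel" and "\<And>x. \<bar>f x\<bar> \<le> B" "\<And>x. x \<notin> {a..b} \<Longrightarrow> f x = 0"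
  shows "bdd_integrable f"
proof -
  have "integrable lborel (\<lambda>x. indicator {a..b} x *\<^sub>R f x)"
  proof (rule integrableI_bounded_set_indicator[where B=B])
    show "AE x in lborel. x \<in> {a..b} \<longrightarrow> norm (f x) \<le> B" using assms by auto
  qed (auto simp: emeasure_lborel_Icc_eq)
  also have "(\<lambda>x. indicator {a..b} x *\<^sub>R f x) = f" using assms(3) by (force simp: indicator_def)
  finally show ?thesis using assms(2) by (auto simp: bdd_integrable_def)
qed

lemma bdd_integrable_bump: "bdd_integrable (bump r)"
proof -
  obtain B where B: "\<And>x. \<bar>bump r x\<bar> \<le> B" using bump_bounded by metis
  show ?thesis by (rule bdd_integrable_compact_support[of _ B 0 1]) (use B bump_outside in auto)
qed

lemma bump_integral_pos: "0 < (\<integral>x. bump 0 x \<partial>lborel)"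
proof -
  have i: "integrable lborel (bump 0)" using bdd_integrable_bump by (auto simp: bdd_integrable_def)
  have "(\<integral>x. bump 0 x \<partial>lborel) \<noteq> 0"
  proof
    assume "(\<integral>x. bump 0 x \<partial>lborel) = 0"
    then have "AE x in lborel. bump 0 x = 0"
      using integral_nonneg_eq_0_iff_AE[OF i] bump_0_nonneg by auto
    then have "AE x in lborel. x \<notin> {0<..<1::real}" by eventually_elim (use bump_0_pos in force)
    then have "emeasure lborel {x \<in> space lborel. \<not> x \<notin> {0<..<1::real}} = 0"
      by (subst (asm) AE_iff_measurable[OF _ refl]) auto
    moreover have "{x \<in> space lborel. \<not> x \<notin> {0<..<1::real}} = {0<..<1}" by auto
    ultimately show False by simp
  qed
  then show ?thesis using integral_nonneg_AE[of "bump 0" lborel] bump_0_nonneg by (auto simp: less_le)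
qed

lemma deriv_bump_affine:
  "(deriv ^^ m) (\<lambda>x. c * bump r (t + d * x)) = (\<lambda>x. c * d ^ m * bump (r + m) (t + d * x))"
proof (induction m)
  case (Suc m)
  have "((\<lambda>x. c * d ^ m * bump (r + m) (t + d * x)) has_real_derivative c * d ^ Suc m * bump (r + Suc m) (t + d * x)) (at x)" for x
    by (auto intro!: derivative_eq_intros DERIV_chain2[OF bump_deriv])
  then show ?case using Suc by (auto intro!: DERIV_imp_deriv)
qed auto

lemma bump_affine_deriv:
  "((\<lambda>x. c * bump r (t + d * x)) has_real_derivative c * d * bump (Suc r) (t + d * x)) (at x)"
  by (auto intro!: derivative_eq_intros DERIV_chain2[OF bump_deriv])

lemma test_function_bump:
  assumes "d \<noteq> 0"
  shows "test_function (\<lambda>x. c * bump r (t + d * x))"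
  unfolding test_function_def deriv_bump_affine
proof (intro conjI allI)
  fix m x
  show "(\<lambda>x. c * d ^ m * bump (r + m) (t + d * x)) field_differentiable at x"
    using bump_affine_deriv field_differentiable_def by blast
  show "\<exists>R. \<forall>x. R < \<bar>x\<bar> \<longrightarrow> c * bump r (t + d * x) = 0"
  proof (intro exI[of _ "(\<bar>t\<bar> + 1) / \<bar>d\<bar>"] allI impI)
    fix x assume "(\<bar>t\<bar> + 1) / \<bar>d\<bar> < \<bar>x\<bar>"
    then have "\<bar>t\<bar> + 1 < \<bar>d * x\<bar>" using assms by (simp add: field_simps abs_mult)
    then have "t + d * x \<le> 0 \<or> 1 \<le> t + d * x" by linarith
    then show "c * bump r (t + d * x) = 0" using bump_outside by auto
  qed
qed

lemma primitive_of_DERIV: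
  assumes "\<And>x. (v has_real_derivative v' x) (at x)" "continuous_on UNIV v'"
  shows "primitive_of v v'"
  unfolding primitive_of_def
proof (intro allI impI)
  fix x y :: real assume "x \<le> y"
  have "(\<integral>s. indicator {x..y} s *\<^sub>R v' s \<partial>lborel) = v y - v x"
    by (rule integral_FTC_Icc[OF \<open>x \<le> y\<close>])
      (use assms in \<open>auto intro: has_field_derivative_at_within continuous_on_subset simp flip: has_real_derivative_iff_has_vector_derivative\<close>)
  moreover have "(\<integral>s. indicator {x..y} s *\<^sub>R v' s \<partial>lborel) = (\<integral>t. indicator {0..y-x} t * v' (y - t) \<partial>lborel)"
    by (subst lborel_integral_real_affine[of "-1" _ y]) (auto simp: indicator_def intro!: Bochner_Integration.integral_cong)
  ultimately show "v y - v x = (\<integral>t. indicator {0..y-x} t * v' (y - t) \<partial>lborel)" by simp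
qed

lemma smooth_chain_of_DERIV:
  assumes "\<And>r. bdd_integrable (v r)" "\<And>r x. (v r has_real_derivative v (Suc r) x) (at x)"
  shows "smooth_chain M v"
proof -
  have "continuous_on UNIV (v r)" for r
    using DERIV_continuous[OF assms(2)] by (simp add: continuous_at_imp_continuous_on)
  then show ?thesis using assms unfolding smooth_chain_def by (auto intro!: primitive_of_DERIV)
qed

lemma smooth_chain_bound:
  assumes "smooth_chain M v"
  shows "\<exists>A>0. \<forall>r\<le>M. (\<forall>x. \<bar>v r x\<bar> \<le> A) \<and> (\<integral>\<^sup>+x. ennreal \<bar>v r x\<bar> \<partial>lborel) \<le> ennreal A"
proof -
  have "\<forall>r\<in>{..M}. \<exists>B>0. (\<forall>x. \<bar>v r x\<bar> \<le> B) \<and> (\<integral>\<^sup>+x. ennreal \<bar>v r x\<bar> \<partial>lborel) \<le> ennreal B"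
  proof
    fix r assume "r \<in> {..M}"
    then have b: "bdd_integrable (v r)" using assms by (auto simp: smooth_chain_def)
    obtain B where B: "0 < B" "\<And>x. \<bar>v r x\<bar> \<le> B" using bdd_integrable_bound[OF b] by metis
    have i: "0 \<le> (\<integral>x. \<bar>v r x\<bar> \<partial>lborel)" by simp
    have "(\<integral>\<^sup>+x. ennreal \<bar>v r x\<bar> \<partial>lborel) = ennreal (\<integral>x. \<bar>v r x\<bar> \<partial>lborel)"
      using bdd_integrableD(1)[OF b] by (intro nn_integral_eq_integral) auto
    also have "\<dots> \<le> ennreal (B + (\<integral>x. \<bar>v r x\<bar> \<partial>lborel))" using B(1) by (intro ennreal_leI) simp
    finally have n: "(\<integral>\<^sup>+x. ennreal \<bar>v r x\<bar> \<partial>lborel) \<le> ennreal (B + (\<integral>x. \<bar>v r x\<bar> \<partial>lborel))" .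
    have "\<bar>v r x\<bar> \<le> B + (\<integral>x. \<bar>v r x\<bar> \<partial>lborel)" for x using B(2)[of x] i by linarith
    then show "\<exists>B>0. (\<forall>x. \<bar>v r x\<bar> \<le> B) \<and> (\<integral>\<^sup>+x. ennreal \<bar>v r x\<bar> \<partial>lborel) \<le> ennreal B"
      using n add_pos_nonneg[OF B(1) i] by blast
  qed
  then obtain B where B: "\<forall>r\<in>{..M}. 0 < B r \<and> (\<forall>x. \<bar>v r x\<bar> \<le> B r) \<and> (\<integral>\<^sup>+x. ennreal \<bar>v r x\<bar> \<partial>lborel) \<le> ennreal (B r)"
    using bchoice[of "{..M}" "\<lambda>r B. 0 < B \<and> (\<forall>x. \<bar>v r x\<bar> \<le> B) \<and> (\<integral>\<^sup>+x. ennreal \<bar>v r x\<bar> \<partial>lborel) \<le> ennreal B"] by auto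
  define A where "A = (\<Sum>r\<le>M. B r)"
  have le: "B r \<le> A" if "r \<le> M" for r
    unfolding A_def using B that by (intro member_le_sum) (auto intro: less_imp_le)
  have "0 < B 0" using B by simp
  then have A0: "0 < A" using le[of 0] by simp
  have "(\<forall>x. \<bar>v r x\<bar> \<le> A) \<and> (\<integral>\<^sup>+x. ennreal \<bar>v r x\<bar> \<partial>lborel) \<le> ennreal A" if r: "r \<le> M" for r
  proof
    have Br: "\<forall>x. \<bar>v r x\<bar> \<le> B r" "(\<integral>\<^sup>+x. ennreal \<bar>v r x\<bar> \<partial>lborel) \<le> ennreal (B r)" using B r by auto
    show "\<forall>x. \<bar>v r x\<bar> \<le> A" using Br(1) le[OF r] by (meson order_trans)
    show "(\<integral>\<^sup>+x. ennreal \<bar>v r x\<bar> \<partial>lborel) \<le> ennreal A" by (rule order_trans[OF Br(2) ennreal_leI[OF le[OF r]]])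
  qed
  then show ?thesis using A0 by blast
qed

section \<open>Private views of neighbouring densities\<close>

text \<open>Tests take values in \<open>[0, 1]\<close>; the facts in this form move between the two kinds of integral.\<close>

lemma (in prob_space) integral_of_unit_valued:
  assumes "g \<in> borel_measurable M" "\<And>y. y \<in> space M \<Longrightarrow> 0 \<le> g y \<and> g y \<le> (1::real)"
  shows "integrable M g" "(\<integral>\<^sup>+y. ennreal (g y) \<partial>M) = ennreal (\<integral>y. g y \<partial>M)"
    "0 \<le> (\<integral>y. g y \<partial>M)" "(\<integral>y. g y \<partial>M) \<le> 1"
proof -
  show i: "integrable M g"
    by (rule integrable_const_bound[where B=1]) (use assms in \<open>auto intro!: AE_I2\<close>)
  show "(\<integral>\<^sup>+y. ennreal (g y) \<partial>M) = ennreal (\<integral>y. g y \<partial>M)"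
    by (rule nn_integral_eq_integral[OF i]) (use assms in \<open>auto intro!: AE_I2\<close>)
  show "0 \<le> (\<integral>y. g y \<partial>M)" by (rule integral_nonneg_AE) (use assms in \<open>auto intro!: AE_I2\<close>)
  have "(\<integral>y. g y \<partial>M) \<le> (\<integral>y. 1 \<partial>M)" by (rule integral_mono_AE[OF i]) (use assms in \<open>auto intro!: AE_I2\<close>)
  then show "(\<integral>y. g y \<partial>M) \<le> 1" by (simp add: prob_space)
qed

text \<open>Let \<open>\<mu>\<close> be the mean of \<open>f\<close> under \<open>M'\<close> and \<open>m\<close> its mean absolute deviation.  The hypothesis for
  the positive and negative parts of \<open>f - \<mu>\<close> gives \<open>\<integral> f dM \<le> \<mu> + \<delta> m\<close>.  Since
  \<open>\<mu>\<^sup>2 + m\<^sup>2 \<le> \<integral> f\<^sup>2 dM'\<close> by Jensen's inequality, the Cauchy-Schwarz inequality finishes the proof.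
  Centring is what makes the excess \<open>\<delta>\<^sup>2\<close> rather than \<open>\<delta>\<close>.\<close>

lemma second_moment_comparison:
  assumes M: "prob_space M" and M': "prob_space M'" and sets: "sets M = sets M'" and d: "0 \<le> \<delta>"
    and H: "\<And>g. g \<in> borel_measurable M' \<Longrightarrow> (\<And>y. y \<in> space M' \<Longrightarrow> 0 \<le> g y \<and> g y \<le> (1::real)) \<Longrightarrow>
        \<bar>(\<integral>y. g y \<partial>M) - (\<integral>y. g y \<partial>M')\<bar> \<le> \<delta> * (\<integral>y. g y \<partial>M')"
    and f: "f \<in> borel_measurable M'" "\<And>y. y \<in> space M' \<Longrightarrow> 0 \<le> f y \<and> f y \<le> (1::real)"
  shows "(\<integral>y. f y \<partial>M)\<^sup>2 \<le> (1 + \<delta>\<^sup>2) * (\<integral>y. (f y)\<^sup>2 \<partial>M')"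
proof -
  interpret M: prob_space M by fact
  interpret M': prob_space M' by fact
  have mc: "borel_measurable M = (borel_measurable M' :: (_ \<Rightarrow> real) set)"
    by (rule measurable_cong_sets[OF sets refl])
  have sp: "space M = space M'" using sets by (rule sets_eq_imp_space_eq)
  note f(1)[measurable]
  define \<mu> where "\<mu> = (\<integral>y. f y \<partial>M')"
  have mu: "0 \<le> \<mu>" "\<mu> \<le> 1" unfolding \<mu>_def using M'.integral_of_unit_valued[OF f] by auto
  \<comment> \<open>positive and negative part of the centred function\<close>
  define p n where "p y = max (f y - \<mu>) 0" and "n y = max (\<mu> - f y) 0" for y
  have [measurable]: "p \<in> borel_measurable M'" "n \<in> borel_measurable M'" unfolding p_def[abs_def] n_def[abs_def] by measurable
  have pn: "0 \<le> p y \<and> p y \<le> 1" "0 \<le> n y \<and> n y \<le> 1" if "y \<in> space M'" for y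
    using f(2)[OF that] mu by (auto simp: p_def n_def)
  have fe: "f y = \<mu> + p y - n y" for y by (auto simp: p_def n_def)
  have i': "integrable M' f" "integrable M' p" "integrable M' n"
    by (rule M'.integral_of_unit_valued(1); use f pn in auto)+
  have i: "integrable M p" "integrable M n" "integrable M f"
    using M.integral_of_unit_valued[of p] M.integral_of_unit_valued[of n] M.integral_of_unit_valued[of f] f pn sp mc by auto
  have "(\<integral>y. f y \<partial>M) = (\<integral>y. \<mu> + p y - n y \<partial>M)" by (simp only: fe[symmetric])
  then have "(\<integral>y. f y \<partial>M) = \<mu> + (\<integral>y. p y \<partial>M) - (\<integral>y. n y \<partial>M)"
    using i by (simp add: M.prob_space)
  moreover have "\<mu> = (\<integral>y. \<mu> + p y - n y \<partial>M')" by (subst \<mu>_def) (simp only: fe[symmetric])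
  then have "\<mu> = \<mu> + (\<integral>y. p y \<partial>M') - (\<integral>y. n y \<partial>M')"
    using i' by (simp add: M'.prob_space)
  ultimately have "(\<integral>y. f y \<partial>M) \<le> \<mu> + \<bar>(\<integral>y. p y \<partial>M) - (\<integral>y. p y \<partial>M')\<bar> + \<bar>(\<integral>y. n y \<partial>M) - (\<integral>y. n y \<partial>M')\<bar>"
    by linarith
  also have "\<dots> \<le> \<mu> + \<delta> * (\<integral>y. p y \<partial>M') + \<delta> * (\<integral>y. n y \<partial>M')"
    by (intro add_mono H order_refl) (use pn in auto)
  also have "\<dots> = \<mu> + \<delta> * (\<integral>y. \<bar>f y - \<mu>\<bar> \<partial>M')"
  proof -
    have "\<bar>f y - \<mu>\<bar> = p y + n y" for y by (auto simp: p_def n_def)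
    then show ?thesis using i' by (simp add: algebra_simps)
  qed
  finally have 1: "(\<integral>y. f y \<partial>M) \<le> \<mu> + \<delta> * (\<integral>y. \<bar>f y - \<mu>\<bar> \<partial>M')" .
  define m where "m = (\<integral>y. \<bar>f y - \<mu>\<bar> \<partial>M')"
  have sq: "integrable M' (\<lambda>y. (f y)\<^sup>2)"
    by (rule M'.integral_of_unit_valued) (use f in \<open>auto simp: power_le_one\<close>)
  have ab: "integrable M' (\<lambda>y. \<bar>f y - \<mu>\<bar>)" using i' by auto
  \<comment> \<open>Jensen's inequality as the nonnegativity of a variance\<close>
  have "0 \<le> (\<integral>y. (\<bar>f y - \<mu>\<bar> - m)\<^sup>2 \<partial>M')" by simp
  also have "(\<lambda>y. (\<bar>f y - \<mu>\<bar> - m)\<^sup>2) = (\<lambda>y. ((f y)\<^sup>2 - 2 * \<mu> * f y) + (\<mu>\<^sup>2 + m\<^sup>2) - 2 * m * \<bar>f y - \<mu>\<bar>)"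
    by (auto simp: power2_diff power2_eq_square algebra_simps)
  also have "(\<integral>y. ((f y)\<^sup>2 - 2 * \<mu> * f y) + (\<mu>\<^sup>2 + m\<^sup>2) - 2 * m * \<bar>f y - \<mu>\<bar> \<partial>M')
      = ((\<integral>y. (f y)\<^sup>2 \<partial>M') - 2 * \<mu> * \<mu>) + (\<mu>\<^sup>2 + m\<^sup>2) - 2 * m * m"
  proof -
    have i1: "integrable M' (\<lambda>y. 2 * \<mu> * f y)" "integrable M' (\<lambda>y. 2 * m * \<bar>f y - \<mu>\<bar>)" using i' ab by auto
    show ?thesis using i1 sq by (simp add: M'.prob_space \<mu>_def[symmetric] m_def[symmetric])
  qed
  finally have 2: "m\<^sup>2 + \<mu>\<^sup>2 \<le> (\<integral>y. (f y)\<^sup>2 \<partial>M')" by (simp add: power2_eq_square algebra_simps)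
  have m0: "0 \<le> m" unfolding m_def by simp
  have "0 \<le> (\<integral>y. f y \<partial>M)" using M.integral_of_unit_valued[of f] f sp mc by auto
  then have "(\<integral>y. f y \<partial>M)\<^sup>2 \<le> (\<mu> + \<delta> * m)\<^sup>2" using 1 by (intro power_mono) (auto simp: m_def)
  also have "\<dots> \<le> (1 + \<delta>\<^sup>2) * (m\<^sup>2 + \<mu>\<^sup>2)"
  proof -
    \<comment> \<open>Cauchy-Schwarz for the vectors \<open>(\<mu>, m)\<close> and \<open>(1, \<delta>)\<close>\<close>
    have "0 \<le> (m - \<delta> * \<mu>)\<^sup>2" by simp
    then show ?thesis by (simp add: power2_eq_square algebra_simps)
  qed
  also have "\<dots> \<le> (1 + \<delta>\<^sup>2) * (\<integral>y. (f y)\<^sup>2 \<partial>M')" using 2 by (intro mult_left_mono) auto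
  finally show ?thesis .
qed

definition prob_density :: "(real \<Rightarrow> real) \<Rightarrow> bool" where
  "prob_density f \<longleftrightarrow> f \<in> borel_measurable borel \<and> (\<forall>x. 0 \<le> f x) \<and> integrable lborel f \<and> (\<integral>x. f x \<partial>lborel) = 1"

abbreviation "law f \<equiv> density lborel (\<lambda>t. ennreal (f t))"

lemma prob_density_prob:
  assumes "prob_density f" shows "prob_space (law f)" "law f \<in> space (prob_algebra borel)"
proof -
  have [measurable]: "f \<in> borel_measurable borel" using assms by (simp add: prob_density_def)
  have "(\<integral>\<^sup>+x. ennreal (f x) \<partial>lborel) = ennreal (\<integral>x. f x \<partial>lborel)"
    by (rule nn_integral_eq_integral) (use assms in \<open>auto simp: prob_density_def\<close>)
  then show "prob_space (law f)" using assms by (intro prob_spaceI) (simp add: emeasure_density prob_density_def)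
  then show "law f \<in> space (prob_algebra borel)" by (simp add: space_prob_algebra)
qed

lemma bind_kernel_integral:
  assumes f: "prob_density f" and K[measurable]: "K \<in> borel \<rightarrow>\<^sub>M prob_algebra Z"
    and g[measurable]: "g \<in> borel_measurable Z" and g01: "\<And>y. y \<in> space Z \<Longrightarrow> 0 \<le> g y \<and> g y \<le> (1::real)"
  shows "(\<lambda>x. \<integral>y. g y \<partial>K x) \<in> borel_measurable borel"
    "\<And>x. 0 \<le> (\<integral>y. g y \<partial>K x) \<and> (\<integral>y. g y \<partial>K x) \<le> 1"
    "(\<integral>y. g y \<partial>(law f \<bind> K)) = (\<integral>x. f x * (\<integral>y. g y \<partial>K x) \<partial>lborel)"
proof -
  have [measurable]: "f \<in> borel_measurable borel" using f by (simp add: prob_density_def)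
  have f0: "0 \<le> f x" for x using f by (simp add: prob_density_def)
  have Kx: "prob_space (K x)" "sets (K x) = sets Z" for x
    using measurable_space[OF K, of x] by (auto simp: space_prob_algebra)
  have spK: "space (K x) = space Z" for x using Kx(2) by (rule sets_eq_imp_space_eq)
  have gK: "g \<in> borel_measurable (K x)" for x by (subst measurable_cong_sets[OF Kx(2) refl]) (rule g)
  have gx: "(\<integral>\<^sup>+y. ennreal (g y) \<partial>K x) = ennreal (\<integral>y. g y \<partial>K x)" "0 \<le> (\<integral>y. g y \<partial>K x) \<and> (\<integral>y. g y \<partial>K x) \<le> 1" for x
    using prob_space.integral_of_unit_valued[OF Kx(1)[of x] gK[of x]] g01 spK[of x] by blast+
  then show "\<And>x. 0 \<le> (\<integral>y. g y \<partial>K x) \<and> (\<integral>y. g y \<partial>K x) \<le> 1" by blast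
  have Ks[measurable]: "K \<in> borel \<rightarrow>\<^sub>M subprob_algebra Z" by (rule measurable_prob_algebraD[OF K])
  have "(\<lambda>x. enn2real (\<integral>\<^sup>+y. ennreal (g y) \<partial>K x)) \<in> borel_measurable borel" by measurable
  then show m[measurable]: "(\<lambda>x. \<integral>y. g y \<partial>K x) \<in> borel_measurable borel" by (simp add: gx)
  have Kl: "K \<in> law f \<rightarrow>\<^sub>M prob_algebra Z" by (subst measurable_cong_sets[OF sets_density refl]) simp
  have P: "prob_space (law f \<bind> K)" "sets (law f \<bind> K) = sets Z"
    using prob_space_bind'[OF prob_density_prob(2)[OF f] K] sets_bind'[OF prob_density_prob(2)[OF f] K] by auto
  have gP: "g \<in> borel_measurable (law f \<bind> K)" by (subst measurable_cong_sets[OF P(2) refl]) (rule g)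
  have g01P: "\<And>y. y \<in> space (law f \<bind> K) \<Longrightarrow> 0 \<le> g y \<and> g y \<le> 1"
    using g01 sets_eq_imp_space_eq[OF P(2)] by blast
  have "ennreal (\<integral>y. g y \<partial>(law f \<bind> K)) = (\<integral>\<^sup>+y. ennreal (g y) \<partial>(law f \<bind> K))"
    by (rule prob_space.integral_of_unit_valued(2)[OF P(1) gP g01P, symmetric])
  also have "\<dots> = (\<integral>\<^sup>+x. \<integral>\<^sup>+y. ennreal (g y) \<partial>K x \<partial>law f)"
    by (rule nn_integral_bind[where B=Z]) (use measurable_prob_algebraD[OF Kl] in auto)
  also have "\<dots> = (\<integral>\<^sup>+x. ennreal (f x * (\<integral>y. g y \<partial>K x)) \<partial>lborel)"
    by (subst nn_integral_density) (auto simp: gx ennreal_mult' f0)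
  also have "\<dots> = ennreal (\<integral>x. f x * (\<integral>y. g y \<partial>K x) \<partial>lborel)"
  proof (rule nn_integral_eq_integral)
    show "integrable lborel (\<lambda>x. f x * (\<integral>y. g y \<partial>K x))"
      by (rule Bochner_Integration.integrable_bound[where f=f])
        (use f gx f0 in \<open>auto simp: prob_density_def abs_mult intro!: AE_I2 mult_left_le\<close>)
  qed (use f0 gx in auto)
  finally have *: "ennreal (\<integral>y. g y \<partial>(law f \<bind> K)) = ennreal (\<integral>x. f x * (\<integral>y. g y \<partial>K x) \<partial>lborel)" .
  have "0 \<le> (\<integral>x. f x * (\<integral>y. g y \<partial>K x) \<partial>lborel)" using f0 gx by (intro integral_nonneg_AE AE_I2) auto
  moreover have "0 \<le> (\<integral>y. g y \<partial>(law f \<bind> K))"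
    by (rule prob_space.integral_of_unit_valued(3)[OF P(1) gP g01P])
  ultimately show "(\<integral>y. g y \<partial>(law f \<bind> K)) = (\<integral>x. f x * (\<integral>y. g y \<partial>K x) \<partial>lborel)" using * by simp
qed

text \<open>With \<open>k x = \<integral> g dK(x)\<close> and \<open>m = inf k\<close>, privacy says \<open>m \<le> k \<le> e m\<close>.  The difference of the two
  integrals is \<open>\<integral> (f - f') k = \<integral> (f - f') (k - m)\<close>, because both densities have mass one, and
  \<open>0 \<le> k - m \<le> (e - 1) m\<close>, where \<open>m\<close> is at most the integral on the right-hand side.\<close>

lemma private_marginals_close:
  assumes f: "prob_density f" and f': "prob_density f'" and K[measurable]: "K \<in> borel \<rightarrow>\<^sub>M prob_algebra Z"
    and e: "1 \<le> e" and priv: "\<And>x x' A. A \<in> sets Z \<Longrightarrow> emeasure (K x) A \<le> ennreal e * emeasure (K x') A"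
    and g[measurable]: "g \<in> borel_measurable Z" and g01: "\<And>y. y \<in> space Z \<Longrightarrow> 0 \<le> g y \<and> g y \<le> (1::real)"
  shows "\<bar>(\<integral>y. g y \<partial>(law f \<bind> K)) - (\<integral>y. g y \<partial>(law f' \<bind> K))\<bar>
     \<le> ((e - 1) * (\<integral>x. \<bar>f x - f' x\<bar> \<partial>lborel)) * (\<integral>y. g y \<partial>(law f' \<bind> K))"
proof -
  define k where "k x = (\<integral>y. g y \<partial>K x)" for x
  note kk = bind_kernel_integral[OF f K g g01, folded k_def] bind_kernel_integral[OF f' K g g01, folded k_def]
  have [measurable]: "k \<in> borel_measurable borel" using kk by auto
  have k01: "0 \<le> k x" "k x \<le> 1" for x using kk by auto
  have Kx: "prob_space (K x)" "sets (K x) = sets Z" for x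
    using measurable_space[OF K, of x] by (auto simp: space_prob_algebra)
  have gK: "g \<in> borel_measurable (K x)" for x by (subst measurable_cong_sets[OF Kx(2) refl]) (rule g)
  have g01K: "0 \<le> g y \<and> g y \<le> 1" if "y \<in> space (K x)" for x y
    using g01 sets_eq_imp_space_eq[OF Kx(2)[of x]] that by blast
  have kle: "k x \<le> e * k x'" for x x'
  proof -
    have ms: "sets (K x) = sets (scale_measure (ennreal e) (K x'))" using Kx by simp
    have le: "K x \<le> scale_measure (ennreal e) (K x')"
      unfolding le_measure[OF ms] by (auto simp: Kx priv)
    have "ennreal (k x) = (\<integral>\<^sup>+y. ennreal (g y) \<partial>K x)" unfolding k_def
      using prob_space.integral_of_unit_valued(2)[OF Kx(1) gK g01K] by simp
    also have "\<dots> \<le> (\<integral>\<^sup>+y. ennreal (g y) \<partial>scale_measure (ennreal e) (K x'))"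
      by (rule nn_integral_mono_measure[OF ms le])
    also have "\<dots> = ennreal e * (\<integral>\<^sup>+y. ennreal (g y) \<partial>K x')"
      by (rule nn_integral_scale_measure) (subst measurable_cong_sets[OF Kx(2) refl], simp)
    also have "(\<integral>\<^sup>+y. ennreal (g y) \<partial>K x') = ennreal (k x')" unfolding k_def
      using prob_space.integral_of_unit_valued(2)[OF Kx(1) gK g01K] by simp
    also have "ennreal e * ennreal (k x') = ennreal (e * k x')" using e by (simp add: ennreal_mult k01)
    finally show ?thesis using e k01 by simp
  qed
  define m where "m = (INF x. k x)"
  have bdd: "bdd_below (range k)" using k01 by (auto intro!: bdd_belowI[of _ 0])
  have mk: "m \<le> k x" for x unfolding m_def by (rule cINF_lower[OF bdd]) simp
  have m0: "0 \<le> m" unfolding m_def by (rule cINF_greatest) (use k01 in auto)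
  have km: "k x \<le> e * m" for x
  proof -
    have "k x / e \<le> m" unfolding m_def
      by (rule cINF_greatest) (use kle[of x] e in \<open>auto simp: field_simps\<close>)
    then show ?thesis using e by (simp add: field_simps)
  qed
  have ib: "integrable lborel (\<lambda>x. h x * k x)" if "integrable lborel h" for h :: "real \<Rightarrow> real"
    by (rule Bochner_Integration.integrable_bound[where f=h])
      (use that k01 in \<open>auto simp: abs_mult intro!: AE_I2 mult_left_le\<close>)
  have fi: "integrable lborel f" "integrable lborel f'" "(\<integral>x. f x \<partial>lborel) = 1" "(\<integral>x. f' x \<partial>lborel) = 1" "\<And>x. 0 \<le> f' x"
    using f f' by (auto simp: prob_density_def)
  have dfi: "integrable lborel (\<lambda>x. f x - f' x)" using fi by auto
  have "(\<integral>y. g y \<partial>(law f \<bind> K)) - (\<integral>y. g y \<partial>(law f' \<bind> K)) = (\<integral>x. (f x - f' x) * k x \<partial>lborel) - (\<integral>x. (f x - f' x) * m \<partial>lborel)"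
    using ib[OF fi(1)] ib[OF fi(2)] fi by (simp add: kk left_diff_distrib)
  also have "\<dots> = (\<integral>x. (f x - f' x) * (k x - m) \<partial>lborel)"
    using ib[OF dfi] dfi by (simp add: right_diff_distrib)
  finally have "\<bar>(\<integral>y. g y \<partial>(law f \<bind> K)) - (\<integral>y. g y \<partial>(law f' \<bind> K))\<bar> \<le> (\<integral>x. \<bar>(f x - f' x) * (k x - m)\<bar> \<partial>lborel)"
    by (simp add: integral_abs_bound)
  also have "\<dots> \<le> (\<integral>x. \<bar>f x - f' x\<bar> * ((e - 1) * m) \<partial>lborel)"
  proof (rule integral_mono)
    have "integrable lborel (\<lambda>x. (f x - f' x) * k x - (f x - f' x) * m)" using ib[OF dfi] dfi by auto
    then show "integrable lborel (\<lambda>x. \<bar>(f x - f' x) * (k x - m)\<bar>)" by (simp add: right_diff_distrib)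
    show "integrable lborel (\<lambda>x. \<bar>f x - f' x\<bar> * ((e - 1) * m))" using dfi by auto
    show "\<bar>(f x - f' x) * (k x - m)\<bar> \<le> \<bar>f x - f' x\<bar> * ((e - 1) * m)" for x
      unfolding abs_mult by (rule mult_left_mono) (use mk[of x] km[of x] in \<open>auto simp: left_diff_distrib\<close>)
  qed
  also have "\<dots> = ((e - 1) * (\<integral>x. \<bar>f x - f' x\<bar> \<partial>lborel)) * m" by simp
  also have "\<dots> \<le> ((e - 1) * (\<integral>x. \<bar>f x - f' x\<bar> \<partial>lborel)) * (\<integral>y. g y \<partial>(law f' \<bind> K))"
  proof (rule mult_left_mono)
    have "m = (\<integral>x. f' x * m \<partial>lborel)" using fi by simp
    also have "\<dots> \<le> (\<integral>x. f' x * k x \<partial>lborel)"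
      by (rule integral_mono) (use fi ib mk in \<open>auto intro!: mult_left_mono\<close>)
    finally show "m \<le> (\<integral>y. g y \<partial>(law f' \<bind> K))" by (simp add: kk)
  qed (use e in auto)
  finally show ?thesis .
qed

lemma views_given_measurable:
  assumes Q: "Q \<in> private_mechanisms Z \<alpha> n" and "i \<le> n" "{..<i} \<subseteq> I"
  shows "(\<lambda>x. views_given Z Q x i) \<in> (\<Pi>\<^sub>M j\<in>I. borel) \<rightarrow>\<^sub>M prob_algebra (views Z i)"
  using assms(2,3)
proof (induction i)
  case 0
  have "(\<lambda>_. undefined) \<in> space (views Z 0)" by (simp add: views_def space_PiM)
  then show ?case
    by (simp add: space_prob_algebra prob_space_return)
next
  case (Suc i)
  have Qi[measurable]: "(\<lambda>(x, z). Q i x z) \<in> (borel \<Otimes>\<^sub>M views Z i) \<rightarrow>\<^sub>M prob_algebra Z"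
    using Q Suc.prems by (auto simp: private_mechanisms_def)
  have [measurable]: "(\<lambda>x. x i) \<in> (\<Pi>\<^sub>M j\<in>I. borel) \<rightarrow>\<^sub>M (borel :: real measure)"
    using Suc.prems by (intro measurable_component_singleton) auto
  have c: "(\<lambda>p. Q i (fst p i) (snd p)) \<in> (\<Pi>\<^sub>M j\<in>I. borel) \<Otimes>\<^sub>M views Z i \<rightarrow>\<^sub>M prob_algebra Z"
    using measurable_compose[OF _ Qi, of "\<lambda>p. (fst p i, snd p)" "(\<Pi>\<^sub>M j\<in>I. borel) \<Otimes>\<^sub>M views Z i"] by simp
  have u: "(\<lambda>q. (snd (fst q))(i := snd q)) \<in> ((\<Pi>\<^sub>M j\<in>I. (borel :: real measure)) \<Otimes>\<^sub>M views Z i) \<Otimes>\<^sub>M Z \<rightarrow>\<^sub>M views Z (Suc i)"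
    unfolding views_def
    by (rule measurable_fun_upd[where J="{..<i}"]) auto
  have IH: "(\<lambda>x. views_given Z Q x i) \<in> (\<Pi>\<^sub>M j\<in>I. borel) \<rightarrow>\<^sub>M prob_algebra (views Z i)"
    by (rule Suc.IH) (use Suc.prems in \<open>auto simp: subset_eq\<close>)
  have "(\<lambda>p. distr (Q i (fst p i) (snd p)) (views Z (Suc i)) (\<lambda>y. (snd p)(i := y))) \<in>
     (\<Pi>\<^sub>M j\<in>I. borel) \<Otimes>\<^sub>M views Z i \<rightarrow>\<^sub>M prob_algebra (views Z (Suc i))"
    by (rule measurable_distr_prob_space2[OF c]) (use u in \<open>simp add: split_beta'\<close>)
  then show ?case using IH by (auto simp: split_beta' intro!: measurable_bind_prob_space2)
qed

lemma views_given_cong: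
  "(\<And>j. j < i \<Longrightarrow> x j = x' j) \<Longrightarrow> views_given Z Q x i = views_given Z Q x' i"
  by (induction i) auto

lemma sets_PiM_law: "sets (\<Pi>\<^sub>M i\<in>I. law f) = sets (\<Pi>\<^sub>M i\<in>I. borel)"
  by (intro sets_PiM_cong) auto

lemma views_law_prob:
  assumes Q: "Q \<in> private_mechanisms Z \<alpha> n" and "i \<le> n" and f: "prob_density f"
  shows "prob_space (views_law Z Q i f)" "sets (views_law Z Q i f) = sets (views Z i)"
proof -
  interpret product_prob_space "\<lambda>_. law f" "{..<i}"
    by (intro product_prob_spaceI prob_density_prob f)
  have A: "(\<Pi>\<^sub>M i\<in>{..<i}. law f) \<in> space (prob_algebra (\<Pi>\<^sub>M i\<in>{..<i}. borel))"
    using prob_space_axioms by (simp add: space_prob_algebra sets_PiM_law)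
  show "prob_space (views_law Z Q i f)" "sets (views_law Z Q i f) = sets (views Z i)"
    unfolding views_law_def
    using prob_space_bind'[OF A views_given_measurable[OF Q \<open>i \<le> n\<close> order_refl]]
      sets_bind'[OF A views_given_measurable[OF Q \<open>i \<le> n\<close> order_refl]] by auto
qed

lemma marginal_measurable:
  assumes Q: "Q \<in> private_mechanisms Z \<alpha> n" and "i < n" and f: "prob_density f"
  shows "(\<lambda>z. law f \<bind> (\<lambda>x. Q i x z)) \<in> views Z i \<rightarrow>\<^sub>M prob_algebra Z"
proof (rule measurable_bind_prob_space2[where N=borel])
  show "(\<lambda>z. law f) \<in> views Z i \<rightarrow>\<^sub>M prob_algebra borel" using prob_density_prob[OF f] by simp
  have Qi[measurable]: "(\<lambda>(x, z). Q i x z) \<in> (borel \<Otimes>\<^sub>M views Z i) \<rightarrow>\<^sub>M prob_algebra Z"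
    using Q assms(2) by (auto simp: private_mechanisms_def)
  show "(\<lambda>(z, x). Q i x z) \<in> views Z i \<Otimes>\<^sub>M borel \<rightarrow>\<^sub>M prob_algebra Z"
    using measurable_compose[OF _ Qi, of "\<lambda>p. (snd p, fst p)" "views Z i \<Otimes>\<^sub>M borel"] by (simp add: split_beta')
qed

text \<open>The last view only depends on the earlier ones and on an observation that is independent of them.
  Integrating that observation out first turns the law of the views into a Markov recursion
  whose kernels are the mixtures of the channels by \<open>law f\<close>.\<close>

lemma nn_integral_views_law_Suc:
  assumes Q: "Q \<in> private_mechanisms Z \<alpha> n" and i: "i < n" and f: "prob_density f"
    and h[measurable]: "h \<in> borel_measurable (views Z (Suc i))"
  shows "(\<integral>\<^sup>+z. h z \<partial>views_law Z Q (Suc i) f)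
    = (\<integral>\<^sup>+z. \<integral>\<^sup>+y. h (z(i := y)) \<partial>(law f \<bind> (\<lambda>x. Q i x z)) \<partial>views_law Z Q i f)"
proof -
  have [measurable]: "f \<in> borel_measurable borel" using f by (simp add: prob_density_def)
  interpret L: prob_space "law f" by (rule prob_density_prob[OF f])
  interpret product_sigma_finite "\<lambda>_. law f" by unfold_locales
  have Qi[measurable]: "(\<lambda>(x, z). Q i x z) \<in> (borel \<Otimes>\<^sub>M views Z i) \<rightarrow>\<^sub>M prob_algebra Z"
    using Q i by (auto simp: private_mechanisms_def)
  note Qs[measurable] = measurable_prob_algebraD[OF Qi]
  have Qz: "(\<lambda>x. Q i x z) \<in> borel \<rightarrow>\<^sub>M subprob_algebra Z" if "z \<in> space (views Z i)" for z
    using measurable_compose[OF _ Qs, of "\<lambda>x. (x, z)" borel] that by simp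
  have setsQ: "sets (Q i t z) = sets Z" if "z \<in> space (views Z i)" for t z
    using measurable_space[OF Qi, of "(t, z)"] that by (auto simp: space_pair_measure space_prob_algebra)
  have upd[measurable]: "(\<lambda>q. (fst q)(i := snd q)) \<in> views Z i \<Otimes>\<^sub>M Z \<rightarrow>\<^sub>M views Z (Suc i)"
    unfolding views_def by (rule measurable_fun_upd[where J="{..<i}"]) auto
  have upd1: "(\<lambda>y. z(i := y)) \<in> Z \<rightarrow>\<^sub>M views Z (Suc i)" if "z \<in> space (views Z i)" for z
    using measurable_compose[OF _ upd, of "\<lambda>y. (z, y)" Z] that by simp
  \<comment> \<open>the conditional expectation given the earlier views \<open>z\<close> and the last observation \<open>t\<close>\<close>
  define k where "k t z = (\<integral>\<^sup>+y. h (z(i := y)) \<partial>Q i t z)" for t z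
  have k[measurable]: "(\<lambda>(t, z). k t z) \<in> borel_measurable (borel \<Otimes>\<^sub>M views Z i)"
  proof -
    have "(\<lambda>q. h ((snd (fst q))(i := snd q))) \<in> borel_measurable ((borel \<Otimes>\<^sub>M views Z i) \<Otimes>\<^sub>M Z)"
      using measurable_compose[OF measurable_compose[OF _ upd, of "\<lambda>q. (snd (fst q), snd q)"] h, of "(borel \<Otimes>\<^sub>M views Z i) \<Otimes>\<^sub>M Z"]
      by simp
    then show ?thesis
      using nn_integral_measurable_subprob_algebra2[OF _ Qs, of "\<lambda>p y. h ((snd p)(i := y))"]
      by (simp add: k_def split_beta')
  qed
  note G = views_given_measurable[OF Q]
  have G1: "(\<lambda>x. views_given Z Q x i) \<in> (\<Pi>\<^sub>M j\<in>{..<i}. borel) \<rightarrow>\<^sub>M prob_algebra (views Z i)"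
    using G i by auto
  have G2: "(\<lambda>x. views_given Z Q x i) \<in> (\<Pi>\<^sub>M j\<in>{..<Suc i}. borel) \<rightarrow>\<^sub>M prob_algebra (views Z i)"
    using G i by auto
  have G3: "(\<lambda>x. views_given Z Q x (Suc i)) \<in> (\<Pi>\<^sub>M j\<in>{..<Suc i}. borel) \<rightarrow>\<^sub>M prob_algebra (views Z (Suc i))"
    by (rule G) (use i in auto)
  have spG: "prob_space (views_given Z Q x i)" "sets (views_given Z Q x i) = sets (views Z i)"
    if "x \<in> space (\<Pi>\<^sub>M j\<in>{..<i}. borel)" for x
    using measurable_space[OF G1 that] by (auto simp: space_prob_algebra)
  have step: "(\<integral>\<^sup>+z. h z \<partial>views_given Z Q x (Suc i)) = (\<integral>\<^sup>+z. k (x i) z \<partial>views_given Z Q x i)"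
    if x: "x \<in> space (\<Pi>\<^sub>M j\<in>{..<Suc i}. borel)" for x
  proof -
    have S: "sets (views_given Z Q x i) = sets (views Z i)"
      using measurable_space[OF G2 x] by (auto simp: space_prob_algebra)
    have Qx: "(\<lambda>z. Q i (x i) z) \<in> views Z i \<rightarrow>\<^sub>M prob_algebra Z"
      using measurable_compose[OF _ Qi, of "\<lambda>z. (x i, z)" "views Z i"] by simp
    have "(\<lambda>z. distr (Q i (x i) z) (views Z (Suc i)) (\<lambda>y. z(i := y))) \<in> views Z i \<rightarrow>\<^sub>M prob_algebra (views Z (Suc i))"
      by (rule measurable_distr_prob_space2[OF Qx]) (use upd in \<open>simp add: split_beta'\<close>)
    then have D: "(\<lambda>z. distr (Q i (x i) z) (views Z (Suc i)) (\<lambda>y. z(i := y))) \<in> views_given Z Q x i \<rightarrow>\<^sub>M subprob_algebra (views Z (Suc i))"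
      by (subst measurable_cong_sets[OF S refl]) (rule measurable_prob_algebraD)
    have "(\<integral>\<^sup>+z. h z \<partial>views_given Z Q x (Suc i)) = (\<integral>\<^sup>+z. \<integral>\<^sup>+w. h w \<partial>distr (Q i (x i) z) (views Z (Suc i)) (\<lambda>y. z(i := y)) \<partial>views_given Z Q x i)"
      by (simp, rule nn_integral_bind[OF h D])
    also have "\<dots> = (\<integral>\<^sup>+z. k (x i) z \<partial>views_given Z Q x i)"
    proof (rule nn_integral_cong)
      fix z assume "z \<in> space (views_given Z Q x i)"
      then have z: "z \<in> space (views Z i)" using sets_eq_imp_space_eq[OF S] by simp
      have "(\<lambda>y. z(i := y)) \<in> Q i (x i) z \<rightarrow>\<^sub>M views Z (Suc i)"
        by (subst measurable_cong_sets[OF setsQ[OF z] refl]) (rule upd1[OF z])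
      then show "(\<integral>\<^sup>+w. h w \<partial>distr (Q i (x i) z) (views Z (Suc i)) (\<lambda>y. z(i := y))) = k (x i) z"
        by (simp add: nn_integral_distr k_def)
    qed
    finally show ?thesis .
  qed
  have spP: "space (\<Pi>\<^sub>M j\<in>I. law f) = space (\<Pi>\<^sub>M j\<in>I. borel)" for I
    by (rule sets_eq_imp_space_eq) (rule sets_PiM_law)
  have "(\<integral>\<^sup>+z. h z \<partial>views_law Z Q (Suc i) f) = (\<integral>\<^sup>+x. \<integral>\<^sup>+z. h z \<partial>views_given Z Q x (Suc i) \<partial>(\<Pi>\<^sub>M j\<in>{..<Suc i}. law f))"
    unfolding views_law_def
    by (rule nn_integral_bind[OF h]) (subst measurable_cong_sets[OF sets_PiM_law refl], rule measurable_prob_algebraD[OF G3])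
  also have "\<dots> = (\<integral>\<^sup>+x. \<integral>\<^sup>+z. k (x i) z \<partial>views_given Z Q x i \<partial>(\<Pi>\<^sub>M j\<in>{..<Suc i}. law f))"
    by (rule nn_integral_cong) (rule step, simp add: spP)
  also have "\<dots> = (\<integral>\<^sup>+x. \<integral>\<^sup>+t. \<integral>\<^sup>+z. k ((x(i := t)) i) z \<partial>views_given Z Q (x(i := t)) i \<partial>law f \<partial>(\<Pi>\<^sub>M j\<in>{..<i}. law f))"
    unfolding lessThan_Suc
  proof (rule product_nn_integral_insert)
    have m: "(\<lambda>p. k (fst p i) (snd p)) \<in> borel_measurable ((\<Pi>\<^sub>M j\<in>{..<Suc i}. borel) \<Otimes>\<^sub>M views Z i)"
      using measurable_compose[OF _ k, of "\<lambda>p. (fst p i, snd p)" "(\<Pi>\<^sub>M j\<in>{..<Suc i}. borel) \<Otimes>\<^sub>M views Z i"]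
      by (simp add: measurable_component_singleton)
    have "(\<lambda>x. \<integral>\<^sup>+z. k (x i) z \<partial>views_given Z Q x i) \<in> borel_measurable (\<Pi>\<^sub>M j\<in>{..<Suc i}. borel)"
      by (rule nn_integral_measurable_subprob_algebra2[OF _ measurable_prob_algebraD[OF G2]]) (use m in \<open>simp add: split_beta'\<close>)
    then show "(\<lambda>x. \<integral>\<^sup>+z. k (x i) z \<partial>views_given Z Q x i) \<in> borel_measurable (\<Pi>\<^sub>M j\<in>insert i {..<i}. law f)"
      by (subst measurable_cong_sets[OF sets_PiM_law refl]) (simp add: lessThan_Suc)
  qed auto
  also have "\<dots> = (\<integral>\<^sup>+x. \<integral>\<^sup>+t. \<integral>\<^sup>+z. k t z \<partial>views_given Z Q x i \<partial>law f \<partial>(\<Pi>\<^sub>M j\<in>{..<i}. law f))"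
  proof -
    have "views_given Z Q (x(i := t)) i = views_given Z Q x i" for x t by (rule views_given_cong) auto
    then show ?thesis by simp
  qed
  also have "\<dots> = (\<integral>\<^sup>+x. \<integral>\<^sup>+z. \<integral>\<^sup>+t. k t z \<partial>law f \<partial>views_given Z Q x i \<partial>(\<Pi>\<^sub>M j\<in>{..<i}. law f))"
  proof (rule nn_integral_cong)
    fix x assume "x \<in> space (\<Pi>\<^sub>M j\<in>{..<i}. law f)"
    then have x: "x \<in> space (\<Pi>\<^sub>M j\<in>{..<i}. borel)" by (simp add: spP)
    interpret V: prob_space "views_given Z Q x i" by (rule spG[OF x])
    interpret P: pair_sigma_finite "views_given Z Q x i" "law f" by unfold_locales
    show "(\<integral>\<^sup>+t. \<integral>\<^sup>+z. k t z \<partial>views_given Z Q x i \<partial>law f) = (\<integral>\<^sup>+z. \<integral>\<^sup>+t. k t z \<partial>law f \<partial>views_given Z Q x i)"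
    proof (rule P.Fubini')
      have "(\<lambda>p. k (snd p) (fst p)) \<in> borel_measurable (views Z i \<Otimes>\<^sub>M borel)"
        using measurable_compose[OF _ k, of "\<lambda>p. (snd p, fst p)" "views Z i \<Otimes>\<^sub>M borel"] by simp
      moreover have "sets (views_given Z Q x i \<Otimes>\<^sub>M law f) = sets (views Z i \<Otimes>\<^sub>M borel)"
        by (intro sets_pair_measure_cong spG[OF x]) simp
      ultimately show "(\<lambda>(z, t). k t z) \<in> borel_measurable (views_given Z Q x i \<Otimes>\<^sub>M law f)"
        by (subst measurable_cong_sets) (auto simp: split_beta')
    qed
  qed
  also have "\<dots> = (\<integral>\<^sup>+x. \<integral>\<^sup>+z. \<integral>\<^sup>+y. h (z(i := y)) \<partial>(law f \<bind> (\<lambda>x. Q i x z)) \<partial>views_given Z Q x i \<partial>(\<Pi>\<^sub>M j\<in>{..<i}. law f))"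
  proof (intro nn_integral_cong)
    fix x z assume "x \<in> space (\<Pi>\<^sub>M j\<in>{..<i}. law f)" and "z \<in> space (views_given Z Q x i)"
    then have z: "z \<in> space (views Z i)" using sets_eq_imp_space_eq[OF spG(2), of x] by (auto simp: spP)
    show "(\<integral>\<^sup>+t. k t z \<partial>law f) = (\<integral>\<^sup>+y. h (z(i := y)) \<partial>(law f \<bind> (\<lambda>x. Q i x z)))"
      unfolding k_def
      by (rule nn_integral_bind[symmetric, where B=Z])
        (use measurable_compose[OF upd1[OF z] h] Qz[OF z] in \<open>auto simp: measurable_cong_sets[OF sets_density refl]\<close>)
  qed
  also have "\<dots> = (\<integral>\<^sup>+z. \<integral>\<^sup>+y. h (z(i := y)) \<partial>(law f \<bind> (\<lambda>x. Q i x z)) \<partial>views_law Z Q i f)"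
    unfolding views_law_def
  proof (rule nn_integral_bind[symmetric, where B="views Z i"])
    have "(\<lambda>q. h ((fst q)(i := snd q))) \<in> borel_measurable (views Z i \<Otimes>\<^sub>M Z)" by measurable
    then show "(\<lambda>z. \<integral>\<^sup>+y. h (z(i := y)) \<partial>(law f \<bind> (\<lambda>x. Q i x z))) \<in> borel_measurable (views Z i)"
      by (intro nn_integral_measurable_subprob_algebra2[OF _ measurable_prob_algebraD[OF marginal_measurable[OF Q i f]]])
        (simp add: split_beta')
    show "(\<lambda>x. views_given Z Q x i) \<in> (\<Pi>\<^sub>M j\<in>{..<i}. law f) \<rightarrow>\<^sub>M subprob_algebra (views Z i)"
      by (subst measurable_cong_sets[OF sets_PiM_law refl], rule measurable_prob_algebraD[OF G1])
  qed
  finally show ?thesis .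
qed

text \<open>The quotient in the definition of privacy gives no information when it is \<open>0 / 0\<close>, but then both
  sides vanish.\<close>

lemma private_emeasure:
  assumes Q: "Q \<in> private_mechanisms Z \<alpha> n" and "i < n" "z \<in> space (views Z i)" "A \<in> sets Z"
  shows "emeasure (Q i x z) A \<le> ennreal (exp \<alpha>) * emeasure (Q i x' z) A"
proof -
  define a b where "a = emeasure (Q i x z) A" and "b = emeasure (Q i x' z) A"
  have Qi: "(\<lambda>(x, z). Q i x z) \<in> (borel \<Otimes>\<^sub>M views Z i) \<rightarrow>\<^sub>M prob_algebra Z"
    using Q assms by (auto simp: private_mechanisms_def)
  have "prob_space (Q i x' z)"
    using measurable_space[OF Qi, of "(x', z)"] assms by (auto simp: space_pair_measure space_prob_algebra)
  then have "b < top" unfolding b_def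
    by (simp add: less_top[symmetric] finite_measure.emeasure_finite prob_space.finite_measure)
  have "(SUP A\<in>sets Z. emeasure (Q i x z) A / emeasure (Q i x' z) A) \<le> ennreal (exp \<alpha>)"
    using Q assms by (auto simp: private_mechanisms_def)
  then have ab: "a / b \<le> ennreal (exp \<alpha>)"
    using assms by (auto simp: SUP_le_iff a_def b_def)
  show ?thesis
  proof (cases "b = 0")
    case True
    then have "a = 0" using ab by (cases "a = 0") (auto simp: divide_ennreal_def ennreal_mult_top top_unique)
    then show ?thesis by (simp add: a_def)
  next
    case False
    have "a = a / b * b" using False \<open>b < top\<close> by (simp add: ennreal_divide_times ennreal_divide_self)
    also have "\<dots> \<le> ennreal (exp \<alpha>) * b" by (intro mult_right_mono ab) simp
    finally show ?thesis by (simp add: a_def b_def)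
  qed
qed

text \<open>Induction on the number of views.  Given the first \<open>i\<close> views, the comparison for a single channel
  bounds the conditional mean of \<open>h\<close> under \<open>f\<close> by \<open>sqrt (1 + \<delta>\<^sup>2)\<close> times the square root of the
  conditional second moment under \<open>f'\<close>.  That square root has again values in \<open>[0, 1]\<close>, so the
  induction hypothesis applies to it, and squaring it restores the second moment.\<close>

lemma views_law_second_moment:
  assumes Q: "Q \<in> private_mechanisms Z \<alpha> n" and i: "i \<le> n" and f: "prob_density f" and f': "prob_density f'" and a: "0 \<le> \<alpha>"
    and h: "h \<in> borel_measurable (views Z i)" "\<And>z. z \<in> space (views Z i) \<Longrightarrow> 0 \<le> h z \<and> h z \<le> (1::real)"
    and d: "\<delta> = (exp \<alpha> - 1) * (\<integral>x. \<bar>f x - f' x\<bar> \<partial>lborel)"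
  shows "(\<integral>z. h z \<partial>views_law Z Q i f)\<^sup>2 \<le> (1 + \<delta>\<^sup>2) ^ i * (\<integral>z. (h z)\<^sup>2 \<partial>views_law Z Q i f')"
  using i h
proof (induction i arbitrary: h)
  case 0
  note P = views_law_prob[OF Q 0(1) f] and P' = views_law_prob[OF Q 0(1) f']
  define c where "c = h (\<lambda>_. undefined)"
  have s0: "space (views Z 0) = {\<lambda>_. undefined}" by (simp add: views_def space_PiM)
  have "(\<integral>z. h z \<partial>views_law Z Q 0 f) = (\<integral>z. c \<partial>views_law Z Q 0 f)"
    by (rule Bochner_Integration.integral_cong) (use sets_eq_imp_space_eq[OF P(2)] s0 in \<open>auto simp: c_def\<close>)
  moreover have "(\<integral>z. (h z)\<^sup>2 \<partial>views_law Z Q 0 f') = (\<integral>z. c\<^sup>2 \<partial>views_law Z Q 0 f')"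
    by (rule Bochner_Integration.integral_cong) (use sets_eq_imp_space_eq[OF P'(2)] s0 in \<open>auto simp: c_def\<close>)
  ultimately show ?case using P(1) P'(1) by (simp add: prob_space.prob_space)
next
  case (Suc i)
  then have i: "i < n" "i \<le> n" by auto
  have Qi: "(\<lambda>(x, z). Q i x z) \<in> (borel \<Otimes>\<^sub>M views Z i) \<rightarrow>\<^sub>M prob_algebra Z"
    using Q i by (auto simp: private_mechanisms_def)
  have Kz: "(\<lambda>x. Q i x z) \<in> borel \<rightarrow>\<^sub>M prob_algebra Z" if "z \<in> space (views Z i)" for z
    using measurable_compose[OF _ Qi, of "\<lambda>x. (x, z)" borel] that by simp
  have upd: "(\<lambda>q. (fst q)(i := snd q)) \<in> views Z i \<Otimes>\<^sub>M Z \<rightarrow>\<^sub>M views Z (Suc i)"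
    unfolding views_def by (rule measurable_fun_upd[where J="{..<i}"]) auto
  have upd1: "(\<lambda>y. z(i := y)) \<in> Z \<rightarrow>\<^sub>M views Z (Suc i)" if "z \<in> space (views Z i)" for z
    using measurable_compose[OF _ upd, of "\<lambda>y. (z, y)" Z] that by simp
  \<comment> \<open>the conditional law of the next view when the observations have density \<open>g\<close>\<close>
  define mg where "mg g z = law g \<bind> (\<lambda>x. Q i x z)" for g z
  have mg: "prob_space (mg g z)" "sets (mg g z) = sets Z" "space (mg g z) = space Z"
    if "prob_density g" "z \<in> space (views Z i)" for g z
    using measurable_space[OF marginal_measurable[OF Q i(1) that(1)] that(2)] sets_eq_imp_space_eq
    by (auto simp: mg_def space_prob_algebra)
  have key: "(\<integral>w. u w \<partial>views_law Z Q (Suc i) g) = (\<integral>z. (\<integral>y. u (z(i := y)) \<partial>mg g z) \<partial>views_law Z Q i g)"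
      "(\<lambda>z. \<integral>y. u (z(i := y)) \<partial>mg g z) \<in> borel_measurable (views Z i)"
      "\<And>z. z \<in> space (views Z i) \<Longrightarrow> 0 \<le> (\<integral>y. u (z(i := y)) \<partial>mg g z) \<and> (\<integral>y. u (z(i := y)) \<partial>mg g z) \<le> 1"
    if u: "u \<in> borel_measurable (views Z (Suc i))" "\<And>z. z \<in> space (views Z (Suc i)) \<Longrightarrow> 0 \<le> u z \<and> u z \<le> (1::real)"
      and g: "prob_density g" for u g
  proof -
    note P = views_law_prob[OF Q i(2) g] and PS = views_law_prob[OF Q Suc.prems(1) g]
    have uz: "(\<lambda>y. u (z(i := y))) \<in> borel_measurable (mg g z)"
      "\<And>y. y \<in> space (mg g z) \<Longrightarrow> 0 \<le> u (z(i := y)) \<and> u (z(i := y)) \<le> 1"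
      if z: "z \<in> space (views Z i)" for z
      using measurable_compose[OF upd1[OF z] u(1)] measurable_space[OF upd1[OF z]] u(2) mg[OF g z]
      by (auto simp: measurable_cong_sets[OF mg(2)[OF g z] refl])
    note I = prob_space.integral_of_unit_valued[OF mg(1)[OF g] uz]
    show r: "\<And>z. z \<in> space (views Z i) \<Longrightarrow> 0 \<le> (\<integral>y. u (z(i := y)) \<partial>mg g z) \<and> (\<integral>y. u (z(i := y)) \<partial>mg g z) \<le> 1"
      using I(3,4) by blast
    have "(\<lambda>z. \<integral>\<^sup>+y. ennreal (u (z(i := y))) \<partial>mg g z) \<in> borel_measurable (views Z i)"
      unfolding mg_def
      by (intro nn_integral_measurable_subprob_algebra2[OF _ measurable_prob_algebraD[OF marginal_measurable[OF Q i(1) g]]])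
        (use measurable_compose[OF upd measurable_compose[OF u(1) measurable_ennreal]] in \<open>simp add: split_beta'\<close>)
    then have "(\<lambda>z. enn2real (\<integral>\<^sup>+y. ennreal (u (z(i := y))) \<partial>mg g z)) \<in> borel_measurable (views Z i)"
      by measurable
    then show m: "(\<lambda>z. \<integral>y. u (z(i := y)) \<partial>mg g z) \<in> borel_measurable (views Z i)"
      by (rule measurable_cong[THEN iffD1, rotated]) (use I(2,3) in simp)
    have m': "(\<lambda>z. \<integral>y. u (z(i := y)) \<partial>mg g z) \<in> borel_measurable (views_law Z Q i g)"
      by (subst measurable_cong_sets[OF P(2) refl]) (rule m)
    have sp: "space (views_law Z Q i g) = space (views Z i)" using P(2) by (rule sets_eq_imp_space_eq)
    have spS: "space (views_law Z Q (Suc i) g) = space (views Z (Suc i))" using PS(2) by (rule sets_eq_imp_space_eq)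
    have u': "u \<in> borel_measurable (views_law Z Q (Suc i) g)"
      by (subst measurable_cong_sets[OF PS(2) refl]) (rule u(1))
    note IS = prob_space.integral_of_unit_valued[OF PS(1) u'] and IP = prob_space.integral_of_unit_valued[OF P(1) m']
    have "ennreal (\<integral>w. u w \<partial>views_law Z Q (Suc i) g) = (\<integral>\<^sup>+w. ennreal (u w) \<partial>views_law Z Q (Suc i) g)"
      using IS(2) u(2) spS by simp
    also have "\<dots> = (\<integral>\<^sup>+z. \<integral>\<^sup>+y. ennreal (u (z(i := y))) \<partial>mg g z \<partial>views_law Z Q i g)"
      unfolding mg_def by (rule nn_integral_views_law_Suc[OF Q i(1) g]) (use u in simp)
    also have "\<dots> = (\<integral>\<^sup>+z. ennreal (\<integral>y. u (z(i := y)) \<partial>mg g z) \<partial>views_law Z Q i g)"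
      by (rule nn_integral_cong) (use I(2) sp in simp)
    also have "\<dots> = ennreal (\<integral>z. (\<integral>y. u (z(i := y)) \<partial>mg g z) \<partial>views_law Z Q i g)"
      using IP(2) r sp by simp
    finally show "(\<integral>w. u w \<partial>views_law Z Q (Suc i) g) = (\<integral>z. (\<integral>y. u (z(i := y)) \<partial>mg g z) \<partial>views_law Z Q i g)"
      using IS(3) IP(3) r u(2) sp spS by simp
  qed
  have h2: "(\<lambda>w. (h w)\<^sup>2) \<in> borel_measurable (views Z (Suc i))"
    "\<And>z. z \<in> space (views Z (Suc i)) \<Longrightarrow> 0 \<le> (h z)\<^sup>2 \<and> (h z)\<^sup>2 \<le> (1::real)"
    using Suc.prems by (auto simp: power_le_one)
  note A = key[OF Suc.prems(2,3) f] and B = key[OF h2 f']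
  define a b where "a z = (\<integral>y. h (z(i := y)) \<partial>mg f z)" and "b z = (\<integral>y. (h (z(i := y)))\<^sup>2 \<partial>mg f' z)" for z
  have ab: "a z \<le> sqrt (1 + \<delta>\<^sup>2) * sqrt (b z)" if z: "z \<in> space (views Z i)" for z
  proof -
    have "(a z)\<^sup>2 \<le> (1 + \<delta>\<^sup>2) * b z"
      unfolding a_def b_def
    proof (rule second_moment_comparison)
      show "prob_space (mg f z)" "prob_space (mg f' z)" "sets (mg f z) = sets (mg f' z)" using mg z f f' by auto
      show "0 \<le> \<delta>" using d a by simp
      show "(\<lambda>y. h (z(i := y))) \<in> borel_measurable (mg f' z)"
        by (subst measurable_cong_sets[OF mg(2)[OF f' z] refl]) (rule measurable_compose[OF upd1[OF z] Suc.prems(2)])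
      show "0 \<le> h (z(i := y)) \<and> h (z(i := y)) \<le> 1" if "y \<in> space (mg f' z)" for y
        using Suc.prems(3)[OF measurable_space[OF upd1[OF z]], of y] mg(3)[OF f' z] that by (simp add: fun_upd_def)
      fix g :: "'a \<Rightarrow> real"
      assume g: "g \<in> borel_measurable (mg f' z)" "\<And>y. y \<in> space (mg f' z) \<Longrightarrow> 0 \<le> g y \<and> g y \<le> 1"
      then have g': "g \<in> borel_measurable Z" using measurable_cong_sets[OF mg(2)[OF f' z] refl] by blast
      show "\<bar>(\<integral>y. g y \<partial>mg f z) - (\<integral>y. g y \<partial>mg f' z)\<bar> \<le> \<delta> * (\<integral>y. g y \<partial>mg f' z)"
        unfolding mg_def d
        by (rule private_marginals_close[OF f f' Kz[OF z] _ _ g'])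
          (use a private_emeasure[OF Q i(1) z] g(2) mg(3)[OF f' z] in auto)
    qed
    then have "sqrt ((a z)\<^sup>2) \<le> sqrt ((1 + \<delta>\<^sup>2) * b z)" by (rule real_sqrt_le_mono)
    then show ?thesis by (simp add: real_sqrt_mult)
  qed
  have sb: "(\<lambda>z. sqrt (b z)) \<in> borel_measurable (views Z i)" "\<And>z. z \<in> space (views Z i) \<Longrightarrow> 0 \<le> sqrt (b z) \<and> sqrt (b z) \<le> 1"
    using B(2,3) by (auto simp: b_def[abs_def] fun_upd_def)
  note P = views_law_prob[OF Q i(2) f] and P' = views_law_prob[OF Q i(2) f']
  have sp: "space (views_law Z Q i f) = space (views Z i)" "space (views_law Z Q i f') = space (views Z i)"
    using P(2) P'(2) by (auto dest: sets_eq_imp_space_eq)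
  have am: "a \<in> borel_measurable (views_law Z Q i f)" "(\<lambda>z. sqrt (b z)) \<in> borel_measurable (views_law Z Q i f)"
    unfolding measurable_cong_sets[OF P(2) refl] using A(2) sb(1) by (simp_all add: a_def[abs_def] fun_upd_def)
  have a01: "0 \<le> a z \<and> a z \<le> 1" if "z \<in> space (views_law Z Q i f)" for z
    using A(3)[of z] that sp by (simp add: a_def fun_upd_def)
  have b01: "0 \<le> sqrt (b z) \<and> sqrt (b z) \<le> 1" if "z \<in> space (views_law Z Q i f)" for z
    using sb(2)[of z] that sp by simp
  have im: "integrable (views_law Z Q i f) a" "integrable (views_law Z Q i f) (\<lambda>z. sqrt (b z))"
    by (rule prob_space.integral_of_unit_valued(1)[OF P(1) am(1) a01], simp)
       (rule prob_space.integral_of_unit_valued(1)[OF P(1) am(2) b01], simp)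
  have "(\<integral>w. h w \<partial>views_law Z Q (Suc i) f) = (\<integral>z. a z \<partial>views_law Z Q i f)" using A(1) by (simp add: a_def fun_upd_def)
  also have "\<dots> \<le> (\<integral>z. sqrt (1 + \<delta>\<^sup>2) * sqrt (b z) \<partial>views_law Z Q i f)"
    by (rule integral_mono) (use im ab sp in auto)
  also have "\<dots> = sqrt (1 + \<delta>\<^sup>2) * (\<integral>z. sqrt (b z) \<partial>views_law Z Q i f)" by simp
  finally have le: "(\<integral>w. h w \<partial>views_law Z Q (Suc i) f) \<le> sqrt (1 + \<delta>\<^sup>2) * (\<integral>z. sqrt (b z) \<partial>views_law Z Q i f)" .
  have "0 \<le> (\<integral>z. a z \<partial>views_law Z Q i f)"
    by (rule integral_nonneg_AE) (use a01 in \<open>auto intro!: AE_I2\<close>)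
  then have "0 \<le> (\<integral>w. h w \<partial>views_law Z Q (Suc i) f)" using A(1) by (simp add: a_def fun_upd_def)
  then have "(\<integral>w. h w \<partial>views_law Z Q (Suc i) f)\<^sup>2 \<le> (sqrt (1 + \<delta>\<^sup>2) * (\<integral>z. sqrt (b z) \<partial>views_law Z Q i f))\<^sup>2"
    using le by (intro power_mono) auto
  also have "\<dots> = (1 + \<delta>\<^sup>2) * (\<integral>z. sqrt (b z) \<partial>views_law Z Q i f)\<^sup>2" by (simp add: power_mult_distrib)
  also have "\<dots> \<le> (1 + \<delta>\<^sup>2) * ((1 + \<delta>\<^sup>2) ^ i * (\<integral>z. (sqrt (b z))\<^sup>2 \<partial>views_law Z Q i f'))"
    by (intro mult_left_mono Suc.IH i sb) auto
  also have "(\<integral>z. (sqrt (b z))\<^sup>2 \<partial>views_law Z Q i f') = (\<integral>z. b z \<partial>views_law Z Q i f')"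
    by (rule Bochner_Integration.integral_cong) (use B(3) sp in \<open>auto simp: b_def fun_upd_def\<close>)
  also have "\<dots> = (\<integral>w. (h w)\<^sup>2 \<partial>views_law Z Q (Suc i) f')" using B(1) by (simp add: b_def fun_upd_def)
  finally show ?case by (simp add: mult.assoc)
qed

text \<open>From the two losses build the test \<open>h = min g D / D\<close>: it satisfies \<open>D h \<le> g\<close>, and \<open>D (1 - h) \<le> g'\<close>
  since the losses add up to \<open>D\<close> at least.  With \<open>s\<close> and \<open>t\<close> the means of \<open>h\<close> under \<open>f\<close> and \<open>f'\<close>, the
  second-moment bound gives \<open>s\<^sup>2 \<le> 2 t\<close>, hence \<open>t + (1 - s) \<ge> 1 / 2\<close>.\<close>

lemma two_point_loss:
  assumes Q: "Q \<in> private_mechanisms Z \<alpha> n" and f: "prob_density f" and f': "prob_density f'" and a: "0 \<le> \<alpha>"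
    and d: "real n * ((exp \<alpha> - 1) * (\<integral>x. \<bar>f x - f' x\<bar> \<partial>lborel))\<^sup>2 \<le> 1 / 2"
    and g[measurable]: "g \<in> borel_measurable (views Z n)" and g'[measurable]: "g' \<in> borel_measurable (views Z n)"
    and D: "0 \<le> D" "\<And>z. z \<in> space (views Z n) \<Longrightarrow> ennreal D \<le> g z + g' z"
  shows "ennreal (D / 2) \<le> (\<integral>\<^sup>+z. g z \<partial>views_law Z Q n f') + (\<integral>\<^sup>+z. g' z \<partial>views_law Z Q n f)"
proof (cases "D = 0")
  case False
  with D have D0: "0 < D" by simp
  define \<delta> where "\<delta> = (exp \<alpha> - 1) * (\<integral>x. \<bar>f x - f' x\<bar> \<partial>lborel)"
  define h where "h z = enn2real (min (g z) (ennreal D)) / D" for z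
  have hm[measurable]: "h \<in> borel_measurable (views Z n)" unfolding h_def[abs_def] by measurable
  have hD: "ennreal (D * h z) = min (g z) (ennreal D)" for z
    unfolding h_def using D0 by (simp add: min_less_iff_disj)
  have h01: "0 \<le> h z \<and> h z \<le> 1" for z
  proof -
    have "enn2real (min (g z) (ennreal D)) \<le> D" using D0 by (intro enn2real_leI) auto
    then show ?thesis using D0 by (auto simp: h_def)
  qed
  note P = views_law_prob[OF Q order_refl f] and P' = views_law_prob[OF Q order_refl f']
  have sp: "space (views_law Z Q n f) = space (views Z n)" "space (views_law Z Q n f') = space (views Z n)"
    using P(2) P'(2) by (auto dest: sets_eq_imp_space_eq)
  interpret P: prob_space "views_law Z Q n f" by (rule P)
  interpret P': prob_space "views_law Z Q n f'" by (rule P')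
  have hP: "h \<in> borel_measurable (views_law Z Q n f)" "h \<in> borel_measurable (views_law Z Q n f')"
    using hm by (auto simp: measurable_cong_sets[OF P(2) refl] measurable_cong_sets[OF P'(2) refl])
  define s t where "s = (\<integral>z. h z \<partial>views_law Z Q n f)" and "t = (\<integral>z. h z \<partial>views_law Z Q n f')"
  have "s\<^sup>2 \<le> (1 + \<delta>\<^sup>2) ^ n * (\<integral>z. (h z)\<^sup>2 \<partial>views_law Z Q n f')"
    unfolding s_def by (rule views_law_second_moment[OF Q order_refl f f' a hm h01 \<delta>_def])
  also have "\<dots> \<le> 2 * t"
  proof (rule mult_mono)
    have "(1 + \<delta>\<^sup>2) ^ n \<le> exp (\<delta>\<^sup>2) ^ n" by (intro power_mono) (auto simp: exp_ge_add_one_self)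
    also have "\<dots> = exp (real n * \<delta>\<^sup>2)" by (simp add: exp_of_nat_mult)
    also have "\<dots> \<le> exp (1/2)" using d by (simp add: \<delta>_def)
    also have "\<dots> \<le> 2" using exp_bound[of "1/2"] by (simp add: power2_eq_square)
    finally show "(1 + \<delta>\<^sup>2) ^ n \<le> 2" .
    show "(\<integral>z. (h z)\<^sup>2 \<partial>views_law Z Q n f') \<le> t" unfolding t_def
    proof (rule integral_mono)
      show "integrable (views_law Z Q n f') (\<lambda>z. (h z)\<^sup>2)"
        by (rule P'.integral_of_unit_valued(1)) (use hP h01 in \<open>auto simp: power_le_one\<close>)
      show "integrable (views_law Z Q n f') h"
        by (rule P'.integral_of_unit_valued(1)) (use hP h01 in auto)
      show "(h z)\<^sup>2 \<le> h z" for z using h01[of z] by (simp add: power2_eq_square mult_left_le)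
    qed
  qed auto
  finally have "s\<^sup>2 \<le> 2 * t" .
  moreover have "0 \<le> (1 - s)\<^sup>2" by simp
  ultimately have st: "1 / 2 \<le> t + (1 - s)" by (simp add: power2_eq_square algebra_simps)
  have s1: "s \<le> 1" and t0: "0 \<le> t" unfolding s_def t_def
    using P.integral_of_unit_valued(4)[OF hP(1) h01] P'.integral_of_unit_valued(3)[OF hP(2) h01] by auto
  have c: "(\<lambda>z. 1 - h z) \<in> borel_measurable (views_law Z Q n f)" using hP by auto
  have Eg: "ennreal (D * t) \<le> (\<integral>\<^sup>+z. g z \<partial>views_law Z Q n f')"
  proof -
    have "ennreal (D * t) = ennreal D * (\<integral>\<^sup>+z. ennreal (h z) \<partial>views_law Z Q n f')"
      unfolding t_def P'.integral_of_unit_valued(2)[OF hP(2) h01] using D0 by (simp add: ennreal_mult')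
    also have "\<dots> = (\<integral>\<^sup>+z. ennreal (D * h z) \<partial>views_law Z Q n f')"
      using hP D0 by (subst nn_integral_cmult[symmetric]) (auto simp: ennreal_mult')
    also have "\<dots> \<le> (\<integral>\<^sup>+z. g z \<partial>views_law Z Q n f')" by (intro nn_integral_mono) (simp add: hD)
    finally show ?thesis .
  qed
  have Eg': "ennreal (D * (1 - s)) \<le> (\<integral>\<^sup>+z. g' z \<partial>views_law Z Q n f)"
  proof -
    have ms: "(\<integral>z. 1 - h z \<partial>views_law Z Q n f) = 1 - s"
      unfolding s_def using P.integral_of_unit_valued(1)[OF hP(1) h01] by (simp add: P.prob_space)
    have "ennreal (D * (1 - s)) = ennreal D * (\<integral>\<^sup>+z. ennreal (1 - h z) \<partial>views_law Z Q n f)"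
      using P.integral_of_unit_valued(2)[OF c] h01 D0 by (simp add: ennreal_mult' ms)
    also have "\<dots> = (\<integral>\<^sup>+z. ennreal (D * (1 - h z)) \<partial>views_law Z Q n f)"
      using c D0 by (subst nn_integral_cmult[symmetric]) (auto simp: ennreal_mult')
    also have "\<dots> \<le> (\<integral>\<^sup>+z. g' z \<partial>views_law Z Q n f)"
    proof (rule nn_integral_mono)
      fix z assume "z \<in> space (views_law Z Q n f)"
      then have z: "ennreal D \<le> g z + g' z" using D(2) sp by auto
      show "ennreal (D * (1 - h z)) \<le> g' z"
      proof (cases "g z \<le> ennreal D")
        case True
        then have gz: "g z = ennreal (D * h z)" using hD[of z] by (simp add: min_def)
        show ?thesis
        proof (cases "g' z")
          case (real r)
          have "ennreal D \<le> ennreal (D * h z + r)"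
            using z gz real h01[of z] D0 by (subst ennreal_plus) auto
          then have "D \<le> D * h z + r" using real h01[of z] D0 by (subst (asm) ennreal_le_iff) auto
          then show ?thesis using real by (auto intro!: ennreal_leI simp: algebra_simps)
        qed simp
      next
        case False
        then have "ennreal (D * h z) = ennreal D" using hD[of z] by (simp add: min_def)
        then have "h z = 1" using D0 h01[of z] by simp
        then show ?thesis by simp
      qed
    qed
    finally show ?thesis .
  qed
  have "ennreal (D / 2) \<le> ennreal (D * t + D * (1 - s))"
    using mult_left_mono[OF st, of D] D0 by (intro ennreal_leI) (simp add: algebra_simps)
  also have "\<dots> = ennreal (D * t) + ennreal (D * (1 - s))" using D0 s1 t0 by simp
  also have "\<dots> \<le> (\<integral>\<^sup>+z. g z \<partial>views_law Z Q n f') + (\<integral>\<^sup>+z. g' z \<partial>views_law Z Q n f)"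
    by (intro add_mono Eg Eg')
  finally show ?thesis .
qed simp

text \<open>Averaging over all vertices of the hypercube: for each coordinate the vertices are matched in
  pairs that differ in that coordinate only.\<close>

lemma hypercube_average:
  fixes R :: "'k set \<Rightarrow> ennreal" and l :: "'k \<Rightarrow> 'k set \<Rightarrow> ennreal"
  assumes I: "finite I" and R: "\<And>A. A \<subseteq> I \<Longrightarrow> (\<Sum>k\<in>I. l k A) \<le> R A"
    and c: "\<And>k A. k \<in> I \<Longrightarrow> A \<subseteq> I - {k} \<Longrightarrow> c \<le> l k A + l k (insert k A)"
    and S: "\<And>A. A \<subseteq> I \<Longrightarrow> R A \<le> S"
  shows "of_nat (card I) * c \<le> 2 * S"
proof (cases "I = {}")
  case False
  define m where "m = card I - 1"
  have m: "card I = Suc m" using False I by (simp add: m_def card_gt_0_iff)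
  have half: "of_nat (2 ^ m) * c \<le> (\<Sum>A\<in>Pow I. l k A)" if k: "k \<in> I" for k
  proof -
    have ins: "I = insert k (I - {k})" using k by auto
    have "of_nat (2 ^ m) * c = (\<Sum>A\<in>Pow (I - {k}). c)" using I k m by (simp add: card_Pow)
    also have "\<dots> \<le> (\<Sum>A\<in>Pow (I - {k}). l k A + l k (insert k A))"
      by (intro sum_mono c[OF k]) auto
    also have "\<dots> = (\<Sum>A\<in>Pow (I - {k}). l k A) + (\<Sum>A\<in>insert k ` Pow (I - {k}). l k A)"
      by (subst sum.reindex) (auto simp: sum.distrib inj_on_def)
    also have "\<dots> = (\<Sum>A\<in>Pow I. l k A)"
      by (subst ins, subst Pow_insert, subst sum.union_disjoint) (use I in auto)
    finally show ?thesis .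
  qed
  have "of_nat (card I) * (of_nat (2 ^ m) * c) = (\<Sum>k\<in>I. of_nat (2 ^ m) * c)" by simp
  also have "\<dots> \<le> (\<Sum>k\<in>I. \<Sum>A\<in>Pow I. l k A)" by (intro sum_mono half)
  also have "\<dots> = (\<Sum>A\<in>Pow I. \<Sum>k\<in>I. l k A)" by (rule sum.swap)
  also have "\<dots> \<le> (\<Sum>A\<in>Pow I. S)" by (intro sum_mono order.trans[OF R S]) auto
  also have "\<dots> = of_nat (2 ^ m) * (2 * S)" using I m by (simp add: card_Pow mult_ac)
  finally have "of_nat (2 ^ m) * (of_nat (card I) * c) \<le> of_nat (2 ^ m) * (2 * S)" by (simp add: mult_ac)
  then show ?thesis by (subst (asm) ennreal_mult_le_mult_iff) (auto simp: ennreal_of_nat_eq_real_of_nat)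
qed simp

text \<open>The loss is restricted to the disjoint cells \<open>C k\<close>.  On one cell the triangle inequality forces
  every estimator to be at least half the distance away from one of two neighbouring
  densities, and their views cannot be told apart.\<close>

lemma assouad_private:
  fixes f :: "int set \<Rightarrow> real \<Rightarrow> real" and C :: "int \<Rightarrow> real set"
  assumes I: "finite I" and fD: "\<And>A. A \<subseteq> I \<Longrightarrow> f A \<in> \<D>" "\<And>A. A \<subseteq> I \<Longrightarrow> prob_density (f A)"
    and C: "\<And>k. C k \<in> sets borel" "disjoint_family_on C I" and D: "0 \<le> D" and r: "1 \<le> r" and a: "0 \<le> \<alpha>"
    and sep: "\<And>k A. k \<in> I \<Longrightarrow> A \<subseteq> I - {k} \<Longrightarrow>
      ennreal D \<le> (\<integral>\<^sup>+t. indicator (C k) t * ennreal ((\<bar>f A t - f (insert k A) t\<bar> / 2) powr r) \<partial>lborel)"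
    and info: "\<And>k A. k \<in> I \<Longrightarrow> A \<subseteq> I - {k} \<Longrightarrow>
      real n * ((exp \<alpha> - 1) * (\<integral>x. \<bar>f (insert k A) x - f A x\<bar> \<partial>lborel))\<^sup>2 \<le> 1 / 2"
  shows "ennreal (real (card I) * D / 4) \<le> minimax_risk Z \<alpha> n r \<D>"
  unfolding minimax_risk_def
proof (rule INF_greatest, clarify)
  fix F Q assume F: "F \<in> estimators Z n" and Q: "Q \<in> private_mechanisms Z \<alpha> n"
  define S where "S = (SUP f\<in>\<D>. risk Z n r F Q f)"
  have Fm[measurable]: "(\<lambda>p. F (fst p) (snd p)) \<in> borel_measurable (views Z n \<Otimes>\<^sub>M lborel)"
    using F by (simp add: estimators_def split_beta' measurable_cong_sets[OF sets_pair_measure_cong[OF refl sets_lborel] refl])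
  have fm[measurable]: "f A \<in> borel_measurable borel" if "A \<subseteq> I" for A using fD(2)[OF that] by (simp add: prob_density_def)
  note C(1)[measurable]
  define L where "L k A z = (\<integral>\<^sup>+t. indicator (C k) t * ennreal (\<bar>F z t - f A t\<bar> powr r) \<partial>lborel)" for k A z
  have Lm: "L k A \<in> borel_measurable (views Z n)" if A: "A \<subseteq> I" for k A
  proof -
    note fm[OF A, measurable]
    have "(\<lambda>p. indicator (C k) (snd p) * ennreal (\<bar>F (fst p) (snd p) - f A (snd p)\<bar> powr r)) \<in> borel_measurable (views Z n \<Otimes>\<^sub>M lborel)"
      by measurable
    then have "(\<lambda>z. \<integral>\<^sup>+t. indicator (C k) t * ennreal (\<bar>F z t - f A t\<bar> powr r) \<partial>lborel) \<in> borel_measurable (views Z n)"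
      by (intro lborel.borel_measurable_nn_integral) (simp add: split_beta')
    then show ?thesis by (simp add: L_def[abs_def])
  qed
  have Ft: "(\<lambda>t. F z t) \<in> borel_measurable borel" if z: "z \<in> space (views Z n)" for z
  proof -
    have "(\<lambda>(z, t). F z t) \<in> borel_measurable (views Z n \<Otimes>\<^sub>M borel)" using F by (simp add: estimators_def)
    from measurable_compose[OF measurable_Pair1'[OF z] this] show ?thesis by simp
  qed
  have "of_nat (card I) * ennreal (D / 2) \<le> 2 * S"
  proof (rule hypercube_average[OF I, where R="\<lambda>A. risk Z n r F Q (f A)" and l="\<lambda>k A. \<integral>\<^sup>+z. L k A z \<partial>views_law Z Q n (f A)"])
    fix A assume A: "A \<subseteq> I"
    note P = views_law_prob[OF Q order_refl fD(2)[OF A]]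
    note fm[OF A, measurable]
    have sp: "space (views_law Z Q n (f A)) = space (views Z n)" using P(2) by (rule sets_eq_imp_space_eq)
    have "(\<Sum>k\<in>I. \<integral>\<^sup>+z. L k A z \<partial>views_law Z Q n (f A)) = (\<integral>\<^sup>+z. (\<Sum>k\<in>I. L k A z) \<partial>views_law Z Q n (f A))"
      using Lm[OF A] by (intro nn_integral_sum[symmetric]) (simp add: measurable_cong_sets[OF P(2) refl])
    also have "\<dots> \<le> risk Z n r F Q (f A)"
      unfolding risk_def
    proof (rule nn_integral_mono)
      fix z assume "z \<in> space (views_law Z Q n (f A))"
      then have z: "z \<in> space (views Z n)" by (simp add: sp)
      note Ft[OF z, measurable]
      have "(\<Sum>k\<in>I. L k A z) = (\<integral>\<^sup>+t. (\<Sum>k\<in>I. indicator (C k) t * ennreal (\<bar>F z t - f A t\<bar> powr r)) \<partial>lborel)"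
        unfolding L_def by (rule nn_integral_sum[symmetric]) measurable
      also have "\<dots> \<le> (\<integral>\<^sup>+t. ennreal (\<bar>F z t - f A t\<bar> powr r) \<partial>lborel)"
      proof (rule nn_integral_mono)
        fix t
        have "(\<Sum>k\<in>I. indicator (C k) t) = (indicator (\<Union>k\<in>I. C k) t :: ennreal)"
          by (rule indicator_UN_disjoint[OF I C(2), symmetric])
        also have "\<dots> \<le> 1" by (simp add: indicator_def)
        finally show "(\<Sum>k\<in>I. indicator (C k) t * ennreal (\<bar>F z t - f A t\<bar> powr r)) \<le> ennreal (\<bar>F z t - f A t\<bar> powr r)"
          unfolding sum_distrib_right[symmetric] using mult_right_mono[of _ 1 "ennreal (\<bar>F z t - f A t\<bar> powr r)"] by simp
      qed
      finally show "(\<Sum>k\<in>I. L k A z) \<le> (\<integral>\<^sup>+t. ennreal (\<bar>F z t - f A t\<bar> powr r) \<partial>lborel)" .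
    qed
    finally show "(\<Sum>k\<in>I. \<integral>\<^sup>+z. L k A z \<partial>views_law Z Q n (f A)) \<le> risk Z n r F Q (f A)" .
    show "risk Z n r F Q (f A) \<le> S" unfolding S_def by (rule SUP_upper) (rule fD(1)[OF A])
  next
    fix k A assume k: "k \<in> I" and A: "A \<subseteq> I - {k}"
    then have A1: "A \<subseteq> I" and A2: "insert k A \<subseteq> I" by auto
    note fm[OF A1, measurable] fm[OF A2, measurable]
    show "ennreal (D / 2) \<le> (\<integral>\<^sup>+z. L k A z \<partial>views_law Z Q n (f A)) + (\<integral>\<^sup>+z. L k (insert k A) z \<partial>views_law Z Q n (f (insert k A)))"
    proof (rule two_point_loss[OF Q fD(2)[OF A2] fD(2)[OF A1] a info[OF k A] Lm[OF A1] Lm[OF A2] D])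
      fix z assume z: "z \<in> space (views Z n)"
      note Ft[OF z, measurable]
      have "ennreal D \<le> (\<integral>\<^sup>+t. indicator (C k) t * ennreal ((\<bar>f A t - f (insert k A) t\<bar> / 2) powr r) \<partial>lborel)" by (rule sep[OF k A])
      also have "\<dots> \<le> (\<integral>\<^sup>+t. indicator (C k) t * ennreal (\<bar>F z t - f A t\<bar> powr r) + indicator (C k) t * ennreal (\<bar>F z t - f (insert k A) t\<bar> powr r) \<partial>lborel)"
        unfolding distrib_left[symmetric]
      proof (intro nn_integral_mono mult_left_mono)
        fix t
        let ?x = "\<bar>F z t - f A t\<bar>" and ?y = "\<bar>F z t - f (insert k A) t\<bar>"
        have tri: "\<bar>f A t - f (insert k A) t\<bar> \<le> ?x + ?y" by linarith
        have "\<bar>f A t - f (insert k A) t\<bar> / 2 \<le> ?x \<or> \<bar>f A t - f (insert k A) t\<bar> / 2 \<le> ?y"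
        proof -
          have "d / 2 \<le> x \<or> d / 2 \<le> y" if "d \<le> x + y" for d x y :: real using that by (cases "d / 2 \<le> x") auto
          then show ?thesis using tri by blast
        qed
        then have "(\<bar>f A t - f (insert k A) t\<bar> / 2) powr r \<le> ?x powr r \<or> (\<bar>f A t - f (insert k A) t\<bar> / 2) powr r \<le> ?y powr r"
          using r by (auto intro: powr_mono2)
        moreover have "0 \<le> ?x powr r" "0 \<le> ?y powr r" by auto
        ultimately have "(\<bar>f A t - f (insert k A) t\<bar> / 2) powr r \<le> ?x powr r + ?y powr r" by linarith
        then show "ennreal ((\<bar>f A t - f (insert k A) t\<bar> / 2) powr r) \<le> ennreal (?x powr r) + ennreal (?y powr r)"
          by (simp add: ennreal_leI flip: ennreal_plus)
      qed simp
      also have "\<dots> = L k A z + L k (insert k A) z" unfolding L_def by (rule nn_integral_add) measurable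
      finally show "ennreal D \<le> L k A z + L k (insert k A) z" .
    qed
  qed
  then have le: "ennreal (real (card I) * (D / 2)) \<le> 2 * S" unfolding ennreal_of_nat_eq_real_of_nat using D by (subst ennreal_mult) auto
  show "ennreal (real (card I) * D / 4) \<le> S"
  proof (cases S)
    case (real x)
    have "2 * S = ennreal (2 * x)" using real by (simp add: ennreal_mult)
    then have "real (card I) * (D / 2) \<le> 2 * x" using le real by (simp add: ennreal_le_iff)
    then show ?thesis using real by (auto intro!: ennreal_leI)
  qed simp
qed

section \<open>Besov norms\<close>

lemma epowr_ennreal: "0 \<le> x \<Longrightarrow> epowr (ennreal x) a = ennreal (x powr a)"
  by (simp add: epowr_def)

lemma epowr_mono: "0 \<le> a \<Longrightarrow> x \<le> y \<Longrightarrow> epowr x a \<le> epowr y a"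
  by (cases x; cases y) (auto simp: epowr_ennreal epowr_def top_unique intro!: ennreal_leI powr_mono2)

lemma epowr_inverse: "0 < a \<Longrightarrow> epowr (epowr x a) (1 / a) = x"
  by (cases x) (auto simp: epowr_ennreal powr_powr epowr_def)

lemma lp_norm_mono: "1 \<le> p \<Longrightarrow> (\<And>k. a k \<le> b k) \<Longrightarrow> lp_norm p a \<le> lp_norm p b"
  unfolding lp_norm_def
  by (auto intro!: SUP_mono epowr_mono nn_integral_mono)

text \<open>Convexity of the \<open>P\<close>-th power at the points \<open>x / A\<close> and \<open>y / B\<close> with weights \<open>A / (A + B)\<close> and
  \<open>B / (A + B)\<close>.  Summed over the coordinates with \<open>A\<close> and \<open>B\<close> the norms of the summands, it is
  Minkowski's inequality without an appeal to Hoelder's.\<close>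

lemma powr_add_le:
  assumes "1 \<le> P" "0 < A" "0 < B" "0 \<le> x" "0 \<le> (y::real)"
  shows "(x + y) powr P \<le> ((A + B) / A) powr (P - 1) * x powr P + ((A + B) / B) powr (P - 1) * y powr P"
proof -
  have ge: "z powr P \<le> ((A + B) / C) powr (P - 1) * z powr P" if "0 < C" "C \<le> A + B" for C z
  proof -
    have "1 \<le> ((A + B) / C) powr (P - 1)" using that assms by (intro ge_one_powr_ge_zero) auto
    from mult_right_mono[OF this, of "z powr P"] show ?thesis by simp
  qed
  show ?thesis
  proof (cases "x = 0 \<or> y = 0")
    case True
    then show ?thesis using ge[of A x] ge[of B y] assms by auto
  next
    case False
    then have pos: "0 < x" "0 < y" using assms by auto
    define S where "S = A + B"
    have S: "0 < S" using assms by (simp add: S_def)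
    have cv: "convex_on {0<..} (\<lambda>x::real. x powr P)"
      using assms by (intro powr_convex) auto
    have "((1 - B / S) *\<^sub>R (x / A) + (B / S) *\<^sub>R (y / B)) powr P \<le> (1 - B / S) * (x / A) powr P + (B / S) * (y / B) powr P"
      by (rule convex_onD[OF cv]) (use assms S pos in \<open>auto simp: S_def\<close>)
    moreover have "1 - B / S = A / S" using S by (simp add: S_def field_simps)
    moreover have "(A / S) *\<^sub>R (x / A) + (B / S) *\<^sub>R (y / B) = (x + y) / S" using assms S by (simp add: field_simps)
    ultimately have 1: "((x + y) / S) powr P \<le> (A / S) * (x / A) powr P + (B / S) * (y / B) powr P" by simp
    have e: "S powr P * ((C / S) * (z / C) powr P) = (S / C) powr (P - 1) * z powr P" if "0 < C" "0 \<le> z" for C z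
      using that S by (simp add: powr_divide powr_diff field_simps)
    have "(x + y) powr P = S powr P * ((x + y) / S) powr P" using S assms by (simp add: powr_divide)
    also have "\<dots> \<le> S powr P * ((A / S) * (x / A) powr P + (B / S) * (y / B) powr P)"
      by (intro mult_left_mono 1) simp
    also have "\<dots> = (S / A) powr (P - 1) * x powr P + (S / B) powr (P - 1) * y powr P"
      using e[of A x] e[of B y] assms by (simp add: distrib_left)
    finally show ?thesis by (simp add: S_def)
  qed
qed

lemma lp_norm_triangle:
  assumes "1 \<le> p"
  shows "lp_norm p (\<lambda>k. a k + b k) \<le> lp_norm p a + lp_norm p b"
proof (cases "p = \<infinity>")
  case True
  then show ?thesis
    by (auto simp: lp_norm_def intro!: SUP_least add_mono SUP_upper)
next
  case False
  define P where "P = enn2real p"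
  have p: "p = ennreal P" using False by (simp add: P_def less_top)
  have P: "1 \<le> P" using assms unfolding p by (cases "0 \<le> P") (auto simp: P_def ennreal_le_iff simp flip: ennreal_1)
  define s where "s c = (\<integral>\<^sup>+k. epowr (c k) P \<partial>count_space UNIV)" for c :: "'a \<Rightarrow> ennreal"
  have lp: "lp_norm p c = epowr (s c) (1 / P)" for c :: "'a \<Rightarrow> ennreal" using False by (simp add: lp_norm_def P_def s_def)
  have main: "s (\<lambda>k. a k + b k) \<le> ennreal ((A + B) powr P)"
    if AB: "0 < A" "0 < B" "s a \<le> ennreal (A powr P)" "s b \<le> ennreal (B powr P)" for A B
  proof -
    define c1 c2 where "c1 = ((A + B) / A) powr (P - 1)" and "c2 = ((A + B) / B) powr (P - 1)"
    have c: "0 < c1" "0 < c2" using AB by (auto simp: c1_def c2_def)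
    have pw: "epowr (x + y) P \<le> ennreal c1 * epowr x P + ennreal c2 * epowr y P" for x y
    proof (cases "x = \<infinity> \<or> y = \<infinity>")
      case True
      then show ?thesis using c by (auto simp: epowr_def ennreal_mult_top)
    next
      case False
      then obtain u v where uv: "x = ennreal u" "y = ennreal v" "0 \<le> u" "0 \<le> v"
        by (metis ennreal_cases infinity_ennreal_def)
      show ?thesis
        using powr_add_le[OF P AB(1,2) uv(3,4)] uv c P
        by (simp add: epowr_ennreal c1_def[symmetric] c2_def[symmetric] flip: ennreal_plus ennreal_mult')
    qed
    have "s (\<lambda>k. a k + b k) \<le> (\<integral>\<^sup>+k. ennreal c1 * epowr (a k) P + ennreal c2 * epowr (b k) P \<partial>count_space UNIV)"
      unfolding s_def by (intro nn_integral_mono pw)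
    also have "\<dots> = ennreal c1 * s a + ennreal c2 * s b"
      by (simp add: s_def nn_integral_add nn_integral_cmult)
    also have "\<dots> \<le> ennreal c1 * ennreal (A powr P) + ennreal c2 * ennreal (B powr P)"
      by (intro add_mono mult_left_mono AB) auto
    also have "\<dots> = ennreal (c1 * A powr P + c2 * B powr P)"
      using c by (simp add: ennreal_mult)
    also have "c1 * A powr P + c2 * B powr P = (A + B) powr P"
    proof -
      have 1: "c1 * A powr P = (A + B) powr (P - 1) * A" "c2 * B powr P = (A + B) powr (P - 1) * B"
        using AB by (auto simp: c1_def c2_def powr_divide powr_diff)
      have "(A + B) powr (P - 1) * A + (A + B) powr (P - 1) * B = (A + B) powr (P - 1) * (A + B)" by (simp add: distrib_left)
      also have "\<dots> = (A + B) powr P" using AB by (simp add: powr_diff)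
      finally show ?thesis using 1 by simp
    qed
    finally show ?thesis .
  qed
  have P0: "0 < P" using P by simp
  have recover: "s c \<le> ennreal (r powr P)" if "lp_norm p c \<le> ennreal r" "0 \<le> r" for c :: "'a \<Rightarrow> ennreal" and r
  proof -
    have "epowr (lp_norm p c) P \<le> epowr (ennreal r) P" by (rule epowr_mono) (use that P in auto)
    moreover have "epowr (lp_norm p c) P = s c" unfolding lp using epowr_inverse[of "1 / P" "s c"] P0 by simp
    ultimately show ?thesis using that by (simp add: epowr_ennreal)
  qed
  show ?thesis
  proof (cases "lp_norm p a = \<infinity> \<or> lp_norm p b = \<infinity>")
    case False
    then obtain A B where AB: "lp_norm p a = ennreal A" "lp_norm p b = ennreal B" "0 \<le> A" "0 \<le> B"
      by (metis ennreal_cases infinity_ennreal_def)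
    \<comment> \<open>the auxiliary inequality needs positive \<open>A\<close> and \<open>B\<close>, so the norms are enlarged a little\<close>
    have "lp_norm p (\<lambda>k. a k + b k) \<le> ennreal (A + B) + ennreal e" if e: "0 < e" for e
    proof -
      have "s (\<lambda>k. a k + b k) \<le> ennreal (((A + e/2) + (B + e/2)) powr P)"
        by (rule main) (use AB e in \<open>auto intro!: recover simp del: ennreal_plus intro!: ennreal_leI\<close>)
      then have "lp_norm p (\<lambda>k. a k + b k) \<le> epowr (ennreal ((A + B + e) powr P)) (1 / P)"
        unfolding lp by (intro epowr_mono) (use P0 in \<open>auto simp: algebra_simps\<close>)
      also have "\<dots> = ennreal (A + B + e)" using AB e P0 by (simp add: epowr_ennreal powr_powr del: ennreal_plus)
      also have "\<dots> = ennreal (A + B) + ennreal e" using AB e by simp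
      finally show ?thesis .
    qed
    then have "lp_norm p (\<lambda>k. a k + b k) \<le> ennreal (A + B)"
      by (rule ennreal_le_epsilon)
    then show ?thesis using AB by simp
  qed auto
qed

text \<open>Wavelet coefficients are only estimated in \<open>\<ell>\<^sup>\<infinity>\<close> and \<open>\<ell>\<^sup>1\<close>; this covers all \<open>p\<close> in between.\<close>

lemma lp_norm_interpolation:
  assumes p: "1 \<le> p" and X: "0 \<le> X" "\<And>k. a k \<le> ennreal X" and Y: "0 \<le> Y" "(\<integral>\<^sup>+k. a k \<partial>count_space UNIV) \<le> ennreal Y"
  shows "lp_norm p a \<le> ennreal (X powr (1 - enn2real (1 / p)) * Y powr enn2real (1 / p))"
proof (cases "p = \<infinity>")
  case True
  show ?thesis
  proof (cases "X = 0 \<or> Y = 0")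
    case True
    have "a k = 0" for k
    proof -
      have "a k \<le> (\<integral>\<^sup>+k. a k \<partial>count_space UNIV)" by (rule nn_integral_ge_point) simp
      then show ?thesis using X Y True by (metis ennreal_0 le_zero_eq order.trans)
    qed
    then show ?thesis using \<open>p = \<infinity>\<close> by (simp add: lp_norm_def)
  next
    case False
    then show ?thesis using True X Y by (auto simp: lp_norm_def intro!: SUP_least)
  qed
next
  case False
  define P where "P = enn2real p"
  have pe: "p = ennreal P" using False by (simp add: P_def less_top)
  have P: "1 \<le> P" using p unfolding pe by (cases "0 \<le> P") (auto simp: P_def ennreal_le_iff simp flip: ennreal_1)
  have ip: "enn2real (1 / p) = 1 / P" unfolding pe using P by (simp add: divide_ennreal flip: ennreal_1)
  have pw: "epowr (a k) P \<le> ennreal (X powr (P - 1)) * a k" for k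
  proof -
    obtain u where u: "a k = ennreal u" "0 \<le> u" using X(2)[of k] by (metis ennreal_cases ennreal_neq_top top_unique)
    then have uX: "u \<le> X" using X(1) X(2)[of k] by simp
    have "u powr P = u powr (P - 1) * u" using u by (cases "u = 0") (auto simp: powr_diff)
    also have "\<dots> \<le> X powr (P - 1) * u" using u uX P by (intro mult_right_mono powr_mono2) auto
    finally show ?thesis using u by (simp add: epowr_ennreal flip: ennreal_mult')
  qed
  have "(\<integral>\<^sup>+k. epowr (a k) P \<partial>count_space UNIV) \<le> (\<integral>\<^sup>+k. ennreal (X powr (P - 1)) * a k \<partial>count_space UNIV)"
    by (intro nn_integral_mono pw)
  also have "\<dots> = ennreal (X powr (P - 1)) * (\<integral>\<^sup>+k. a k \<partial>count_space UNIV)" by (simp add: nn_integral_cmult)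
  also have "\<dots> \<le> ennreal (X powr (P - 1)) * ennreal Y" by (intro mult_left_mono Y) simp
  also have "\<dots> = ennreal (X powr (P - 1) * Y)" using Y by (simp add: ennreal_mult)
  finally have "lp_norm p a \<le> epowr (ennreal (X powr (P - 1) * Y)) (1 / P)"
    unfolding lp_norm_def P_def[symmetric] using False P by (auto intro!: epowr_mono)
  also have "\<dots> = ennreal ((X powr (P - 1) * Y) powr (1 / P))" using Y by (simp add: epowr_ennreal)
  also have "(X powr (P - 1) * Y) powr (1 / P) = X powr (1 - 1 / P) * Y powr (1 / P)"
    using X Y P by (simp add: powr_mult powr_powr diff_divide_distrib)
  finally show ?thesis by (simp add: ip)
qed

lemma lp_norm_le_sum:
  assumes "1 \<le> p" shows "lp_norm p a \<le> (\<integral>\<^sup>+k. a k \<partial>count_space UNIV)"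
proof (cases "(\<integral>\<^sup>+k. a k \<partial>count_space UNIV)")
  case (real S)
  have "a k \<le> ennreal S" for k unfolding real(2)[symmetric] by (rule nn_integral_ge_point) simp
  then have "lp_norm p a \<le> ennreal (S powr (1 - enn2real (1 / p)) * S powr enn2real (1 / p))"
    using real by (intro lp_norm_interpolation assms) auto
  also have "S powr (1 - enn2real (1 / p)) * S powr enn2real (1 / p) = S"
    using real(1) by (cases "S = 0") (auto simp flip: powr_add)
  finally show ?thesis using real by simp
qed auto

lemma coeff_norm_triangle:
  assumes "1 \<le> p" "\<And>k. integrable lborel (\<lambda>x. u x * dil g j k x)" "\<And>k. integrable lborel (\<lambda>x. v x * dil g j k x)"
  shows "coeff_norm p g j (\<lambda>x. u x + v x) \<le> coeff_norm p g j u + coeff_norm p g j v"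
proof -
  have "coeff_norm p g j (\<lambda>x. u x + v x)
    \<le> lp_norm p (\<lambda>k. ennreal \<bar>\<integral>x. u x * dil g j k x \<partial>lborel\<bar> + ennreal \<bar>\<integral>x. v x * dil g j k x \<partial>lborel\<bar>)"
    unfolding coeff_norm_def
    by (rule lp_norm_mono) (use assms in \<open>auto simp: distrib_right simp flip: ennreal_plus intro!: ennreal_leI\<close>)
  also have "\<dots> \<le> coeff_norm p g j u + coeff_norm p g j v"
    unfolding coeff_norm_def by (rule lp_norm_triangle) fact
  finally show ?thesis .
qed

lemma besov_norm_triangle:
  assumes p: "1 \<le> p" and q: "1 \<le> q"
    and "\<And>k. integrable lborel (\<lambda>x. u x * dil \<phi> 0 k x)" "\<And>k. integrable lborel (\<lambda>x. v x * dil \<phi> 0 k x)"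
    and "\<And>j k. integrable lborel (\<lambda>x. u x * dil \<psi> j k x)" "\<And>j k. integrable lborel (\<lambda>x. v x * dil \<psi> j k x)"
  shows "besov_norm \<phi> \<psi> s p q (\<lambda>x. u x + v x) \<le> besov_norm \<phi> \<psi> s p q u + besov_norm \<phi> \<psi> s p q v"
proof -
  define w where "w j = ennreal (2 powr (real j * (s + 1/2 - enn2real (1 / p))))" for j :: nat
  have "lp_norm q (\<lambda>j. w j * coeff_norm p \<psi> (int j) (\<lambda>x. u x + v x))
     \<le> lp_norm q (\<lambda>j. w j * coeff_norm p \<psi> (int j) u + w j * coeff_norm p \<psi> (int j) v)"
    by (rule lp_norm_mono[OF q]) (use assms in \<open>auto simp flip: distrib_left intro!: mult_left_mono coeff_norm_triangle\<close>)
  also have "\<dots> \<le> lp_norm q (\<lambda>j. w j * coeff_norm p \<psi> (int j) u) + lp_norm q (\<lambda>j. w j * coeff_norm p \<psi> (int j) v)"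
    by (rule lp_norm_triangle[OF q])
  finally have "besov_norm \<phi> \<psi> s p q (\<lambda>x. u x + v x) \<le> (coeff_norm p \<phi> 0 u + coeff_norm p \<phi> 0 v) + \<dots>"
    unfolding besov_norm_def w_def[symmetric] by (intro add_mono coeff_norm_triangle assms)
  then show ?thesis unfolding besov_norm_def w_def[symmetric] by (simp add: ac_simps)
qed

lemma besov_norm_scale_le:
  assumes p: "1 \<le> p" and q: "1 \<le> q" and c: "\<bar>c\<bar> \<le> 1"
  shows "besov_norm \<phi> \<psi> s p q (\<lambda>x. c * u x) \<le> besov_norm \<phi> \<psi> s p q u"
proof -
  have "coeff_norm p g j (\<lambda>x. c * u x) \<le> coeff_norm p g j u" for g j
    unfolding coeff_norm_def
    by (rule lp_norm_mono[OF p]) (use c in \<open>auto simp: mult.assoc abs_mult intro!: ennreal_leI mult_left_le_one_le\<close>)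
  then show ?thesis unfolding besov_norm_def
    by (intro add_mono lp_norm_mono[OF q] mult_left_mono) auto
qed

text \<open>The two bounds at level \<open>j\<close> interpolate to \<open>\<kappa> t\<^sub>j 2\<^bsup>j(1/p - 1/2)\<^esup>\<close>, so that the weights of the norm
  leave \<open>\<kappa> 2\<^bsup>js\<^esup> t\<^sub>j\<close> for every \<open>p\<close>, and the \<open>\<ell>\<^sup>q\<close> norm over the levels is at most the sum.\<close>

lemma besov_norm_le:
  assumes p: "1 \<le> p" and q: "1 \<le> q" and K: "0 \<le> \<kappa>" "0 \<le> \<Theta>" "\<And>j. 0 \<le> t j"
    and f0: "\<And>k. \<bar>\<integral>x. u x * dil \<phi> 0 k x \<partial>lborel\<bar> \<le> \<kappa>"
      "(\<integral>\<^sup>+k. ennreal \<bar>\<integral>x. u x * dil \<phi> 0 k x \<partial>lborel\<bar> \<partial>count_space UNIV) \<le> ennreal \<kappa>"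
    and fj: "\<And>j k. \<bar>\<integral>x. u x * dil \<psi> (int j) k x \<partial>lborel\<bar> \<le> \<kappa> * t j * 2 powr (- (real j / 2))"
      "\<And>j. (\<integral>\<^sup>+k. ennreal \<bar>\<integral>x. u x * dil \<psi> (int j) k x \<partial>lborel\<bar> \<partial>count_space UNIV) \<le> ennreal (\<kappa> * t j * 2 powr (real j / 2))"
    and t: "(\<integral>\<^sup>+j. ennreal (2 powr (real j * s) * t j) \<partial>count_space UNIV) \<le> ennreal \<Theta>"
  shows "besov_norm \<phi> \<psi> s p q u \<le> ennreal (\<kappa> + \<kappa> * \<Theta>)"
proof -
  define ip where "ip = enn2real (1 / p)"
  have gen: "lp_norm p (\<lambda>k. ennreal (c k)) \<le> ennreal (b * 2 powr (e * (ip - 1/2)))"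
    if "0 \<le> b" "\<And>k. c k \<le> b * 2 powr (- (e / 2))"
      "(\<integral>\<^sup>+k. ennreal (c k) \<partial>count_space UNIV) \<le> ennreal (b * 2 powr (e / 2))" for c :: "int \<Rightarrow> real" and b e
  proof -
    have "lp_norm p (\<lambda>k. ennreal (c k)) \<le> ennreal ((b * 2 powr (- (e / 2))) powr (1 - ip) * (b * 2 powr (e / 2)) powr ip)"
      unfolding ip_def by (rule lp_norm_interpolation[OF p]) (use that in \<open>auto intro!: ennreal_leI\<close>)
    also have "(b * 2 powr (- (e / 2))) powr (1 - ip) * (b * 2 powr (e / 2)) powr ip
        = (b powr (1 - ip) * b powr ip) * (2 powr (- (e / 2) * (1 - ip)) * 2 powr (e / 2 * ip))"
      using that by (simp add: powr_mult powr_powr)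
    also have "b powr (1 - ip) * b powr ip = b" using that(1) by (cases "b = 0") (auto simp flip: powr_add)
    also have "2 powr (- (e / 2) * (1 - ip)) * 2 powr (e / 2 * ip) = (2::real) powr (e * (ip - 1/2))"
      unfolding powr_add[symmetric] by (rule arg_cong[of _ _ "(powr) 2"]) (simp add: field_simps)
    finally show ?thesis .
  qed
  have c0: "coeff_norm p \<phi> 0 u \<le> ennreal \<kappa>"
    unfolding coeff_norm_def using gen[of \<kappa> _ 0] K f0 by simp
  have cj: "coeff_norm p \<psi> (int j) u \<le> ennreal (\<kappa> * t j * 2 powr (real j * (ip - 1/2)))" for j
    unfolding coeff_norm_def using gen[of "\<kappa> * t j" _ "real j"] K fj by simp
  have "lp_norm q (\<lambda>j::nat. ennreal (2 powr (real j * (s + 1/2 - ip))) * coeff_norm p \<psi> (int j) u)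
     \<le> (\<integral>\<^sup>+j. ennreal (2 powr (real j * (s + 1/2 - ip))) * coeff_norm p \<psi> (int j) u \<partial>count_space UNIV)"
    by (rule lp_norm_le_sum[OF q])
  also have "\<dots> \<le> (\<integral>\<^sup>+j. ennreal \<kappa> * ennreal (2 powr (real j * s) * t j) \<partial>count_space UNIV)"
  proof (rule nn_integral_mono)
    fix j :: nat
    have "ennreal (2 powr (real j * (s + 1/2 - ip))) * coeff_norm p \<psi> (int j) u
       \<le> ennreal (2 powr (real j * (s + 1/2 - ip))) * ennreal (\<kappa> * t j * 2 powr (real j * (ip - 1/2)))"
      by (intro mult_left_mono cj) simp
    also have "\<dots> = ennreal (\<kappa> * (t j * (2 powr (real j * (s + 1/2 - ip)) * 2 powr (real j * (ip - 1/2)))))"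
      using K by (simp add: ennreal_mult[symmetric] mult_ac)
    also have "2 powr (real j * (s + 1/2 - ip)) * 2 powr (real j * (ip - 1/2)) = (2::real) powr (real j * s)"
      by (simp add: algebra_simps flip: powr_add)
    also have "ennreal (\<kappa> * (t j * 2 powr (real j * s))) = ennreal \<kappa> * ennreal (2 powr (real j * s) * t j)"
      using K by (simp add: ennreal_mult[symmetric] mult_ac)
    finally show "ennreal (2 powr (real j * (s + 1/2 - ip))) * coeff_norm p \<psi> (int j) u
       \<le> ennreal \<kappa> * ennreal (2 powr (real j * s) * t j)" .
  qed
  also have "\<dots> = ennreal \<kappa> * (\<integral>\<^sup>+j. ennreal (2 powr (real j * s) * t j) \<partial>count_space UNIV)"
    by (rule nn_integral_cmult) simp
  also have "\<dots> \<le> ennreal \<kappa> * ennreal \<Theta>" by (intro mult_left_mono t) simp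
  finally show ?thesis unfolding besov_norm_def ip_def[symmetric]
    using c0 K by (simp add: ennreal_mult add_mono)
qed

section \<open>Continuous functions that vanish at the integers\<close>

lemma integral_shift:
  fixes f :: "real \<Rightarrow> real" shows "(\<integral>x. f (x + h) \<partial>lborel) = (\<integral>x. f x \<partial>lborel)"
  using lborel_integral_real_affine[of 1 f h] by (simp add: add.commute)

lemma integrable_shift:
  fixes f :: "real \<Rightarrow> real" shows "integrable lborel f \<Longrightarrow> integrable lborel (\<lambda>x. f (x + h))"
  using integrable_affine[of f 1 h] by (simp add: add.commute)

lemma convol_continuous_of_continuous:
  assumes w: "integrable lborel w" and v: "continuous_on UNIV v" "\<And>x. \<bar>v x\<bar> \<le> B"
  shows "continuous_on UNIV (convol w v)"
proof (rule continuous_at_imp_continuous_on, intro ballI)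
  fix x
  have [measurable]: "v \<in> borel_measurable borel" by (rule borel_measurable_continuous_onI[OF v(1)])
  have [measurable]: "w \<in> borel_measurable borel" using w by auto
  show "isCont (convol w v) x"
    unfolding continuous_at_sequentially comp_def convol_def
  proof (intro allI impI)
    fix y assume y: "y \<longlonglongrightarrow> x"
    show "(\<lambda>n. \<integral>z. w z * v (y n - z) \<partial>lborel) \<longlonglongrightarrow> (\<integral>z. w z * v (x - z) \<partial>lborel)"
    proof (rule integral_dominated_convergence[where w="\<lambda>z. \<bar>w z\<bar> * B"])
      have "isCont v t" for t using v(1) by (simp add: continuous_on_eq_continuous_at)
      then show "AE z in lborel. (\<lambda>n. w z * v (y n - z)) \<longlonglongrightarrow> w z * v (x - z)"
        by (intro AE_I2 tendsto_mult_left isCont_tendsto_compose[where g=v]) (auto intro: tendsto_diff y)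
    qed (use w v(2) in \<open>auto simp: abs_mult intro!: mult_left_mono\<close>)
  qed
qed

text \<open>Convolution with a bounded \<open>w\<close> turns convergence in \<open>L\<^sup>1\<close> into uniform convergence.\<close>

lemma convol_continuous_L1_limit:
  assumes w: "bdd_integrable w" and v: "integrable lborel v" and u: "\<And>n. bdd_integrable (u n)" "\<And>n. continuous_on UNIV (convol w (u n))"
    and lim: "AE x in lborel. (\<lambda>n. u n x) \<longlonglongrightarrow> v x" and d: "integrable lborel d" "\<And>n x. \<bar>u n x\<bar> \<le> d x"
  shows "continuous_on UNIV (convol w v)"
proof (rule uniform_limit_theorem)
  obtain B where B: "0 < B" "\<And>x. \<bar>w x\<bar> \<le> B" using bdd_integrable_bound[OF w] by metis
  have ui: "integrable lborel (u n)" for n by (rule bdd_integrableD[OF u(1)])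
  have wi: "integrable lborel w" by (rule bdd_integrableD[OF w])
  define \<delta> where "\<delta> n = (\<integral>t. \<bar>u n t - v t\<bar> \<partial>lborel)" for n
  have "\<delta> \<longlonglongrightarrow> (\<integral>t. 0 \<partial>(lborel :: real measure))"
    unfolding \<delta>_def[abs_def]
  proof (rule integral_dominated_convergence[where w="\<lambda>t. d t + \<bar>v t\<bar>"])
    show "AE t in lborel. (\<lambda>n. \<bar>u n t - v t\<bar>) \<longlonglongrightarrow> 0"
      using lim by eventually_elim (simp add: tendsto_rabs_zero LIM_zero)
    show "AE t in lborel. norm \<bar>u n t - v t\<bar> \<le> d t + \<bar>v t\<bar>" for n
    proof (rule AE_I2)
      fix t show "norm \<bar>u n t - v t\<bar> \<le> d t + \<bar>v t\<bar>" using d(2)[of n t] by simp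
    qed
  qed (use ui v d in auto)
  then have \<delta>: "(\<lambda>n. B * \<delta> n) \<longlonglongrightarrow> 0" using tendsto_mult_right_zero[of \<delta> _ B] by simp
  have le: "\<bar>convol w (u n) x - convol w v x\<bar> \<le> B * \<delta> n" for n x
  proof -
    have iu: "integrable lborel (\<lambda>t. u n t * w (x - t))" and iv: "integrable lborel (\<lambda>t. v t * w (x - t))"
      by (rule convol_integrand[OF ui w] convol_integrand[OF v w])+
    have id: "integrable lborel (\<lambda>t. (u n t - v t) * w (x - t))"
      using Bochner_Integration.integrable_diff[OF iu iv] by (simp add: left_diff_distrib)
    have "convol w (u n) x - convol w v x = (\<integral>t. (u n t - v t) * w (x - t) \<partial>lborel)"
      unfolding convol_commute[of w] convol_def left_diff_distrib by (rule Bochner_Integration.integral_diff[OF iu iv, symmetric])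
    also have "\<bar>\<dots>\<bar> \<le> (\<integral>t. \<bar>(u n t - v t) * w (x - t)\<bar> \<partial>lborel)" by (rule integral_abs_bound)
    also have "\<dots> \<le> (\<integral>t. \<bar>u n t - v t\<bar> * B \<partial>lborel)"
    proof (rule integral_mono)
      show "integrable lborel (\<lambda>t. \<bar>(u n t - v t) * w (x - t)\<bar>)" by (rule integrable_abs[OF id])
      show "integrable lborel (\<lambda>t. \<bar>u n t - v t\<bar> * B)" using ui[of n] v by auto
    qed (use B(2) in \<open>auto simp: abs_mult intro!: mult_left_mono\<close>)
    finally show ?thesis by (simp add: \<delta>_def mult.commute)
  qed
  show "uniform_limit UNIV (\<lambda>n. convol w (u n)) (convol w v) sequentially"
  proof (rule uniform_limitI)
    fix e :: real assume "0 < e"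
    then have "\<forall>\<^sub>F n in sequentially. B * \<delta> n < e" using \<delta> by (intro order_tendstoD(2)[OF \<delta>])
    then show "\<forall>\<^sub>F n in sequentially. \<forall>x\<in>UNIV. dist (convol w (u n) x) (convol w v x) < e"
      by eventually_elim (auto simp: dist_real_def intro: le_less_trans[OF le])
  qed
qed (use u in auto)

text \<open>By the previous lemma the second factor may be replaced by continuous approximations.  A
  measurable function is almost everywhere a limit of continuous ones; truncating these in
  height makes them dominated on a bounded interval, and the cut-offs exhaust the line.\<close>

lemma convol_continuous:
  assumes w: "bdd_integrable w" and v: "bdd_integrable v"
  shows "continuous_on UNIV (convol w v)"
proof -
  obtain B where B: "0 < B" "\<And>x. \<bar>v x\<bar> \<le> B" using bdd_integrable_bound[OF v] by metis
  \<comment> \<open>a continuous cut-off that equals \<open>1\<close> on \<open>[-m, m]\<close>\<close>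
  define cut where "cut m x = max 0 (min 1 (real m + 1 - \<bar>x\<bar>))" for m :: nat and x :: real
  have cut: "0 \<le> cut m x" "cut m x \<le> 1" "continuous_on UNIV (cut m)" for m x
    by (auto simp: cut_def[abs_def] intro!: continuous_intros)
  have bc: "bdd_integrable (\<lambda>x. B * cut m x)" for m
  proof (rule bdd_integrable_cmult[OF bdd_integrable_compact_support])
    show "cut m \<in> borel_measurable borel" by (rule borel_measurable_continuous_onI[OF cut(3)])
    show "\<bar>cut m x\<bar> \<le> 1" for x using cut(1,2)[of m x] by simp
    show "cut m x = 0" if "x \<notin> {-(real m + 1)..real m + 1}" for x using that by (auto simp: cut_def)
  qed
  have "v measurable_on UNIV"
    using bdd_integrableD(2)[OF v] by (intro lebesgue_measurable_imp_measurable_on) (auto intro: measurable_completion)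
  then obtain N g where g: "negligible N" "\<And>n. continuous_on UNIV (g n)" "\<And>x. x \<notin> N \<Longrightarrow> (\<lambda>n::nat. g n x) \<longlonglongrightarrow> v x"
    unfolding measurable_on_def by auto
  have N: "AE x in lborel. x \<notin> N" using AE_not_in[of N lebesgue] g(1) by (simp add: negligible_iff_null_sets AE_completion_iff)
  have vm: "bdd_integrable (\<lambda>x. v x * cut m x)" "continuous_on UNIV (convol w (\<lambda>x. v x * cut m x))" for m
  proof -
    define u where "u n x = max (- B) (min B (g n x)) * cut m x" for n x
    have uc: "continuous_on UNIV (u n)" for n
      unfolding u_def[abs_def] by (intro continuous_intros g(2) cut(3))
    have ub: "\<bar>u n x\<bar> \<le> B * cut m x" for n x
      unfolding u_def abs_mult using B(1) cut(1,2)[of m x] by (intro mult_mono) auto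
    have uB: "\<bar>u n x\<bar> \<le> B" for n x using ub[of n x] B(1) cut(2)[of m x] mult_left_mono[of "cut m x" 1 B] by linarith
    have ui: "bdd_integrable (u n)" for n
    proof -
      have "integrable lborel (u n)"
        by (rule Bochner_Integration.integrable_bound[OF bdd_integrableD(1)[OF bc[of m]]])
          (use ub borel_measurable_continuous_onI[OF uc] cut(1) B(1) in \<open>auto simp: abs_mult\<close>)
      then show ?thesis unfolding bdd_integrable_def using uB by blast
    qed
    have "AE x in lborel. (\<lambda>n. u n x) \<longlonglongrightarrow> v x * cut m x"
      using N
    proof eventually_elim
      case (elim x)
      have "max (- B) (min B (v x)) = v x" using B(2)[of x] by auto
      moreover have "(\<lambda>n. u n x) \<longlonglongrightarrow> max (- B) (min B (v x)) * cut m x"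
        unfolding u_def by (intro tendsto_intros tendsto_max tendsto_min g(3) elim)
      ultimately show ?case by simp
    qed
    moreover show bv: "bdd_integrable (\<lambda>x. v x * cut m x)"
    proof -
      have le: "\<bar>v x * cut m x\<bar> \<le> \<bar>v x\<bar>" for x using cut(1,2)[of m x] by (simp add: abs_mult mult_left_le)
      have [measurable]: "cut m \<in> borel_measurable borel" by (rule borel_measurable_continuous_onI[OF cut(3)])
      have [measurable]: "v \<in> borel_measurable borel" by (rule bdd_integrableD[OF v])
      have "integrable lborel (\<lambda>x. v x * cut m x)"
        by (rule Bochner_Integration.integrable_bound[OF bdd_integrableD(1)[OF v]]) (use le in auto)
      then show ?thesis unfolding bdd_integrable_def using order_trans[OF le B(2)] by blast
    qed
    ultimately show "continuous_on UNIV (convol w (\<lambda>x. v x * cut m x))"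
      by (intro convol_continuous_L1_limit[OF w _ ui convol_continuous_of_continuous[OF bdd_integrableD(1)[OF w] uc uB] _ bdd_integrableD(1)[OF bc] ub] bdd_integrableD(1)[OF bv])
  qed
  show ?thesis
  proof (rule convol_continuous_L1_limit[OF w bdd_integrableD(1)[OF v] vm, where d="\<lambda>x. \<bar>v x\<bar>"])
    show "AE x in lborel. (\<lambda>m. v x * cut m x) \<longlonglongrightarrow> v x"
    proof (rule AE_I2, rule tendsto_eventually)
      fix x
      show "\<forall>\<^sub>F m in sequentially. v x * cut m x = v x"
        using eventually_ge_at_top[of "nat \<lceil>\<bar>x\<bar>\<rceil>"]
      proof eventually_elim
        case (elim m)
        then have "\<bar>x\<bar> \<le> real m" by linarith
        then show ?case by (simp add: cut_def)
      qed
    qed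
    show "\<bar>v x * cut m x\<bar> \<le> \<bar>v x\<bar>" for m x
      using cut(1,2)[of m x] by (simp add: abs_mult mult_left_le)
  qed (use bdd_integrableD(1)[OF v] in auto)
qed

text \<open>Rolle's theorem: between \<open>E + 1\<close> zeros of \<open>f 0\<close> there are \<open>E + 1 - r\<close> zeros of the \<open>r\<close>-th derivative.\<close>

lemma zeros_of_derivatives:
  fixes f :: "nat \<Rightarrow> real \<Rightarrow> real"
  assumes d: "\<And>r x. r < E \<Longrightarrow> (f r has_real_derivative f (Suc r) x) (at x)"
    and z0: "\<And>i. i \<le> E \<Longrightarrow> f 0 (a + real i) = 0" and "r < E"
  shows "\<exists>z. a \<le> z \<and> z \<le> a + real E \<and> f r z = 0"
proof -
  have "\<exists>z::nat \<Rightarrow> real. (\<forall>i<E - r. z i < z (Suc i)) \<and> (\<forall>i\<le>E - r. a \<le> z i \<and> z i \<le> a + real E \<and> f r (z i) = 0)"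
    if "r < E" for r
    using that
  proof (induction r)
    case 0
    show ?case by (rule exI[of _ "\<lambda>i. a + real i"]) (use z0 in auto)
  next
    case (Suc r)
    then obtain z where z: "\<And>i. i < E - r \<Longrightarrow> z i < z (Suc i)"
      "\<And>i. i \<le> E - r \<Longrightarrow> a \<le> z i \<and> z i \<le> a + real E \<and> f r (z i) = 0" by auto
    have "\<exists>y. z i < y \<and> y < z (Suc i) \<and> f (Suc r) y = 0" if i: "i < E - r" for i
    proof -
      have dr: "(f r has_real_derivative f (Suc r) x) (at x)" for x using d Suc.prems by simp
      have "\<exists>y. z i < y \<and> y < z (Suc i) \<and> (\<lambda>v. f (Suc r) y * v) = (\<lambda>v. 0)"
      proof (rule Rolle_deriv[of _ _ "f r"])
        show "z i < z (Suc i)" using z(1) i by simp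
        show "f r (z i) = f r (z (Suc i))" using z(2)[of i] z(2)[of "Suc i"] i by simp
        show "continuous_on {z i..z (Suc i)} (f r)"
          using dr DERIV_isCont continuous_at_imp_continuous_on by blast
        show "(f r has_derivative (\<lambda>v. f (Suc r) x * v)) (at x)" for x
          using dr[of x] by (simp add: has_field_derivative_def)
      qed
      then obtain y where "z i < y" "y < z (Suc i)" "f (Suc r) y * 1 = 0" by metis
      then show ?thesis by auto
    qed
    then obtain y where y: "\<And>i. i < E - r \<Longrightarrow> z i < y i \<and> y i < z (Suc i) \<and> f (Suc r) (y i) = 0" by metis
    have "y i < y (Suc i)" if "i < E - Suc r" for i
      using y[of i] y[of "Suc i"] that by force
    moreover have "a \<le> y i \<and> y i \<le> a + real E \<and> f (Suc r) (y i) = 0" if "i \<le> E - Suc r" for i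
    proof -
      have i: "i < E - r" using that Suc.prems by auto
      then show ?thesis using y[OF i] z(2)[of i] z(2)[of "Suc i"] by auto
    qed
    ultimately show ?case by blast
  qed
  from this[OF \<open>r < E\<close>] show ?thesis by blast
qed

text \<open>Each derivative of order below \<open>E\<close> has a zero in the interval of length \<open>E\<close>, so integrating from
  that zero costs a factor \<open>E\<close> per order.\<close>

lemma bound_from_zeros:
  fixes f :: "nat \<Rightarrow> real \<Rightarrow> real"
  assumes d: "\<And>r x. r < E \<Longrightarrow> (f r has_real_derivative f (Suc r) x) (at x)"
    and z0: "\<And>i. i \<le> E \<Longrightarrow> f 0 (a + real i) = 0"
    and B: "\<And>x. a \<le> x \<Longrightarrow> x \<le> a + real E \<Longrightarrow> \<bar>f E x\<bar> \<le> B"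
    and x: "a \<le> x" "x \<le> a + real E"
  shows "\<bar>f 0 x\<bar> \<le> real E ^ E * B"
proof -
  have B0: "0 \<le> B" using B[OF x] by linarith
  have "\<bar>f (E - m) x\<bar> \<le> real E ^ m * B" if "m \<le> E" "a \<le> x" "x \<le> a + real E" for m x
    using that
  proof (induction m arbitrary: x)
    case 0
    then show ?case using B by simp
  next
    case (Suc m)
    define r where "r = E - Suc m"
    have r: "r < E" "Suc r = E - m" using Suc.prems by (auto simp: r_def)
    obtain z where z: "a \<le> z" "z \<le> a + real E" "f r z = 0" using zeros_of_derivatives[OF d z0 r(1)] by blast
    have dr: "(f r has_real_derivative f (Suc r) y) (at y within {a..a + real E})" for y
      using d[OF r(1)] by (rule has_field_derivative_at_within)
    have "norm (f r x - f r z) \<le> (real E ^ m * B) * norm (x - z)"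
      by (rule field_differentiable_bound[of "{a..a + real E}" "f r" "f (Suc r)"])
        (use dr Suc.IH Suc.prems z r in auto)
    also have "\<dots> \<le> (real E ^ m * B) * real E"
      using z Suc.prems B0 by (intro mult_left_mono) auto
    finally show ?case using z by (simp add: r_def[symmetric] mult_ac)
  qed
  from this[of E x] x show ?thesis by simp
qed

lemma primitive_of_imp_DERIV:
  assumes p: "primitive_of v v'" and c: "continuous_on UNIV v'"
  shows "(v has_real_derivative v' x) (at x)"
proof -
  have c1: "continuous_on {x-1..x+1} v'" using c continuous_on_subset by blast
  obtain G where G: "\<And>y. y \<in> {x-1..x+1} \<Longrightarrow> (G has_vector_derivative v' y) (at y within {x-1..x+1})"
    using antiderivative_continuous[OF c1] by metis
  have eq: "v y - v (x-1) = G y - G (x-1)" if y: "y \<in> {x-1..x+1}" for y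
  proof -
    have "v y - v (x-1) = (\<integral>t. indicator {0..y-(x-1)} t * v' (y - t) \<partial>lborel)"
      using p y by (simp add: primitive_of_def)
    also have "\<dots> = (\<integral>s. indicator {x-1..y} s *\<^sub>R v' s \<partial>lborel)"
      by (subst lborel_integral_real_affine[of "-1" _ y]) (auto simp: indicator_def intro!: Bochner_Integration.integral_cong)
    also have "\<dots> = G y - G (x-1)"
      by (rule integral_FTC_Icc) (use y c1 in \<open>auto intro: has_vector_derivative_within_subset[OF G] continuous_on_subset\<close>)
    finally show ?thesis .
  qed
  have "(G has_vector_derivative v' x) (at x within {x-1..x+1})" by (rule G) auto
  then have "(G has_real_derivative v' x) (at x)"
    by (subst (asm) at_within_interior) (auto simp flip: has_real_derivative_iff_has_vector_derivative)
  then have "((\<lambda>y. v (x-1) + (G y - G (x-1))) has_real_derivative v' x) (at x)"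
    by (auto intro!: derivative_eq_intros)
  then show ?thesis
    by (rule has_field_derivative_transform_within_open[where S="{x-1<..<x+1}"]) (auto simp: eq[symmetric])
qed

text \<open>The \<open>r\<close>-th derivative of the bump rescaled to mass one and to the interval \<open>[0, 1 / d]\<close>.\<close>

definition mollifier :: "real \<Rightarrow> nat \<Rightarrow> real \<Rightarrow> real" where
  "mollifier d r x = d ^ (r + 1) / (\<integral>x. bump 0 x \<partial>lborel) * bump r (0 + d * x)"

lemma bdd_integrable_mollifier: "d \<noteq> 0 \<Longrightarrow> bdd_integrable (mollifier d r)"
  unfolding mollifier_def[abs_def] by (intro bdd_integrable_cmult bdd_integrable_affine bdd_integrable_bump)

lemma mollifier_deriv: "(mollifier d r has_real_derivative mollifier d (Suc r) x) (at x)"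
proof -
  have e: "d ^ (r + 1) / I * d = d ^ (Suc r + 1) / I" for I by simp
  show ?thesis unfolding mollifier_def[abs_def]
    using bump_affine_deriv[of "d ^ (r + 1) / (\<integral>x. bump 0 x \<partial>lborel)" r 0 d x] unfolding e .
qed

lemma mollifier_continuous: "continuous_on A (mollifier d r)"
  by (intro continuous_at_imp_continuous_on ballI DERIV_isCont[OF mollifier_deriv])

lemma mollifier_primitive: "primitive_of (mollifier d r) (mollifier d (Suc r))"
  by (rule primitive_of_DERIV[OF mollifier_deriv mollifier_continuous])

lemma mollifier_nonneg: "0 < d \<Longrightarrow> 0 \<le> mollifier d 0 x"
  unfolding mollifier_def using bump_integral_pos bump_0_nonneg by (intro mult_nonneg_nonneg) auto

lemma mollifier_integral:
  assumes "0 < d" shows "(\<integral>x. mollifier d 0 x \<partial>lborel) = 1"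
proof -
  define I J where "I = (\<integral>x. bump 0 x \<partial>lborel)" and "J = (\<integral>x. bump 0 (0 + d * x) \<partial>lborel)"
  have "I = d * J"
    unfolding I_def J_def using lborel_integral_real_affine[of d "bump 0" 0] assms by simp
  moreover have "0 < I" using bump_integral_pos by (simp add: I_def)
  moreover have "(\<integral>x. mollifier d 0 x \<partial>lborel) = d / I * J" by (simp add: mollifier_def I_def J_def)
  ultimately show ?thesis using assms by auto
qed

lemma mollifier_outside: "0 < d \<Longrightarrow> x < 0 \<or> 1 / d < x \<Longrightarrow> mollifier d r x = 0"
  unfolding mollifier_def by (auto simp: bump_outside mult_nonneg_nonpos field_simps intro!: bump_outside)

lemma convol_mollifier_tendsto:
  assumes F: "bdd_integrable F" "continuous_on UNIV F"
  shows "(\<lambda>n. convol F (mollifier (real (Suc n)) 0) w) \<longlonglongrightarrow> F w"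
proof (rule LIMSEQ_I)
  fix e :: real assume e: "0 < e"
  have "isCont F w" using F(2) by (simp add: continuous_on_eq_continuous_at)
  then obtain \<delta> where d: "0 < \<delta>" "\<And>y. \<bar>y - w\<bar> < \<delta> \<Longrightarrow> \<bar>F y - F w\<bar> < e / 2"
    using half_gt_zero[OF e] unfolding continuous_at_real_range real_norm_def by blast
  obtain N where N: "1 / \<delta> < real N" using reals_Archimedean2 by blast
  have "norm (convol F (mollifier (real (Suc n)) 0) w - F w) < e" if n: "n \<ge> N" for n
  proof -
    let ?m = "mollifier (real (Suc n)) 0"
    have m: "bdd_integrable ?m" "(\<integral>x. ?m x \<partial>lborel) = 1" by (auto intro!: bdd_integrable_mollifier mollifier_integral)
    have small: "1 / real (Suc n) < \<delta>"
    proof -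
      have "1 / \<delta> < real (Suc n)" using N n by simp
      then show ?thesis using d(1) by (simp add: field_simps)
    qed
    have i: "integrable lborel (\<lambda>z. ?m z * F (w - z))" using convol_integrand[OF bdd_integrableD(1)[OF m(1)] F(1)] .
    have "convol F ?m w - F w = (\<integral>z. ?m z * F (w - z) - ?m z * F w \<partial>lborel)"
      using i bdd_integrableD(1)[OF m(1)] m(2) by (subst convol_commute) (simp add: convol_def Bochner_Integration.integral_diff)
    also have "norm \<dots> \<le> (\<integral>z. ?m z * (e / 2) \<partial>lborel)"
    proof (rule order.trans[OF integral_norm_bound], rule integral_mono)
      show "integrable lborel (\<lambda>z. norm (?m z * F (w - z) - ?m z * F w))" using i bdd_integrableD(1)[OF m(1)] by auto
      show "integrable lborel (\<lambda>z. ?m z * (e / 2))" using bdd_integrableD(1)[OF m(1)] by auto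
      fix z
      show "norm (?m z * F (w - z) - ?m z * F w) \<le> ?m z * (e / 2)"
      proof (cases "z < 0 \<or> 1 / real (Suc n) < z")
        case True
        then show ?thesis using mollifier_outside[of "real (Suc n)" z 0] by simp
      next
        case False
        then have "\<bar>F (w - z) - F w\<bar> < e / 2" using small by (intro d(2)) auto
        then have "?m z * \<bar>F (w - z) - F w\<bar> \<le> ?m z * (e / 2)"
          using mollifier_nonneg[of "real (Suc n)" z] by (intro mult_left_mono) auto
        then show ?thesis using mollifier_nonneg[of "real (Suc n)" z]
          by (simp add: abs_mult flip: right_diff_distrib)
      qed
    qed
    also have "\<dots> = e / 2" using m by simp
    finally show ?thesis using e by simp
  qed
  then show "\<exists>no. \<forall>n\<ge>no. norm (convol F (mollifier (real (Suc n)) 0) w - F w) < e" by blast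
qed

text \<open>The bump stretched to \<open>[-1, 1]\<close>, with value \<open>1\<close> at \<open>0\<close> and \<open>0\<close> at all other integers, and its
  derivatives.  Its integer translates interpolate prescribed values at the integers.\<close>

definition cardinal_bump :: "nat \<Rightarrow> real \<Rightarrow> real" where
  "cardinal_bump r y = (1/2) ^ r / bump 0 (1/2) * bump r (1/2 + (1/2) * y)"

lemma cardinal_bump_deriv: "(cardinal_bump r has_real_derivative cardinal_bump (Suc r) x) (at x)"
proof -
  have e: "(1/2) ^ r / I * (1/2) = (1/2) ^ (Suc r) / I" for I :: real by simp
  show ?thesis unfolding cardinal_bump_def[abs_def]
    using bump_affine_deriv[of "(1/2) ^ r / bump 0 (1/2)" r "1/2" "1/2" x] unfolding e .
qed

lemma cardinal_bump_int: "cardinal_bump 0 (real i - real j) = (if i = j then 1 else 0)"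
proof (cases "i = j")
  case True
  then show ?thesis using bump_0_pos[of "1/2"] by (simp add: cardinal_bump_def)
next
  case False
  then have "real i - real j \<le> -1 \<or> 1 \<le> real i - real j" by linarith
  then have "1/2 + (1/2) * (real i - real j) \<le> 0 \<or> 1 \<le> 1/2 + (1/2) * (real i - real j)" by argo
  then show ?thesis using False by (simp add: cardinal_bump_def bump_outside)
qed

lemma cardinal_bump_bounded: obtains C where "0 < C" "\<And>y. \<bar>cardinal_bump r y\<bar> \<le> C"
proof -
  obtain B where B: "0 < B" "\<And>x. \<bar>bump r x\<bar> \<le> B" using bump_bounded by metis
  have p: "0 < (1/2) ^ r / bump 0 (1/2)" using bump_0_pos[of "1/2"] by simp
  then have "\<bar>cardinal_bump r y\<bar> \<le> (1/2) ^ r / bump 0 (1/2) * B" for y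
    using B unfolding cardinal_bump_def abs_mult by (intro mult_mono) auto
  then show ?thesis using that[OF mult_pos_pos[OF p B(1)]] by blast
qed

text \<open>\<open>F\<close> is only continuous, so Rolle's theorem is applied to mollified versions of \<open>F\<close>.  These do not
  vanish at the integers, but nearly so; an interpolating combination of bumps corrects that,
  and disappears in the limit.\<close>

lemma small_if_vanishing_on_integers:
  assumes F: "bdd_integrable F" "continuous_on UNIV F" and z: "\<And>k. F (of_int k) = 0" and E: "1 \<le> E"
    and B: "\<And>n y. \<bar>x - y\<bar> \<le> real E \<Longrightarrow> \<bar>convol F (mollifier (real (Suc n)) E) y\<bar> \<le> B"
  shows "\<bar>F x\<bar> \<le> real E ^ E * B"
proof -
  define a where "a = real_of_int \<lfloor>x\<rfloor>"
  have a: "a \<le> x" "x \<le> a + 1" unfolding a_def by linarith+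
  then have x: "a \<le> x" "x \<le> a + real E" using E by auto
  obtain C where C: "0 < C" "\<And>y. \<bar>cardinal_bump E y\<bar> \<le> C" using cardinal_bump_bounded by metis
  obtain C0 where C0: "0 < C0" "\<And>y. \<bar>cardinal_bump 0 y\<bar> \<le> C0" using cardinal_bump_bounded by metis
  define f where "f n r = convol F (mollifier (real (Suc n)) r)" for n r
  have fd: "(f n r has_real_derivative f n (Suc r) y) (at y)" for n r y
    unfolding f_def
    by (intro primitive_of_imp_DERIV primitive_of_convol convol_continuous F bdd_integrable_mollifier mollifier_primitive) auto
  define s where "s n = (\<Sum>i\<le>E. \<bar>f n 0 (a + real i)\<bar>)" for n
  have le: "\<bar>f n 0 x\<bar> \<le> real E ^ E * (B + s n * C) + s n * C0" for n
  proof -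
    \<comment> \<open>subtract the interpolation of the values at \<open>a, \<dots>, a + E\<close>\<close>
    define g where "g r y = f n r y - (\<Sum>i\<le>E. f n 0 (a + real i) * cardinal_bump r (y - (a + real i)))" for r y
    have "\<bar>g 0 x\<bar> \<le> real E ^ E * (B + s n * C)"
    proof (rule bound_from_zeros[where f=g and a=a])
      show "(g r has_real_derivative g (Suc r) y) (at y)" for r y
      proof -
        have h: "((\<lambda>y. cardinal_bump r (y - c)) has_real_derivative cardinal_bump (Suc r) (y - c)) (at y)" for c
        proof -
          have "((\<lambda>y. y - c) has_real_derivative 1) (at y)" by (auto intro!: derivative_eq_intros)
          from DERIV_chain2[OF cardinal_bump_deriv this] show ?thesis by simp
        qed
        show ?thesis unfolding g_def[abs_def]
          by (intro DERIV_diff fd DERIV_sum DERIV_cmult h)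
      qed
      show "g 0 (a + real j) = 0" if j: "j \<le> E" for j
      proof -
        have "(\<Sum>i\<le>E. f n 0 (a + real i) * cardinal_bump 0 ((a + real j) - (a + real i))) = (\<Sum>i\<le>E. if i = j then f n 0 (a + real i) else 0)"
          using cardinal_bump_int by (intro sum.cong) auto
        then show ?thesis using j by (simp add: g_def)
      qed
      fix y assume y: "a \<le> y" "y \<le> a + real E"
      have "\<bar>\<Sum>i\<le>E. f n 0 (a + real i) * cardinal_bump E (y - (a + real i))\<bar> \<le> (\<Sum>i\<le>E. \<bar>f n 0 (a + real i)\<bar> * C)"
        by (rule order.trans[OF sum_abs]) (intro sum_mono, simp add: abs_mult C mult_left_mono)
      moreover have "\<bar>f n E y\<bar> \<le> B" unfolding f_def by (rule B) (use x y in auto)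
      ultimately show "\<bar>g E y\<bar> \<le> B + s n * C" unfolding g_def s_def by (simp add: sum_distrib_right)
    qed (use x in auto)
    moreover have "\<bar>\<Sum>i\<le>E. f n 0 (a + real i) * cardinal_bump 0 (x - (a + real i))\<bar> \<le> (\<Sum>i\<le>E. \<bar>f n 0 (a + real i)\<bar> * C0)"
      by (rule order.trans[OF sum_abs]) (intro sum_mono, simp add: abs_mult C0 mult_left_mono)
    ultimately show ?thesis unfolding g_def s_def by (simp add: sum_distrib_right)
  qed
  have l: "(\<lambda>n. f n 0 w) \<longlonglongrightarrow> F w" for w unfolding f_def by (rule convol_mollifier_tendsto[OF F])
  have "s \<longlonglongrightarrow> (\<Sum>i\<le>E. \<bar>F (a + real i)\<bar>)" unfolding s_def[abs_def] by (intro tendsto_sum tendsto_rabs l)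
  also have "(\<Sum>i\<le>E. \<bar>F (a + real i)\<bar>) = 0"
  proof -
    have "F (a + real i) = 0" for i using z[of "\<lfloor>x\<rfloor> + int i"] by (simp add: a_def)
    then show ?thesis by simp
  qed
  finally have s0: "s \<longlonglongrightarrow> 0" .
  have "(\<lambda>n. real E ^ E * (B + s n * C) + s n * C0) \<longlonglongrightarrow> real E ^ E * (B + 0 * C) + 0 * C0"
    by (intro tendsto_intros s0)
  from LIMSEQ_le[OF tendsto_rabs[OF l] this] le show ?thesis by simp
qed

section \<open>Father wavelets at coarse scales against the mother wavelet\<close>

text \<open>The largest value that \<open>\<Phi> \<bar>w\<bar>\<close> can have for \<open>w\<close> at distance at most \<open>R\<close> from \<open>u\<close>, for
  non-increasing \<open>\<Phi>\<close>.  It absorbs the shifts caused by mollifiers and by windows of length \<open>E\<close>.\<close>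

definition envelope :: "(real \<Rightarrow> real) \<Rightarrow> real \<Rightarrow> real \<Rightarrow> real" where
  "envelope \<Phi> R u = \<Phi> (max 0 (\<bar>u\<bar> - R))"

definition dominating :: "(real \<Rightarrow> real) \<Rightarrow> (real \<Rightarrow> real) \<Rightarrow> bool" where
  "dominating \<Phi> g \<longleftrightarrow> antimono_on {0..} \<Phi> \<and> (\<forall>u. \<bar>g u\<bar> \<le> \<Phi> \<bar>u\<bar>) \<and> integrable lborel (\<lambda>u. \<Phi> \<bar>u\<bar>)"

lemma dominating_nonneg: "dominating \<Phi> g \<Longrightarrow> 0 \<le> u \<Longrightarrow> 0 \<le> \<Phi> u"
  unfolding dominating_def by (metis abs_ge_zero abs_of_nonneg order_trans)

lemma dominating_mono: "dominating \<Phi> g \<Longrightarrow> 0 \<le> u \<Longrightarrow> u \<le> v \<Longrightarrow> \<Phi> v \<le> \<Phi> u"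
  unfolding dominating_def monotone_on_def by auto

lemma envelope_nonneg: "dominating \<Phi> g \<Longrightarrow> 0 \<le> envelope \<Phi> R u"
  unfolding envelope_def by (rule dominating_nonneg) auto

lemma envelope_dominates: "dominating \<Phi> g \<Longrightarrow> \<bar>w - u\<bar> \<le> R \<Longrightarrow> \<bar>g w\<bar> \<le> envelope \<Phi> R u"
proof -
  assume d: "dominating \<Phi> g" and wu: "\<bar>w - u\<bar> \<le> R"
  have "\<bar>g w\<bar> \<le> \<Phi> \<bar>w\<bar>" using d by (simp add: dominating_def)
  also have "\<dots> \<le> envelope \<Phi> R u" unfolding envelope_def by (rule dominating_mono[OF d]) (use wu in auto)
  finally show ?thesis .
qed

lemma envelope_shift: "dominating \<Phi> g \<Longrightarrow> \<bar>w - u\<bar> \<le> d \<Longrightarrow> envelope \<Phi> R u \<le> envelope \<Phi> (R + d) w"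
  unfolding envelope_def by (rule dominating_mono) auto

lemma envelope_measurable:
  assumes "dominating \<Phi> g" shows "envelope \<Phi> R \<in> borel_measurable borel"
proof -
  have m: "(\<lambda>u. \<Phi> \<bar>u\<bar>) \<in> borel_measurable borel" using assms by (auto simp: dominating_def)
  have "(\<lambda>u::real. max 0 (\<bar>u\<bar> - R)) \<in> borel_measurable borel" by measurable
  from measurable_compose[OF this m] show ?thesis by (simp add: envelope_def[abs_def])
qed

lemma envelope_integrable:
  assumes d: "dominating \<Phi> g" shows "integrable lborel (envelope \<Phi> R)"
proof (rule Bochner_Integration.integrable_bound)
  have i: "integrable lborel (\<lambda>u. \<Phi> \<bar>u\<bar>)" using d by (simp add: dominating_def)
  have "integrable lborel (\<lambda>u. \<Phi> \<bar>u + - R\<bar>)" "integrable lborel (\<lambda>u. \<Phi> \<bar>u + R\<bar>)"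
    using integrable_shift[OF i, of "-R"] integrable_shift[OF i, of R] by auto
  moreover have "integrable lborel (\<lambda>u. \<Phi> 0 * indicator {-\<bar>R\<bar>..\<bar>R\<bar>} u)"
    by (intro integrable_mult_right integrable_real_indicator) (auto simp: emeasure_lborel_Icc_eq)
  ultimately show "integrable lborel (\<lambda>u. \<Phi> 0 * indicator {-\<bar>R\<bar>..\<bar>R\<bar>} u + (\<Phi> \<bar>u + - R\<bar> + \<Phi> \<bar>u + R\<bar>))"
    by (intro Bochner_Integration.integrable_add)
  show "AE u in lborel. norm (envelope \<Phi> R u) \<le> norm (\<Phi> 0 * indicator {-\<bar>R\<bar>..\<bar>R\<bar>} u + (\<Phi> \<bar>u + - R\<bar> + \<Phi> \<bar>u + R\<bar>))"
  proof (rule AE_I2)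
    fix u
    have nn: "0 \<le> \<Phi> 0" "0 \<le> \<Phi> \<bar>u + - R\<bar>" "0 \<le> \<Phi> \<bar>u + R\<bar>" using dominating_nonneg[OF d] by auto
    consider "\<bar>u\<bar> \<le> \<bar>R\<bar>" | "\<bar>u\<bar> > \<bar>R\<bar>" "u > 0" | "\<bar>u\<bar> > \<bar>R\<bar>" "u < 0" by linarith
    then have "envelope \<Phi> R u \<le> \<Phi> 0 * indicator {-\<bar>R\<bar>..\<bar>R\<bar>} u + (\<Phi> \<bar>u + - R\<bar> + \<Phi> \<bar>u + R\<bar>)"
    proof cases
      case 1
      have "envelope \<Phi> R u \<le> \<Phi> 0" unfolding envelope_def by (rule dominating_mono[OF d]) auto
      then show ?thesis using nn 1 by (auto simp: indicator_def)
    next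
      case 2
      then have "envelope \<Phi> R u = \<Phi> \<bar>u + - R\<bar>" unfolding envelope_def by (intro arg_cong[of _ _ \<Phi>]) auto
      then show ?thesis using nn by (auto simp: indicator_def)
    next
      case 3
      then have "envelope \<Phi> R u = \<Phi> \<bar>u + R\<bar>" unfolding envelope_def by (intro arg_cong[of _ _ \<Phi>]) auto
      then show ?thesis using nn by (auto simp: indicator_def)
    qed
    moreover have "0 \<le> envelope \<Phi> R u" by (rule envelope_nonneg[OF d])
    ultimately show "norm (envelope \<Phi> R u) \<le> norm (\<Phi> 0 * indicator {-\<bar>R\<bar>..\<bar>R\<bar>} u + (\<Phi> \<bar>u + - R\<bar> + \<Phi> \<bar>u + R\<bar>))"
      by simp
  qed
qed (use envelope_measurable[OF d] in auto)

text \<open>An envelope is at most a wider envelope at each point of a unit interval, hence at most the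
  average of the wider one over it; the sum over the integers becomes an integral.\<close>

lemma norm_per_envelope_finite:
  assumes d: "dominating \<Phi> g"
  obtains S where "0 \<le> S" "norm_per (envelope \<Phi> R) \<le> ennreal S"
proof -
  define S where "S = (\<integral>u. envelope \<Phi> (R + 1) u \<partial>lborel)"
  have m[measurable]: "envelope \<Phi> R \<in> borel_measurable borel" for R by (rule envelope_measurable[OF d])
  have S: "0 \<le> S" "(\<integral>\<^sup>+u. ennreal (envelope \<Phi> (R + 1) u) \<partial>lborel) = ennreal S"
    unfolding S_def using envelope_nonneg[OF d] envelope_integrable[OF d]
    by (auto intro!: nn_integral_eq_integral integral_nonneg_AE)
  have "(\<integral>\<^sup>+k. ennreal \<bar>envelope \<Phi> R (x - of_int k)\<bar> \<partial>count_space (UNIV :: int set)) \<le> ennreal S" for x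
  proof -
    interpret P: pair_sigma_finite "count_space (UNIV::int set)" "lborel :: real measure"
      by (intro pair_sigma_finite.intro sigma_finite_lborel sigma_finite_measure_count_space_countable) auto
    have le: "ennreal \<bar>envelope \<Phi> R u\<bar> \<le> (\<integral>\<^sup>+t. indicator {0..<1} t * ennreal (envelope \<Phi> (R + 1) (u + t)) \<partial>lborel)" for u
    proof -
      have "ennreal \<bar>envelope \<Phi> R u\<bar> = (\<integral>\<^sup>+t. ennreal (envelope \<Phi> R u) * indicator {0..<1::real} t \<partial>lborel)"
        using envelope_nonneg[OF d] by (simp add: nn_integral_cmult)
      also have "\<dots> \<le> (\<integral>\<^sup>+t. indicator {0..<1} t * ennreal (envelope \<Phi> (R + 1) (u + t)) \<partial>lborel)"
        by (rule nn_integral_mono) (auto simp: indicator_def intro!: ennreal_leI envelope_shift[OF d])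
      finally show ?thesis .
    qed
    have "(\<integral>\<^sup>+k. ennreal \<bar>envelope \<Phi> R (x - of_int k)\<bar> \<partial>count_space (UNIV :: int set))
      \<le> (\<integral>\<^sup>+k. (\<integral>\<^sup>+t. indicator {0..<1} t * ennreal (envelope \<Phi> (R + 1) (x - of_int k + t)) \<partial>lborel) \<partial>count_space (UNIV :: int set))"
      by (intro nn_integral_mono le)
    also have "\<dots> = (\<integral>\<^sup>+t. (\<integral>\<^sup>+k. indicator {0..<1} t * ennreal (envelope \<Phi> (R + 1) (x - of_int k + t)) \<partial>count_space (UNIV :: int set)) \<partial>lborel)"
      by (rule P.Fubini'[symmetric]) measurable
    also have "\<dots> = (\<integral>\<^sup>+t. indicator {0..<1} t * (\<integral>\<^sup>+k. ennreal (envelope \<Phi> (R + 1) (x + (t - of_int k))) \<partial>count_space (UNIV :: int set)) \<partial>lborel)"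
      by (intro nn_integral_cong) (simp add: nn_integral_cmult algebra_simps)
    also have "\<dots> = (\<integral>\<^sup>+t. ennreal (envelope \<Phi> (R + 1) (x + t)) \<partial>lborel)"
      by (rule nn_integral_split_int[symmetric]) measurable
    also have "\<dots> = ennreal S"
      using nn_integral_real_affine[of "\<lambda>t. ennreal (envelope \<Phi> (R + 1) t)" 1 x] S by simp
    finally show ?thesis .
  qed
  then have "norm_per (envelope \<Phi> R) \<le> ennreal S" unfolding shift_norm_le_iff by blast
  with S that show ?thesis by blast
qed

text \<open>The \<open>E\<close> derivatives sit on the mollifier; it is a test function, so they can be moved to \<open>\<phi>\<close> as
  its weak derivative \<open>h\<close>, at the price \<open>\<rho>\<^bsup>-E\<^esup>\<close> of the dilation.  The remaining mollifier has mass
  one and a support of length at most one, whence the envelope of \<open>\<psi>\<close>.\<close>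

lemma derivative_kernel_bound:
  assumes ph: "bdd_integrable \<phi>" and wd: "weak_derivative E \<phi> h" and h: "integrable lborel h"
    and ps: "bdd_integrable \<psi>" "dominating \<Psi> \<psi>" and l: "0 < \<rho>"
  shows "ennreal \<bar>convol (convol (\<lambda>z. \<phi> (z / \<rho>) / \<rho>) (\<lambda>x. \<psi> (- x))) (mollifier (real (Suc n)) E) w\<bar>
     \<le> ennreal ((1 / \<rho>) ^ E) * (\<integral>\<^sup>+u. ennreal \<bar>h u\<bar> * ennreal (envelope \<Psi> 1 (\<rho> * u - w)) \<partial>lborel)"
proof -
  define d where "d = real (Suc n)"
  have d: "0 < d" "1 / d \<le> 1" by (auto simp: d_def)
  define \<Phi> where "\<Phi> z = \<phi> (z / \<rho>) / \<rho>" for z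
  define \<psi>' where "\<psi>' x = \<psi> (- x)" for x
  have bP: "bdd_integrable \<Phi>" using bdd_integrable_cmult[OF bdd_integrable_affine[OF ph, of "1/\<rho>" 0], of "1/\<rho>"] l by (simp add: \<Phi>_def[abs_def])
  have bp: "bdd_integrable \<psi>'" using bdd_integrable_affine[OF ps(1), of "-1" 0] by (simp add: \<psi>'_def[abs_def])
  have [measurable]: "h \<in> borel_measurable borel" "\<psi>' \<in> borel_measurable borel" "mollifier d 0 \<in> borel_measurable borel"
    using h bp bdd_integrable_mollifier[of d 0] d by (auto intro: bdd_integrableD(2))
  have a: "convol (convol \<Phi> \<psi>') (mollifier d E) = convol \<psi>' (convol \<Phi> (mollifier d E))"
    by (rule convol_assoc[OF bp bP bdd_integrable_mollifier]) (use d in auto)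
  have b: "convol \<Phi> (mollifier d E) y = (1 / \<rho>) ^ E * (\<integral>u. h u * mollifier d 0 (y - \<rho> * u) \<partial>lborel)" for y
  proof -
    \<comment> \<open>the mollifier, dilated and reflected, as a test function of the variable of \<open>\<phi>\<close>\<close>
    define \<eta> where "\<eta> u = d / (\<integral>x. bump 0 x \<partial>lborel) * bump 0 (d * y + (- d * \<rho>) * u)" for u
    have \<eta>: "mollifier d 0 (y - \<rho> * u) = \<eta> u" for u by (simp add: mollifier_def \<eta>_def algebra_simps)
    have tf: "test_function \<eta>" unfolding \<eta>_def[abs_def] by (rule test_function_bump) (use d l in auto)
    have dE: "(deriv ^^ E) \<eta> u = (- \<rho>) ^ E * mollifier d E (y - \<rho> * u)" for u
      unfolding \<eta>_def[abs_def] deriv_bump_affine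
      by (simp add: mollifier_def power_mult_distrib[symmetric] algebra_simps)
    have "convol \<Phi> (mollifier d E) y = (\<integral>u. \<rho> * (\<phi> ((0 + \<rho> * u) / \<rho>) / \<rho> * mollifier d E (y - (0 + \<rho> * u))) \<partial>lborel)"
      unfolding convol_def \<Phi>_def using l
      by (subst lborel_integral_real_affine[of \<rho> _ 0]) auto
    also have "\<dots> = (\<integral>u. (- 1 / \<rho>) ^ E * (\<phi> u * (deriv ^^ E) \<eta> u) \<partial>lborel)"
    proof (rule Bochner_Integration.integral_cong[OF refl])
      fix u
      have "(- 1 / \<rho>) ^ E * (- \<rho>) ^ E = 1" using l by (simp flip: power_mult_distrib)
      then show "\<rho> * (\<phi> ((0 + \<rho> * u) / \<rho>) / \<rho> * mollifier d E (y - (0 + \<rho> * u))) = (- 1 / \<rho>) ^ E * (\<phi> u * (deriv ^^ E) \<eta> u)"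
        unfolding dE using l by (simp add: mult.left_commute[of _ "\<phi> u"])
    qed
    also have "\<dots> = (- 1 / \<rho>) ^ E * ((- 1) ^ E * (\<integral>u. h u * \<eta> u \<partial>lborel))"
      using wd tf by (simp add: weak_derivative_def)
    also have "\<dots> = (1 / \<rho>) ^ E * (\<integral>u. h u * \<eta> u \<partial>lborel)"
      by (simp add: mult.assoc[symmetric] flip: power_mult_distrib)
    finally show ?thesis by (simp add: \<eta>)
  qed
  have lE: "0 \<le> (1 / \<rho>) ^ E" using l by simp
  have "ennreal \<bar>convol \<psi>' (convol \<Phi> (mollifier d E)) w\<bar> \<le> (\<integral>\<^sup>+z. ennreal \<bar>\<psi>' z\<bar> * ennreal \<bar>convol \<Phi> (mollifier d E) (w - z)\<bar> \<partial>lborel)"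
    by (rule convol_abs_le)
  also have "\<dots> \<le> (\<integral>\<^sup>+z. \<integral>\<^sup>+u. ennreal ((1 / \<rho>) ^ E) * (ennreal \<bar>h u\<bar> * (ennreal \<bar>\<psi>' z\<bar> * ennreal (mollifier d 0 (w - z - \<rho> * u)))) \<partial>lborel \<partial>lborel)"
  proof (rule nn_integral_mono)
    fix z
    have "ennreal \<bar>\<integral>u. h u * mollifier d 0 (w - z - \<rho> * u) \<partial>lborel\<bar> \<le> (\<integral>\<^sup>+u. ennreal \<bar>h u * mollifier d 0 (w - z - \<rho> * u)\<bar> \<partial>lborel)"
      by (rule abs_integral_le_nn)
    then have "ennreal \<bar>convol \<Phi> (mollifier d E) (w - z)\<bar> \<le> ennreal ((1 / \<rho>) ^ E) * (\<integral>\<^sup>+u. ennreal \<bar>h u * mollifier d 0 (w - z - \<rho> * u)\<bar> \<partial>lborel)"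
      unfolding b abs_mult using lE by (simp add: ennreal_mult mult_left_mono del: power_one_over power_divide)
    then have "ennreal \<bar>\<psi>' z\<bar> * ennreal \<bar>convol \<Phi> (mollifier d E) (w - z)\<bar>
      \<le> ennreal \<bar>\<psi>' z\<bar> * (ennreal ((1 / \<rho>) ^ E) * (\<integral>\<^sup>+u. ennreal \<bar>h u * mollifier d 0 (w - z - \<rho> * u)\<bar> \<partial>lborel))"
      by (rule mult_left_mono) simp
    also have "\<dots> = (\<integral>\<^sup>+u. ennreal \<bar>\<psi>' z\<bar> * (ennreal ((1 / \<rho>) ^ E) * ennreal \<bar>h u * mollifier d 0 (w - z - \<rho> * u)\<bar>) \<partial>lborel)"
      by (subst nn_integral_cmult[symmetric], measurable)+
    also have "\<dots> = (\<integral>\<^sup>+u. ennreal ((1 / \<rho>) ^ E) * (ennreal \<bar>h u\<bar> * (ennreal \<bar>\<psi>' z\<bar> * ennreal (mollifier d 0 (w - z - \<rho> * u)))) \<partial>lborel)"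
      by (intro nn_integral_cong) (simp add: abs_mult ennreal_mult mollifier_nonneg d mult_ac)
    finally show "ennreal \<bar>\<psi>' z\<bar> * ennreal \<bar>convol \<Phi> (mollifier d E) (w - z)\<bar>
      \<le> (\<integral>\<^sup>+u. ennreal ((1 / \<rho>) ^ E) * (ennreal \<bar>h u\<bar> * (ennreal \<bar>\<psi>' z\<bar> * ennreal (mollifier d 0 (w - z - \<rho> * u)))) \<partial>lborel)" .
  qed
  also have "\<dots> = (\<integral>\<^sup>+u. \<integral>\<^sup>+z. ennreal ((1 / \<rho>) ^ E) * (ennreal \<bar>h u\<bar> * (ennreal \<bar>\<psi>' z\<bar> * ennreal (mollifier d 0 (w - z - \<rho> * u)))) \<partial>lborel \<partial>lborel)"
    by (rule lborel_pair.Fubini') measurable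
  also have "\<dots> = (\<integral>\<^sup>+u. ennreal ((1 / \<rho>) ^ E) * (ennreal \<bar>h u\<bar> * (\<integral>\<^sup>+z. ennreal \<bar>\<psi>' z\<bar> * ennreal (mollifier d 0 (w - z - \<rho> * u)) \<partial>lborel)) \<partial>lborel)"
    by (intro nn_integral_cong) (subst nn_integral_cmult, measurable)+
  also have "\<dots> \<le> (\<integral>\<^sup>+u. ennreal ((1 / \<rho>) ^ E) * (ennreal \<bar>h u\<bar> * ennreal (envelope \<Psi> 1 (\<rho> * u - w))) \<partial>lborel)"
  proof (intro nn_integral_mono mult_left_mono)
    fix u
    have "(\<integral>\<^sup>+z. ennreal \<bar>\<psi>' z\<bar> * ennreal (mollifier d 0 (w - z - \<rho> * u)) \<partial>lborel)
      \<le> (\<integral>\<^sup>+z. ennreal (envelope \<Psi> 1 (\<rho> * u - w)) * ennreal (mollifier d 0 (w - z - \<rho> * u)) \<partial>lborel)"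
    proof (rule nn_integral_mono)
      fix z
      show "ennreal \<bar>\<psi>' z\<bar> * ennreal (mollifier d 0 (w - z - \<rho> * u)) \<le> ennreal (envelope \<Psi> 1 (\<rho> * u - w)) * ennreal (mollifier d 0 (w - z - \<rho> * u))"
      proof (cases "w - z - \<rho> * u < 0 \<or> 1 / d < w - z - \<rho> * u")
        case True
        then show ?thesis using mollifier_outside[OF d(1) True, of 0] by simp
      next
        case False
        then have "\<bar>- z - (\<rho> * u - w)\<bar> \<le> 1" using d by linarith
        then have "\<bar>\<psi>' z\<bar> \<le> envelope \<Psi> 1 (\<rho> * u - w)" unfolding \<psi>'_def by (rule envelope_dominates[OF ps(2)])
        then show ?thesis by (intro mult_right_mono ennreal_leI) auto
      qed
    qed
    also have "\<dots> = ennreal (envelope \<Psi> 1 (\<rho> * u - w)) * (\<integral>\<^sup>+z. ennreal (mollifier d 0 (w - z - \<rho> * u)) \<partial>lborel)"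
      by (rule nn_integral_cmult) measurable
    also have "(\<integral>\<^sup>+z. ennreal (mollifier d 0 (w - z - \<rho> * u)) \<partial>lborel) = (\<integral>\<^sup>+z. ennreal (mollifier d 0 z) \<partial>lborel)"
      using nn_integral_real_affine[of "\<lambda>z. ennreal (mollifier d 0 z)" "-1" "w - \<rho> * u"] by (simp add: algebra_simps)
    also have "\<dots> = ennreal (\<integral>z. mollifier d 0 z \<partial>lborel)"
      by (rule nn_integral_eq_integral) (use bdd_integrable_mollifier[of d 0] d mollifier_nonneg in \<open>auto simp: bdd_integrable_def\<close>)
    also have "\<dots> = 1" using mollifier_integral[OF d(1)] by simp
    finally show "(\<integral>\<^sup>+z. ennreal \<bar>\<psi>' z\<bar> * ennreal (mollifier d 0 (w - z - \<rho> * u)) \<partial>lborel) \<le> ennreal (envelope \<Psi> 1 (\<rho> * u - w))" by simp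
  qed auto
  also have "\<dots> = ennreal ((1 / \<rho>) ^ E) * (\<integral>\<^sup>+u. ennreal \<bar>h u\<bar> * ennreal (envelope \<Psi> 1 (\<rho> * u - w)) \<partial>lborel)"
    using envelope_measurable[OF ps(2), measurable] by (intro nn_integral_cmult) measurable
  finally show ?thesis unfolding a[symmetric] by (simp add: \<Phi>_def[abs_def] \<psi>'_def[abs_def] d_def)
qed

text \<open>Near \<open>x\<close> the mollified derivatives of order \<open>E\<close> of \<open>F\<close> are at most \<open>\<rho>\<^bsup>-E\<^esup>\<close> times a superposition
  of envelopes of \<open>\<psi>\<close> with integrable weight \<open>h\<close>, and the zeros at the integers give the same
  bound for \<open>F x\<close> itself, up to the factor \<open>E\<^sup>E\<close>.  Periodising a superposition only costs the mass of its weight.\<close>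

lemma coarse_father_mother_small:
  assumes ph: "bdd_integrable \<phi>" and wd: "weak_derivative E \<phi> h" and h: "integrable lborel h" and E: "1 \<le> E"
    and ps: "bdd_integrable \<psi>" "dominating \<Psi> \<psi>" and l: "0 < \<rho>"
    and F: "F = convol (\<lambda>z. \<phi> (z / \<rho>) / \<rho>) (\<lambda>x. \<psi> (- x))"
    and z: "\<And>k. F (of_int k) = 0"
    and S: "0 \<le> S" "norm_per (envelope \<Psi> (real E + 1)) \<le> ennreal S"
  shows "norm_per F \<le> ennreal (real E ^ E * (1 / \<rho>) ^ E * (\<integral>u. \<bar>h u\<bar> \<partial>lborel) * S)"
proof -
  define c where "c = real E ^ E * (1 / \<rho>) ^ E"
  have c: "0 \<le> c" using l by (simp add: c_def)
  have bP: "bdd_integrable (\<lambda>z. \<phi> (z / \<rho>) / \<rho>)" using bdd_integrable_cmult[OF bdd_integrable_affine[OF ph, of "1/\<rho>" 0], of "1/\<rho>"] l by simp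
  have bp: "bdd_integrable (\<lambda>x. \<psi> (- x))" using bdd_integrable_affine[OF ps(1), of "-1" 0] by simp
  have bF: "bdd_integrable F" unfolding F by (rule bdd_integrable_convol[OF bP bp])
  have cF: "continuous_on UNIV F" unfolding F by (rule convol_continuous[OF bP bp])
  have [measurable]: "h \<in> borel_measurable borel" using h by auto
  note em[measurable] = envelope_measurable[OF ps(2)]
  have pt: "ennreal \<bar>F x\<bar> \<le> (\<integral>\<^sup>+u. ennreal \<bar>h u\<bar> * ennreal (c * envelope \<Psi> (real E + 1) (\<rho> * u - x)) \<partial>lborel)" for x
  proof -
    define J where "J = (\<integral>\<^sup>+u. ennreal \<bar>h u\<bar> * ennreal (envelope \<Psi> (real E + 1) (\<rho> * u - x)) \<partial>lborel)"
    have "J \<le> (\<integral>\<^sup>+u. ennreal \<bar>h u\<bar> * ennreal (\<Psi> 0) \<partial>lborel)"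
      unfolding J_def
    proof (intro nn_integral_mono mult_left_mono ennreal_leI)
      show "envelope \<Psi> (real E + 1) (\<rho> * u - x) \<le> \<Psi> 0" for u
        unfolding envelope_def by (rule dominating_mono[OF ps(2)]) auto
    qed auto
    also have "\<dots> = (\<integral>\<^sup>+u. ennreal \<bar>h u\<bar> \<partial>lborel) * ennreal (\<Psi> 0)" by (rule nn_integral_multc) measurable
    also have "\<dots> < \<infinity>" using h by (auto simp: integrable_iff_bounded ennreal_mult_less_top)
    finally obtain j where j: "J = ennreal j" "0 \<le> j" by (cases J) auto
    have "\<bar>F x\<bar> \<le> real E ^ E * ((1 / \<rho>) ^ E * j)"
    proof (rule small_if_vanishing_on_integers[OF bF cF z E])
      fix n y assume y: "\<bar>x - y\<bar> \<le> real E"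
      have "ennreal \<bar>convol F (mollifier (real (Suc n)) E) y\<bar> \<le> ennreal ((1 / \<rho>) ^ E) * (\<integral>\<^sup>+u. ennreal \<bar>h u\<bar> * ennreal (envelope \<Psi> 1 (\<rho> * u - y)) \<partial>lborel)"
        unfolding F by (rule derivative_kernel_bound[OF ph wd h ps l])
      also have "\<dots> \<le> ennreal ((1 / \<rho>) ^ E) * J"
        unfolding J_def
      proof (intro mult_left_mono nn_integral_mono ennreal_leI)
        show "envelope \<Psi> 1 (\<rho> * u - y) \<le> envelope \<Psi> (real E + 1) (\<rho> * u - x)" for u
          using envelope_shift[OF ps(2), of "\<rho> * u - x" "\<rho> * u - y" "real E" 1] y by (simp add: add.commute abs_minus_commute)
      qed auto
      also have "\<dots> = ennreal ((1 / \<rho>) ^ E * j)" using j l by (simp add: ennreal_mult)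
      finally show "\<bar>convol F (mollifier (real (Suc n)) E) y\<bar> \<le> (1 / \<rho>) ^ E * j"
        using j l by (subst (asm) ennreal_le_iff) auto
    qed
    then have "ennreal \<bar>F x\<bar> \<le> ennreal (c * j)" by (intro ennreal_leI) (simp add: c_def mult.assoc)
    also have "\<dots> = ennreal c * J" using c j by (simp add: ennreal_mult)
    also have "\<dots> = (\<integral>\<^sup>+u. ennreal c * (ennreal \<bar>h u\<bar> * ennreal (envelope \<Psi> (real E + 1) (\<rho> * u - x))) \<partial>lborel)"
      unfolding J_def by (rule nn_integral_cmult[symmetric]) measurable
    also have "\<dots> = (\<integral>\<^sup>+u. ennreal \<bar>h u\<bar> * ennreal (c * envelope \<Psi> (real E + 1) (\<rho> * u - x)) \<partial>lborel)"
      using c envelope_nonneg[OF ps(2)] by (intro nn_integral_cong) (simp add: ennreal_mult mult_ac)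
    finally show ?thesis .
  qed
  have "norm_per F \<le> (\<integral>\<^sup>+u. ennreal \<bar>h u\<bar> * ennreal (c * S) \<partial>lborel)"
  proof (rule shift_norm_mono_kernel[where g="\<lambda>x u. ennreal (c * envelope \<Psi> (real E + 1) (\<rho> * u - x))" and v=h])
    fix x u
    have "(\<integral>\<^sup>+k. ennreal (c * envelope \<Psi> (real E + 1) (\<rho> * u - (x - real_of_int k))) \<partial>count_space UNIV)
       = (\<integral>\<^sup>+k. ennreal c * ennreal \<bar>envelope \<Psi> (real E + 1) ((x - \<rho> * u) - real_of_int k)\<bar> \<partial>count_space UNIV)"
    proof (rule nn_integral_cong)
      fix k :: int
      have "envelope \<Psi> (real E + 1) (\<rho> * u - (x - real_of_int k)) = envelope \<Psi> (real E + 1) ((x - \<rho> * u) - real_of_int k)"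
        unfolding envelope_def by (subst abs_minus_commute) (simp add: algebra_simps)
      then show "ennreal (c * envelope \<Psi> (real E + 1) (\<rho> * u - (x - real_of_int k))) = ennreal c * ennreal \<bar>envelope \<Psi> (real E + 1) ((x - \<rho> * u) - real_of_int k)\<bar>"
        using c envelope_nonneg[OF ps(2)] by (simp add: ennreal_mult)
    qed
    also have "\<dots> = ennreal c * (\<integral>\<^sup>+k. ennreal \<bar>envelope \<Psi> (real E + 1) ((x - \<rho> * u) - real_of_int k)\<bar> \<partial>count_space UNIV)"
      by (rule nn_integral_cmult) simp
    also have "\<dots> \<le> ennreal c * ennreal S"
      by (intro mult_left_mono order.trans[OF shift_norm_ge S(2)]) simp
    finally show "(\<integral>\<^sup>+k. ennreal (c * envelope \<Psi> (real E + 1) (\<rho> * u - (x - real_of_int k))) \<partial>count_space UNIV) \<le> ennreal (c * S)"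
      using c S by (simp add: ennreal_mult)
  qed (use pt in \<open>auto intro!: sigma_finite_measure_count_space_countable\<close>)
  also have "\<dots> = (\<integral>\<^sup>+u. ennreal \<bar>h u\<bar> \<partial>lborel) * ennreal (c * S)" by (rule nn_integral_multc) measurable
  also have "(\<integral>\<^sup>+u. ennreal \<bar>h u\<bar> \<partial>lborel) = ennreal (\<integral>u. \<bar>h u\<bar> \<partial>lborel)"
    by (rule nn_integral_eq_integral) (use h in auto)
  also have "ennreal (\<integral>u. \<bar>h u\<bar> \<partial>lborel) * ennreal (c * S) = ennreal (c * (\<integral>u. \<bar>h u\<bar> \<partial>lborel) * S)"
    using c S by (simp add: ennreal_mult[symmetric] mult_ac)
  finally show ?thesis by (simp add: c_def)
qed

section \<open>A band-limited kernel\<close>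

text \<open>The \<open>r\<close>-th derivative of \<open>(1 - cos x) / x\<^sup>2\<close>, written as a Fourier integral over frequencies in
  \<open>[0, 1]\<close>.  Bounded frequencies keep the derivatives of all orders below \<open>const \<cdot> 4\<^sup>r\<close> in \<open>L\<^sup>1\<close>,
  which a nonzero function of compact support cannot satisfy.\<close>

definition low_pass :: "nat \<Rightarrow> real \<Rightarrow> real" where
  "low_pass r x = integral {0..1} (\<lambda>t. (1 - t) * t ^ r * cos (t * x + real r * (pi / 2)))"

lemma low_pass_deriv: "(low_pass r has_real_derivative low_pass (Suc r) x) (at x)"
proof -
  have c: "cos (y + real (Suc r) * (pi/2)) = - sin (y + real r * (pi/2))" for y
  proof -
    have "y + real (Suc r) * (pi/2) = (y + real r * (pi/2)) + pi/2" by (simp add: algebra_simps)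
    then show ?thesis by (simp only: cos_add cos_pi_half sin_pi_half)
  qed
  have "((\<lambda>x. integral (cbox 0 1) (\<lambda>t. (1 - t) * t ^ r * cos (t * x + real r * (pi / 2)))) has_field_derivative
     integral (cbox 0 1) (\<lambda>t. (1 - t) * t ^ Suc r * cos (t * x + real (Suc r) * (pi / 2)))) (at x within UNIV)"
  proof (rule leibniz_rule_field_derivative)
    fix x t :: real
    show "((\<lambda>x. (1 - t) * t ^ r * cos (t * x + real r * (pi / 2))) has_field_derivative
        (1 - t) * t ^ Suc r * cos (t * x + real (Suc r) * (pi / 2))) (at x within UNIV)"
      unfolding c by (auto intro!: derivative_eq_intros)
    show "(\<lambda>t. (1 - t) * t ^ r * cos (t * x + real r * (pi / 2))) integrable_on cbox 0 1"
      by (intro integrable_continuous continuous_intros)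
  qed (auto simp: split_beta' intro!: continuous_intros)
  then show ?thesis by (simp add: low_pass_def[abs_def])
qed

lemma low_pass_continuous: "continuous_on A (low_pass r)"
  using low_pass_deriv DERIV_isCont continuous_at_imp_continuous_on by blast

lemma low_pass_measurable [measurable]: "low_pass r \<in> borel_measurable borel"
  by (rule borel_measurable_continuous_onI[OF low_pass_continuous])

text \<open>Two integrations by parts in the frequency variable.\<close>

lemma low_pass_parts:
  defines "b \<equiv> \<lambda>r t. (1 - t) * t ^ r" and "b' \<equiv> \<lambda>r t. real r * t ^ (r - 1) - real (Suc r) * t ^ r"
    and "b'' \<equiv> \<lambda>r t. real r * (real (r - 1) * t ^ (r - 2)) - real (Suc r) * (real r * t ^ (r - 1))"
    and "\<theta> \<equiv> \<lambda>r x t. t * x + real r * (pi / 2)"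
  shows "x\<^sup>2 * low_pass r x = (b r 1 * x * sin (\<theta> r x 1) + b' r 1 * cos (\<theta> r x 1))
     - (b r 0 * x * sin (\<theta> r x 0) + b' r 0 * cos (\<theta> r x 0))
     - integral {0..1::real} (\<lambda>t. b'' r t * cos (\<theta> r x t))"
proof -
  have db: "(b r has_real_derivative b' r t) (at t within S)" for t S
  proof -
    have "b r = (\<lambda>t. t ^ r - t ^ Suc r)" by (auto simp: b_def algebra_simps)
    then show ?thesis using DERIV_diff[OF DERIV_pow[of r] DERIV_pow[of "Suc r"]] by (simp add: b'_def)
  qed
  have db': "(b' r has_real_derivative b'' r t) (at t within S)" for t S
    unfolding b'_def b''_def
    by (auto intro!: derivative_eq_intros simp: numeral_2_eq_2)
  have h1: "((\<lambda>t. b r t * x\<^sup>2 * cos (\<theta> r x t) + b'' r t * cos (\<theta> r x t)) has_integral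
      ((b r 1 * x * sin (\<theta> r x 1) + b' r 1 * cos (\<theta> r x 1)) - (b r 0 * x * sin (\<theta> r x 0) + b' r 0 * cos (\<theta> r x 0)))) {0..1}"
    by (rule fundamental_theorem_of_calculus)
      (auto intro!: derivative_eq_intros db db' simp: \<theta>_def power2_eq_square algebra_simps simp flip: has_real_derivative_iff_has_vector_derivative)
  have h2: "((\<lambda>t. b'' r t * cos (\<theta> r x t)) has_integral integral {0..1} (\<lambda>t. b'' r t * cos (\<theta> r x t))) {0..1}"
    by (intro integrable_integral integrable_continuous_interval) (auto simp: b''_def \<theta>_def intro!: continuous_intros)
  have h3: "((\<lambda>t. x\<^sup>2 * (b r t * cos (\<theta> r x t))) has_integral x\<^sup>2 * low_pass r x) {0..1}"
    unfolding low_pass_def b_def \<theta>_def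
    by (intro has_integral_mult_right integrable_integral integrable_continuous_interval) (auto intro!: continuous_intros)
  have "(\<lambda>t. b r t * x\<^sup>2 * cos (\<theta> r x t) + b'' r t * cos (\<theta> r x t)) = (\<lambda>t. x\<^sup>2 * (b r t * cos (\<theta> r x t)) + b'' r t * cos (\<theta> r x t))"
    by (simp add: mult_ac)
  from has_integral_unique[OF h1[unfolded this] has_integral_add[OF h3 h2]]
  show ?thesis by linarith
qed

lemma low_pass_abs_le_1: "\<bar>low_pass r x\<bar> \<le> 1"
proof -
  have "norm (low_pass r x) \<le> 1 * (1 - 0)"
    unfolding low_pass_def
  proof (rule integral_bound)
    show "norm ((1 - t) * t ^ r * cos (t * x + real r * (pi / 2))) \<le> 1" if "t \<in> {0..1}" for t
      unfolding norm_mult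
      using that by (intro mult_le_one) (auto simp: power_le_one)
  qed (auto intro!: continuous_intros)
  then show ?thesis by simp
qed

lemma low_pass_decay: "\<bar>low_pass r x\<bar> \<le> (3 + 2 * (real r)\<^sup>2) / (1 + x\<^sup>2)"
proof -
  define b'' where "b'' t = real r * (real (r - 1) * t ^ (r - 2)) - real (Suc r) * (real r * t ^ (r - 1))" for t :: real
  define \<theta> where "\<theta> t = t * x + real r * (pi / 2)" for t
  have I: "\<bar>integral {0..1} (\<lambda>t. b'' t * cos (\<theta> t))\<bar> \<le> 2 * (real r)\<^sup>2"
  proof -
    have "norm (integral {0..1} (\<lambda>t. b'' t * cos (\<theta> t))) \<le> (2 * (real r)\<^sup>2) * (1 - 0)"
    proof (rule integral_bound)
      show "norm (b'' t * cos (\<theta> t)) \<le> 2 * (real r)\<^sup>2" if t: "t \<in> {0..1}" for t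
      proof -
        have p: "0 \<le> t ^ m" "t ^ m \<le> 1" for m using t by (auto simp: power_le_one)
        have 1: "\<bar>real r * (real (r - 1) * t ^ (r - 2))\<bar> \<le> real r * (real (r - 1) * 1)"
          unfolding abs_mult using p by (intro mult_mono) auto
        have 2: "\<bar>real (Suc r) * (real r * t ^ (r - 1))\<bar> \<le> real (Suc r) * (real r * 1)"
          unfolding abs_mult using p by (intro mult_mono) auto
        have 3: "real r * real (r - 1) + real (Suc r) * real r = 2 * (real r)\<^sup>2"
          by (cases r) (auto simp: power2_eq_square algebra_simps)
        have "\<bar>b'' t\<bar> \<le> 2 * (real r)\<^sup>2" using 1 2 3 unfolding b''_def by linarith
        moreover have "\<bar>b'' t * cos (\<theta> t)\<bar> \<le> \<bar>b'' t\<bar>" by (simp add: abs_mult mult_left_le)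
        ultimately show ?thesis by simp
      qed
    qed (auto simp: b''_def \<theta>_def intro!: continuous_intros)
    then show ?thesis by simp
  qed
  have e: "x\<^sup>2 * low_pass r x = - cos (\<theta> 1) - (0 ^ r * x * sin (\<theta> 0) + (real r * 0 ^ (r - 1) - real (Suc r) * 0 ^ r) * cos (\<theta> 0))
     - integral {0..1} (\<lambda>t. b'' t * cos (\<theta> t))"
    using low_pass_parts[of x r] by (simp add: b''_def \<theta>_def)
  have "0 ^ r * x * sin (\<theta> 0) = 0" by (cases r) (auto simp: \<theta>_def)
  moreover have "\<bar>(real r * 0 ^ (r - 1) - real (Suc r) * 0 ^ r) * cos (\<theta> 0)\<bar> \<le> 1"
  proof -
    have "\<bar>real r * 0 ^ (r - 1) - real (Suc r) * 0 ^ r\<bar> \<le> 1"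
    proof (cases r)
      case (Suc m) then show ?thesis by (cases m) auto
    qed simp
    then show ?thesis unfolding abs_mult using mult_le_one[of _ "\<bar>cos (\<theta> 0)\<bar>"] by auto
  qed
  moreover have "\<bar>cos (\<theta> 1)\<bar> \<le> 1" by simp
  ultimately have "\<bar>x\<^sup>2 * low_pass r x\<bar> \<le> 2 + 2 * (real r)\<^sup>2" using e I by linarith
  then have "\<bar>low_pass r x\<bar> * (1 + x\<^sup>2) \<le> 3 + 2 * (real r)\<^sup>2"
    using low_pass_abs_le_1[of r x] by (simp add: abs_mult distrib_left mult.commute)
  moreover have "0 < 1 + x\<^sup>2" by (simp add: add_pos_nonneg)
  ultimately show ?thesis by (simp add: pos_le_divide_eq)
qed

lemma low_pass_0_eq: "x\<^sup>2 * low_pass 0 x = 1 - cos x"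
  using low_pass_parts[of x 0] by simp

lemma nn_integral_tail: "(\<integral>\<^sup>+z. ennreal ((1 + \<bar>z\<bar>) powr (-3/2)) \<partial>lborel) \<le> ennreal 4"
proof -
  have m: "(\<lambda>z::real. (1 + \<bar>z\<bar>) powr (-3/2)) \<in> borel_measurable borel" by measurable
  have m': "(\<lambda>z::real. (1 + z) powr (-3/2)) \<in> borel_measurable borel" by measurable
  have "((\<lambda>z::real. (1 + z) powr (-1/2)) \<longlongrightarrow> 0) at_top"
    by (rule tendsto_neg_powr) (auto intro!: filterlim_tendsto_add_at_top[OF tendsto_const] filterlim_ident)
  from tendsto_mult_right_zero[OF this, of "-2"]
  have lim: "((\<lambda>z::real. - 2 * (1 + z) powr (-1/2)) \<longlongrightarrow> 0) at_top" .
  have "(\<integral>\<^sup>+z. ennreal ((1 + z) powr (-3/2)) * indicator {0..} z \<partial>lborel)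
      = ennreal (0 - (- 2 * (1 + 0) powr (-1/2)))"
  proof (rule nn_integral_FTC_atLeast[OF m' _ _ lim])
    fix x :: real assume "0 \<le> x"
    then show "((\<lambda>z. - 2 * (1 + z) powr (-1/2)) has_real_derivative (1 + x) powr (-3/2)) (at x)"
      by (auto intro!: derivative_eq_intros)
  qed auto
  also have "(\<integral>\<^sup>+z. ennreal ((1 + z) powr (-3/2)) * indicator {0..} z \<partial>lborel)
     = (\<integral>\<^sup>+z. ennreal ((1 + \<bar>z\<bar>) powr (-3/2)) * indicator {0..} z \<partial>lborel)"
    by (rule nn_integral_cong) (auto simp: indicator_def)
  finally have "(\<integral>\<^sup>+z. ennreal ((1 + \<bar>z\<bar>) powr (-3/2)) * indicator {0..} z \<partial>lborel) = ennreal (0 - (- 2 * (1 + 0) powr (-1/2)))" .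
  then have h: "(\<integral>\<^sup>+z. ennreal ((1 + \<bar>z\<bar>) powr (-3/2)) * indicator {0..} z \<partial>lborel) = ennreal 2" by simp
  have "(\<integral>\<^sup>+z. ennreal ((1 + \<bar>z\<bar>) powr (-3/2)) \<partial>lborel)
     \<le> (\<integral>\<^sup>+z. ennreal ((1 + \<bar>z\<bar>) powr (-3/2)) * indicator {0..} z + ennreal ((1 + \<bar>-z\<bar>) powr (-3/2)) * indicator {0..} (-z) \<partial>lborel)"
    by (rule nn_integral_mono) (auto simp: indicator_def)
  also have "\<dots> = (\<integral>\<^sup>+z. ennreal ((1 + \<bar>z\<bar>) powr (-3/2)) * indicator {0..} z \<partial>lborel)
     + (\<integral>\<^sup>+z. ennreal ((1 + \<bar>-z\<bar>) powr (-3/2)) * indicator {0..} (-z) \<partial>lborel)"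
    by (rule nn_integral_add) (use m in auto)
  also have "(\<integral>\<^sup>+z. ennreal ((1 + \<bar>-z\<bar>) powr (-3/2)) * indicator {0..} (-z) \<partial>lborel)
     = (\<integral>\<^sup>+z. ennreal ((1 + \<bar>z\<bar>) powr (-3/2)) * indicator {0..} z \<partial>lborel)"
    using nn_integral_real_affine[of "\<lambda>z. ennreal ((1 + \<bar>z\<bar>) powr (-3/2)) * indicator {0..} z" "-1" 0] by simp
  finally show ?thesis unfolding h by (simp flip: ennreal_plus)
qed

lemma inv_square_le:
  fixes x :: real
  shows "1 / (1 + x\<^sup>2) \<le> 2 * (1 + \<bar>x\<bar>) powr (-2)"
proof -
  have "(1 + \<bar>x\<bar>)\<^sup>2 \<le> 2 * (1 + x\<^sup>2)"
    using sum_squares_bound[of 1 "\<bar>x\<bar>"] by (simp add: power2_eq_square algebra_simps)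
  moreover have "0 < 1 + x\<^sup>2" using zero_le_power2[of x] by linarith
  moreover have "0 < (1 + \<bar>x\<bar>)\<^sup>2" by simp
  ultimately have "2 / (2 * (1 + x\<^sup>2)) \<le> 2 / (1 + \<bar>x\<bar>)\<^sup>2" by (intro divide_left_mono mult_pos_pos) linarith+
  moreover have "1 / (1 + x\<^sup>2) = 2 / (2 * (1 + x\<^sup>2))" by (subst mult_divide_mult_cancel_left[of 2 1, symmetric]) auto
  ultimately have "1 / (1 + x\<^sup>2) \<le> 2 / (1 + \<bar>x\<bar>)\<^sup>2" by (simp only:)
  also have "\<dots> = 2 * (1 + \<bar>x\<bar>) powr (-2)" by (simp add: powr_minus divide_inverse powr_numeral)
  finally show ?thesis .
qed

lemma low_pass_nn_integral: "(\<integral>\<^sup>+x. ennreal \<bar>low_pass r x\<bar> \<partial>lborel) \<le> ennreal (24 * 4 ^ r)"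
proof -
  \<comment> \<open>a geometric bound in \<open>r\<close> is all that iterated smoothing can use\<close>
  have p: "3 + 2 * (real r)\<^sup>2 \<le> 3 * 4 ^ r"
  proof (induction r)
    case (Suc r)
    have r: "real r \<le> 4 ^ r"
    proof (induction r)
      case (Suc r)
      have "(1::real) \<le> 4 ^ r" by simp
      then show ?case using Suc.IH unfolding of_nat_Suc power_Suc by linarith
    qed simp
    have "(1::real) \<le> 4 ^ r" by simp
    then show ?case using Suc r unfolding of_nat_Suc power_Suc power2_eq_square by (simp only: algebra_simps)
  qed simp
  have "(\<integral>\<^sup>+x. ennreal \<bar>low_pass r x\<bar> \<partial>lborel) \<le> (\<integral>\<^sup>+x. ennreal (6 * 4 ^ r) * ennreal ((1 + \<bar>x\<bar>) powr (-3/2)) \<partial>lborel)"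
  proof (rule nn_integral_mono)
    fix x :: real
    have "\<bar>low_pass r x\<bar> \<le> (3 + 2 * (real r)\<^sup>2) * (1 / (1 + x\<^sup>2))" using low_pass_decay[of r x] by simp
    also have "\<dots> \<le> (3 * 4 ^ r) * (2 * (1 + \<bar>x\<bar>) powr (-2))"
      by (intro mult_mono p inv_square_le) (auto simp: add_nonneg_nonneg)
    also have "\<dots> \<le> (3 * 4 ^ r) * (2 * (1 + \<bar>x\<bar>) powr (-3/2))"
      by (intro mult_left_mono powr_mono) auto
    finally show "ennreal \<bar>low_pass r x\<bar> \<le> ennreal (6 * 4 ^ r) * ennreal ((1 + \<bar>x\<bar>) powr (-3/2))"
      by (simp add: ennreal_mult[symmetric] ennreal_leI)
  qed
  also have "\<dots> = ennreal (6 * 4 ^ r) * (\<integral>\<^sup>+x. ennreal ((1 + \<bar>x\<bar>) powr (-3/2)) \<partial>lborel)"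
    by (rule nn_integral_cmult) measurable
  also have "\<dots> \<le> ennreal (6 * 4 ^ r) * ennreal 4" by (intro mult_left_mono nn_integral_tail) simp
  also have "\<dots> = ennreal (24 * 4 ^ r)" by (subst ennreal_mult[symmetric]) auto
  finally show ?thesis .
qed

lemma bdd_integrable_low_pass: "bdd_integrable (low_pass r)"
proof -
  have "(\<integral>\<^sup>+x. ennreal \<bar>low_pass r x\<bar> \<partial>lborel) < \<infinity>" using low_pass_nn_integral[of r] by (rule le_less_trans) simp
  then show ?thesis using low_pass_abs_le_1 by (auto simp: bdd_integrable_def integrable_iff_bounded)
qed

text \<open>A kernel that decays like \<open>x\<^bsup>-2\<^esup>\<close> need not have a first moment, but it has a moment of order
  \<open>1/2\<close>; so the truncated moment is \<open>O (sqrt D)\<close> because \<open>min 2 t \<le> 2 sqrt t\<close>.\<close>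

lemma low_pass_half_moment:
  assumes "0 \<le> D" shows "(\<integral>\<^sup>+z. ennreal (\<bar>low_pass 0 z\<bar> * min 2 (D * \<bar>z\<bar>)) \<partial>lborel) \<le> ennreal (48 * sqrt D)"
proof -
  have mn: "min 2 t \<le> 2 * sqrt t" if "0 \<le> t" for t :: real
  proof (cases "t \<le> 4")
    case True
    have "sqrt t \<le> sqrt 4" using True by (rule real_sqrt_le_mono)
    then have "sqrt t * sqrt t \<le> 2 * sqrt t" using that by (intro mult_right_mono) auto
    then show ?thesis using that by simp
  next
    case False
    have "sqrt 4 \<le> sqrt t" using False by (intro real_sqrt_le_mono) simp
    then show ?thesis by simp
  qed
  have "(\<integral>\<^sup>+z. ennreal (\<bar>low_pass 0 z\<bar> * min 2 (D * \<bar>z\<bar>)) \<partial>lborel) \<le> (\<integral>\<^sup>+x. ennreal (12 * sqrt D) * ennreal ((1 + \<bar>x\<bar>) powr (-3/2)) \<partial>lborel)"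
  proof (rule nn_integral_mono)
    fix x :: real
    have "\<bar>low_pass 0 x\<bar> \<le> 3 * (1 / (1 + x\<^sup>2))" using low_pass_decay[of 0 x] by simp
    also have "\<dots> \<le> 3 * (2 * (1 + \<bar>x\<bar>) powr (-2))" by (intro mult_left_mono inv_square_le) auto
    finally have 1: "\<bar>low_pass 0 x\<bar> \<le> 6 * (1 + \<bar>x\<bar>) powr (-2)" by simp
    have "min 2 (D * \<bar>x\<bar>) \<le> 2 * sqrt (D * \<bar>x\<bar>)" using assms by (intro mn) auto
    also have "\<dots> = 2 * (sqrt D * sqrt \<bar>x\<bar>)" by (simp add: real_sqrt_mult)
    also have "\<dots> \<le> 2 * (sqrt D * sqrt (1 + \<bar>x\<bar>))"
      using assms by (intro mult_left_mono real_sqrt_le_mono) auto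
    also have "sqrt (1 + \<bar>x\<bar>) = (1 + \<bar>x\<bar>) powr (1/2)" by (simp add: powr_half_sqrt)
    finally have 2: "min 2 (D * \<bar>x\<bar>) \<le> 2 * (sqrt D * (1 + \<bar>x\<bar>) powr (1/2))" .
    have "\<bar>low_pass 0 x\<bar> * min 2 (D * \<bar>x\<bar>) \<le> (6 * (1 + \<bar>x\<bar>) powr (-2)) * (2 * (sqrt D * (1 + \<bar>x\<bar>) powr (1/2)))"
      using 1 2 assms by (intro mult_mono) auto
    also have "\<dots> = 12 * sqrt D * ((1 + \<bar>x\<bar>) powr (-2) * (1 + \<bar>x\<bar>) powr (1/2))" by simp
    also have "(1 + \<bar>x\<bar>) powr (-2) * (1 + \<bar>x\<bar>) powr (1/2) = (1 + \<bar>x\<bar>) powr (-3/2)" by (simp flip: powr_add)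
    finally show "ennreal (\<bar>low_pass 0 x\<bar> * min 2 (D * \<bar>x\<bar>)) \<le> ennreal (12 * sqrt D) * ennreal ((1 + \<bar>x\<bar>) powr (-3/2))"
      using assms by (simp add: ennreal_mult[symmetric] ennreal_leI)
  qed
  also have "\<dots> = ennreal (12 * sqrt D) * (\<integral>\<^sup>+x. ennreal ((1 + \<bar>x\<bar>) powr (-3/2)) \<partial>lborel)"
    by (rule nn_integral_cmult) measurable
  also have "\<dots> \<le> ennreal (12 * sqrt D) * ennreal 4" by (intro mult_left_mono nn_integral_tail) simp
  also have "\<dots> = ennreal (48 * sqrt D)" using assms by (subst ennreal_mult[symmetric]) auto
  finally show ?thesis .
qed

lemma low_pass_integral_pos: "0 < (\<integral>x. low_pass 0 x \<partial>lborel)"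
proof -
  have i: "integrable lborel (low_pass 0)" using bdd_integrable_low_pass by (auto simp: bdd_integrable_def)
  have nn: "0 \<le> low_pass 0 x" if "x \<noteq> 0" for x
  proof -
    have "0 \<le> x\<^sup>2 * low_pass 0 x" unfolding low_pass_0_eq by simp
    then show ?thesis using that by (simp add: zero_le_mult_iff)
  qed
  have ae: "AE x in lborel. 0 \<le> low_pass 0 x"
    using AE_lborel_singleton[of "0::real"] by eventually_elim (rule nn)
  have "(\<integral>x. low_pass 0 x \<partial>lborel) \<noteq> 0"
  proof
    assume "(\<integral>x. low_pass 0 x \<partial>lborel) = 0"
    then have "AE x in lborel. low_pass 0 x = 0" using integral_nonneg_eq_0_iff_AE[OF i ae] by simp
    then have "AE x in lborel. x \<notin> {0<..<1::real}"
    proof eventually_elim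
      case (elim x)
      have "cos x < cos 0" if "0 < x" "x < 1"
        using that pi_gt3 by (intro cos_monotone_0_pi) auto
      then show ?case using elim low_pass_0_eq[of x] by auto
    qed
    then have "emeasure lborel {x \<in> space lborel. \<not> x \<notin> {0<..<1::real}} = 0"
      by (subst (asm) AE_iff_measurable[OF _ refl]) auto
    moreover have "{x \<in> space lborel. \<not> x \<notin> {0<..<1::real}} = {0<..<1}" by auto
    ultimately show False by simp
  qed
  moreover have "0 \<le> (\<integral>x. low_pass 0 x \<partial>lborel)" by (rule integral_nonneg_AE[OF ae])
  ultimately show ?thesis by simp
qed

lemma low_pass_primitive: "primitive_of (low_pass r) (low_pass (Suc r))"
  by (rule primitive_of_DERIV[OF low_pass_deriv low_pass_continuous])

lemma smooth_chain_low_pass: "smooth_chain M low_pass"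
  by (auto simp: smooth_chain_def bdd_integrable_low_pass low_pass_primitive)

section \<open>Dilations and wavelet systems\<close>

lemma L2_prod_integrable:
  assumes "f \<in> L2" "g \<in> L2" shows "integrable lborel (\<lambda>x. f x * g x)"
proof (rule Bochner_Integration.integrable_bound)
  have m: "f \<in> borel_measurable borel" "g \<in> borel_measurable borel" using assms by (auto simp: L2_def)
  then show "(\<lambda>x. f x * g x) \<in> borel_measurable lborel" by measurable
  show "integrable lborel (\<lambda>x. (f x)\<^sup>2 + (g x)\<^sup>2)" using assms by (auto simp: L2_def)
  have "\<bar>f x * g x\<bar> \<le> (f x)\<^sup>2 + (g x)\<^sup>2" for x
  proof -
    have "2 * \<bar>f x\<bar> * \<bar>g x\<bar> \<le> (f x)\<^sup>2 + (g x)\<^sup>2" using sum_squares_bound[of "\<bar>f x\<bar>" "\<bar>g x\<bar>"] by simp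
    moreover have "0 \<le> \<bar>f x\<bar> * \<bar>g x\<bar>" by simp
    ultimately show ?thesis unfolding abs_mult by linarith
  qed
  then show "AE x in lborel. norm (f x * g x) \<le> norm ((f x)\<^sup>2 + (g x)\<^sup>2)" by simp
qed

text \<open>Completing the square in each coefficient, as in Bessel's inequality.\<close>

lemma best_approximation:
  assumes e: "orthonormal_system I e" and F: "finite F" "F \<subseteq> I" and f: "f \<in> L2"
  shows "ennreal ((\<integral>x. (f x)\<^sup>2 \<partial>lborel) - (\<Sum>k\<in>F. (l2_inner f (e k))\<^sup>2)) \<le> l2_dist_sq f (\<lambda>x. \<Sum>k\<in>F. c k * e k x)"
proof -
  have eL: "e k \<in> L2" if "k \<in> F" for k using e F that by (auto simp: orthonormal_system_def)
  have on: "(\<integral>x. e k x * e l x \<partial>lborel) = (if k = l then 1 else 0)" if "k \<in> F" "l \<in> F" for k l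
    using e F that by (auto simp: orthonormal_system_def l2_inner_def subset_iff)
  define p where "p x = (\<Sum>k\<in>F. c k * e k x)" for x
  have i1: "integrable lborel (\<lambda>x. (f x)\<^sup>2)" using f by (simp add: L2_def)
  have fe: "integrable lborel (\<lambda>x. f x * e k x)" if "k \<in> F" for k using L2_prod_integrable[OF f eL[OF that]] .
  have ee: "integrable lborel (\<lambda>x. e k x * e l x)" if "k \<in> F" "l \<in> F" for k l using L2_prod_integrable[OF eL eL] that .
  have sq: "(f x - p x)\<^sup>2 = (f x)\<^sup>2 - 2 * (\<Sum>k\<in>F. c k * (f x * e k x)) + (\<Sum>k\<in>F. \<Sum>l\<in>F. c k * c l * (e k x * e l x))" for x
  proof -
    have "(p x)\<^sup>2 = (\<Sum>k\<in>F. \<Sum>l\<in>F. c k * c l * (e k x * e l x))"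
      unfolding p_def power2_eq_square sum_product by (intro sum.cong refl) (simp add: mult_ac)
    moreover have "f x * p x = (\<Sum>k\<in>F. c k * (f x * e k x))"
      unfolding p_def sum_distrib_left by (intro sum.cong refl) (simp add: mult_ac)
    ultimately show ?thesis by (simp add: power2_diff)
  qed
  have i2: "integrable lborel (\<lambda>x. \<Sum>k\<in>F. c k * (f x * e k x))" by (intro Bochner_Integration.integrable_sum integrable_mult_right fe)
  have i3: "integrable lborel (\<lambda>x. \<Sum>k\<in>F. \<Sum>l\<in>F. c k * c l * (e k x * e l x))"
    by (intro Bochner_Integration.integrable_sum integrable_mult_right ee)
  have int: "integrable lborel (\<lambda>x. (f x - p x)\<^sup>2)" unfolding sq using i1 i2 i3 by auto
  have "(\<integral>x. (f x - p x)\<^sup>2 \<partial>lborel) = (\<integral>x. (f x)\<^sup>2 \<partial>lborel) - 2 * (\<Sum>k\<in>F. c k * l2_inner f (e k)) + (\<Sum>k\<in>F. \<Sum>l\<in>F. c k * c l * (if k = l then 1 else 0))"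
  proof -
    have "(\<integral>x. (\<Sum>k\<in>F. \<Sum>l\<in>F. c k * c l * (e k x * e l x)) \<partial>lborel) = (\<Sum>k\<in>F. \<Sum>l\<in>F. c k * c l * (if k = l then 1 else 0))"
    proof -
      have "(\<integral>x. (\<Sum>k\<in>F. \<Sum>l\<in>F. c k * c l * (e k x * e l x)) \<partial>lborel) = (\<Sum>k\<in>F. (\<integral>x. (\<Sum>l\<in>F. c k * c l * (e k x * e l x)) \<partial>lborel))"
        by (rule Bochner_Integration.integral_sum) (intro Bochner_Integration.integrable_sum integrable_mult_right ee)
      also have "\<dots> = (\<Sum>k\<in>F. \<Sum>l\<in>F. (\<integral>x. c k * c l * (e k x * e l x) \<partial>lborel))"
        by (intro sum.cong refl Bochner_Integration.integral_sum integrable_mult_right ee)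
      also have "\<dots> = (\<Sum>k\<in>F. \<Sum>l\<in>F. c k * c l * (if k = l then 1 else 0))"
        by (intro sum.cong refl) (simp only: integral_mult_right_zero on)
      finally show ?thesis .
    qed
    moreover have "(\<integral>x. (\<Sum>k\<in>F. c k * (f x * e k x)) \<partial>lborel) = (\<Sum>k\<in>F. c k * l2_inner f (e k))"
      by (subst Bochner_Integration.integral_sum) (auto simp: l2_inner_def intro!: fe)
    ultimately show ?thesis unfolding sq using i1 i2 i3 by simp
  qed
  also have "(\<Sum>k\<in>F. \<Sum>l\<in>F. c k * c l * (if k = l then 1 else 0)) = (\<Sum>k\<in>F. (c k)\<^sup>2)"
    using F(1) by (intro sum.cong refl) (simp add: power2_eq_square sum.delta' if_distrib cong: if_cong)
  finally have 1: "(\<integral>x. (f x - p x)\<^sup>2 \<partial>lborel) = (\<integral>x. (f x)\<^sup>2 \<partial>lborel) + (\<Sum>k\<in>F. (c k)\<^sup>2 - 2 * (c k * l2_inner f (e k)))"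
    by (simp add: sum_subtractf sum_distrib_left)
  have "- (\<Sum>k\<in>F. (l2_inner f (e k))\<^sup>2) \<le> (\<Sum>k\<in>F. (c k)\<^sup>2 - 2 * (c k * l2_inner f (e k)))"
    unfolding sum_negf[symmetric]
  proof (rule sum_mono)
    fix k
    have "0 \<le> (c k - l2_inner f (e k))\<^sup>2" by simp
    then show "- (l2_inner f (e k))\<^sup>2 \<le> (c k)\<^sup>2 - 2 * (c k * l2_inner f (e k))" by (simp add: power2_diff)
  qed
  then have "ennreal ((\<integral>x. (f x)\<^sup>2 \<partial>lborel) - (\<Sum>k\<in>F. (l2_inner f (e k))\<^sup>2)) \<le> ennreal (\<integral>x. (f x - p x)\<^sup>2 \<partial>lborel)"
    unfolding 1 by (intro ennreal_leI) linarith
  also have "\<dots> = (\<integral>\<^sup>+x. ennreal ((f x - p x)\<^sup>2) \<partial>lborel)" by (rule nn_integral_eq_integral[symmetric]) (use int in auto)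
  finally show ?thesis by (simp add: l2_dist_sq_def p_def)
qed

lemma min_moment_tendsto_0:
  fixes w :: "real \<Rightarrow> real"
  assumes w: "integrable lborel w" and D: "D \<longlonglongrightarrow> 0" "\<And>n::nat. 0 \<le> D n"
  shows "(\<lambda>n. \<integral>z. \<bar>w z\<bar> * min 2 (D n * \<bar>z\<bar>) \<partial>lborel) \<longlonglongrightarrow> 0"
    "integrable lborel (\<lambda>z. \<bar>w z\<bar> * min 2 (D n * \<bar>z\<bar>))"
proof -
  have [measurable]: "w \<in> borel_measurable borel" using w by auto
  have le: "norm (\<bar>w z\<bar> * min 2 (D n * \<bar>z\<bar>)) \<le> 2 * \<bar>w z\<bar>" for n z
  proof -
    have "\<bar>min 2 (D n * \<bar>z\<bar>)\<bar> \<le> 2" using D(2)[of n] by (auto simp: min_def)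
    then show ?thesis using mult_left_mono[of "\<bar>min 2 (D n * \<bar>z\<bar>)\<bar>" 2 "\<bar>w z\<bar>"] by (simp add: abs_mult mult.commute)
  qed
  have "(\<lambda>n. \<integral>z. \<bar>w z\<bar> * min 2 (D n * \<bar>z\<bar>) \<partial>lborel) \<longlonglongrightarrow> (\<integral>z. 0 \<partial>(lborel :: real measure))"
  proof (rule integral_dominated_convergence[where w="\<lambda>z. 2 * \<bar>w z\<bar>"])
    show "AE z in lborel. (\<lambda>n. \<bar>w z\<bar> * min 2 (D n * \<bar>z\<bar>)) \<longlonglongrightarrow> 0"
    proof (rule AE_I2)
      fix z
      have "(\<lambda>n. \<bar>w z\<bar> * min 2 (D n * \<bar>z\<bar>)) \<longlonglongrightarrow> \<bar>w z\<bar> * min 2 (0 * \<bar>z\<bar>)" by (intro tendsto_intros D)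
      then show "(\<lambda>n. \<bar>w z\<bar> * min 2 (D n * \<bar>z\<bar>)) \<longlonglongrightarrow> 0" by simp
    qed
  qed (use w le in auto)
  then show "(\<lambda>n. \<integral>z. \<bar>w z\<bar> * min 2 (D n * \<bar>z\<bar>) \<partial>lborel) \<longlonglongrightarrow> 0" by simp
  show "integrable lborel (\<lambda>z. \<bar>w z\<bar> * min 2 (D n * \<bar>z\<bar>))"
    by (rule Bochner_Integration.integrable_bound[where f="\<lambda>z. 2 * \<bar>w z\<bar>"]) (use w le in auto)
qed

text \<open>Dilation that preserves the integral.\<close>

definition stretch :: "real \<Rightarrow> (real \<Rightarrow> real) \<Rightarrow> real \<Rightarrow> real" where
  "stretch \<rho> v x = v (x / \<rho>) / \<rho>"

lemma bdd_integrable_stretch: "bdd_integrable v \<Longrightarrow> 0 < \<rho> \<Longrightarrow> bdd_integrable (stretch \<rho> v)"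
  using bdd_integrable_cmult[OF bdd_integrable_affine[of v "1/\<rho>" 0], of "1/\<rho>"] by (simp add: stretch_def[abs_def])

lemma bdd_integrable_reflect: "bdd_integrable v \<Longrightarrow> bdd_integrable (\<lambda>x. v (- x))"
  using bdd_integrable_affine[of v "-1" 0] by simp

lemma nn_integral_stretch:
  assumes [measurable]: "v \<in> borel_measurable borel" "g \<in> borel_measurable borel" and r: "0 < \<rho>"
  shows "(\<integral>\<^sup>+z. ennreal (\<bar>stretch \<rho> v z\<bar> * g z) \<partial>lborel) = (\<integral>\<^sup>+z. ennreal (\<bar>v z\<bar> * g (\<rho> * z)) \<partial>lborel)"
proof -
  have "(\<integral>\<^sup>+z. ennreal (\<bar>stretch \<rho> v z\<bar> * g z) \<partial>lborel)
     = ennreal \<rho> * (\<integral>\<^sup>+z. ennreal (\<bar>stretch \<rho> v (0 + \<rho> * z)\<bar> * g (0 + \<rho> * z)) \<partial>lborel)"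
    using r unfolding stretch_def by (subst nn_integral_real_affine[of _ \<rho> 0]) auto
  also have "\<dots> = (\<integral>\<^sup>+z. ennreal \<rho> * ennreal (\<bar>v z\<bar> / \<rho> * g (\<rho> * z)) \<partial>lborel)"
    using r by (subst nn_integral_cmult[symmetric]) (auto simp: stretch_def)
  also have "\<dots> = (\<integral>\<^sup>+z. ennreal (\<bar>v z\<bar> * g (\<rho> * z)) \<partial>lborel)"
    using r by (intro nn_integral_cong) (simp flip: ennreal_mult')
  finally show ?thesis .
qed

lemma norm_L1_stretch:
  assumes "v \<in> borel_measurable borel" "0 < \<rho>"
  shows "norm_L1 (stretch \<rho> v) = (\<integral>\<^sup>+z. ennreal \<bar>v z\<bar> \<partial>lborel)"
proof -
  have "stretch \<rho> v \<in> borel_measurable borel" using assms(1) unfolding stretch_def[abs_def] by measurable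
  then show ?thesis using nn_integral_stretch[of v "\<lambda>_. 1" \<rho>] assms by (simp add: norm_L1_eq)
qed

lemma integral_stretch: "0 < \<rho> \<Longrightarrow> (\<integral>z. stretch \<rho> v z \<partial>lborel) = (\<integral>z. v z \<partial>lborel)"
  unfolding stretch_def by (subst lborel_integral_real_affine[of \<rho> _ 0]) auto

lemma primitive_of_cmult: "primitive_of v v' \<Longrightarrow> primitive_of (\<lambda>x. c * v x) (\<lambda>x. c * v' x)"
  unfolding primitive_of_def by (simp add: mult.left_commute[of _ c] flip: right_diff_distrib)

lemma primitive_of_stretch:
  assumes p: "primitive_of v v'" and r: "0 < \<rho>"
  shows "primitive_of (stretch \<rho> v) (\<lambda>x. stretch \<rho> v' x / \<rho>)"
  unfolding primitive_of_def
proof (intro allI impI)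
  fix x y :: real assume "x \<le> y"
  then have "v (y / \<rho>) - v (x / \<rho>) = (\<integral>t. indicator {0..y/\<rho> - x/\<rho>} t * v' (y/\<rho> - t) \<partial>lborel)"
    using p r unfolding primitive_of_def by (simp add: divide_right_mono)
  also have "\<dots> = (\<integral>t. \<bar>1/\<rho>\<bar> *\<^sub>R (indicator {0..y/\<rho> - x/\<rho>} (0 + 1/\<rho> * t) * v' (y/\<rho> - (0 + 1/\<rho> * t))) \<partial>lborel)"
    using r by (subst lborel_integral_real_affine[of "1/\<rho>" _ 0]) auto
  also have "\<dots> = (\<integral>t. \<rho> * (indicator {0..y - x} t * (stretch \<rho> v' (y - t) / \<rho>)) \<partial>lborel)"
  proof (rule Bochner_Integration.integral_cong[OF refl])
    fix t
    have "indicator {0..y/\<rho> - x/\<rho>} (0 + 1/\<rho> * t) = (indicator {0..y - x} t :: real)"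
      using r by (auto simp: indicator_def field_simps)
    then show "\<bar>1/\<rho>\<bar> *\<^sub>R (indicator {0..y/\<rho> - x/\<rho>} (0 + 1/\<rho> * t) * v' (y/\<rho> - (0 + 1/\<rho> * t))) = \<rho> * (indicator {0..y - x} t * (stretch \<rho> v' (y - t) / \<rho>))"
      using r by (simp add: stretch_def diff_divide_distrib)
  qed
  finally show "stretch \<rho> v y - stretch \<rho> v x = (\<integral>t. indicator {0..y - x} t * (stretch \<rho> v' (y - t) / \<rho>) \<partial>lborel)"
    using r by (simp add: stretch_def diff_divide_distrib[symmetric])
qed

lemma smooth_chain_stretch:
  assumes "smooth_chain M v" "0 < \<rho>"
  shows "smooth_chain M (\<lambda>r x. (1/\<rho>) ^ r * stretch \<rho> (v r) x)"
  unfolding smooth_chain_def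
proof (intro conjI allI impI)
  fix r assume "r \<le> M"
  then show "bdd_integrable (\<lambda>x. (1/\<rho>) ^ r * stretch \<rho> (v r) x)" using assms by (auto simp: smooth_chain_def intro!: bdd_integrable_cmult bdd_integrable_stretch)
next
  fix r assume "r < M"
  then have "primitive_of (v r) (v (Suc r))" using assms by (simp add: smooth_chain_def)
  from primitive_of_cmult[OF primitive_of_stretch[OF this assms(2)], of "(1/\<rho>) ^ r"]
  show "primitive_of (\<lambda>x. (1/\<rho>) ^ r * stretch \<rho> (v r) x) (\<lambda>x. (1/\<rho>) ^ Suc r * stretch \<rho> (v (Suc r)) x)"
    by (simp add: mult_ac)
qed

lemma shift_norm_cmult: "shift_norm W y (\<lambda>x. c * v x) \<le> ennreal \<bar>c\<bar> * shift_norm W y v" if "y \<in> borel_measurable W" "v \<in> borel_measurable borel"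
  unfolding shift_norm_le_iff
proof
  fix x
  have "(\<integral>\<^sup>+i. ennreal \<bar>c * v (x - y i)\<bar> \<partial>W) = ennreal \<bar>c\<bar> * (\<integral>\<^sup>+i. ennreal \<bar>v (x - y i)\<bar> \<partial>W)"
    using that by (subst nn_integral_cmult[symmetric]) (auto simp: abs_mult ennreal_mult)
  also have "\<dots> \<le> ennreal \<bar>c\<bar> * shift_norm W y v" by (intro mult_left_mono shift_norm_ge) simp
  finally show "(\<integral>\<^sup>+i. ennreal \<bar>c * v (x - y i)\<bar> \<partial>W) \<le> ennreal \<bar>c\<bar> * shift_norm W y v" .
qed

text \<open>Wavelet coefficients are values at the integers of one convolution, so its supremum norm bounds
  each of them and its periodised norm their sum.\<close>

lemma convol_stretch_int:
  assumes r: "0 < \<rho>"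
  shows "convol (stretch \<rho> G) (\<lambda>x. g (- x)) (of_int k) = (\<integral>x. G x * g (\<rho> * x - of_int k) \<partial>lborel)"
  unfolding convol_def stretch_def using r by (subst lborel_integral_real_affine[of \<rho> _ 0]) auto

lemma norm_per_at_0: "(\<integral>\<^sup>+k. ennreal \<bar>v (of_int k)\<bar> \<partial>count_space (UNIV::int set)) \<le> norm_per v"
proof -
  have "(\<integral>\<^sup>+k. ennreal \<bar>v (of_int k)\<bar> \<partial>count_space (UNIV::int set)) = (\<integral>\<^sup>+k. ennreal \<bar>v (0 - of_int k)\<bar> \<partial>count_space (UNIV::int set))"
    using nn_integral_bij_count_space[of "uminus" UNIV UNIV "\<lambda>k::int. ennreal \<bar>v (of_int k)\<bar>"] by (simp add: bij_uminus)
  also have "\<dots> \<le> norm_per v" by (rule shift_norm_ge)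
  finally show ?thesis .
qed

text \<open>\<open>X\<close> bounds the \<open>\<ell>\<^sup>\<infinity>\<close> norm and \<open>Y\<close> the \<open>\<ell>\<^sup>1\<close> norm of the coefficients of \<open>G\<close> against the translates
  of \<open>g\<close> dilated by \<open>\<rho>\<close>.\<close>

definition coeffs_bounded :: "(real \<Rightarrow> real) \<Rightarrow> (real \<Rightarrow> real) \<Rightarrow> real \<Rightarrow> real \<Rightarrow> real \<Rightarrow> bool" where
  "coeffs_bounded G g \<rho> X Y \<longleftrightarrow> (\<forall>k. \<bar>\<integral>x. G x * g (\<rho> * x - of_int k) \<partial>lborel\<bar> \<le> X) \<and>
     (\<integral>\<^sup>+k. ennreal \<bar>\<integral>x. G x * g (\<rho> * x - of_int k) \<partial>lborel\<bar> \<partial>count_space (UNIV::int set)) \<le> ennreal Y"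

lemma norm_sup_at: "norm_sup v \<le> ennreal c \<Longrightarrow> 0 \<le> c \<Longrightarrow> \<bar>v x\<bar> \<le> c"
  by (simp add: norm_sup_le_iff)

lemma dominating_bdd_integrable: "dominating \<Phi> g \<Longrightarrow> g \<in> borel_measurable borel \<Longrightarrow> bdd_integrable g"
proof -
  assume d: "dominating \<Phi> g" and m: "g \<in> borel_measurable borel"
  have "integrable lborel g"
    by (rule Bochner_Integration.integrable_bound[where f="\<lambda>u. \<Phi> \<bar>u\<bar>"])
      (use d m dominating_nonneg[OF d] in \<open>auto simp: dominating_def\<close>)
  moreover have "\<bar>g x\<bar> \<le> \<Phi> 0" for x
    using d dominating_mono[OF d, of 0 "\<bar>x\<bar>"] by (auto simp: dominating_def intro: order_trans)
  ultimately show ?thesis by (auto simp: bdd_integrable_def)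
qed

lemma localised_dominating: "localised N g \<Longrightarrow> \<exists>\<Phi>. dominating \<Phi> g"
  by (auto simp: localised_def dominating_def)

lemma norm_per_reflect_finite:
  assumes d: "dominating \<Phi> g"
  obtains S where "0 \<le> S" "norm_per (\<lambda>x. g (- x)) \<le> ennreal S"
proof -
  obtain S where S: "0 \<le> S" "norm_per (envelope \<Phi> 0) \<le> ennreal S" using norm_per_envelope_finite[OF d] by metis
  have "norm_per (\<lambda>x. g (- x)) \<le> norm_per (envelope \<Phi> 0)"
    unfolding shift_norm_le_iff
  proof
    fix x
    have "\<bar>g (- y)\<bar> \<le> \<bar>envelope \<Phi> 0 y\<bar>" for y
    proof -
      have "\<bar>g (- y)\<bar> \<le> \<Phi> \<bar>- y\<bar>" using d unfolding dominating_def by blast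
      also have "\<Phi> \<bar>- y\<bar> = envelope \<Phi> 0 y" by (simp add: envelope_def)
      finally show ?thesis by simp
    qed
    then have "(\<integral>\<^sup>+k. ennreal \<bar>g (- (x - real_of_int k))\<bar> \<partial>count_space UNIV) \<le> (\<integral>\<^sup>+k. ennreal \<bar>envelope \<Phi> 0 (x - real_of_int k)\<bar> \<partial>count_space UNIV)"
      by (intro nn_integral_mono ennreal_leI)
    also have "\<dots> \<le> norm_per (envelope \<Phi> 0)" by (rule shift_norm_ge)
    finally show "(\<integral>\<^sup>+k. ennreal \<bar>g (- (x - real_of_int k))\<bar> \<partial>count_space UNIV) \<le> norm_per (envelope \<Phi> 0)" .
  qed
  also have "\<dots> \<le> ennreal S" by (rule S)
  finally show ?thesis using that S by blast
qed

lemma orthonormal_in_closed_span: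
  assumes "orthonormal_system I e" "i \<in> I" shows "e i \<in> closed_span I e"
proof -
  have "l2_dist_sq (e i) (\<lambda>x. \<Sum>j\<in>{i}. 1 * e j x) = 0" by (simp add: l2_dist_sq_def)
  then have "\<exists>F c. finite F \<and> F \<subseteq> I \<and> l2_dist_sq (e i) (\<lambda>x. \<Sum>j\<in>F. c j * e j x) < ennreal \<epsilon>" if "0 < \<epsilon>" for \<epsilon>
    using assms that by (intro exI[of _ "{i}"] exI[of _ "\<lambda>_. 1"]) auto
  then show ?thesis using assms by (auto simp: closed_span_def orthonormal_system_def)
qed

lemma dil_0_0: "dil g 0 0 = g" by (simp add: dil_def fun_eq_iff)

lemma L2_measurable: "f \<in> L2 \<Longrightarrow> f \<in> borel_measurable borel" by (simp add: L2_def)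

context
  fixes N :: nat and \<phi> \<psi> :: "real \<Rightarrow> real"
  assumes ws: "wavelet_system N \<phi> \<psi>"
begin

lemma orthonormal_father: "orthonormal_system UNIV (dil \<phi> j)"
proof -
  have "orthonormal_system (UNIV <+> {j..} \<times> UNIV) (wavelet_family \<phi> \<psi> j)"
    using ws by (auto simp: wavelet_system_def wavelet_basis_def orthonormal_basis_of_def)
  note o = this[unfolded orthonormal_system_def]
  show ?thesis unfolding orthonormal_system_def
  proof (intro conjI ballI)
    fix i k :: int
    have I: "Inl i \<in> UNIV <+> {j..} \<times> (UNIV :: int set)" "Inl k \<in> UNIV <+> {j..} \<times> (UNIV :: int set)" by auto
    show "dil \<phi> j i \<in> L2" using bspec[OF conjunct1[OF o] I(1)] by (simp add: wavelet_family_def)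
    show "l2_inner (dil \<phi> j i) (dil \<phi> j k) = (if i = k then 1 else 0)"
      using bspec[OF bspec[OF conjunct2[OF o] I(1)] I(2)] by (simp add: wavelet_family_def)
  qed
qed

lemma orthonormal_mother: "orthonormal_system UNIV (dil \<psi> 0)"
  using ws by (auto simp: wavelet_system_def mother_wavelet_def orthonormal_basis_of_def)

lemma father_dominated: "\<exists>\<Phi>. dominating \<Phi> \<phi>"
  using ws localised_dominating by (auto simp: wavelet_system_def)

lemma mother_dominated: "\<exists>\<Psi>. dominating \<Psi> \<psi>"
  using ws localised_dominating by (auto simp: wavelet_system_def)

lemma bdd_integrable_father: "bdd_integrable \<phi>"
proof -
  have "dil \<phi> 0 0 \<in> L2" using orthonormal_father[of 0] unfolding orthonormal_system_def by blast
  then show ?thesis using father_dominated dominating_bdd_integrable L2_measurable unfolding dil_0_0 by blast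
qed

lemma bdd_integrable_mother: "bdd_integrable \<psi>"
proof -
  have "dil \<psi> 0 0 \<in> L2" using orthonormal_mother unfolding orthonormal_system_def by blast
  then show ?thesis using mother_dominated dominating_bdd_integrable L2_measurable unfolding dil_0_0 by blast
qed

lemma mra_mono: "mra_space \<phi> j \<subseteq> mra_space \<phi> (j + int n)"
proof (induction n)
  case (Suc n)
  have "mra_space \<phi> (j + int n) \<subseteq> mra_space \<phi> (j + int n + 1)" using ws by (auto simp: wavelet_system_def father_wavelet_def)
  then show ?case using Suc by (auto simp: ac_simps)
qed simp

text \<open>\<open>\<phi>(\<cdot> / 2\<^sup>m)\<close> lies in \<open>V\<^bsub>-m\<^esub>\<close>, hence in \<open>V\<^sub>0\<close>, to which the translates of \<open>\<psi>\<close> are orthogonal.\<close>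

lemma coarse_father_orthogonal:
  "(\<integral>z. \<phi> (z / 2 ^ m) / 2 ^ m * \<psi> (z - of_int k) \<partial>lborel) = 0"
proof -
  have "dil \<phi> (- int m) 0 \<in> mra_space \<phi> (- int m)"
    unfolding mra_space_def by (rule orthonormal_in_closed_span[OF orthonormal_father]) simp
  then have g: "dil \<phi> (- int m) 0 \<in> mra_space \<phi> 0" using mra_mono[of "- int m" m] by auto
  have "dil \<psi> 0 k \<in> closed_span UNIV (dil \<psi> 0)" by (rule orthonormal_in_closed_span[OF orthonormal_mother]) simp
  then have "l2_inner (dil \<psi> 0 k) (dil \<phi> (- int m) 0) = 0"
    using ws g by (auto simp: wavelet_system_def mother_wavelet_def orthonormal_basis_of_def)
  then have "(\<integral>z. 2 powr (- real m / 2) * (\<psi> (z - of_int k) * \<phi> (2 powr (- real m) * z)) \<partial>lborel) = 0"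
    by (simp add: l2_inner_def dil_def mult_ac)
  then have "(\<integral>z. \<psi> (z - of_int k) * \<phi> (2 powr (- real m) * z) \<partial>lborel) = 0" by simp
  moreover have "2 powr (- real m) * z = z / 2 ^ m" for z :: real
    by (simp add: powr_minus powr_realpow field_simps)
  ultimately have "(\<integral>z. \<psi> (z - of_int k) * \<phi> (z / 2 ^ m) \<partial>lborel) = 0" by simp
  moreover have "(\<integral>z. \<phi> (z / 2 ^ m) / 2 ^ m * \<psi> (z - of_int k) \<partial>lborel) = (\<integral>z. (\<psi> (z - of_int k) * \<phi> (z / 2 ^ m)) / 2 ^ m \<partial>lborel)"
    by (simp add: mult_ac)
  ultimately show ?thesis by simp
qed

text \<open>A bounded periodisation makes the weak derivative integrable over the line.\<close>

lemma father_weak_derivative: "\<exists>h. weak_derivative (N + 1) \<phi> h \<and> integrable lborel h"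
proof -
  obtain h C where h: "weak_derivative (N + 1) \<phi> h"
    and C: "AE x in lborel. (\<integral>\<^sup>+k. ennreal \<bar>h (x - of_int k)\<bar> \<partial>count_space (UNIV :: int set)) \<le> ennreal C"
    using ws by (auto simp: wavelet_system_def regular_def)
  have li: "set_integrable lborel {-R..R} h" for R using h by (auto simp: weak_derivative_def locally_integrable_def)
  have m: "h \<in> borel_measurable borel"
  proof (rule borel_measurable_LIMSEQ_real)
    show "(\<lambda>x. indicator {-real n..real n} x *\<^sub>R h x) \<in> borel_measurable borel" for n
      using li[of "real n"] by (auto simp: set_integrable_def)
    show "(\<lambda>n. indicator {-real n..real n} x *\<^sub>R h x) \<longlonglongrightarrow> h x" for x
    proof (rule tendsto_eventually, rule eventually_mono)
      show "\<forall>\<^sub>F n in sequentially. \<bar>x\<bar> \<le> real n"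
        using eventually_ge_at_top[of "nat \<lceil>\<bar>x\<bar>\<rceil>"] by eventually_elim linarith
      fix n assume "\<bar>x\<bar> \<le> real n"
      then show "indicator {-real n..real n} x *\<^sub>R h x = h x" by (auto simp: indicator_def abs_le_iff)
    qed
  qed
  have "(\<integral>\<^sup>+x. ennreal \<bar>h x\<bar> \<partial>lborel) = (\<integral>\<^sup>+x. indicator {0..<1} x * (\<integral>\<^sup>+k. ennreal \<bar>h (x - of_int k)\<bar> \<partial>count_space (UNIV::int set)) \<partial>lborel)"
    by (rule nn_integral_split_int) (use m in measurable)
  also have "\<dots> \<le> (\<integral>\<^sup>+x. indicator {0..<1::real} x * ennreal C \<partial>lborel)"
    by (rule nn_integral_mono_AE) (use C in \<open>eventually_elim, auto simp: indicator_def\<close>)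
  also have "\<dots> < \<infinity>" by (simp add: nn_integral_multc)
  finally have "integrable lborel h" using m by (auto simp: integrable_iff_bounded)
  with h show ?thesis by blast
qed

text \<open>Without using any cancellation: this serves at the levels coarser than the function, and at the
  bottom level of the father wavelets.\<close>

lemma coefficients_crude:
  "\<exists>C\<ge>0. \<forall>g G A B \<rho>. g \<in> {\<phi>, \<psi>} \<longrightarrow> bdd_integrable G \<longrightarrow> 0 < \<rho> \<longrightarrow> (\<forall>x. \<bar>G x\<bar> \<le> A) \<longrightarrow> 0 \<le> B \<longrightarrow>
     (\<integral>\<^sup>+x. ennreal \<bar>G x\<bar> \<partial>lborel) \<le> ennreal B \<longrightarrow> coeffs_bounded G g \<rho> (C * A / \<rho>) (C * B)"
proof -
  obtain S1 where S1: "0 \<le> S1" "norm_per (\<lambda>x. \<phi> (- x)) \<le> ennreal S1" using father_dominated norm_per_reflect_finite by metis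
  obtain S2 where S2: "0 \<le> S2" "norm_per (\<lambda>x. \<psi> (- x)) \<le> ennreal S2" using mother_dominated norm_per_reflect_finite by metis
  define C where "C = S1 + S2"
  have C: "0 \<le> C" using S1 S2 by (simp add: C_def)
  have gC: "norm_per (\<lambda>x. g (- x)) \<le> ennreal C" "bdd_integrable g" if "g \<in> {\<phi>, \<psi>}" for g
    using that S1 S2 bdd_integrable_father bdd_integrable_mother by (auto simp: C_def intro: order_trans intro!: ennreal_leI)
  have "coeffs_bounded G g \<rho> (C * A / \<rho>) (C * B)"
    if g: "g \<in> {\<phi>, \<psi>}" and G: "bdd_integrable G" and r: "0 < \<rho>" and A: "\<forall>x. \<bar>G x\<bar> \<le> A" and B0: "0 \<le> B"
       and B: "(\<integral>\<^sup>+x. ennreal \<bar>G x\<bar> \<partial>lborel) \<le> ennreal B" for g G A B \<rho>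
  proof -
    let ?u = "stretch \<rho> G" and ?g = "\<lambda>x. g (- x)"
    have AB: "0 \<le> A" "0 \<le> B" using A B0 abs_ge_zero[of "G 0"] order_trans by blast+
    have Gm: "G \<in> borel_measurable borel" using G by (rule bdd_integrableD(2))
    have n1: "norm_L1 ?u \<le> ennreal B" using B Gm r by (simp add: norm_L1_stretch)
    have nS: "norm_sup ?u \<le> ennreal (A / \<rho>)" using A AB r by (auto simp: norm_sup_le_iff stretch_def divide_right_mono)
    have Z: "norm_per (convol ?u ?g) \<le> ennreal (B * C)"
      by (rule norm_per_convol_le[OF bdd_integrable_stretch[OF G r] bdd_integrable_reflect[OF gC(2)[OF g]] AB(2) C n1 gC(1)[OF g]])
    have "norm_sup (convol ?u ?g) \<le> ennreal (A / \<rho> * C)"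
      by (rule norm_sup_convol_le[OF bdd_integrable_stretch[OF G r] bdd_integrable_reflect[OF gC(2)[OF g]] _ C nS gC(1)[OF g]]) (use AB r in auto)
    from norm_sup_at[OF this, of "of_int _"] have "\<bar>convol ?u ?g (of_int k)\<bar> \<le> A / \<rho> * C" for k :: int using AB r C by auto
    then have 1: "\<bar>\<integral>x. G x * g (\<rho> * x - of_int k) \<partial>lborel\<bar> \<le> C * A / \<rho>" for k unfolding convol_stretch_int[OF r] by (simp add: mult_ac)
    have 2: "(\<integral>\<^sup>+k. ennreal \<bar>\<integral>x. G x * g (\<rho> * x - of_int k) \<partial>lborel\<bar> \<partial>count_space (UNIV::int set)) \<le> ennreal (C * B)"
      using order.trans[OF norm_per_at_0 Z] unfolding convol_stretch_int[OF r] by (simp add: mult_ac)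
    show ?thesis using 1 2 by (simp add: coeffs_bounded_def)
  qed
  with C show ?thesis by blast
qed

end

section \<open>Decay of the coefficients of smooth functions\<close>

lemma sum_le_nn_integral_count_space:
  assumes "finite F" shows "(\<Sum>k\<in>F. g k) \<le> (\<integral>\<^sup>+k. g k \<partial>count_space UNIV)"
proof -
  have "(\<Sum>k\<in>F. g k) = (\<integral>\<^sup>+k. g k \<partial>count_space F)" using assms by (simp add: nn_integral_count_space_finite)
  also have "\<dots> = (\<integral>\<^sup>+k. g k * indicator F k \<partial>count_space UNIV)" by (rule nn_integral_count_space_indicator) simp
  also have "\<dots> \<le> (\<integral>\<^sup>+k. g k \<partial>count_space UNIV)" by (rule nn_integral_mono) (simp add: indicator_def)
  finally show ?thesis .
qed

lemma bump_L2: "bump 0 \<in> L2" "0 < (\<integral>x. (bump 0 x)\<^sup>2 \<partial>lborel)"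
proof -
  have i: "integrable lborel (\<lambda>x. (bump 0 x)\<^sup>2)"
    using bdd_integrable_mult_integrable[OF bdd_integrableD(1)[OF bdd_integrable_bump[of 0]] bdd_integrable_bump[of 0], of 1 0] by (simp add: power2_eq_square)
  then show "bump 0 \<in> L2" by (simp add: L2_def)
  have "(\<integral>x. (bump 0 x)\<^sup>2 \<partial>lborel) \<noteq> 0"
  proof
    assume "(\<integral>x. (bump 0 x)\<^sup>2 \<partial>lborel) = 0"
    then have "AE x in lborel. (bump 0 x)\<^sup>2 = 0" using integral_nonneg_eq_0_iff_AE[OF i] by simp
    then have "AE x in lborel. bump 0 x = 0" by simp
    then have "(\<integral>x. bump 0 x \<partial>lborel) = (\<integral>x. 0 \<partial>(lborel :: real measure))" by (intro integral_cong_AE) auto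
    then show False using bump_integral_pos by simp
  qed
  moreover have "0 \<le> (\<integral>x. (bump 0 x)\<^sup>2 \<partial>lborel)" by simp
  ultimately show "0 < (\<integral>x. (bump 0 x)\<^sup>2 \<partial>lborel)" by (metis less_le)
qed

text \<open>The bump is Lipschitz and bounded; the right-hand side combines both into the truncated moment.\<close>

lemma bump_increment:
  obtains K where "0 < K" "\<And>y t. \<bar>bump 0 (y + t) - bump 0 y\<bar> \<le> K * min 2 \<bar>t\<bar>"
proof -
  obtain B where B: "0 < B" "\<And>x. \<bar>bump 0 x\<bar> \<le> B" using bump_bounded by metis
  obtain B1 where B1: "0 < B1" "\<And>x. \<bar>bump 1 x\<bar> \<le> B1" using bump_bounded by metis
  have "\<bar>bump 0 (y + t) - bump 0 y\<bar> \<le> (B + B1) * min 2 \<bar>t\<bar>" for y t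
  proof -
    have "norm (bump 0 (y + t) - bump 0 y) \<le> B1 * norm ((y + t) - y)"
      by (rule field_differentiable_bound[of UNIV "bump 0" "bump 1"])
        (use bump_deriv[of 0] B1 in auto)
    then have 1: "\<bar>bump 0 (y + t) - bump 0 y\<bar> \<le> B1 * \<bar>t\<bar>" by simp
    have 2: "\<bar>bump 0 (y + t) - bump 0 y\<bar> \<le> B * 2" using B(2)[of "y+t"] B(2)[of y] by linarith
    have 3: "0 \<le> B * \<bar>t\<bar>" using B by simp
    show ?thesis
    proof (cases "2 \<le> \<bar>t\<bar>")
      case True
      then have m: "min 2 \<bar>t\<bar> = 2" by simp
      show ?thesis unfolding m distrib_right using 2 B1(1) by linarith
    next
      case False
      then have m: "min 2 \<bar>t\<bar> = \<bar>t\<bar>" by simp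
      show ?thesis unfolding m distrib_right using 1 3 by linarith
    qed
  qed
  then show ?thesis using that[of "B + B1"] B B1 by simp
qed

lemma l2_dist_sq_triangle:
  assumes [measurable]: "f \<in> borel_measurable borel" "g \<in> borel_measurable borel" "h \<in> borel_measurable borel"
  shows "l2_dist_sq f h \<le> 2 * l2_dist_sq f g + 2 * l2_dist_sq g h"
proof -
  have "l2_dist_sq f h \<le> (\<integral>\<^sup>+x. 2 * ennreal ((f x - g x)\<^sup>2) + 2 * ennreal ((g x - h x)\<^sup>2) \<partial>lborel)"
    unfolding l2_dist_sq_def
  proof (rule nn_integral_mono)
    fix x
    have "0 \<le> ((f x - g x) - (g x - h x))\<^sup>2" by simp
    then have "(f x - h x)\<^sup>2 \<le> 2 * (f x - g x)\<^sup>2 + 2 * (g x - h x)\<^sup>2" by (simp add: power2_eq_square algebra_simps)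
    then have "ennreal ((f x - h x)\<^sup>2) \<le> ennreal (2 * (f x - g x)\<^sup>2 + 2 * (g x - h x)\<^sup>2)" by (rule ennreal_leI)
    also have "\<dots> = 2 * ennreal ((f x - g x)\<^sup>2) + 2 * ennreal ((g x - h x)\<^sup>2)" by (simp add: ennreal_mult)
    finally show "ennreal ((f x - h x)\<^sup>2) \<le> 2 * ennreal ((f x - g x)\<^sup>2) + 2 * ennreal ((g x - h x)\<^sup>2)" .
  qed
  also have "\<dots> = 2 * l2_dist_sq f g + 2 * l2_dist_sq g h"
    unfolding l2_dist_sq_def by (subst nn_integral_add) (auto simp: nn_integral_cmult)
  finally show ?thesis .
qed

context
  fixes N :: nat and \<phi> \<psi> :: "real \<Rightarrow> real"
  assumes ws: "wavelet_system N \<phi> \<psi>"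
begin

text \<open>Suppose \<open>\<integral> \<phi> = 0\<close>.  Then the coefficients of the bump against \<open>\<phi>\<^bsub>j,k\<^esub>\<close> only see its increments at
  scale \<open>2\<^bsup>-j\<^esup>\<close>, and the sum of their squares, which is at most the largest one times their
  \<open>\<ell>\<^sup>1\<close> norm, tends to zero.  The projections of the bump to \<open>V\<^sub>j\<close> would tend to zero, although
  the spaces \<open>V\<^sub>j\<close> are dense.\<close>

lemma father_mean_nonzero: "(\<integral>z. \<phi> z \<partial>lborel) \<noteq> 0"
proof
  assume m0: "(\<integral>z. \<phi> z \<partial>lborel) = 0"
  note bp = bdd_integrable_father[OF ws]
  have ip: "integrable lborel \<phi>" using bp by (simp add: bdd_integrable_def)
  define n2 where "n2 = (\<integral>x. (bump 0 x)\<^sup>2 \<partial>lborel)"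
  have n2: "0 < n2" using bump_L2(2) by (simp add: n2_def)
  obtain K where K: "0 < K" "\<And>y t. \<bar>bump 0 (y + t) - bump 0 y\<bar> \<le> K * min 2 \<bar>t\<bar>" using bump_increment by metis
  define \<delta> where "\<delta> j = (\<integral>z. \<bar>\<phi> z\<bar> * min 2 (1 / 2 ^ j * \<bar>z\<bar>) \<partial>lborel)" for j :: nat
  have D0: "(\<lambda>j. 1 / 2 ^ j :: real) \<longlonglongrightarrow> 0" using LIMSEQ_realpow_zero[of "1/2::real"] by (simp add: power_one_over)
  have \<delta>: "\<delta> \<longlonglongrightarrow> 0" "\<And>j. integrable lborel (\<lambda>z. \<bar>\<phi> z\<bar> * min 2 (1 / 2 ^ j * \<bar>z\<bar>))"
    unfolding \<delta>_def[abs_def] using min_moment_tendsto_0[OF ip D0] by auto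
  define c where "c j k = (\<integral>x. bump 0 x * \<phi> (2 ^ j * x - of_int k) \<partial>lborel)" for j :: nat and k :: int
  have c_le: "\<bar>c j k\<bar> \<le> K * \<delta> j / 2 ^ j" for j k
  proof -
    have "c j k = (\<integral>z. bump 0 (of_int k / 2 ^ j + 1 / 2 ^ j * z) * \<phi> z \<partial>lborel) / 2 ^ j"
      unfolding c_def
      by (subst lborel_integral_real_affine[of "1 / 2 ^ j" _ "of_int k / 2 ^ j"]) (auto simp: distrib_left)
    also have "(\<integral>z. bump 0 (of_int k / 2 ^ j + 1 / 2 ^ j * z) * \<phi> z \<partial>lborel)
       = (\<integral>z. (bump 0 (of_int k / 2 ^ j + 1 / 2 ^ j * z) - bump 0 (of_int k / 2 ^ j)) * \<phi> z \<partial>lborel)"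
    proof -
      have "integrable lborel (\<lambda>z. bump 0 (of_int k / 2 ^ j + 1 / 2 ^ j * z) * \<phi> z)"
        using bdd_integrable_mult_integrable[OF ip bdd_integrable_bump[of 0], of "1 / 2 ^ j" "of_int k / 2 ^ j"] by (simp add: mult.commute)
      then show ?thesis using ip m0 by (simp add: left_diff_distrib)
    qed
    finally have "c j k = \<dots> / 2 ^ j" .
    moreover have "\<bar>\<integral>z. (bump 0 (of_int k / 2 ^ j + 1 / 2 ^ j * z) - bump 0 (of_int k / 2 ^ j)) * \<phi> z \<partial>lborel\<bar> \<le> K * \<delta> j"
    proof -
      have "\<bar>\<integral>z. (bump 0 (of_int k / 2 ^ j + 1 / 2 ^ j * z) - bump 0 (of_int k / 2 ^ j)) * \<phi> z \<partial>lborel\<bar>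
        \<le> (\<integral>z. K * (\<bar>\<phi> z\<bar> * min 2 (1 / 2 ^ j * \<bar>z\<bar>)) \<partial>lborel)"
      proof (rule order.trans[OF integral_abs_bound], rule integral_mono)
        have "integrable lborel (\<lambda>z. \<phi> z * bump 0 (of_int k / 2 ^ j + 1 / 2 ^ j * z))"
          using bdd_integrable_mult_integrable[OF ip bdd_integrable_bump[of 0], of "1 / 2 ^ j" "of_int k / 2 ^ j"] by simp
        then have "integrable lborel (\<lambda>z. \<phi> z * bump 0 (of_int k / 2 ^ j + 1 / 2 ^ j * z) - \<phi> z * bump 0 (of_int k / 2 ^ j))"
          using ip by (intro Bochner_Integration.integrable_diff) auto
        then show "integrable lborel (\<lambda>z. \<bar>(bump 0 (of_int k / 2 ^ j + 1 / 2 ^ j * z) - bump 0 (of_int k / 2 ^ j)) * \<phi> z\<bar>)"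
          by (intro integrable_abs) (simp add: algebra_simps)
        show "integrable lborel (\<lambda>z. K * (\<bar>\<phi> z\<bar> * min 2 (1 / 2 ^ j * \<bar>z\<bar>)))" using \<delta>(2)[of j] by (rule integrable_mult_right)
        fix z
        have "\<bar>bump 0 (of_int k / 2 ^ j + 1 / 2 ^ j * z) - bump 0 (of_int k / 2 ^ j)\<bar> \<le> K * min 2 (1 / 2 ^ j * \<bar>z\<bar>)"
          using K(2)[of "of_int k / 2 ^ j" "1 / 2 ^ j * z"] by (simp add: abs_mult)
        from mult_right_mono[OF this abs_ge_zero[of "\<phi> z"]]
        show "\<bar>(bump 0 (of_int k / 2 ^ j + 1 / 2 ^ j * z) - bump 0 (of_int k / 2 ^ j)) * \<phi> z\<bar> \<le> K * (\<bar>\<phi> z\<bar> * min 2 (1 / 2 ^ j * \<bar>z\<bar>))"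
          unfolding abs_mult[of _ "\<phi> z"] by (simp only: mult_ac)
      qed
      then show ?thesis by (simp add: \<delta>_def)
    qed
    ultimately show ?thesis by (simp add: divide_right_mono)
  qed
  obtain B where B: "0 < B" "\<And>x. \<bar>bump 0 x\<bar> \<le> B" using bump_bounded by metis
  define b where "b = (\<integral>x. \<bar>bump 0 x\<bar> \<partial>lborel)"
  have b: "(\<integral>\<^sup>+x. ennreal \<bar>bump 0 x\<bar> \<partial>lborel) \<le> ennreal b" "0 \<le> b"
    unfolding b_def using bdd_integrable_bump[of 0] by (auto simp: bdd_integrable_def nn_integral_eq_integral)
  obtain C where C: "0 \<le> C" "\<And>j. (\<integral>\<^sup>+k. ennreal \<bar>c j k\<bar> \<partial>count_space UNIV) \<le> ennreal (C * b)"
  proof -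
    obtain C where C: "0 \<le> C" and
      CC: "\<forall>g G A B \<rho>. g \<in> {\<phi>, \<psi>} \<longrightarrow> bdd_integrable G \<longrightarrow> 0 < \<rho> \<longrightarrow> (\<forall>x. \<bar>G x\<bar> \<le> A) \<longrightarrow> 0 \<le> B \<longrightarrow>
        (\<integral>\<^sup>+x. ennreal \<bar>G x\<bar> \<partial>lborel) \<le> ennreal B \<longrightarrow> coeffs_bounded G g \<rho> (C * A / \<rho>) (C * B)"
      using coefficients_crude[OF ws] by blast
    have "coeffs_bounded (bump 0) \<phi> (2 ^ j) (C * B / 2 ^ j) (C * b)" for j :: nat
      using CC[rule_format, of \<phi> "bump 0" "2 ^ j" B b] B b bdd_integrable_bump by simp
    then show ?thesis using that[OF C] by (simp add: c_def coeffs_bounded_def)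
  qed
  \<comment> \<open>largest coefficient times the \<open>\<ell>\<^sup>1\<close> norm of the coefficients\<close>
  have bessel: "(\<Sum>k\<in>F. (l2_inner (bump 0) (dil \<phi> (int j) k))\<^sup>2) \<le> K * \<delta> j * (C * b)" if F: "finite F" for F j
  proof -
    have "l2_inner (bump 0) (dil \<phi> (int j) k) = 2 powr (real j / 2) * c j k" for k
      unfolding l2_inner_def c_def dil_def by (subst integral_mult_right_zero[symmetric]) (simp add: powr_realpow mult_ac)
    then have eq: "(l2_inner (bump 0) (dil \<phi> (int j) k))\<^sup>2 = 2 ^ j * (\<bar>c j k\<bar> * \<bar>c j k\<bar>)" for k
      by (simp add: power_mult_distrib power2_eq_square powr_realpow flip: powr_add)
    have "(\<Sum>k\<in>F. (l2_inner (bump 0) (dil \<phi> (int j) k))\<^sup>2) \<le> (\<Sum>k\<in>F. 2 ^ j * ((K * \<delta> j / 2 ^ j) * \<bar>c j k\<bar>))"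
      unfolding eq by (intro sum_mono mult_left_mono mult_right_mono c_le) auto
    also have "\<dots> = K * \<delta> j * (\<Sum>k\<in>F. \<bar>c j k\<bar>)" by (simp add: sum_distrib_left)
    also have "\<dots> \<le> K * \<delta> j * (C * b)"
    proof (rule mult_left_mono)
      have "ennreal (\<Sum>k\<in>F. \<bar>c j k\<bar>) = (\<Sum>k\<in>F. ennreal \<bar>c j k\<bar>)" by simp
      also have "\<dots> \<le> ennreal (C * b)" using sum_le_nn_integral_count_space[OF F] C(2) by (rule order.trans)
      finally show "(\<Sum>k\<in>F. \<bar>c j k\<bar>) \<le> C * b" using C b by (subst (asm) ennreal_le_iff) auto
      show "0 \<le> K * \<delta> j" using K by (simp add: \<delta>_def)
    qed
    finally show ?thesis .
  qed
  have "(\<lambda>j. K * \<delta> j * (C * b)) \<longlonglongrightarrow> K * 0 * (C * b)" by (intro tendsto_intros \<delta>)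
  then have "\<forall>\<^sub>F j in sequentially. K * \<delta> j * (C * b) < n2 / 2" using n2 by (intro order_tendstoD(2)) auto
  then obtain J where J: "\<And>j. j \<ge> J \<Longrightarrow> K * \<delta> j * (C * b) < n2 / 2" by (auto simp: eventually_sequentially)
  have "father_wavelet \<phi>" using ws by (simp add: wavelet_system_def)
  then obtain j g where g: "g \<in> mra_space \<phi> j" "l2_dist_sq (bump 0) g < ennreal (n2 / 16)"
    using bump_L2(1) n2 unfolding father_wavelet_def by (metis divide_pos_pos zero_less_numeral)
  \<comment> \<open>fine enough both for the approximation in \<open>V\<^sub>j\<close> and for the smallness of the coefficients\<close>
  define jj where "jj = max J (nat j)"
  have "j \<le> int jj" by (auto simp: jj_def)
  then have "g \<in> mra_space \<phi> (int jj)" using mra_mono[OF ws, of j "nat (int jj - j)"] g(1) by auto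
  then obtain F a where Fa: "finite F" "l2_dist_sq g (\<lambda>x. \<Sum>i\<in>F. a i * dil \<phi> (int jj) i x) < ennreal (n2 / 16)" and gL: "g \<in> L2"
    unfolding mra_space_def closed_span_def using n2 by (auto dest!: spec[of _ "n2 / 16"])
  let ?p = "\<lambda>x. \<Sum>i\<in>F. a i * dil \<phi> (int jj) i x"
  have dm: "dil \<phi> (int jj) i \<in> borel_measurable borel" for i
    using orthonormal_father[OF ws, of "int jj"] L2_measurable by (auto simp: orthonormal_system_def)
  have "?p \<in> borel_measurable borel" using dm by measurable
  then have "l2_dist_sq (bump 0) ?p \<le> 2 * l2_dist_sq (bump 0) g + 2 * l2_dist_sq g ?p"
    by (intro l2_dist_sq_triangle) (use L2_measurable[OF gL] in auto)
  also have "\<dots> \<le> 2 * ennreal (n2 / 16) + 2 * ennreal (n2 / 16)"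
    using g(2) Fa(2) by (intro add_mono mult_left_mono less_imp_le) auto
  also have "\<dots> = ennreal (n2 / 4)" using n2
    by (simp add: ennreal_plus[symmetric] ennreal_numeral[symmetric] ennreal_mult[symmetric] del: ennreal_plus ennreal_numeral)
  finally have up: "l2_dist_sq (bump 0) ?p \<le> ennreal (n2 / 4)" .
  have "ennreal (n2 - (\<Sum>k\<in>F. (l2_inner (bump 0) (dil \<phi> (int jj) k))\<^sup>2)) \<le> l2_dist_sq (bump 0) ?p"
    unfolding n2_def by (rule best_approximation[OF orthonormal_father[OF ws] Fa(1) _ bump_L2(1)]) simp
  then have "ennreal (n2 - (\<Sum>k\<in>F. (l2_inner (bump 0) (dil \<phi> (int jj) k))\<^sup>2)) \<le> ennreal (n2 / 4)" using up by (rule order.trans)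
  then have "n2 - (\<Sum>k\<in>F. (l2_inner (bump 0) (dil \<phi> (int jj) k))\<^sup>2) \<le> n2 / 4" using n2 by (subst (asm) ennreal_le_iff) auto
  moreover have "(\<Sum>k\<in>F. (l2_inner (bump 0) (dil \<phi> (int jj) k))\<^sup>2) < n2 / 2"
    using bessel[OF Fa(1), of jj] J[of jj] by (simp add: jj_def)
  ultimately show False using n2 by linarith
qed

text \<open>Iterated smoothing with the normalised father wavelet as \<open>w\<close>, at a scale finer than that of the
  kernel by a fixed factor \<open>2\<^sup>a\<close>.  The factor is chosen such that the smoothing defect is at most
  \<open>1/2\<close>; since the kernel has derivatives of all orders under control, the remainder
  disappears in the limit, and only the smallness of \<open>w * \<psi>\<close> is left.\<close>

lemma low_pass_mother_small:
  obtains C where "0 \<le> C"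
    "\<And>m. norm_per (convol (stretch (2 ^ m) (low_pass 0)) (\<lambda>x. \<psi> (- x))) \<le> ennreal (C * (1 / 2 ^ m) ^ (N + 1))"
proof -
  define E where "E = N + 1"
  define \<psi>' where "\<psi>' x = \<psi> (- x)" for x
  define A0 where "A0 = (\<integral>z. \<phi> z \<partial>lborel)"
  have A0: "A0 \<noteq> 0" using father_mean_nonzero by (simp add: A0_def)
  note bp = bdd_integrable_father[OF ws] and bm = bdd_integrable_mother[OF ws]
  have bp': "bdd_integrable \<psi>'" unfolding \<psi>'_def[abs_def] by (rule bdd_integrable_reflect[OF bm])
  have ip: "integrable lborel \<phi>" using bp by (simp add: bdd_integrable_def)
  obtain h where h: "weak_derivative E \<phi> h" "integrable lborel h" using father_weak_derivative[OF ws] by (auto simp: E_def)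
  obtain \<Psi> where P: "dominating \<Psi> \<psi>" using mother_dominated[OF ws] by blast
  obtain S where S: "0 \<le> S" "norm_per (envelope \<Psi> (real E + 1)) \<le> ennreal S" using norm_per_envelope_finite[OF P] by metis
  obtain C0 where C0: "0 \<le> C0" "norm_per \<psi>' \<le> ennreal C0" using norm_per_reflect_finite[OF P] unfolding \<psi>'_def[abs_def] by metis
  define CA where "CA = real E ^ E * (\<integral>u. \<bar>h u\<bar> \<partial>lborel) * S"
  have CA: "0 \<le> CA" using S by (simp add: CA_def)
  have A: "norm_per (convol (stretch (2 ^ n) \<phi>) \<psi>') \<le> ennreal (CA * (1 / 2 ^ n) ^ E)" for n :: nat
  proof -
    have "norm_per (convol (stretch (2 ^ n) \<phi>) \<psi>') \<le> ennreal (real E ^ E * (1 / 2 ^ n) ^ E * (\<integral>u. \<bar>h u\<bar> \<partial>lborel) * S)"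
    proof (rule coarse_father_mother_small[OF bp h _ bm P _ _ _ S])
      show "convol (stretch (2 ^ n) \<phi>) \<psi>' = convol (\<lambda>z. \<phi> (z / 2 ^ n) / 2 ^ n) (\<lambda>x. \<psi> (- x))"
        by (simp add: stretch_def[abs_def] \<psi>'_def[abs_def])
      show "convol (stretch (2 ^ n) \<phi>) \<psi>' (of_int k) = 0" for k
        using coarse_father_orthogonal[OF ws, of n k] by (simp add: convol_def stretch_def \<psi>'_def)
    qed (auto simp: E_def)
    then show ?thesis by (simp add: CA_def mult_ac)
  qed
  have D0: "(\<lambda>a. 4 / 2 ^ a :: real) \<longlonglongrightarrow> 0"
    using tendsto_mult_right_zero[OF LIMSEQ_realpow_zero[of "1/2::real"], of 4] by (simp add: power_one_over)
  \<comment> \<open>the \<open>4\<close> is the growth rate of the derivatives of the kernel in \<open>L\<^sup>1\<close>\<close>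
  have "\<forall>\<^sub>F a in sequentially. (\<integral>z. \<bar>\<phi> z\<bar> * min 2 (4 / 2 ^ a * \<bar>z\<bar>) \<partial>lborel) < \<bar>A0\<bar> / 2"
    using min_moment_tendsto_0(1)[OF ip D0] A0 by (intro order_tendstoD(2)) auto
  then obtain a where a: "(\<integral>z. \<bar>\<phi> z\<bar> * min 2 (4 / 2 ^ a * \<bar>z\<bar>) \<partial>lborel) < \<bar>A0\<bar> / 2" by (auto simp: eventually_sequentially)
  have ai: "integrable lborel (\<lambda>z. \<bar>\<phi> z\<bar> * min 2 (4 / 2 ^ a * \<bar>z\<bar>))" using min_moment_tendsto_0(2)[OF ip D0] by simp
  define C where "C = 48 * (CA / \<bar>A0\<bar>) * (2 ^ a) ^ E + 24 * C0 * (2 ^ a) ^ E"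
  have C: "0 \<le> C" using CA C0 by (simp add: C_def)
  have "norm_per (convol (stretch (2 ^ m) (low_pass 0)) \<psi>') \<le> ennreal (C * (1 / 2 ^ m) ^ E)" for m
  proof (cases "a \<le> m")
    case True
    define n where "n = m - a"
    have mn: "m = n + a" using True by (simp add: n_def)
    define w where "w = stretch (2 ^ n) (\<lambda>z. 1 / A0 * \<phi> z)"
    have bw: "bdd_integrable w" unfolding w_def by (intro bdd_integrable_stretch bdd_integrable_cmult bp) simp
    have iw: "(\<integral>z. w z \<partial>lborel) = 1" unfolding w_def using A0 by (simp add: integral_stretch A0_def)
    have weq: "w = (\<lambda>z. 1 / A0 * stretch (2 ^ n) \<phi> z)" by (simp add: w_def stretch_def fun_eq_iff)
    define \<kappa> where "\<kappa> = CA / \<bar>A0\<bar> * (1 / 2 ^ n) ^ E"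
    have \<kappa>: "0 \<le> \<kappa>" using CA by (simp add: \<kappa>_def)
    have zw: "norm_per (convol w \<psi>') \<le> ennreal \<kappa>"
    proof -
      have "convol w \<psi>' = (\<lambda>x. 1 / A0 * convol (stretch (2 ^ n) \<phi>) \<psi>' x)" unfolding weq convol_def by (simp add: mult.assoc)
      then have "norm_per (convol w \<psi>') \<le> ennreal \<bar>1 / A0\<bar> * norm_per (convol (stretch (2 ^ n) \<phi>) \<psi>')"
        by (simp only:) (rule shift_norm_cmult, auto intro!: bdd_integrableD(2) bdd_integrable_convol bdd_integrable_stretch bp bp')
      also have "\<dots> \<le> ennreal \<bar>1 / A0\<bar> * ennreal (CA * (1 / 2 ^ n) ^ E)" by (intro mult_left_mono A) simp
      also have "\<dots> = ennreal \<kappa>" using CA by (simp add: \<kappa>_def ennreal_mult[symmetric])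
      finally show ?thesis .
    qed
    have eps: "(\<integral>\<^sup>+z. ennreal (\<bar>w z\<bar> * min 2 ((4 / 2 ^ m) * \<bar>z\<bar>)) \<partial>lborel) \<le> ennreal (1/2)"
    proof -
      have "(\<integral>\<^sup>+z. ennreal (\<bar>w z\<bar> * min 2 ((4 / 2 ^ m) * \<bar>z\<bar>)) \<partial>lborel)
         = (\<integral>\<^sup>+z. ennreal (\<bar>1 / A0 * \<phi> z\<bar> * min 2 ((4 / 2 ^ m) * \<bar>2 ^ n * z\<bar>)) \<partial>lborel)"
        unfolding w_def by (rule nn_integral_stretch) (use bdd_integrableD(2)[OF bp] in auto)
      also have "\<dots> = (\<integral>\<^sup>+z. ennreal (1 / \<bar>A0\<bar> * (\<bar>\<phi> z\<bar> * min 2 (4 / 2 ^ a * \<bar>z\<bar>))) \<partial>lborel)"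
      proof -
        have "(4 / 2 ^ m) * \<bar>2 ^ n * z\<bar> = 4 / 2 ^ a * \<bar>z\<bar>" for z :: real by (simp add: mn power_add abs_mult)
        then show ?thesis by (simp add: abs_mult)
      qed
      also have "\<dots> = ennreal (\<integral>z. 1 / \<bar>A0\<bar> * (\<bar>\<phi> z\<bar> * min 2 (4 / 2 ^ a * \<bar>z\<bar>)) \<partial>lborel)"
        by (rule nn_integral_eq_integral) (use ai in auto)
      also have "\<dots> \<le> ennreal (1/2)" using a A0 by (intro ennreal_leI) (simp add: field_simps)
      finally show ?thesis .
    qed
    define v where "v r x = (1 / 2 ^ m) ^ r * stretch (2 ^ m) (low_pass r) x" for r x
    have chain: "smooth_chain M v" for M unfolding v_def[abs_def] by (rule smooth_chain_stretch[OF smooth_chain_low_pass]) simp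
    have vn: "norm_L1 (v r) \<le> ennreal (24 * (4 / 2 ^ m) ^ r)" for r
    proof -
      have "norm_L1 (v r) \<le> ennreal \<bar>(1 / 2 ^ m) ^ r\<bar> * norm_L1 (stretch (2 ^ m) (low_pass r))"
        unfolding v_def[abs_def] by (rule shift_norm_cmult) (auto intro!: bdd_integrableD(2) bdd_integrable_stretch bdd_integrable_low_pass)
      also have "\<dots> \<le> ennreal \<bar>(1 / 2 ^ m) ^ r\<bar> * ennreal (24 * 4 ^ r)"
        by (intro mult_left_mono) (auto simp: norm_L1_stretch intro: low_pass_nn_integral)
      also have "\<dots> = ennreal (24 * (4 / 2 ^ m) ^ r)" by (simp add: ennreal_mult[symmetric] power_divide)
      finally show ?thesis .
    qed
    have it: "norm_per (convol (v 0) \<psi>') \<le> ennreal (24 * (\<kappa> * (\<Sum>n<M. (1/2) ^ n) + C0 * (1/2) ^ M))" for M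
      by (rule iterated_smoothing[where W=lborel and y="\<lambda>x. x" and w=w and D="4 / 2 ^ m", OF sigma_finite_lborel _ _ norm_per_convol_le bw iw _ eps _ bp' C0(2) zw C0(1) \<kappa> chain vn])
        auto
    have "norm_per (convol (v 0) \<psi>') \<le> ennreal (48 * \<kappa>)"
    proof (rule ennreal_le_epsilon)
      fix e :: real assume e: "0 < e"
      have "(\<lambda>M. 24 * (C0 * (1/2) ^ M)) \<longlonglongrightarrow> 24 * (C0 * 0)" by (intro tendsto_intros LIMSEQ_realpow_zero) auto
      then have "\<forall>\<^sub>F M in sequentially. 24 * (C0 * (1/2) ^ M) < e" using e by (intro order_tendstoD(2)) auto
      then obtain M where M: "24 * (C0 * (1/2) ^ M) < e" by (auto simp: eventually_sequentially)
      have "(\<Sum>n<M. (1/2::real) ^ n) \<le> 2" by (simp add: sum_gp_strict)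
      then have "\<kappa> * (\<Sum>n<M. (1/2) ^ n) \<le> \<kappa> * 2" by (intro mult_left_mono \<kappa>)
      moreover have "24 * (x + y) \<le> 48 * \<kappa> + e" if "x \<le> \<kappa> * 2" "24 * y < e" for x y :: real
      proof -
        have "24 * x \<le> 24 * (\<kappa> * 2)" using that(1) by (rule mult_left_mono) simp
        then show ?thesis unfolding distrib_left using that(2) by simp
      qed
      ultimately have "24 * (\<kappa> * (\<Sum>n<M. (1/2) ^ n) + C0 * (1/2) ^ M) \<le> 48 * \<kappa> + e" using M by blast
      then have "norm_per (convol (v 0) \<psi>') \<le> ennreal (48 * \<kappa> + e)" using it[of M] by (meson ennreal_leI order.trans)
      then show "norm_per (convol (v 0) \<psi>') \<le> ennreal (48 * \<kappa>) + ennreal e" using \<kappa> e by (simp add: ennreal_plus)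
    qed
    also have "48 * \<kappa> \<le> C * (1 / 2 ^ m) ^ E"
    proof -
      have "(1 / 2 ^ n) ^ E = (2 ^ a) ^ E * (1 / 2 ^ m :: real) ^ E" by (simp add: mn power_add flip: power_mult_distrib)
      then have "48 * \<kappa> = 48 * (CA / \<bar>A0\<bar>) * (2 ^ a) ^ E * (1 / 2 ^ m) ^ E" by (simp add: \<kappa>_def)
      also have "\<dots> \<le> C * (1 / 2 ^ m) ^ E" unfolding C_def using C0 by (intro mult_right_mono) auto
      finally show ?thesis .
    qed
    finally have "norm_per (convol (v 0) \<psi>') \<le> ennreal (C * (1 / 2 ^ m) ^ E)" by (simp add: ennreal_leI)
    then show ?thesis by (simp add: v_def[abs_def])
  next
    case False
    have "norm_per (convol (stretch (2 ^ m) (low_pass 0)) \<psi>') \<le> ennreal (24 * C0)"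
      by (rule norm_per_convol_le[OF bdd_integrable_stretch[OF bdd_integrable_low_pass] bp' _ C0(1) _ C0(2)])
        (use low_pass_nn_integral[of 0] in \<open>auto simp: norm_L1_stretch\<close>)
    also have "24 * C0 \<le> C * (1 / 2 ^ m) ^ E"
    proof -
      have "(1::real) \<le> (2 ^ a) ^ E * (1 / 2 ^ m) ^ E"
        unfolding power_mult_distrib[symmetric] using False by (intro one_le_power) (simp add: field_simps power_increasing)
      then have "24 * C0 * 1 \<le> 24 * C0 * ((2 ^ a) ^ E * (1 / 2 ^ m) ^ E)"
        using C0 by (intro mult_left_mono) auto
      also have "\<dots> \<le> C * (1 / 2 ^ m) ^ E" unfolding C_def mult.assoc[symmetric] using CA by (intro mult_right_mono) auto
      finally show ?thesis by simp
    qed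
    finally show ?thesis by (simp add: ennreal_leI)
  qed
  then show ?thesis using that[OF C] by (simp add: E_def \<psi>'_def[abs_def])
qed

text \<open>Iterated smoothing with the band-limited kernel as \<open>w\<close>, now at scale \<open>2\<^sup>m\<close> with \<open>m = i - l\<close> and \<open>l\<close>
  proportional to \<open>i\<close>.  The main term is of order \<open>2\<^bsup>-mE\<^esup>\<close> with \<open>E = N + 1\<close>, which loses a factor
  \<open>2\<^bsup>lE\<^esup>\<close> against \<open>2\<^bsup>-iE\<^esup>\<close> and explains why \<open>s' < E\<close>; the defect in each step is of order \<open>2\<^bsup>-l/2\<^esup>\<close>, and a
  number of steps that does not depend on \<open>i\<close> turns this into \<open>2\<^bsup>-is'\<^esup>\<close>.\<close>

lemma jackson_estimate:
  assumes s: "0 \<le> s'" "s' < real N + 1"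
  shows "\<exists>M C. 0 \<le> C \<and> (\<forall>G A B i. smooth_chain M G \<longrightarrow> (\<forall>r\<le>M. \<forall>x. \<bar>G r x\<bar> \<le> A) \<longrightarrow> 0 \<le> B \<longrightarrow>
      (\<forall>r\<le>M. (\<integral>\<^sup>+x. ennreal \<bar>G r x\<bar> \<partial>lborel) \<le> ennreal B) \<longrightarrow>
      coeffs_bounded (G 0) \<psi> (2 ^ i) (C * A / 2 ^ i * 2 powr (- (real i * s'))) (C * B * 2 powr (- (real i * s'))))"
proof -
  define E where "E = N + 1"
  define \<psi>' where "\<psi>' x = \<psi> (- x)" for x
  have bp': "bdd_integrable \<psi>'" unfolding \<psi>'_def[abs_def] by (rule bdd_integrable_reflect[OF bdd_integrable_mother[OF ws]])
  obtain \<Psi> where P: "dominating \<Psi> \<psi>" using mother_dominated[OF ws] by blast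
  obtain C0 where C0: "0 \<le> C0" "norm_per \<psi>' \<le> ennreal C0" using norm_per_reflect_finite[OF P] unfolding \<psi>'_def[abs_def] by metis
  obtain C1 where C1: "0 \<le> C1" "\<And>m. norm_per (convol (stretch (2 ^ m) (low_pass 0)) \<psi>') \<le> ennreal (C1 * (1 / 2 ^ m) ^ E)"
    using low_pass_mother_small unfolding \<psi>'_def[abs_def] E_def by metis
  define I where "I = (\<integral>x. low_pass 0 x \<partial>lborel)"
  have I: "0 < I" using low_pass_integral_pos by (simp add: I_def)
  \<comment> \<open>with \<open>l = \<theta> i\<close> the main term \<open>2\<^bsup>-(i-l)E\<^esup>\<close> is exactly \<open>2\<^bsup>-is'\<^esup>\<close>\<close>
  define \<theta> where "\<theta> = (real E - s') / real E"
  have E0: "0 < real E" by (simp add: E_def)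
  have th: "0 < \<theta>" "\<theta> \<le> 1" using s by (auto simp: \<theta>_def E_def field_simps)
  \<comment> \<open>so many steps that \<open>2\<^bsup>-lM/2\<^esup>\<close> is at most of the order \<open>2\<^bsup>-is'\<^esup>\<close>\<close>
  define M where "M = nat \<lceil>2 * s' / \<theta>\<rceil>"
  have M: "s' \<le> \<theta> * real M / 2"
  proof -
    have "2 * s' / \<theta> \<le> real M" unfolding M_def by (rule real_nat_ceiling_ge)
    then show ?thesis using th by (simp add: field_simps)
  qed
  define K where "K = 48 / I"
  have K: "0 < K" using I by (simp add: K_def)
  define K2 where "K2 = (\<Sum>n<M. K ^ n)"
  have K2: "0 \<le> K2" unfolding K2_def using K by (intro sum_nonneg) auto
  define C where "C = (C1 / I) * K2 + C0 * (K ^ M * 2 powr (real M / 2))"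
  have C: "0 \<le> C" using C1 I K2 C0 K by (simp add: C_def)
  have main: "norm_per (convol (stretch (2 ^ i) (G 0)) \<psi>') \<le> ennreal (C * B * 2 powr (- (real i * s'))) \<and>
      norm_sup (convol (stretch (2 ^ i) (G 0)) \<psi>') \<le> ennreal (C * A / 2 ^ i * 2 powr (- (real i * s')))"
    if G: "smooth_chain M G" and AB: "0 \<le> A" "0 \<le> B" and A: "\<And>r x. r \<le> M \<Longrightarrow> \<bar>G r x\<bar> \<le> A"
      and B: "\<And>r. r \<le> M \<Longrightarrow> (\<integral>\<^sup>+x. ennreal \<bar>G r x\<bar> \<partial>lborel) \<le> ennreal B" for G A B i
  proof -
    define l where "l = nat \<lfloor>\<theta> * real i\<rfloor>"
    have lb: "real l \<le> \<theta> * real i" "\<theta> * real i - 1 \<le> real l" using th by (auto simp: l_def)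
    have li: "l \<le> i"
    proof -
      have "\<theta> * real i \<le> 1 * real i" using th by (intro mult_right_mono) auto
      then have "real l \<le> real i" using lb by linarith
      then show ?thesis by simp
    qed
    define m where "m = i - l"
    have im: "i = m + l" using li by (simp add: m_def)
    define w where "w = stretch (2 ^ m) (\<lambda>z. 1 / I * low_pass 0 z)"
    have bw: "bdd_integrable w" unfolding w_def by (intro bdd_integrable_stretch bdd_integrable_cmult bdd_integrable_low_pass) simp
    have iw: "(\<integral>z. w z \<partial>lborel) = 1" unfolding w_def using I by (simp add: integral_stretch I_def)
    have weq: "w = (\<lambda>z. 1 / I * stretch (2 ^ m) (low_pass 0) z)" by (simp add: w_def stretch_def fun_eq_iff)
    define \<kappa> where "\<kappa> = C1 / I * (1 / 2 ^ m) ^ E"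
    have \<kappa>: "0 \<le> \<kappa>" using C1 I by (simp add: \<kappa>_def)
    have zw: "norm_per (convol w \<psi>') \<le> ennreal \<kappa>"
    proof -
      have "convol w \<psi>' = (\<lambda>x. 1 / I * convol (stretch (2 ^ m) (low_pass 0)) \<psi>' x)" unfolding weq convol_def by (simp add: mult.assoc)
      then have "norm_per (convol w \<psi>') \<le> ennreal \<bar>1 / I\<bar> * norm_per (convol (stretch (2 ^ m) (low_pass 0)) \<psi>')"
        by (simp only:) (rule shift_norm_cmult, auto intro!: bdd_integrableD(2) bdd_integrable_convol bdd_integrable_stretch bdd_integrable_low_pass bp')
      also have "\<dots> \<le> ennreal \<bar>1 / I\<bar> * ennreal (C1 * (1 / 2 ^ m) ^ E)" by (intro mult_left_mono C1) simp
      also have "\<dots> = ennreal \<kappa>" using C1 I by (simp add: \<kappa>_def ennreal_mult[symmetric])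
      finally show ?thesis .
    qed
    define \<epsilon> where "\<epsilon> = K * sqrt (1 / 2 ^ l)"
    have e0: "0 \<le> \<epsilon>" using K by (simp add: \<epsilon>_def)
    have eK: "\<epsilon> \<le> K"
    proof -
      have "(1::real) \<le> 2 ^ l" by simp
      then have "sqrt (1 / 2 ^ l) \<le> sqrt 1" by (intro real_sqrt_le_mono) (simp add: field_simps)
      then show ?thesis using K by (simp add: \<epsilon>_def mult_left_le)
    qed
    have eps: "(\<integral>\<^sup>+z. ennreal (\<bar>w z\<bar> * min 2 ((1 / 2 ^ i) * \<bar>z\<bar>)) \<partial>lborel) \<le> ennreal \<epsilon>"
    proof -
      have "(\<integral>\<^sup>+z. ennreal (\<bar>w z\<bar> * min 2 ((1 / 2 ^ i) * \<bar>z\<bar>)) \<partial>lborel)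
         = (\<integral>\<^sup>+z. ennreal (\<bar>1 / I * low_pass 0 z\<bar> * min 2 ((1 / 2 ^ i) * \<bar>2 ^ m * z\<bar>)) \<partial>lborel)"
        unfolding w_def by (rule nn_integral_stretch) auto
      also have "\<dots> = (\<integral>\<^sup>+z. ennreal (1 / I) * ennreal (\<bar>low_pass 0 z\<bar> * min 2 (1 / 2 ^ l * \<bar>z\<bar>)) \<partial>lborel)"
      proof -
        have "(1 / 2 ^ i) * \<bar>2 ^ m * z\<bar> = 1 / 2 ^ l * \<bar>z\<bar>" for z :: real by (simp add: im power_add abs_mult)
        then show ?thesis using I by (intro nn_integral_cong) (simp add: abs_mult ennreal_mult[symmetric])
      qed
      also have "\<dots> = ennreal (1 / I) * (\<integral>\<^sup>+z. ennreal (\<bar>low_pass 0 z\<bar> * min 2 (1 / 2 ^ l * \<bar>z\<bar>)) \<partial>lborel)"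
        by (rule nn_integral_cmult) measurable
      also have "\<dots> \<le> ennreal (1 / I) * ennreal (48 * sqrt (1 / 2 ^ l))"
        by (intro mult_left_mono low_pass_half_moment) auto
      also have "\<dots> = ennreal \<epsilon>" using I by (simp add: \<epsilon>_def K_def ennreal_mult[symmetric])
      finally show ?thesis .
    qed
    have const: "\<kappa> * (\<Sum>n<M. \<epsilon> ^ n) + C0 * \<epsilon> ^ M \<le> C * 2 powr (- (real i * s'))"
    proof -
      have 1: "(1 / 2 ^ m) ^ E \<le> (2::real) powr (- (real i * s'))"
      proof -
        have "real i * s' = (real i - \<theta> * real i) * real E" using E0 by (simp add: \<theta>_def field_simps)
        also have "\<dots> \<le> real m * real E" using lb im by (intro mult_right_mono) auto
        finally have "2 powr (- (real m * real E)) \<le> (2::real) powr (- (real i * s'))" by (intro powr_mono) auto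
        moreover have "2 powr (- (real m * real E)) = (1 / 2 ^ m :: real) ^ E"
          by (simp add: powr_minus powr_powr[symmetric] powr_realpow inverse_eq_divide power_divide)
        ultimately show ?thesis by simp
      qed
      have 2: "\<epsilon> ^ M \<le> K ^ M * 2 powr (real M / 2) * 2 powr (- (real i * s'))"
      proof -
        have sq: "sqrt (1 / 2 ^ l) = (2::real) powr (- (real l / 2))"
          by (simp add: powr_half_sqrt[symmetric] real_sqrt_divide powr_powr powr_minus powr_realpow[symmetric] inverse_eq_divide)
        have "sqrt (1 / 2 ^ l) ^ M = (2::real) powr (- (real l / 2) * real M)"
          unfolding sq by (simp add: powr_powr flip: powr_realpow)
        also have "\<dots> \<le> 2 powr (real M / 2 + - (real i * s'))"
        proof (rule powr_mono)
          have "real i * s' \<le> real i * (\<theta> * real M / 2)" by (intro mult_left_mono M) auto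
          moreover have "(\<theta> * real i - 1) * (real M / 2) \<le> real l * (real M / 2)" using lb by (intro mult_right_mono) auto
          ultimately show "- (real l / 2) * real M \<le> real M / 2 + - (real i * s')" by (simp add: algebra_simps)
        qed simp
        finally have "sqrt (1 / 2 ^ l) ^ M \<le> 2 powr (real M / 2) * 2 powr (- (real i * s'))" unfolding powr_add .
        then have "K ^ M * sqrt (1 / 2 ^ l) ^ M \<le> K ^ M * (2 powr (real M / 2) * 2 powr (- (real i * s')))"
          using K by (intro mult_left_mono) auto
        then show ?thesis by (simp add: \<epsilon>_def power_mult_distrib mult.assoc)
      qed
      have 3: "(\<Sum>n<M. \<epsilon> ^ n) \<le> K2" unfolding K2_def using e0 eK by (intro sum_mono power_mono)
      have "\<kappa> * (\<Sum>n<M. \<epsilon> ^ n) \<le> (C1 / I * 2 powr (- (real i * s'))) * K2"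
        unfolding \<kappa>_def using C1 I 1 3 e0 by (intro mult_mono mult_left_mono sum_nonneg) auto
      moreover have "C0 * \<epsilon> ^ M \<le> C0 * (K ^ M * 2 powr (real M / 2) * 2 powr (- (real i * s')))"
        using C0 2 by (intro mult_left_mono) auto
      ultimately show ?thesis unfolding C_def by (simp add: algebra_simps)
    qed
    define v where "v r x = (1 / 2 ^ i) ^ r * stretch (2 ^ i) (G r) x" for r x
    have chain: "smooth_chain M v" unfolding v_def[abs_def] by (rule smooth_chain_stretch[OF G]) simp
    have Gm: "G r \<in> borel_measurable borel" "stretch (2 ^ i) (G r) \<in> borel_measurable borel" if "r \<le> M" for r
      using G that by (auto simp: smooth_chain_def intro!: bdd_integrableD(2) bdd_integrable_stretch)
    have v1: "norm_L1 (v r) \<le> ennreal (B * (1 / 2 ^ i) ^ r)" if r: "r \<le> M" for r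
    proof -
      have "norm_L1 (v r) \<le> ennreal \<bar>(1 / 2 ^ i) ^ r\<bar> * norm_L1 (stretch (2 ^ i) (G r))"
        unfolding v_def[abs_def] by (rule shift_norm_cmult) (use Gm r in auto)
      also have "\<dots> \<le> ennreal \<bar>(1 / 2 ^ i) ^ r\<bar> * ennreal B"
        using Gm[OF r] B[OF r] by (intro mult_left_mono) (auto simp: norm_L1_stretch)
      also have "\<dots> = ennreal (B * (1 / 2 ^ i) ^ r)" using AB by (simp add: ennreal_mult[symmetric] mult.commute)
      finally show ?thesis .
    qed
    have vS: "norm_sup (v r) \<le> ennreal (A / 2 ^ i * (1 / 2 ^ i) ^ r)" if r: "r \<le> M" for r
    proof -
      have "norm_sup (v r) \<le> ennreal \<bar>(1 / 2 ^ i) ^ r\<bar> * norm_sup (stretch (2 ^ i) (G r))"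
        unfolding v_def[abs_def] by (rule shift_norm_cmult) (use Gm r in auto)
      also have "\<dots> \<le> ennreal \<bar>(1 / 2 ^ i) ^ r\<bar> * ennreal (A / 2 ^ i)"
        using A[OF r] AB by (intro mult_left_mono) (auto simp: norm_sup_le_iff stretch_def divide_right_mono)
      also have "\<dots> = ennreal (A / 2 ^ i * (1 / 2 ^ i) ^ r)" using AB by (simp add: ennreal_mult[symmetric] mult.commute)
      finally show ?thesis .
    qed
    have "norm_per (convol (v 0) \<psi>') \<le> ennreal (B * (\<kappa> * (\<Sum>n<M. \<epsilon> ^ n) + C0 * \<epsilon> ^ M))"
      by (rule iterated_smoothing[where W=lborel and y="\<lambda>x. x" and w=w and D="1 / 2 ^ i", OF sigma_finite_lborel _ _ norm_per_convol_le bw iw _ eps e0 bp' C0(2) zw C0(1) \<kappa> chain v1 AB(2)])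
        auto
    also have "\<dots> \<le> ennreal (C * B * 2 powr (- (real i * s')))"
      using mult_left_mono[OF const AB(2)] by (intro ennreal_leI) (simp add: mult_ac)
    finally have Z: "norm_per (convol (v 0) \<psi>') \<le> ennreal (C * B * 2 powr (- (real i * s')))" .
    have "norm_sup (convol (v 0) \<psi>') \<le> ennreal (A / 2 ^ i * (\<kappa> * (\<Sum>n<M. \<epsilon> ^ n) + C0 * \<epsilon> ^ M))"
      by (rule iterated_smoothing[where W="count_space (UNIV::unit set)" and y="\<lambda>_. 0" and w=w and D="1 / 2 ^ i", OF sigma_finite_measure_count_space_countable _ _ norm_sup_convol_le bw iw _ eps e0 bp' C0(2) zw C0(1) \<kappa> chain vS])
        (use AB in auto)
    also have "\<dots> \<le> ennreal (C * A / 2 ^ i * 2 powr (- (real i * s')))"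
      using mult_left_mono[OF const, of "A / 2 ^ i"] AB by (intro ennreal_leI) (simp add: mult_ac)
    finally have S: "norm_sup (convol (v 0) \<psi>') \<le> ennreal (C * A / 2 ^ i * 2 powr (- (real i * s')))" .
    show ?thesis using Z S by (simp add: v_def[abs_def])
  qed
  have "coeffs_bounded (G 0) \<psi> (2 ^ i) (C * A / 2 ^ i * 2 powr (- (real i * s'))) (C * B * 2 powr (- (real i * s')))"
    if "smooth_chain M G" and A: "\<forall>r\<le>M. \<forall>x. \<bar>G r x\<bar> \<le> A" and "0 \<le> B"
      "\<forall>r\<le>M. (\<integral>\<^sup>+x. ennreal \<bar>G r x\<bar> \<partial>lborel) \<le> ennreal B" for G A B i
    unfolding coeffs_bounded_def
  proof
    have A0: "0 \<le> A" using A abs_ge_zero[of "G 0 0"] order_trans by blast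
    have R: "norm_per (convol (stretch (2 ^ i) (G 0)) \<psi>') \<le> ennreal (C * B * 2 powr (- (real i * s'))) \<and>
      norm_sup (convol (stretch (2 ^ i) (G 0)) \<psi>') \<le> ennreal (C * A / 2 ^ i * 2 powr (- (real i * s')))"
      by (rule main) (use that A0 in auto)
    have c: "convol (stretch (2 ^ i) (G 0)) \<psi>' (of_int k) = (\<integral>x. G 0 x * \<psi> (2 ^ i * x - of_int k) \<partial>lborel)" for k
      unfolding \<psi>'_def[abs_def] by (rule convol_stretch_int) simp
    show "(\<integral>\<^sup>+k. ennreal \<bar>\<integral>x. G 0 x * \<psi> (2 ^ i * x - of_int k) \<partial>lborel\<bar> \<partial>count_space (UNIV::int set))
         \<le> ennreal (C * B * 2 powr (- (real i * s')))"
      using order.trans[OF norm_per_at_0 conjunct1[OF R]] unfolding c .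
    show "\<forall>k. \<bar>\<integral>x. G 0 x * \<psi> (2 ^ i * x - of_int k) \<partial>lborel\<bar> \<le> C * A / 2 ^ i * 2 powr (- (real i * s'))"
      using norm_sup_at[OF conjunct2[OF R], of "of_int _"] C A0 unfolding c by simp
  qed
  then show ?thesis using C by blast
qed

end

section \<open>Besov norms of rescaled smooth functions\<close>

lemma dil_coefficient:
  "(\<integral>x. (c * G (2 ^ J * x)) * dil g (int j) k x \<partial>lborel)
     = c * 2 powr (real j / 2) / 2 ^ J * (\<integral>y. G y * g (2 ^ j / 2 ^ J * y - of_int k) \<partial>lborel)"
proof -
  have "(\<integral>y. G y * g (2 ^ j / 2 ^ J * y - of_int k) \<partial>lborel) = 2 ^ J * (\<integral>x. G (2 ^ J * x) * g (2 ^ j * x - of_int k) \<partial>lborel)"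
    by (subst lborel_integral_real_affine[of "2 ^ J" _ 0]) auto
  moreover have "(\<integral>x. (c * G (2 ^ J * x)) * dil g (int j) k x \<partial>lborel)
     = (\<integral>x. (c * 2 powr (real j / 2)) * (G (2 ^ J * x) * g (2 ^ j * x - of_int k)) \<partial>lborel)"
    by (simp add: dil_def powr_realpow mult_ac)
  ultimately show ?thesis by simp
qed

text \<open>The level sum of a function at resolution \<open>J\<close> decays to both sides of \<open>J\<close>; the bound must not
  depend on \<open>J\<close>.\<close>

lemma geometric_two_sided:
  fixes x y :: real
  assumes "0 \<le> x" "x < 1" "0 \<le> y" "y < 1"
  shows "(\<integral>\<^sup>+j. ennreal (if J \<le> j then x ^ (j - J) else y ^ (J - j)) \<partial>count_space (UNIV :: nat set))
     \<le> ennreal (1 / (1 - x) + 1 / (1 - y))"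
proof -
  let ?f = "\<lambda>j. if J \<le> j then x ^ (j - J) else y ^ (J - j)"
  have geo: "(\<Sum>i<n. z ^ i) \<le> 1 / (1 - z)" if "0 \<le> z" "z < 1" for z :: real and n
    using that by (simp add: sum_gp_strict divide_right_mono)
  have part: "(\<Sum>j<n. ?f j) \<le> 1 / (1 - x) + 1 / (1 - y)" for n
  proof -
    have "(\<Sum>j<n. ?f j) \<le> (\<Sum>j\<in>{..<J} \<union> {J..<J + n}. ?f j)"
      using assms by (intro sum_mono2) auto
    also have "\<dots> = (\<Sum>j<J. ?f j) + (\<Sum>j=J..<J + n. ?f j)" by (rule sum.union_disjoint) auto
    also have "(\<Sum>j=J..<J + n. ?f j) = (\<Sum>i<n. x ^ i)"
      using sum.shift_bounds_nat_ivl[of ?f 0 J n] by (simp add: add.commute atLeast0LessThan)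
    also have "(\<Sum>j<J. ?f j) = (\<Sum>j<J. y ^ Suc (J - Suc j))" by (rule sum.cong) (auto simp: Suc_diff_Suc)
    also have "\<dots> = (\<Sum>i<J. y ^ Suc i)" by (rule sum.nat_diff_reindex)
    also have "\<dots> \<le> (\<Sum>i<J. y ^ i)" using assms by (intro sum_mono) (simp add: mult_left_le_one_le)
    finally show ?thesis using geo[OF assms(1,2), of n] geo[OF assms(3,4), of J] by linarith
  qed
  have "(\<integral>\<^sup>+j. ennreal (?f j) \<partial>count_space UNIV) = (\<Sum>j. ennreal (?f j))" by (rule nn_integral_count_space_nat)
  also have "\<dots> \<le> ennreal (1 / (1 - x) + 1 / (1 - y))"
  proof (rule suminf_le_const)
    show "summable (\<lambda>j. ennreal (?f j))" by (rule summableI)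
    fix n
    have "(\<Sum>j<n. ennreal (?f j)) = ennreal (\<Sum>j<n. ?f j)" by (rule sum_ennreal) (use assms in auto)
    also have "\<dots> \<le> ennreal (1 / (1 - x) + 1 / (1 - y))" by (rule ennreal_leI) (rule part)
    finally show "(\<Sum>j<n. ennreal (?f j)) \<le> ennreal (1 / (1 - x) + 1 / (1 - y))" .
  qed
  finally show ?thesis .
qed

text \<open>At levels \<open>j \<ge> J\<close> use the decay \<open>2\<^bsup>-(j-J)s'\<^esup>\<close> for some \<open>s'\<close> strictly between \<open>s\<close> and \<open>N + 1\<close>, below
  \<open>J\<close> the crude bound, where the factor \<open>2\<^bsup>(j-J)s\<^esup>\<close> of the norm itself decays.  The allowance
  \<open>2\<^sup>J\<close> in the \<open>L\<^sup>1\<close> norms is what makes room for \<open>2\<^sup>J\<close> bumps with disjoint supports.\<close>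

lemma besov_norm_rescaled_smooth:
  assumes ws: "wavelet_system N \<phi> \<psi>" and s: "0 < s" "s < real N + 1" and p: "1 \<le> p" and q: "1 \<le> q"
  shows "\<exists>M C. 0 \<le> C \<and> (\<forall>G A J. smooth_chain M G \<longrightarrow> (\<forall>r\<le>M. \<forall>x. \<bar>G r x\<bar> \<le> A) \<longrightarrow>
      (\<forall>r\<le>M. (\<integral>\<^sup>+x. ennreal \<bar>G r x\<bar> \<partial>lborel) \<le> ennreal (A * 2 ^ J)) \<longrightarrow>
      besov_norm \<phi> \<psi> s p q (\<lambda>x. 2 powr (- (real J * s)) * G 0 (2 ^ J * x)) \<le> ennreal (C * A))"
proof -
  define s' where "s' = (s + (real N + 1)) / 2"
  have s': "0 \<le> s'" "s' < real N + 1" "s < s'" using s by (auto simp: s'_def)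
  obtain M C1 where C1: "0 \<le> C1" and jk: "\<forall>G A B i. smooth_chain M G \<longrightarrow> (\<forall>r\<le>M. \<forall>x. \<bar>G r x\<bar> \<le> A) \<longrightarrow> 0 \<le> B \<longrightarrow>
      (\<forall>r\<le>M. (\<integral>\<^sup>+x. ennreal \<bar>G r x\<bar> \<partial>lborel) \<le> ennreal B) \<longrightarrow>
      coeffs_bounded (G 0) \<psi> (2 ^ i) (C1 * A / 2 ^ i * 2 powr (- (real i * s'))) (C1 * B * 2 powr (- (real i * s')))"
    using jackson_estimate[OF ws s'(1,2)] by blast
  obtain C2 where C2: "0 \<le> C2" and cr: "\<forall>g G A B \<rho>. g \<in> {\<phi>, \<psi>} \<longrightarrow> bdd_integrable G \<longrightarrow> 0 < \<rho> \<longrightarrow> (\<forall>x. \<bar>G x\<bar> \<le> A) \<longrightarrow> 0 \<le> B \<longrightarrow>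
     (\<integral>\<^sup>+x. ennreal \<bar>G x\<bar> \<partial>lborel) \<le> ennreal B \<longrightarrow> coeffs_bounded G g \<rho> (C2 * A / \<rho>) (C2 * B)"
    using coefficients_crude[OF ws] by blast
  define C where "C = C1 + C2"
  have C: "0 \<le> C" "C1 \<le> C" "C2 \<le> C" using C1 C2 by (auto simp: C_def)
  define x y where "x = (2::real) powr (- (s' - s))" and "y = (2::real) powr (- s)"
  have xy: "0 \<le> x" "x < 1" "0 \<le> y" "y < 1" using s s' by (auto simp: x_def y_def powr_less_one)
  define \<Theta> where "\<Theta> = 1 / (1 - x) + 1 / (1 - y)"
  have Th: "0 \<le> \<Theta>" using xy by (simp add: \<Theta>_def)
  have "besov_norm \<phi> \<psi> s p q (\<lambda>x. 2 powr (- (real J * s)) * G 0 (2 ^ J * x)) \<le> ennreal (C * (1 + \<Theta>) * A)"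
    if G: "smooth_chain M G" and A: "\<forall>r\<le>M. \<forall>x. \<bar>G r x\<bar> \<le> A"
      and B: "\<forall>r\<le>M. (\<integral>\<^sup>+x. ennreal \<bar>G r x\<bar> \<partial>lborel) \<le> ennreal (A * 2 ^ J)" for G A J
  proof -
    have A0: "0 \<le> A" using A abs_ge_zero[of "G 0 0"] order_trans by blast
    have bG: "bdd_integrable (G 0)" using G by (simp add: smooth_chain_def)
    have AJ: "0 \<le> A * 2 ^ J" using A0 by simp
    define w where "w = (2::real) powr (- (real J * s))"
    have w: "0 \<le> w" "w \<le> 1" using s by (auto simp: w_def powr_le_one_le intro: order_trans[OF powr_mono[of _ 0]])
    \<comment> \<open>the gain over the crude bound at level \<open>j\<close>\<close>
    define e where "e j = (if J \<le> j then 2 powr (- (real (j - J) * s')) else (1::real))" for j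
    have e0: "0 \<le> e j" for j by (simp add: e_def)
    have cf: "coeffs_bounded (G 0) \<psi> (2 ^ j / 2 ^ J) (C * A * 2 ^ J / 2 ^ j * e j) (C * (A * 2 ^ J) * e j)" for j
    proof (cases "J \<le> j")
      case True
      have r: "2 ^ j / 2 ^ J = (2::real) ^ (j - J)" using True by (simp add: power_diff)
      have k: "coeffs_bounded (G 0) \<psi> (2 ^ (j - J)) (C1 * A / 2 ^ (j - J) * 2 powr (- (real (j - J) * s'))) (C1 * (A * 2 ^ J) * 2 powr (- (real (j - J) * s')))"
        using jk G A B AJ by blast
      have 1: "C1 * A / 2 ^ (j - J) * 2 powr (- (real (j - J) * s')) \<le> C * A * 2 ^ J / 2 ^ j * e j"
      proof -
        have "C1 * A / 2 ^ (j - J) = C1 * A * 2 ^ J / 2 ^ j" by (simp add: r[symmetric])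
        also have "\<dots> \<le> C * A * 2 ^ J / 2 ^ j" using C A0 by (intro divide_right_mono mult_right_mono) auto
        finally have le: "C1 * A / 2 ^ (j - J) \<le> C * A * 2 ^ J / 2 ^ j" .
        show ?thesis unfolding e_def if_P[OF True] by (rule mult_right_mono[OF le]) simp
      qed
      have 2: "C1 * (A * 2 ^ J) * 2 powr (- (real (j - J) * s')) \<le> C * (A * 2 ^ J) * e j"
        using True C AJ by (simp add: e_def mult_right_mono)
      show ?thesis using k 1 2 unfolding r coeffs_bounded_def by (meson ennreal_leI order.trans)
    next
      case False
      have k: "coeffs_bounded (G 0) \<psi> (2 ^ j / 2 ^ J) (C2 * A / (2 ^ j / 2 ^ J)) (C2 * (A * 2 ^ J))"
        by (rule cr[rule_format]) (use bG A B AJ in auto)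
      have 1: "C2 * A / (2 ^ j / 2 ^ J) \<le> C * A * 2 ^ J / 2 ^ j * e j"
        using False C A0 by (simp add: e_def divide_right_mono mult_right_mono)
      have 2: "C2 * (A * 2 ^ J) \<le> C * (A * 2 ^ J) * e j" using False C AJ by (simp add: e_def mult_right_mono)
      show ?thesis using k 1 2 unfolding coeffs_bounded_def by (meson ennreal_leI order.trans)
    qed
    have "besov_norm \<phi> \<psi> s p q (\<lambda>x. w * G 0 (2 ^ J * x)) \<le> ennreal (C * A + C * A * \<Theta>)"
    proof (rule besov_norm_le[OF p q, where t="\<lambda>j. w * e j"])
      show "0 \<le> C * A" using C A0 by simp
      show "0 \<le> \<Theta>" by (rule Th)
      show "0 \<le> w * e j" for j using w e0 by simp
      have pr: "c * 2 powr (real j / 2) / 2 ^ J * z = c * 2 powr (real j / 2) * (z / 2 ^ J)" for c z :: real and j by simp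
      have c0: "coeffs_bounded (G 0) \<phi> (1 / 2 ^ J) (C2 * A / (1 / 2 ^ J)) (C2 * (A * 2 ^ J))"
        by (rule cr[rule_format]) (use bG A B AJ in auto)
      have dc0: "(\<integral>x. (w * G 0 (2 ^ J * x)) * dil \<phi> 0 k x \<partial>lborel) = w / 2 ^ J * (\<integral>y. G 0 y * \<phi> (1 / 2 ^ J * y - of_int k) \<partial>lborel)" for k
        using dil_coefficient[of w "G 0" J \<phi> 0 k] by simp
      show "\<bar>\<integral>x. (w * G 0 (2 ^ J * x)) * dil \<phi> 0 k x \<partial>lborel\<bar> \<le> C * A" for k
      proof -
        have "\<bar>\<integral>y. G 0 y * \<phi> (1 / 2 ^ J * y - of_int k) \<partial>lborel\<bar> \<le> C2 * A * 2 ^ J" using c0 by (simp add: coeffs_bounded_def)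
        then have "w / 2 ^ J * \<bar>\<integral>y. G 0 y * \<phi> (1 / 2 ^ J * y - of_int k) \<partial>lborel\<bar> \<le> w / 2 ^ J * (C2 * A * 2 ^ J)"
          using w by (intro mult_left_mono) auto
        also have "\<dots> = w * (C2 * A)" by simp
        also have "\<dots> \<le> 1 * (C * A)" using w C A0 C2 by (intro mult_mono mult_right_mono) auto
        finally show ?thesis unfolding dc0 abs_mult using w by simp
      qed
      show "(\<integral>\<^sup>+k. ennreal \<bar>\<integral>x. (w * G 0 (2 ^ J * x)) * dil \<phi> 0 k x \<partial>lborel\<bar> \<partial>count_space UNIV) \<le> ennreal (C * A)"
      proof -
        have "(\<integral>\<^sup>+k. ennreal \<bar>\<integral>x. (w * G 0 (2 ^ J * x)) * dil \<phi> 0 k x \<partial>lborel\<bar> \<partial>count_space UNIV)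
          = (\<integral>\<^sup>+k. ennreal (w / 2 ^ J) * ennreal \<bar>\<integral>y. G 0 y * \<phi> (1 / 2 ^ J * y - of_int k) \<partial>lborel\<bar> \<partial>count_space UNIV)"
          unfolding dc0 abs_mult by (intro nn_integral_cong) (subst ennreal_mult[symmetric], use w in auto)
        also have "\<dots> = ennreal (w / 2 ^ J) * (\<integral>\<^sup>+k. ennreal \<bar>\<integral>y. G 0 y * \<phi> (1 / 2 ^ J * y - of_int k) \<partial>lborel\<bar> \<partial>count_space UNIV)"
          by (rule nn_integral_cmult) simp
        also have "\<dots> \<le> ennreal (w / 2 ^ J) * ennreal (C2 * (A * 2 ^ J))" using c0 by (intro mult_left_mono) (auto simp: coeffs_bounded_def)
        also have "\<dots> = ennreal (w * (C2 * A))" using w by (subst ennreal_mult'[symmetric]) auto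
        also have "\<dots> \<le> ennreal (1 * (C * A))" using w C A0 C2 by (intro ennreal_leI mult_mono mult_right_mono) auto
        finally show ?thesis by simp
      qed
      fix j
      have dc: "(\<integral>x. (w * G 0 (2 ^ J * x)) * dil \<psi> (int j) k x \<partial>lborel) = w * 2 powr (real j / 2) / 2 ^ J * (\<integral>y. G 0 y * \<psi> (2 ^ j / 2 ^ J * y - of_int k) \<partial>lborel)" for k
        by (rule dil_coefficient)
      have wj: "0 \<le> w * 2 powr (real j / 2) / 2 ^ J" using w by simp
      show "\<bar>\<integral>x. (w * G 0 (2 ^ J * x)) * dil \<psi> (int j) k x \<partial>lborel\<bar> \<le> C * A * (w * e j) * 2 powr (- (real j / 2))" for k
      proof -
        have "\<bar>\<integral>y. G 0 y * \<psi> (2 ^ j / 2 ^ J * y - of_int k) \<partial>lborel\<bar> \<le> C * A * 2 ^ J / 2 ^ j * e j"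
          using cf[of j] by (simp add: coeffs_bounded_def)
        then have "w * 2 powr (real j / 2) / 2 ^ J * \<bar>\<integral>y. G 0 y * \<psi> (2 ^ j / 2 ^ J * y - of_int k) \<partial>lborel\<bar>
            \<le> w * 2 powr (real j / 2) / 2 ^ J * (C * A * 2 ^ J / 2 ^ j * e j)" using wj by (rule mult_left_mono)
        also have "\<dots> = C * A * (w * e j) * (2 powr (real j / 2) / 2 ^ j)" by simp
        also have "2 powr (real j / 2) / 2 ^ j = (2::real) powr (- (real j / 2))"
          by (simp add: powr_realpow[symmetric] powr_diff[symmetric])
        finally show ?thesis unfolding dc abs_mult using w by simp
      qed
      show "(\<integral>\<^sup>+k. ennreal \<bar>\<integral>x. (w * G 0 (2 ^ J * x)) * dil \<psi> (int j) k x \<partial>lborel\<bar> \<partial>count_space UNIV)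
          \<le> ennreal (C * A * (w * e j) * 2 powr (real j / 2))"
      proof -
        have "(\<integral>\<^sup>+k. ennreal \<bar>\<integral>x. (w * G 0 (2 ^ J * x)) * dil \<psi> (int j) k x \<partial>lborel\<bar> \<partial>count_space UNIV)
          = (\<integral>\<^sup>+k. ennreal (w * 2 powr (real j / 2) / 2 ^ J) * ennreal \<bar>\<integral>y. G 0 y * \<psi> (2 ^ j / 2 ^ J * y - of_int k) \<partial>lborel\<bar> \<partial>count_space UNIV)"
          unfolding dc abs_mult[of "w * 2 powr (real j / 2) / 2 ^ J"] by (intro nn_integral_cong) (subst ennreal_mult[symmetric], use wj w in \<open>auto simp: abs_mult\<close>)
        also have "\<dots> = ennreal (w * 2 powr (real j / 2) / 2 ^ J) * (\<integral>\<^sup>+k. ennreal \<bar>\<integral>y. G 0 y * \<psi> (2 ^ j / 2 ^ J * y - of_int k) \<partial>lborel\<bar> \<partial>count_space UNIV)"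
          by (rule nn_integral_cmult) simp
        also have "\<dots> \<le> ennreal (w * 2 powr (real j / 2) / 2 ^ J) * ennreal (C * (A * 2 ^ J) * e j)"
          using cf[of j] by (intro mult_left_mono) (auto simp: coeffs_bounded_def)
        also have "\<dots> = ennreal (C * A * (w * e j) * 2 powr (real j / 2))"
          using wj by (subst ennreal_mult'[symmetric]) (auto simp: mult_ac)
        finally show ?thesis .
      qed
    next
      have "2 powr (real j * s) * (w * e j) = (if J \<le> j then x ^ (j - J) else y ^ (J - j))" for j
      proof (cases "J \<le> j")
        case True
        then have "2 powr (real j * s) * (w * e j) = 2 powr (real j * s - real J * s - real (j - J) * s')"
          by (simp add: w_def e_def powr_add[symmetric] algebra_simps)
        also have "real j * s - real J * s - real (j - J) * s' = - (s' - s) * real (j - J)" using True by (simp add: of_nat_diff algebra_simps)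
        also have "2 powr \<dots> = x ^ (j - J)" by (simp add: x_def powr_powr[symmetric] powr_realpow)
        finally show ?thesis using True by simp
      next
        case False
        then have "2 powr (real j * s) * (w * e j) = 2 powr (real j * s - real J * s)" by (simp add: w_def e_def powr_add[symmetric])
        also have "real j * s - real J * s = - s * real (J - j)" using False by (simp add: of_nat_diff algebra_simps)
        also have "2 powr \<dots> = y ^ (J - j)" unfolding powr_powr[symmetric] y_def by (rule powr_realpow) simp
        finally show ?thesis using False by simp
      qed
      then show "(\<integral>\<^sup>+j. ennreal (2 powr (real j * s) * (w * e j)) \<partial>count_space UNIV) \<le> ennreal \<Theta>"
        using geometric_two_sided[OF xy] by (simp add: \<Theta>_def)
    qed
    also have "C * A + C * A * \<Theta> = C * (1 + \<Theta>) * A" by (simp add: algebra_simps)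
    finally show ?thesis by (simp add: w_def)
  qed
  then show ?thesis using C Th by (intro exI[of _ M] exI[of _ "C * (1 + \<Theta>)"]) auto
qed

section \<open>The hypercube of densities\<close>

definition bump_train :: "int set \<Rightarrow> nat \<Rightarrow> real \<Rightarrow> real" where
  "bump_train A r x = (\<Sum>k\<in>A. bump r (x - of_int k))"

text \<open>The supports of the translates do not overlap.\<close>

lemma bump_train_eq:
  assumes "finite A"
  shows "bump_train A r x = (if \<lfloor>x\<rfloor> \<in> A then bump r (frac x) else 0)"
proof -
  have "bump r (x - of_int k) = 0" if "k \<noteq> \<lfloor>x\<rfloor>" for k
  proof (rule bump_outside)
    have "k < \<lfloor>x\<rfloor> \<or> \<lfloor>x\<rfloor> < k" using that by linarith
    then show "x - of_int k \<le> 0 \<or> 1 \<le> x - of_int k" by linarith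
  qed
  then have "bump_train A r x = (\<Sum>k\<in>A. if k = \<lfloor>x\<rfloor> then bump r (frac x) else 0)"
    unfolding bump_train_def by (intro sum.cong) (auto simp: frac_def)
  then show ?thesis using assms by simp
qed

lemma bump_train_deriv: "(bump_train A r has_real_derivative bump_train A (Suc r) x) (at x)"
  unfolding bump_train_def[abs_def]
proof (rule DERIV_sum)
  fix k
  show "((\<lambda>x. bump r (x - of_int k)) has_real_derivative bump (Suc r) (x - of_int k)) (at x)"
    using bump_affine_deriv[of 1 r "- of_int k" 1 x] by (simp add: add.commute)
qed

lemma bump_train_measurable [measurable]: "bump_train A r \<in> borel_measurable borel"
  unfolding bump_train_def[abs_def] by measurable

lemma bump_shift_integrable: "integrable lborel (\<lambda>x. bump r (x - of_int k))"
  using integrable_affine[OF bdd_integrableD(1)[OF bdd_integrable_bump[of r]], of 1 "- of_int k"] by simp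

lemma bdd_integrable_bump_train:
  assumes "finite A" shows "bdd_integrable (bump_train A r)"
proof -
  obtain B where B: "0 < B" "\<And>x. \<bar>bump r x\<bar> \<le> B" using bump_bounded by metis
  have "\<bar>bump_train A r x\<bar> \<le> B" for x using B by (simp add: bump_train_eq[OF assms])
  moreover have "integrable lborel (bump_train A r)"
    unfolding bump_train_def[abs_def] by (intro Bochner_Integration.integrable_sum bump_shift_integrable)
  ultimately show ?thesis unfolding bdd_integrable_def by blast
qed

lemma integral_bump_train: "(\<integral>x. bump_train A r x \<partial>lborel) = real (card A) * (\<integral>x. bump r x \<partial>lborel)"
proof -
  have "(\<integral>x. bump_train A r x \<partial>lborel) = (\<Sum>k\<in>A. \<integral>x. bump r (x - of_int k) \<partial>lborel)"
    unfolding bump_train_def by (rule Bochner_Integration.integral_sum) (rule bump_shift_integrable)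
  also have "\<dots> = (\<Sum>k\<in>A. \<integral>x. bump r x \<partial>lborel)"
    by (intro sum.cong refl) (use integral_shift[of "bump r" "- of_int _"] in simp)
  finally show ?thesis by simp
qed

lemma nn_integral_bump_train:
  assumes "(\<integral>\<^sup>+x. ennreal \<bar>bump r x\<bar> \<partial>lborel) \<le> ennreal H" "0 \<le> H"
  shows "(\<integral>\<^sup>+x. ennreal \<bar>bump_train A r x\<bar> \<partial>lborel) \<le> ennreal (real (card A) * H)"
proof -
  have "(\<integral>\<^sup>+x. ennreal \<bar>bump_train A r x\<bar> \<partial>lborel) \<le> (\<integral>\<^sup>+x. (\<Sum>k\<in>A. ennreal \<bar>bump r (x - of_int k)\<bar>) \<partial>lborel)"
    unfolding bump_train_def by (intro nn_integral_mono) (simp add: sum_ennreal ennreal_leI)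
  also have "\<dots> = (\<Sum>k\<in>A. \<integral>\<^sup>+x. ennreal \<bar>bump r (x - of_int k)\<bar> \<partial>lborel)" by (rule nn_integral_sum) measurable
  also have "\<dots> = (\<Sum>k\<in>A. \<integral>\<^sup>+x. ennreal \<bar>bump r x\<bar> \<partial>lborel)"
  proof (rule sum.cong[OF refl])
    fix k
    have "(\<integral>\<^sup>+x. ennreal \<bar>bump r x\<bar> \<partial>lborel) = (\<integral>\<^sup>+x. ennreal \<bar>bump r (- of_int k + 1 * x)\<bar> \<partial>lborel)"
      by (subst nn_integral_real_affine[of _ 1 "- of_int k"]) auto
    then show "(\<integral>\<^sup>+x. ennreal \<bar>bump r (x - of_int k)\<bar> \<partial>lborel) = (\<integral>\<^sup>+x. ennreal \<bar>bump r x\<bar> \<partial>lborel)" by simp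
  qed
  also have "\<dots> \<le> (\<Sum>k\<in>A. ennreal H)" by (rule sum_mono) (rule assms(1))
  also have "\<dots> = ennreal (real (card A) * H)" using assms(2) by (simp add: ennreal_mult ennreal_of_nat_eq_real_of_nat)
  finally show ?thesis .
qed

lemma integral_bump_Suc: "(\<integral>x. bump (Suc r) x \<partial>lborel) = 0"
proof -
  have "primitive_of (bump r) (bump (Suc r))"
    by (rule primitive_of_DERIV[OF bump_deriv bump_continuous])
  have out: "bump (Suc r) (1 - t) = 0 \<or> 0 \<le> t \<and> t \<le> 1" for t using bump_outside[of "1 - t" "Suc r"] by linarith
  have "bump r 1 - bump r 0 = (\<integral>t. indicator {0..1 - 0} t * bump (Suc r) (1 - t) \<partial>lborel)"
    using \<open>primitive_of (bump r) (bump (Suc r))\<close> unfolding primitive_of_def using zero_le_one by blast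
  also have "\<dots> = (\<integral>t. bump (Suc r) (1 + (-1) * t) \<partial>lborel)"
    by (intro Bochner_Integration.integral_cong refl) (simp add: out indicator_def)
  also have "\<dots> = (\<integral>x. bump (Suc r) x \<partial>lborel)" by (subst lborel_integral_real_affine[of "-1" _ 1]) auto
  finally show ?thesis by (simp add: bump_outside)
qed

lemma integrable_bump_powr: "integrable lborel (\<lambda>x. \<bar>bump 1 x\<bar> powr r)" if r: "1 \<le> r"
proof -
  obtain B where B: "0 < B" "\<And>x. \<bar>bump 1 x\<bar> \<le> B" using bump_bounded by metis
  have "bdd_integrable (\<lambda>x. \<bar>bump 1 x\<bar> powr r)"
  proof (rule bdd_integrable_compact_support[where a=0 and b=1 and B="B powr r"])
    show "\<bar>\<bar>bump 1 x\<bar> powr r\<bar> \<le> B powr r" for x using B(2)[of x] r by (auto intro: powr_mono2)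
    show "\<bar>bump 1 x\<bar> powr r = 0" if "x \<notin> {0..1}" for x using that by (auto simp: bump_outside)
  qed measurable
  then show ?thesis by (rule bdd_integrableD)
qed

text \<open>Otherwise the bump itself, a primitive, would vanish.\<close>

lemma bump_1_not_null: "0 < (\<integral>x. \<bar>bump 1 x\<bar> powr r \<partial>lborel)" if r: "1 \<le> r"
proof -
  note int = integrable_bump_powr[OF r]
  have "(\<integral>x. \<bar>bump 1 x\<bar> powr r \<partial>lborel) \<noteq> 0"
  proof
    assume "(\<integral>x. \<bar>bump 1 x\<bar> powr r \<partial>lborel) = 0"
    then have "AE x in lborel. \<bar>bump 1 x\<bar> powr r = 0"
      using integral_nonneg_eq_0_iff_AE[OF int] by simp
    then have ae: "AE x in lborel. bump 1 x = 0" by simp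
    have "primitive_of (bump 0) (bump (Suc 0))" by (rule primitive_of_DERIV[OF bump_deriv bump_continuous])
    then have "bump 0 (1/2) - bump 0 0 = (\<integral>t. indicator {0..1/2 - 0} t * bump (Suc 0) (1/2 - t) \<partial>lborel)"
      unfolding primitive_of_def by (meson half_gt_zero_iff less_imp_le zero_less_one)
    also have "\<dots> = (\<integral>t. indicator {0..1/2} (1/2 - t) * bump 1 t \<partial>lborel)"
      by (subst lborel_integral_real_affine[of "-1" _ "1/2"]) auto
    also have "\<dots> = (\<integral>t. 0 \<partial>(lborel :: real measure))"
      by (intro integral_cong_AE) (use ae in auto)
    finally show False using bump_0_pos[of "1/2"] bump_outside[of 0 0] by simp
  qed
  then show ?thesis by (simp add: order_less_le)
qed

lemma besov_densities_iff:
  "f \<in> besov_densities \<phi> \<psi> s p q L T \<longleftrightarrow>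
    prob_density f \<and> closure {x. f x \<noteq> 0} \<subseteq> {-T..T} \<and> besov_norm \<phi> \<psi> s p q f \<le> ennreal L"
  by (auto simp: besov_densities_def prob_density_def)

lemma besov_norm_add_le:
  assumes ws: "wavelet_system N \<phi> \<psi>" and p: "1 \<le> p" and q: "1 \<le> q"
    and u: "integrable lborel u" "besov_norm \<phi> \<psi> s p q u \<le> ennreal a" "0 \<le> a"
    and v: "integrable lborel v" "besov_norm \<phi> \<psi> s p q v \<le> ennreal b" "0 \<le> b"
  shows "besov_norm \<phi> \<psi> s p q (\<lambda>x. u x + v x) \<le> ennreal (a + b)"
proof -
  have int: "integrable lborel (\<lambda>x. w x * dil g j k x)" if "integrable lborel w" "g \<in> {\<phi>, \<psi>}" for w g j k
  proof -
    have "bdd_integrable g" using that(2) bdd_integrable_father[OF ws] bdd_integrable_mother[OF ws] by auto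
    then have "integrable lborel (\<lambda>x. w x * g (- of_int k + 2 powr of_int j * x))"
      by (rule bdd_integrable_mult_integrable[OF that(1)]) simp
    then have "integrable lborel (\<lambda>x. 2 powr (of_int j / 2) * (w x * g (- of_int k + 2 powr of_int j * x)))"
      by (rule integrable_mult_right)
    then show ?thesis unfolding dil_def by (simp add: mult_ac)
  qed
  have "besov_norm \<phi> \<psi> s p q (\<lambda>x. u x + v x) \<le> besov_norm \<phi> \<psi> s p q u + besov_norm \<phi> \<psi> s p q v"
    by (rule besov_norm_triangle[OF p q]) (use int u(1) v(1) in auto)
  also have "\<dots> \<le> ennreal a + ennreal b" by (rule add_mono[OF u(2) v(2)])
  finally show ?thesis using u(3) v(3) by (simp add: ennreal_plus)
qed

lemma bump_0_lower: "\<exists>c>0. \<forall>x. 1/4 \<le> x \<longrightarrow> x \<le> 1/2 \<longrightarrow> c \<le> bump 0 x"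
proof -
  obtain x where x: "x \<in> {1/4..1/2::real}" "\<forall>y\<in>{1/4..1/2}. bump 0 x \<le> bump 0 y"
    using continuous_attains_inf[of "{1/4..1/2::real}" "bump 0"] bump_continuous by auto
  have "0 < bump 0 x" using x(1) by (intro bump_0_pos) auto
  then show ?thesis using x(2) by (intro exI[of _ "bump 0 x"]) auto
qed

text \<open>Mixing a little of a smooth density into \<open>f0\<close> makes it positive on \<open>[T/4, T/2]\<close>; the slack
  \<open>L - besov_norm f0\<close> pays for the norm of the addition and is used up only in part.\<close>

lemma besov_density_bounded_below:
  assumes ws: "wavelet_system N \<phi> \<psi>" and s: "0 < s" "s < real N + 1" and p: "1 \<le> p" and q: "1 \<le> q"
    and T: "0 < T" and f0: "f0 \<in> besov_densities \<phi> \<psi> s p q L T" "besov_norm \<phi> \<psi> s p q f0 < ennreal L"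
  shows "\<exists>f1 l c. 0 \<le> l \<and> l < L \<and> 0 < c \<and> f1 \<in> besov_densities \<phi> \<psi> s p q l T \<and>
    (\<forall>x. T/4 \<le> x \<longrightarrow> x \<le> T/2 \<longrightarrow> c \<le> f1 x)"
proof -
  obtain M C where C: "0 \<le> C" and smooth: "\<forall>G A J. smooth_chain M G \<longrightarrow> (\<forall>r\<le>M. \<forall>x. \<bar>G r x\<bar> \<le> A) \<longrightarrow>
      (\<forall>r\<le>M. (\<integral>\<^sup>+x. ennreal \<bar>G r x\<bar> \<partial>lborel) \<le> ennreal (A * 2 ^ J)) \<longrightarrow>
      besov_norm \<phi> \<psi> s p q (\<lambda>x. 2 powr (- (real J * s)) * G 0 (2 ^ J * x)) \<le> ennreal (C * A)"
    using besov_norm_rescaled_smooth[OF ws s p q] by blast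
  obtain l0 where l0: "0 \<le> l0" "besov_norm \<phi> \<psi> s p q f0 = ennreal l0" "l0 < L"
    using f0(2) by (cases "besov_norm \<phi> \<psi> s p q f0") (auto simp: ennreal_less_iff)
  define Ib where "Ib = (\<integral>x. bump 0 x \<partial>lborel)"
  have Ib: "0 < Ib" using bump_integral_pos by (simp add: Ib_def)
  define c where "c = 1 / (T * Ib)"
  have c: "0 < c" using T Ib by (simp add: c_def)
  define G where "G r x = c * (1/T) ^ r * bump r (x / T)" for r x
  have bG: "bdd_integrable (G r)" for r
    using bdd_integrable_cmult[OF bdd_integrable_affine[OF bdd_integrable_bump[of r], of "1/T" 0], of "c * (1/T) ^ r"] T
    by (simp add: G_def[abs_def])
  have dG: "(G r has_real_derivative G (Suc r) x) (at x)" for r x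
    using bump_affine_deriv[of "c * (1/T) ^ r" r 0 "1/T" x] by (simp add: G_def[abs_def] mult_ac)
  have chain: "smooth_chain M G" by (rule smooth_chain_of_DERIV[of G]) (rule bG dG)+
  obtain A where A: "0 < A" "\<forall>r\<le>M. (\<forall>x. \<bar>G r x\<bar> \<le> A) \<and> (\<integral>\<^sup>+x. ennreal \<bar>G r x\<bar> \<partial>lborel) \<le> ennreal A"
    using smooth_chain_bound[OF chain] by blast
  define \<epsilon> where "\<epsilon> = min (1/2) ((L - l0) / (2 * (C * A + 1)))"
  have CA: "0 < C * A + 1" using C A(1) by (simp add: add_nonneg_pos)
  have eps: "0 < \<epsilon>" "\<epsilon> \<le> 1/2" "\<epsilon> * (C * A + 1) \<le> (L - l0) / 2"
  proof -
    show "0 < \<epsilon>" using l0 CA by (auto simp: \<epsilon>_def)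
    show "\<epsilon> \<le> 1/2" unfolding \<epsilon>_def by (rule min.cobounded1)
    have "\<epsilon> \<le> (L - l0) / (2 * (C * A + 1))" unfolding \<epsilon>_def by (rule min.cobounded2)
    then show "\<epsilon> * (C * A + 1) \<le> (L - l0) / 2" using CA by (simp add: field_simps)
  qed
  have chain_eps: "smooth_chain M (\<lambda>r x. \<epsilon> * G r x)"
    using chain unfolding smooth_chain_def by (auto intro: bdd_integrable_cmult primitive_of_cmult)
  have "besov_norm \<phi> \<psi> s p q (\<lambda>x. 2 powr (- (real 0 * s)) * ((\<lambda>r x. \<epsilon> * G r x) 0 (2 ^ 0 * x))) \<le> ennreal (C * (\<epsilon> * A))"
  proof (rule smooth[rule_format, OF chain_eps])
    fix r assume r: "r \<le> M"
    show "\<bar>\<epsilon> * G r x\<bar> \<le> \<epsilon> * A" for x using A(2) r eps(1) by (simp add: abs_mult)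
    have [measurable]: "G r \<in> borel_measurable borel" by (rule bdd_integrableD[OF bG])
    have "(\<integral>\<^sup>+x. ennreal \<bar>\<epsilon> * G r x\<bar> \<partial>lborel) = ennreal \<epsilon> * (\<integral>\<^sup>+x. ennreal \<bar>G r x\<bar> \<partial>lborel)"
      using eps(1) by (subst nn_integral_cmult[symmetric]) (auto simp: abs_mult ennreal_mult)
    also have "\<dots> \<le> ennreal \<epsilon> * ennreal A" using A(2) r by (intro mult_left_mono) auto
    finally show "(\<integral>\<^sup>+x. ennreal \<bar>\<epsilon> * G r x\<bar> \<partial>lborel) \<le> ennreal (\<epsilon> * A * 2 ^ 0)"
      using eps(1) A(1) by (simp add: ennreal_mult)
  qed
  then have bG0: "besov_norm \<phi> \<psi> s p q (\<lambda>x. \<epsilon> * G 0 x) \<le> ennreal (C * (\<epsilon> * A))" by simp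
  define f1 where "f1 x = (1 - \<epsilon>) * f0 x + \<epsilon> * G 0 x" for x
  define l where "l = l0 + C * (\<epsilon> * A)"
  have l: "0 \<le> l" "l < L"
  proof -
    show "0 \<le> l" using l0 C eps A(1) by (simp add: l_def)
    have "C * (\<epsilon> * A) \<le> (L - l0) / 2" using eps(1,3) by (simp add: algebra_simps)
    then show "l < L" using l0(3) by (simp add: l_def field_simps)
  qed
  have pf: "prob_density f0" and cf: "closure {x. f0 x \<noteq> 0} \<subseteq> {-T..T}" using f0(1) by (auto simp: besov_densities_iff)
  have if0: "integrable lborel f0" using pf by (simp add: prob_density_def)
  have G0: "0 \<le> G 0 x" for x using c by (simp add: G_def bump_0_nonneg)
  have intG: "(\<integral>x. G 0 x \<partial>lborel) = 1"
  proof -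
    have "(\<integral>x. bump 0 (x / T) \<partial>lborel) = T * Ib"
      using T by (subst lborel_integral_real_affine[of T _ 0]) (auto simp: Ib_def)
    then show ?thesis using T Ib by (simp add: G_def c_def)
  qed
  have "f1 \<in> besov_densities \<phi> \<psi> s p q l T"
    unfolding besov_densities_iff
  proof (intro conjI)
    have "(\<integral>x. f1 x \<partial>lborel) = (1 - \<epsilon>) * (\<integral>x. f0 x \<partial>lborel) + \<epsilon> * (\<integral>x. G 0 x \<partial>lborel)"
      unfolding f1_def using if0 bdd_integrableD(1)[OF bG[of 0]] by simp
    also have "\<dots> = 1" using pf by (simp add: intG prob_density_def)
    finally have "(\<integral>x. f1 x \<partial>lborel) = 1" .
    then show "prob_density f1"
      using pf bdd_integrableD(1,2)[OF bG[of 0]] eps G0 unfolding prob_density_def f1_def[abs_def] by auto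
    show "closure {x. f1 x \<noteq> 0} \<subseteq> {-T..T}"
    proof (rule closure_minimal)
      show "{x. f1 x \<noteq> 0} \<subseteq> {-T..T}"
      proof
        fix x assume "x \<in> {x. f1 x \<noteq> 0}"
        then have "f0 x \<noteq> 0 \<or> bump 0 (x / T) \<noteq> 0" by (auto simp: f1_def G_def)
        then show "x \<in> {-T..T}"
        proof
          assume nz: "f0 x \<noteq> 0"
          show ?thesis by (rule subsetD[OF cf], rule subsetD[OF closure_subset]) (use nz in simp)
        next
          assume "bump 0 (x / T) \<noteq> 0"
          then have "0 < x / T" "x / T < 1" using bump_outside[of "x / T" 0] by linarith+
          then show ?thesis using T by (auto simp: field_simps)
        qed
      qed
    qed simp
    have "besov_norm \<phi> \<psi> s p q (\<lambda>x. (1 - \<epsilon>) * f0 x) \<le> ennreal l0"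
      using besov_norm_scale_le[OF p q, of "1 - \<epsilon>" \<phi> \<psi> s f0] eps l0(2) by simp
    then show "besov_norm \<phi> \<psi> s p q f1 \<le> ennreal l"
      unfolding f1_def[abs_def] l_def
      by (intro besov_norm_add_le[OF ws p q] bG0) (use if0 bdd_integrableD(1)[OF bG[of 0]] l0 C eps A(1) in auto)
  qed
  moreover obtain cb where cb: "0 < cb" "\<forall>x. 1/4 \<le> x \<longrightarrow> x \<le> 1/2 \<longrightarrow> cb \<le> bump 0 x" using bump_0_lower by blast
  have "\<epsilon> * (c * cb) \<le> f1 x" if "T/4 \<le> x" "x \<le> T/2" for x
  proof -
    have "1/4 \<le> x / T" "x / T \<le> 1/2" using that T by (auto simp: field_simps)
    then have "cb \<le> bump 0 (x / T)" using cb(2) by blast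
    then have "\<epsilon> * (c * cb) \<le> \<epsilon> * G 0 x" using eps c by (simp add: G_def)
    moreover have "0 \<le> (1 - \<epsilon>) * f0 x" using eps pf by (simp add: prob_density_def)
    ultimately show ?thesis by (simp add: f1_def)
  qed
  moreover have "0 < \<epsilon> * (c * cb)" using eps c cb by simp
  ultimately show ?thesis using l by blast
qed

text \<open>The dyadic cells of length \<open>2\<^bsup>-J\<^esup>\<close> inside \<open>[T/4, T/2]\<close>, by their left end points times \<open>2\<^sup>J\<close>.\<close>

definition cell_grid :: "real \<Rightarrow> nat \<Rightarrow> int set" where
  "cell_grid T J = {\<lceil>2 ^ J * T / 4\<rceil>..\<lfloor>2 ^ J * T / 2\<rfloor> - 1}"

lemma finite_cell_grid: "finite (cell_grid T J)" by (simp add: cell_grid_def)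

lemma cell_gridD:
  assumes "\<lfloor>2 ^ J * x\<rfloor> \<in> cell_grid T J"
  shows "T / 4 \<le> x" "x \<le> T / 2"
proof -
  have "\<lceil>2 ^ J * T / 4\<rceil> \<le> \<lfloor>2 ^ J * x\<rfloor>" "\<lfloor>2 ^ J * x\<rfloor> \<le> \<lfloor>2 ^ J * T / 2\<rfloor> - 1"
    using assms by (simp_all only: cell_grid_def atLeastAtMost_iff)
  then have "2 ^ J * T / 4 \<le> 2 ^ J * x" "2 ^ J * x \<le> 2 ^ J * T / 2" by linarith+
  then have "2 ^ J * (T / 4) \<le> 2 ^ J * x" "2 ^ J * x \<le> 2 ^ J * (T / 2)" by auto
  then show "T / 4 \<le> x" "x \<le> T / 2" by (simp_all only: mult_le_cancel_left_pos zero_less_power zero_less_numeral)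
qed

lemma card_cell_grid:
  assumes "0 < T"
  shows "real (card (cell_grid T J)) \<le> (T + 1) * 2 ^ J"
    and "16 \<le> 2 ^ J * T \<Longrightarrow> 2 ^ J * T / 8 \<le> real (card (cell_grid T J))"
proof -
  define y where "y = 2 ^ J * T"
  have c: "card (cell_grid T J) = nat (\<lfloor>y / 2\<rfloor> - \<lceil>y / 4\<rceil>)" by (simp add: cell_grid_def y_def)
  have y: "0 \<le> y" using assms by (simp add: y_def)
  have "real (card (cell_grid T J)) \<le> y" unfolding c using y by linarith
  also have "\<dots> \<le> (T + 1) * 2 ^ J" by (simp add: y_def algebra_simps)
  finally show "real (card (cell_grid T J)) \<le> (T + 1) * 2 ^ J" .
  show "2 ^ J * T / 8 \<le> real (card (cell_grid T J))" if "16 \<le> 2 ^ J * T"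
    using that unfolding c y_def[symmetric] by linarith
qed

definition hypercube_density :: "(real \<Rightarrow> real) \<Rightarrow> real \<Rightarrow> real \<Rightarrow> nat \<Rightarrow> int set \<Rightarrow> real \<Rightarrow> real" where
  "hypercube_density f \<gamma> s J A x = f x + 2 powr (- (real J * s)) * (\<gamma> * bump_train A 1 (2 ^ J * x))"

text \<open>The perturbation has \<open>L\<^sup>\<infinity>\<close> norm at most \<open>\<gamma> H\<close> and vanishes outside \<open>[T/4, T/2]\<close>, so positivity
  holds for small \<open>\<gamma>\<close>; mass one holds because the derivative of a bump integrates to zero; and
  the Besov norm of the perturbation is at most a constant times \<open>\<gamma>\<close> whatever \<open>J\<close> and \<open>A\<close> are.\<close>

lemma hypercube_in_class:
  assumes ws: "wavelet_system N \<phi> \<psi>" and s: "0 < s" "s < real N + 1" and p: "1 \<le> p" and q: "1 \<le> q"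
    and T: "0 < T" and l: "0 \<le> l" "l < L" and f1: "f1 \<in> besov_densities \<phi> \<psi> s p q l T"
    and c: "0 < c" "\<forall>x. T/4 \<le> x \<longrightarrow> x \<le> T/2 \<longrightarrow> c \<le> f1 x"
  shows "\<exists>\<gamma>>0. \<gamma> * (\<integral>x. \<bar>bump 1 x\<bar> \<partial>lborel) \<le> 1/2 \<and>
    (\<forall>J. \<forall>A\<subseteq>cell_grid T J. hypercube_density f1 \<gamma> s J A \<in> besov_densities \<phi> \<psi> s p q L T)"
proof -
  obtain M C where C: "0 \<le> C" and smooth: "\<forall>G A J. smooth_chain M G \<longrightarrow> (\<forall>r\<le>M. \<forall>x. \<bar>G r x\<bar> \<le> A) \<longrightarrow>
      (\<forall>r\<le>M. (\<integral>\<^sup>+x. ennreal \<bar>G r x\<bar> \<partial>lborel) \<le> ennreal (A * 2 ^ J)) \<longrightarrow>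
      besov_norm \<phi> \<psi> s p q (\<lambda>x. 2 powr (- (real J * s)) * G 0 (2 ^ J * x)) \<le> ennreal (C * A)"
    using besov_norm_rescaled_smooth[OF ws s p q] by blast
  have "smooth_chain M (\<lambda>r. bump (Suc r))" by (rule smooth_chain_of_DERIV[of "\<lambda>r. bump (Suc r)"]) (rule bdd_integrable_bump bump_deriv)+
  from smooth_chain_bound[OF this] obtain H where H: "0 < H"
    "\<forall>r\<le>M. (\<forall>x. \<bar>bump (Suc r) x\<bar> \<le> H) \<and> (\<integral>\<^sup>+x. ennreal \<bar>bump (Suc r) x\<bar> \<partial>lborel) \<le> ennreal H" by blast
  have H1: "\<bar>bump 1 x\<bar> \<le> H" for x using H(2)[rule_format, of 0] by simp
  have HI: "(\<integral>x. \<bar>bump 1 x\<bar> \<partial>lborel) \<le> H"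
  proof -
    have "ennreal (\<integral>x. \<bar>bump 1 x\<bar> \<partial>lborel) = (\<integral>\<^sup>+x. ennreal \<bar>bump 1 x\<bar> \<partial>lborel)"
      using bdd_integrableD(1)[OF bdd_integrable_bump[of 1]] by (intro nn_integral_eq_integral[symmetric]) auto
    also have "\<dots> \<le> ennreal H" using H(2)[rule_format, of 0] by simp
    finally show ?thesis using H(1) by (simp add: ennreal_le_iff)
  qed
  \<comment> \<open>three conditions: little information in one cell, positivity, and the slack in the Besov norm\<close>
  define \<gamma> where "\<gamma> = Min {1 / (2 * H), c / H, (L - l) / (C * H * (T + 1) + 1)}"
  have CH: "0 < C * H * (T + 1) + 1" using C H(1) T by (simp add: add_nonneg_pos)
  have g: "0 < \<gamma>" "\<gamma> * H \<le> 1/2" "\<gamma> * H \<le> c" "C * (\<gamma> * H * (T + 1)) \<le> L - l"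
  proof -
    show g0: "0 < \<gamma>" using H(1) c(1) l CH by (simp add: \<gamma>_def)
    have "\<gamma> \<le> 1 / (2 * H)" "\<gamma> \<le> c / H" "\<gamma> \<le> (L - l) / (C * H * (T + 1) + 1)" by (simp_all add: \<gamma>_def)
    then have "\<gamma> * (2 * H) \<le> 1" "\<gamma> * H \<le> c" "\<gamma> * (C * H * (T + 1) + 1) \<le> L - l"
      using H(1) CH by (simp_all add: pos_le_divide_eq)
    then show "\<gamma> * H \<le> 1/2" "\<gamma> * H \<le> c" "C * (\<gamma> * H * (T + 1)) \<le> L - l" using g0 by (auto simp: algebra_simps)
  qed
  have pf: "prob_density f1" and cf: "closure {x. f1 x \<noteq> 0} \<subseteq> {-T..T}" and nf: "besov_norm \<phi> \<psi> s p q f1 \<le> ennreal l"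
    using f1 by (auto simp: besov_densities_iff)
  have if1: "integrable lborel f1" using pf by (simp add: prob_density_def)
  have "hypercube_density f1 \<gamma> s J A \<in> besov_densities \<phi> \<psi> s p q L T" if A: "A \<subseteq> cell_grid T J" for J A
    unfolding besov_densities_iff
  proof (intro conjI)
    have finA: "finite A" using A finite_cell_grid finite_subset by blast
    define w where "w = (2::real) powr (- (real J * s))"
    have w: "0 \<le> w" "w \<le> 1" using s by (auto simp: w_def powr_le_one_le intro: order_trans[OF powr_mono[of _ 0]])
    define u where "u x = w * (\<gamma> * bump_train A 1 (2 ^ J * x))" for x
    have h: "hypercube_density f1 \<gamma> s J A = (\<lambda>x. f1 x + u x)" by (simp add: hypercube_density_def[abs_def] u_def w_def)
    have bu: "bdd_integrable u"
      using bdd_integrable_cmult[OF bdd_integrable_affine[OF bdd_integrable_bump_train[OF finA, of 1], of "2 ^ J" 0], of "w * \<gamma>"]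
      by (simp add: u_def[abs_def] mult_ac)
    have iu: "(\<integral>x. u x \<partial>lborel) = 0"
    proof -
      have "(\<integral>x. bump_train A 1 x \<partial>lborel) = 2 ^ J * (\<integral>x. bump_train A 1 (2 ^ J * x) \<partial>lborel)"
        by (subst lborel_integral_real_affine[of "2 ^ J" _ 0]) auto
      then show ?thesis using integral_bump_train[of A 1] integral_bump_Suc[of 0] by (simp add: u_def)
    qed
    have supp: "T / 4 \<le> x \<and> x \<le> T / 2" if "u x \<noteq> 0" for x
    proof -
      have "\<lfloor>2 ^ J * x\<rfloor> \<in> A" using that by (auto simp: u_def bump_train_eq[OF finA] split: if_splits)
      then show ?thesis using A cell_gridD by blast
    qed
    have ub: "\<bar>u x\<bar> \<le> \<gamma> * H" for x
    proof -
      have "\<bar>bump_train A 1 (2 ^ J * x)\<bar> \<le> H" using H1 H(1) by (simp add: bump_train_eq[OF finA])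
      then have "\<bar>u x\<bar> \<le> 1 * (\<gamma> * H)"
        unfolding u_def abs_mult using w g(1) by (intro mult_mono) auto
      then show ?thesis by simp
    qed
    show "prob_density (hypercube_density f1 \<gamma> s J A)"
      unfolding prob_density_def h
    proof (intro conjI allI)
      show "0 \<le> f1 x + u x" for x
      proof (cases "u x = 0")
        case True then show ?thesis using pf by (simp add: prob_density_def)
      next
        case False
        then have "c \<le> f1 x" using supp c(2) by blast
        then show ?thesis using ub[of x] g(3) by linarith
      qed
      show "(\<lambda>x. f1 x + u x) \<in> borel_measurable borel" using pf bdd_integrableD(2)[OF bu] by (auto simp: prob_density_def intro: borel_measurable_add)
      show "integrable lborel (\<lambda>x. f1 x + u x)" using if1 bdd_integrableD(1)[OF bu] by simp
      show "(\<integral>x. f1 x + u x \<partial>lborel) = 1" using if1 bdd_integrableD(1)[OF bu] pf iu by (simp add: prob_density_def)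
    qed
    show "closure {x. hypercube_density f1 \<gamma> s J A x \<noteq> 0} \<subseteq> {-T..T}"
    proof (rule closure_minimal)
      show "{x. hypercube_density f1 \<gamma> s J A x \<noteq> 0} \<subseteq> {-T..T}"
      proof
        fix x assume "x \<in> {x. hypercube_density f1 \<gamma> s J A x \<noteq> 0}"
        then have "f1 x \<noteq> 0 \<or> u x \<noteq> 0" by (auto simp: h)
        then show "x \<in> {-T..T}"
        proof
          assume nz: "f1 x \<noteq> 0"
          show ?thesis by (rule subsetD[OF cf], rule subsetD[OF closure_subset]) (use nz in simp)
        qed (use supp[of x] T in auto)
      qed
    qed simp
    define G where "G r x = \<gamma> * bump_train A (Suc r) x" for r x
    have "besov_norm \<phi> \<psi> s p q (\<lambda>x. 2 powr (- (real J * s)) * G 0 (2 ^ J * x)) \<le> ennreal (C * (\<gamma> * H * (T + 1)))"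
    proof (rule smooth[rule_format])
      show "smooth_chain M G"
        unfolding G_def[abs_def]
      proof (rule smooth_chain_of_DERIV)
        show "bdd_integrable (\<lambda>x. \<gamma> * bump_train A (Suc r) x)" for r by (rule bdd_integrable_cmult[OF bdd_integrable_bump_train[OF finA]])
        show "((\<lambda>x. \<gamma> * bump_train A (Suc r) x) has_real_derivative \<gamma> * bump_train A (Suc (Suc r)) x) (at x)" for r x
          by (rule DERIV_cmult[OF bump_train_deriv])
      qed
      fix r assume r: "r \<le> M"
      have gH: "0 \<le> \<gamma> * H" using g(1) H(1) by simp
      show "\<bar>G r x\<bar> \<le> \<gamma> * H * (T + 1)" for x
      proof -
        have "\<bar>bump_train A (Suc r) x\<bar> \<le> H" using H r by (simp add: bump_train_eq[OF finA])
        then have "\<bar>G r x\<bar> \<le> \<gamma> * H" using g(1) by (simp add: G_def abs_mult)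
        also have "\<dots> \<le> \<gamma> * H * (T + 1)" using mult_left_mono[OF _ gH, of 1 "T + 1"] T by simp
        finally show ?thesis .
      qed
      have "(\<integral>\<^sup>+x. ennreal \<bar>G r x\<bar> \<partial>lborel) = ennreal \<gamma> * (\<integral>\<^sup>+x. ennreal \<bar>bump_train A (Suc r) x\<bar> \<partial>lborel)"
        using g(1) by (subst nn_integral_cmult[symmetric]) (auto simp: G_def abs_mult ennreal_mult)
      also have "\<dots> \<le> ennreal \<gamma> * ennreal (real (card A) * H)"
        using H r by (intro mult_left_mono nn_integral_bump_train) auto
      also have "\<dots> = ennreal (\<gamma> * H * real (card A))" using g(1) H(1) by (simp add: ennreal_mult' mult_ac)
      also have "\<dots> \<le> ennreal (\<gamma> * H * ((T + 1) * 2 ^ J))"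
      proof (intro ennreal_leI mult_left_mono gH)
        have "real (card A) \<le> real (card (cell_grid T J))" using card_mono[OF finite_cell_grid A] by simp
        also have "\<dots> \<le> (T + 1) * 2 ^ J" by (rule card_cell_grid(1)[OF T])
        finally show "real (card A) \<le> (T + 1) * 2 ^ J" .
      qed
      finally show "(\<integral>\<^sup>+x. ennreal \<bar>G r x\<bar> \<partial>lborel) \<le> ennreal (\<gamma> * H * (T + 1) * 2 ^ J)" by (simp add: mult_ac)
    qed
    then have nu: "besov_norm \<phi> \<psi> s p q u \<le> ennreal (C * (\<gamma> * H * (T + 1)))"
      by (simp add: G_def u_def[abs_def] w_def)
    have "besov_norm \<phi> \<psi> s p q (\<lambda>x. f1 x + u x) \<le> ennreal (l + C * (\<gamma> * H * (T + 1)))"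
      by (rule besov_norm_add_le[OF ws p q if1 nf l(1) bdd_integrableD(1)[OF bu] nu]) (use C g(1) H(1) T in auto)
    also have "\<dots> \<le> ennreal L" using g(4) by (intro ennreal_leI) simp
    finally show "besov_norm \<phi> \<psi> s p q (hypercube_density f1 \<gamma> s J A) \<le> ennreal L" unfolding h .
  qed
  moreover have "\<gamma> * (\<integral>x. \<bar>bump 1 x\<bar> \<partial>lborel) \<le> 1/2"
    using order_trans[OF mult_left_mono[OF HI] g(2)] g(1) by simp
  ultimately show ?thesis using g(1) by blast
qed

section \<open>The minimax bound\<close>

lemma hypercube_density_insert:
  assumes "finite A" "k \<notin> A"
  shows "hypercube_density f \<gamma> s J (insert k A) x - hypercube_density f \<gamma> s J A x
    = 2 powr (- (real J * s)) * \<gamma> * bump 1 (- of_int k + 2 ^ J * x)"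
  using assms by (simp add: hypercube_density_def bump_train_def algebra_simps)

lemma bump_cell_outside: "\<lfloor>2 ^ J * x\<rfloor> \<noteq> k \<Longrightarrow> bump r (- of_int k + 2 ^ J * x) = 0"
proof (rule bump_outside)
  assume "\<lfloor>2 ^ J * x\<rfloor> \<noteq> k"
  then have "\<lfloor>2 ^ J * x\<rfloor> < k \<or> k < \<lfloor>2 ^ J * x\<rfloor>" by linarith
  then show "- of_int k + 2 ^ J * x \<le> 0 \<or> 1 \<le> - of_int k + 2 ^ J * x" by linarith
qed

lemma integral_dyadic_affine:
  fixes f :: "real \<Rightarrow> real"
  shows "(\<integral>x. f (t + 2 ^ J * x) \<partial>lborel) = (\<integral>x. f x \<partial>lborel) / 2 ^ J"
  by (subst (2) lborel_integral_real_affine[of "2 ^ J" _ t]) auto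

text \<open>The smallest power of two above \<open>y\<^bsup>1/a\<^esup>\<close>.\<close>

lemma dyadic_level:
  assumes y: "1 \<le> y" and a: "0 < a"
  shows "\<exists>J::nat. y \<le> 2 powr (real J * a) \<and> y powr (1 / a) \<le> 2 ^ J \<and> 2 ^ J \<le> 2 * y powr (1 / a)"
proof -
  define z where "z = y powr (1 / a)"
  have z: "1 \<le> z" unfolding z_def using y a by (intro ge_one_powr_ge_zero) auto
  define J where "J = nat \<lceil>log 2 z\<rceil>"
  have "0 \<le> log 2 z" using z by simp
  then have J: "log 2 z \<le> real J" "real J \<le> log 2 z + 1" unfolding J_def by linarith+
  have lg: "2 powr log 2 z = z" using z by simp
  have zJ: "z \<le> 2 powr real J" using powr_mono[OF J(1), of 2] by (simp add: lg)
  have Jz: "2 powr real J \<le> 2 * z" using powr_mono[OF J(2), of 2] lg by (simp add: powr_add)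
  have "y = z powr a" using y a by (simp add: z_def powr_powr)
  also have "\<dots> \<le> (2 powr real J) powr a" using zJ z a by (intro powr_mono2) auto
  finally have "y \<le> 2 powr (real J * a)" by (simp add: powr_powr)
  then show ?thesis using zJ Jz unfolding z_def[symmetric] by (intro exI[of _ J]) (simp add: powr_realpow)
qed

text \<open>Number of cells, \<open>2\<^sup>J T / 8\<close>, times the separation on one cell, \<open>2\<^bsup>-J\<^esup> (\<gamma> 2\<^bsup>-Js\<^esup> / 2)\<^sup>r \<integral> \<bar>h\<bar>\<^sup>r\<close>,
  divided by four.\<close>

lemma hypercube_minimax_bound:
  assumes T: "0 < T" and r: "1 \<le> r" and a: "0 \<le> \<alpha>" and g: "0 < \<gamma>" "\<gamma> * (\<integral>x. \<bar>bump 1 x\<bar> \<partial>lborel) \<le> 1/2"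
    and cls: "\<forall>A\<subseteq>cell_grid T J. hypercube_density f1 \<gamma> s J A \<in> besov_densities \<phi> \<psi> s p q L T"
    and J: "16 \<le> 2 ^ J * T" "real n * (exp \<alpha> - 1)\<^sup>2 \<le> 2 powr (real J * (2 * s + 2))"
  shows "ennreal (T / 32 * (\<gamma> / 2) powr r * (\<integral>x. \<bar>bump 1 x\<bar> powr r \<partial>lborel) * 2 powr (- (real J * s * r)))
    \<le> minimax_risk Z \<alpha> n r (besov_densities \<phi> \<psi> s p q L T)"
proof -
  let ?f = "hypercube_density f1 \<gamma> s J"
  define hr where "hr = (\<integral>x. \<bar>bump 1 x\<bar> powr r \<partial>lborel)"
  have hr: "0 \<le> hr" by (simp add: hr_def)
  define w where "w = (2::real) powr (- (real J * s))"
  have w: "0 < w" by (simp add: w_def)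
  define K where "K = (w * \<gamma> / 2) powr r"
  define D where "D = K * hr / 2 ^ J"
  define C where "C k = {x::real. \<lfloor>2 ^ J * x\<rfloor> = k}" for k :: int
  have D0: "0 \<le> D" using hr by (simp add: D_def K_def)
  have le: "ennreal (real (card (cell_grid T J)) * D / 4) \<le> minimax_risk Z \<alpha> n r (besov_densities \<phi> \<psi> s p q L T)"
  proof (rule assouad_private[OF finite_cell_grid _ _ _ _ D0 r a, where f="?f" and C=C])
    fix A assume A: "A \<subseteq> cell_grid T J"
    then show c: "?f A \<in> besov_densities \<phi> \<psi> s p q L T" using cls by blast
    then show "prob_density (?f A)" by (simp add: besov_densities_iff)
  next
    show "C k \<in> sets borel" for k unfolding C_def by measurable
    show "disjoint_family_on C (cell_grid T J)" by (auto simp: disjoint_family_on_def C_def)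
  next
    fix k A assume k: "k \<in> cell_grid T J" and A: "A \<subseteq> cell_grid T J - {k}"
    then have fA: "finite A" "k \<notin> A" using finite_subset[OF A] finite_cell_grid by auto
    have diff: "\<bar>?f (insert k A) x - ?f A x\<bar> = w * \<gamma> * \<bar>bump 1 (- of_int k + 2 ^ J * x)\<bar>" for x
      unfolding hypercube_density_insert[OF fA] using w g(1) by (simp add: w_def abs_mult)
    show "ennreal D \<le> (\<integral>\<^sup>+t. indicator (C k) t * ennreal ((\<bar>?f A t - ?f (insert k A) t\<bar> / 2) powr r) \<partial>lborel)"
    proof -
      have eq: "indicator (C k) t * ennreal ((\<bar>?f A t - ?f (insert k A) t\<bar> / 2) powr r)
          = ennreal (K * \<bar>bump 1 (- of_int k + 2 ^ J * t)\<bar> powr r)" for t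
      proof (cases "t \<in> C k")
        case True
        have "(\<bar>?f A t - ?f (insert k A) t\<bar> / 2) powr r = (w * \<gamma> / 2 * \<bar>bump 1 (- of_int k + 2 ^ J * t)\<bar>) powr r"
          using diff[of t] by (simp add: abs_minus_commute)
        also have "\<dots> = K * \<bar>bump 1 (- of_int k + 2 ^ J * t)\<bar> powr r"
          using w g(1) by (subst powr_mult) (auto simp: K_def)
        finally show ?thesis using True by simp
      next
        case False
        then have "bump 1 (- of_int k + 2 ^ J * t) = 0" by (intro bump_cell_outside) (simp add: C_def)
        then show ?thesis using False by simp
      qed
      have "(\<integral>\<^sup>+t. ennreal (K * \<bar>bump 1 (- of_int k + 2 ^ J * t)\<bar> powr r) \<partial>lborel)
          = ennreal (\<integral>t. K * \<bar>bump 1 (- of_int k + 2 ^ J * t)\<bar> powr r \<partial>lborel)"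
        using integrable_affine[OF integrable_bump_powr[OF r], of "2 ^ J" "- of_int k"]
        by (intro nn_integral_eq_integral) (auto simp: K_def)
      also have "(\<integral>t. K * \<bar>bump 1 (- of_int k + 2 ^ J * t)\<bar> powr r \<partial>lborel) = D"
        using integral_dyadic_affine[of "\<lambda>x. \<bar>bump 1 x\<bar> powr r" "- of_int k" J] by (simp add: D_def hr_def)
      finally show ?thesis unfolding eq by simp
    qed
    define I1 where "I1 = (\<integral>x. \<bar>bump 1 x\<bar> \<partial>lborel)"
    have "(\<integral>x. \<bar>?f (insert k A) x - ?f A x\<bar> \<partial>lborel) = w / 2 ^ J * (\<gamma> * I1)"
      unfolding diff using integral_dyadic_affine[of "\<lambda>x. \<bar>bump 1 x\<bar>" "- of_int k" J] by (simp add: I1_def)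
    also have "\<dots> \<le> w / 2 ^ J * (1 / 2)" using g(2) w by (intro mult_left_mono) (auto simp: I1_def)
    finally have "(\<integral>x. \<bar>?f (insert k A) x - ?f A x\<bar> \<partial>lborel) \<le> w / 2 ^ J * (1 / 2)" .
    then have sq: "(\<integral>x. \<bar>?f (insert k A) x - ?f A x\<bar> \<partial>lborel)\<^sup>2 \<le> (w / 2 ^ J * (1 / 2))\<^sup>2"
      by (intro power_mono) auto
    have "w / 2 ^ J = 2 powr (- (real J * s) - real J)" by (simp add: w_def powr_realpow[symmetric] powr_diff)
    also have "- (real J * s) - real J = - (real J * (s + 1))" by (simp add: algebra_simps)
    finally have "(w / 2 ^ J)\<^sup>2 = 2 powr (- (real J * (s + 1)) + - (real J * (s + 1)))"
      unfolding power2_eq_square by (simp only: powr_add)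
    also have "- (real J * (s + 1)) + - (real J * (s + 1)) = - (real J * (2 * s + 2))" by (simp add: algebra_simps)
    finally have "(w / 2 ^ J)\<^sup>2 = 2 powr (- (real J * (2 * s + 2)))" .
    with sq have sq: "(\<integral>x. \<bar>?f (insert k A) x - ?f A x\<bar> \<partial>lborel)\<^sup>2 \<le> 2 powr (- (real J * (2 * s + 2))) / 4"
      unfolding power_mult_distrib by (simp add: power2_eq_square)
    have "real n * ((exp \<alpha> - 1) * (\<integral>x. \<bar>?f (insert k A) x - ?f A x\<bar> \<partial>lborel))\<^sup>2
        = (real n * (exp \<alpha> - 1)\<^sup>2) * (\<integral>x. \<bar>?f (insert k A) x - ?f A x\<bar> \<partial>lborel)\<^sup>2"
      by (simp only: power_mult_distrib mult.assoc)
    also have "\<dots> \<le> 2 powr (real J * (2 * s + 2)) * (2 powr (- (real J * (2 * s + 2))) / 4)"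
      using J(2) sq by (intro mult_mono) auto
    also have "\<dots> = 1 / 4" by (simp add: powr_minus)
    finally show "real n * ((exp \<alpha> - 1) * (\<integral>x. \<bar>?f (insert k A) x - ?f A x\<bar> \<partial>lborel))\<^sup>2 \<le> 1 / 2" by simp
  qed
  have "T / 32 * (\<gamma> / 2) powr r * hr * 2 powr (- (real J * s * r)) = T / 32 * K * hr"
  proof -
    have "K = w powr r * (\<gamma> / 2) powr r" using w g(1) powr_mult[of w "\<gamma> / 2" r] by (simp add: K_def)
    then show ?thesis by (simp add: w_def powr_powr)
  qed
  also have "\<dots> = 2 ^ J * T / 8 * D / 4" by (simp add: D_def)
  also have "\<dots> \<le> real (card (cell_grid T J)) * D / 4"
    using card_cell_grid(2)[OF T J(1)] D0 by (intro divide_right_mono mult_right_mono) auto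
  finally have "T / 32 * (\<gamma> / 2) powr r * hr * 2 powr (- (real J * s * r)) \<le> real (card (cell_grid T J)) * D / 4" .
  from order_trans[OF ennreal_leI[OF this] le] show ?thesis by (simp only: hr_def)
qed

theorem proposition2p1:
  fixes \<phi> \<psi> :: "real \<Rightarrow> real" and N :: nat
    and s r \<alpha> L T :: real and p q :: ennreal
  assumes "wavelet_system N \<phi> \<psi>"
    and "0 < s" and "s < real N + 1"
    and "1 \<le> p" and "1 \<le> q" and "1 \<le> r"
    and "0 < \<alpha>" and "0 < L" and "0 < T"
    and "\<exists>f0\<in>besov_densities \<phi> \<psi> s p q L T. besov_norm \<phi> \<psi> s p q f0 < ennreal L"
  shows "\<exists>C>0. \<exists>n0. \<forall>Z :: 'z measure. \<forall>n\<ge>n0.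
    ennreal (C * (real n * (exp \<alpha> - 1)\<^sup>2) powr (- (r * s) / (2 * s + 2)))
      \<le> minimax_risk Z \<alpha> n r (besov_densities \<phi> \<psi> s p q L T)"
proof -
  obtain f0 where f0: "f0 \<in> besov_densities \<phi> \<psi> s p q L T" "besov_norm \<phi> \<psi> s p q f0 < ennreal L"
    using assms(10) by blast
  obtain f1 l c where l: "0 \<le> l" "l < L" and c: "0 < c" "\<forall>x. T/4 \<le> x \<longrightarrow> x \<le> T/2 \<longrightarrow> c \<le> f1 x"
    and f1: "f1 \<in> besov_densities \<phi> \<psi> s p q l T"
    using besov_density_bounded_below[OF assms(1-5,9) f0] by blast
  obtain \<gamma> where g: "0 < \<gamma>" "\<gamma> * (\<integral>x. \<bar>bump 1 x\<bar> \<partial>lborel) \<le> 1/2"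
    and cls: "\<forall>J. \<forall>A\<subseteq>cell_grid T J. hypercube_density f1 \<gamma> s J A \<in> besov_densities \<phi> \<psi> s p q L T"
    using hypercube_in_class[OF assms(1-5,9) l f1 c] by blast
  define a where "a = 2 * s + 2"
  have a: "0 < a" using assms(2) by (simp add: a_def)
  define e where "e = (exp \<alpha> - 1)\<^sup>2"
  have e: "0 < e" using assms(7) by (simp add: e_def)
  define c0 where "c0 = T / 32 * (\<gamma> / 2) powr r * (\<integral>x. \<bar>bump 1 x\<bar> powr r \<partial>lborel)"
  have c0: "0 < c0" using assms(9) g(1) bump_1_not_null[OF assms(6)] by (simp add: c0_def)
  \<comment> \<open>from here on there is a resolution at all, and it is fine enough for sixteen cells in \<open>[0, T]\<close>\<close>
  define n0 where "n0 = nat \<lceil>max 1 ((16 / T) powr a) / e\<rceil>"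
  have "ennreal (c0 * 2 powr (- (s * r)) * (real n * e) powr (- (r * s) / a))
      \<le> minimax_risk Z \<alpha> n r (besov_densities \<phi> \<psi> s p q L T)" if n: "n0 \<le> n" for n and Z :: "'z measure"
  proof -
    define y where "y = real n * e"
    have "max 1 ((16 / T) powr a) / e \<le> real n" using n unfolding n0_def by linarith
    then have "max 1 ((16 / T) powr a) \<le> y" using e by (simp add: y_def pos_divide_le_eq)
    then have y: "1 \<le> y" "(16 / T) powr a \<le> y" by auto
    obtain J where J: "y \<le> 2 powr (real J * a)" "y powr (1 / a) \<le> 2 ^ J" "2 ^ J \<le> 2 * y powr (1 / a)"
      using dyadic_level[OF y(1) a] by blast
    have "16 / T = ((16 / T) powr a) powr (1 / a)" using assms(9) a by (simp add: powr_powr)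
    also have "\<dots> \<le> y powr (1 / a)" using y(2) a by (intro powr_mono2) auto
    also have "\<dots> \<le> 2 ^ J" by (rule J(2))
    finally have big: "16 \<le> 2 ^ J * T" using assms(9) by (simp add: pos_divide_le_eq)
    have "2 powr (- (s * r)) * y powr (- (r * s) / a) = (2 * y powr (1 / a)) powr (- (s * r))"
      using y(1) by (simp add: powr_mult powr_powr mult.commute)
    also have "\<dots> \<le> (2 ^ J) powr (- (s * r))"
      using J(3) assms(2,6) by (intro powr_mono2') auto
    also have "\<dots> = 2 powr (- (real J * s * r))" by (simp add: powr_realpow[symmetric] powr_powr mult.assoc)
    finally have "c0 * (2 powr (- (s * r)) * y powr (- (r * s) / a)) \<le> c0 * 2 powr (- (real J * s * r))"
      using c0 by (intro mult_left_mono) auto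
    then have "ennreal (c0 * 2 powr (- (s * r)) * y powr (- (r * s) / a)) \<le> ennreal (c0 * 2 powr (- (real J * s * r)))"
      by (intro ennreal_leI) (simp only: mult.assoc)
    also have "\<dots> \<le> minimax_risk Z \<alpha> n r (besov_densities \<phi> \<psi> s p q L T)"
      unfolding c0_def
      by (rule hypercube_minimax_bound[OF assms(9,6) _ g _ big])
        (use assms(7) J(1) cls in \<open>auto simp: y_def e_def a_def\<close>)
    finally show ?thesis by (simp only: y_def)
  qed
  then show ?thesis using c0 unfolding e_def a_def
    by (intro exI[of _ "c0 * 2 powr (- (s * r))"] exI[of _ n0]) (auto simp: mult.assoc)
qed

end
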